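(* In the setting described in the context, assume the following two conditions. (A) There are a measure $\boldsymbol{\pi}=\mathcal{L}\otimes\boldsymbol{\pi}_t\in\mathcal{M}_+(\mathbb{R}_+\times X\times Y)$ with $\boldsymbol{\pi}_t\in\Pi(\mu,\nu)$ for a.e. $t\in\mathbb{R}_+$ and an infinite subset $\mathcal{Z}\subset2\mathbb{N}$ such that $\lim_{n\in\mathcal{Z},\,n\to\infty}\mathcal{W}(\boldsymbol{\pi}^n_t,\boldsymbol{\pi}_t)=0$ for $\mathcal{L}$-a.e. $t\in\mathbb{R}_+$. (B) There is $\sigma\in\mathcal{P}(Z)$ such that for $\mathcal{L}\otimes\mu$-almost all $(t,x)\in\mathbb{R}_+\times X$ the sequence $(\sigma^n_{t,x})_n$ converges weak* to $\sigma$, and $\sigma(\{z\in Z:z_\ell=0\})=0$ for $\ell=1,\dots,d$. Then for every $T>0$, the functionals $F^n_T$ $\Gamma$-converge to $F_T$ on $\mathcal{V}_T$ with respect to weak* convergence along the subsequence $n\in\mathcal{Z}$, $n\to\infty$.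
   Context: Notation. $\mathbb{R}_+=[0,\infty)$, $\mathbb{N}=\{0,1,2,\dots\}$, $2\mathbb{N}$ denotes the positive even integers, $\mathcal{L}$ is Lebesgue measure; $\mathcal{M}_+(S)$, $\mathcal{P}(S)$ are the non-negative (Radon) and probability measures on $S$; $\rho|_A$ is the restriction of a measure $\rho$ to $A$; $P_Y$ denotes the marginal on $Y$ (similarly for other factors); $\Pi(\alpha,\beta)$ is the set of non-negative measures on the product space with first marginal $\alpha$ and second marginal $\beta$. $\mathrm{KL}(\alpha|\beta)=\int\varphi(\frac{d\alpha}{d\beta})\,d\beta$ if $0\le\alpha\ll\beta$ and $+\infty$ otherwise, with $\varphi(s)=s\log s-s+1$ for $s>0$, $\varphi(0)=1$; the convention $0\cdot\infty=0$ is used. $W_Y$ is the Wasserstein-1 metric on $\mathcal{P}(Y)$. Subscripts $t$ or $t,x$ on a measure denote its disintegration with respect to $\mathcal{L}$ (in time) or $\mathcal{L}\otimes\mu$ (in time and $X$). Problem data. $d\ge1$, $X=[0,1]^d$, $Y\subset\mathbb{R}^d$ compact, $\mu\in\mathcal{P}(X)$ with $\mu\ll\mathcal{L}$, $\nu\in\mathcal{P}(Y)$, $c\in C^1(X\times Y)$, $\pi_{\mathrm{init}}\in\Pi(\mu,\nu)$. For $n\in2\mathbb{N}$: the basic cells are $X^n_i=i/n+[0,1/n]^d$, $i\in I^n=\{0,\dots,n-1\}^d$, and it is assumed that $m^n_i:=\mu(X^n_i)>0$. $\mu^n\in\mathcal{P}(X)$ satisfies $\mu^n(X^n_i)=m^n_i$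 for all $i$ and gives no mass to boundaries of basic cells (hence overlaps of closed cells are irrelevant). $\nu^n\in\mathcal{P}(Y)$, $\nu^n\to\nu$ weak*; $\pi^n_{\mathrm{init}}\in\Pi(\mu^n,\nu^n)$, $\pi^n_{\mathrm{init}}\to\pi_{\mathrm{init}}$ weak*. $c^n=c+f^n/n$ is continuous, where $f^n:X\times Y\to\mathbb{R}$ converge uniformly to $0$. $\varepsilon^n\in[0,\infty)$ and $\eta:=\lim_{n\to\infty}n\varepsilon^n$ exists in $[0,\infty]$; if $\eta=\infty$ only those $n$ with $\varepsilon^n>0$ (all but finitely many) are considered. Composite cells. $\mathcal{J}^n_A$ is the partition of $I^n$ into the groups of $2^d$ adjacent indices on which $(\lfloor i_\ell/2\rfloor)_{\ell=1}^d$ is constant; $\mathcal{J}^n_B$ is the partition into groups on which $(\lfloor (i_\ell+1)/2\rfloor)_{\ell=1}^d$ is constant (the same grouping shifted by one cell in each direction; boundary groups are smaller). For $J$ in either: $X^n_J=\bigcup_{i\in J}X^n_i$, $\mu^n_J=\mu^n|_{X^n_J}$, $m^n_J=\sum_{i\in J}m^n_i$, and the center $x^n_J$ is the unique point of $\{1/n,3/n,\dots,(n-1)/n\}^d$ (if $J\in\mathcal{J}^n_A$), resp. of $\{0,2/n,\dots,1\}^d$ (if $J\in\mathcal{J}^n_B$), contained in $X^n_J$. Set $\mathcal{J}^{n,k}=\mathcal{J}^n_A$ for $k$ odd and $\mathcal{J}^{n,k}=\mathcal{J}^n_B$ for $k$ even. Domain decomposition iterates. $\pi^{n,0}=\pi^n_{\mathrm{init}}$;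 for $k\ge1$, $\pi^{n,k}=\sum_{J\in\mathcal{J}^{n,k}}\pi^{n,k}_J$, where $\pi^{n,k}_J$ is a (selected) minimizer of $\int_{X^n_J\times Y}c^n\,d\pi+\varepsilon^n\,\mathrm{KL}(\pi|\mu^n_J\otimes\nu^n)$ over $\pi\in\Pi(\mu^n_J,P_Y(\pi^{n,k-1}|_{X^n_J\times Y}))$. Set $\nu^{n,k}_J=P_Y(\pi^{n,k}|_{X^n_J\times Y})$. Discrete trajectory. $\boldsymbol{\pi}^n\in\mathcal{M}_+(\mathbb{R}_+\times X\times Y)$ is defined by its disintegration with respect to $\mathcal{L}\otimes\mu$: for $t\ge0$, $x\in X$, with $k=\lfloor nt\rfloor$ and $J=J^n_{t,x}$ the ($\mu$-a.e. unique) cell in $\mathcal{J}^{n,k}$ with $x\in X^n_J$, $\boldsymbol{\pi}^n_{t,x}=\nu^{n,k}_J/m^n_J$. Vertical transport metric. For $\pi,\pi'\in\Pi(\mu):=\{\pi\in\mathcal{M}_+(X\times Y):P_X\pi=\mu\}$ with disintegrations $\pi_x,\pi'_x$ with respect to $\mu$: $\mathcal{W}(\pi,\pi')=\int_XW_Y(\pi_x,\pi'_x)\,d\mu(x)$. Fiber problems. $Z=[-1,1]^d$; $S^n_J:X^n_J\to Z$, $S^n_J(x)=n(x-x^n_J)$; $\sigma^n_J=(S^n_J)_\sharp\mu^n_J/m^n_J$; $\sigma^n_{t,x}=\sigma^n_J$ and $\bar x^n_{t,x}=x^n_J$ with $J=J^n_{t,x}$. Set $\Delta^n(x,z,y)=n[c^n(x+z/n,y)-c(x,y)-\langle\nabla_Xc(x,y),z/n\rangle]$.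 For $\lambda\in\mathcal{P}(Z\times Y)$ let $F^n_{t,x}(\lambda)=C^n_{t,x}(\lambda)$ if $\lambda\in\Pi(\sigma^n_{t,x},\boldsymbol{\pi}^n_{t,x})$ and $+\infty$ otherwise, where, with $L^n_{t,x}(\lambda)=\int_{Z\times Y}[\langle\nabla_Xc(\bar x^n_{t,x},y),z\rangle+\Delta^n(\bar x^n_{t,x},z,y)]\,d\lambda(z,y)$, $$C^n_{t,x}(\lambda)=\begin{cases}L^n_{t,x}(\lambda)+n\varepsilon^n\,\mathrm{KL}(\lambda|\sigma^n_{t,x}\otimes\boldsymbol{\pi}^n_{t,x})&\text{if }\eta<\infty,\\ \mathrm{KL}(\lambda|\sigma^n_{t,x}\otimes\boldsymbol{\pi}^n_{t,x})+\frac1{n\varepsilon^n}L^n_{t,x}(\lambda)&\text{if }\eta=\infty.\end{cases}$$ Let $F_{t,x}(\lambda)=C_{t,x}(\lambda)$ if $\lambda\in\Pi(\sigma,\boldsymbol{\pi}_{t,x})$ and $+\infty$ otherwise, where $$C_{t,x}(\lambda)=\begin{cases}\int_{Z\times Y}\langle\nabla_Xc(x,y),z\rangle\,d\lambda(z,y)+\eta\,\mathrm{KL}(\lambda|\sigma\otimes\boldsymbol{\pi}_{t,x})&\text{if }\eta<\infty,\\ \mathrm{KL}(\lambda|\sigma\otimes\boldsymbol{\pi}_{t,x})&\text{if }\eta=\infty.\end{cases}$$ Glued problems. For $T>0$, $\mathcal{V}_T$ is the set of $\boldsymbol{\lambda}\in\mathcal{M}_+([0,T]\times X\times Z\times Y)$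 whose marginal on $[0,T]\times X$ is $(\mathcal{L}|_{[0,T]})\otimes\mu$; such $\boldsymbol{\lambda}$ disintegrate into probability measures $\boldsymbol{\lambda}_{t,x}$ on $Z\times Y$, and $$F^n_T(\boldsymbol{\lambda})=\int_0^T\int_XF^n_{t,x}(\boldsymbol{\lambda}_{t,x})\,d\mu(x)\,dt,\qquad F_T(\boldsymbol{\lambda})=\int_0^T\int_XF_{t,x}(\boldsymbol{\lambda}_{t,x})\,d\mu(x)\,dt.$$ *)

theory Defs
  imports "HOL-Probability.Probability"
begin

section \<open>Measures on subsets of Euclidean space\<close>

text \<open>A measure on a Borel set \<open>S\<close> is encoded as a measure on the Borel sets of the ambient type that
  does not charge the complement of \<open>S\<close>.\<close>

definition prob_on :: "'a::topological_space set \<Rightarrow> 'a measure set" where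
  "prob_on S = {M. sets M = sets borel \<and> prob_space M \<and> emeasure M (- S) = 0}"

text \<open>The restriction \<open>\<rho>|\<^sub>A\<close>, still as a measure on the ambient type.\<close>

definition restr :: "'a set \<Rightarrow> 'a measure \<Rightarrow> 'a measure" where
  "restr A M = density M (indicator A)"

definition couplings ::
  "'a::topological_space measure \<Rightarrow> 'b::topological_space measure \<Rightarrow> ('a \<times> 'b) measure set" where
  "couplings \<alpha> \<beta> = {\<gamma>. sets \<gamma> = sets borel \<and> distr \<gamma> borel fst = \<alpha> \<and> distr \<gamma> borel snd = \<beta>}"

text \<open>Weak* convergence of measures on a compact set \<open>S\<close>; test functions need only be defined
  on \<open>S\<close>, hence the set integrals.\<close>

definition weakstar_on ::
  "'a::topological_space set \<Rightarrow> 'i filter \<Rightarrow> ('i \<Rightarrow> 'a measure) \<Rightarrow> 'a measure \<Rightarrow> bool" where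
  "weakstar_on S F Ms M \<longleftrightarrow>
     (\<forall>f::'a \<Rightarrow> real. continuous_on S f \<longrightarrow>
        ((\<lambda>n. LINT x:S|Ms n. f x) \<longlongrightarrow> (LINT x:S|M. f x)) F)"

text \<open>The measure \<open>\<alpha> \<otimes> \<kappa>\<^sub>a\<close> on the product space.\<close>

definition glue ::
  "'a::topological_space measure \<Rightarrow> ('a \<Rightarrow> 'b::topological_space measure) \<Rightarrow> ('a \<times> 'b) measure" where
  "glue \<alpha> \<kappa> = \<alpha> \<bind> (\<lambda>a. distr (\<kappa> a) borel (Pair a))"

definition is_disintegration ::
  "'a::topological_space measure \<Rightarrow> ('a \<times> 'b::topological_space) measure \<Rightarrow> ('a \<Rightarrow> 'b measure) \<Rightarrow> bool" where
  "is_disintegration \<alpha> M \<kappa> \<longleftrightarrow> \<kappa> \<in> \<alpha> \<rightarrow>\<^sub>M prob_algebra borel \<and> M = glue \<alpha> \<kappa>"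

text \<open>Some version of the disintegration; on second-countable spaces it is unique
  \<open>\<alpha>\<close>-almost everywhere.\<close>

definition disint ::
  "'a::topological_space measure \<Rightarrow> ('a \<times> 'b::topological_space) measure \<Rightarrow> 'a \<Rightarrow> 'b measure" where
  "disint \<alpha> M = (SOME \<kappa>. is_disintegration \<alpha> M \<kappa>)"

text \<open>Integral of an extended-real function as positive part minus negative part. It is only used
  for integrands that are bounded below, with respect to finite measures.\<close>

definition ereal_integral :: "'a measure \<Rightarrow> ('a \<Rightarrow> ereal) \<Rightarrow> ereal" where
  "ereal_integral M f =
     enn2ereal (\<integral>\<^sup>+x. e2ennreal (f x) \<partial>M) - enn2ereal (\<integral>\<^sup>+x. e2ennreal (- f x) \<partial>M)"

definition kl_phi :: "real \<Rightarrow> real" where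
  "kl_phi s = (if s = 0 then 1 else s * ln s - s + 1)"

definition KL :: "'a measure \<Rightarrow> 'a measure \<Rightarrow> ereal" where
  "KL \<alpha> \<beta> =
     (if absolutely_continuous \<beta> \<alpha>
      then enn2ereal (\<integral>\<^sup>+x. ennreal (kl_phi (enn2real (RN_deriv \<beta> \<alpha> x))) \<partial>\<beta>)
      else \<infinity>)"

definition wasserstein1 :: "'a::metric_space measure \<Rightarrow> 'a measure \<Rightarrow> ennreal" where
  "wasserstein1 \<alpha> \<beta> = (INF \<gamma> \<in> couplings \<alpha> \<beta>. \<integral>\<^sup>+p. ennreal (dist (fst p) (snd p)) \<partial>\<gamma>)"

definition vertical_dist ::
  "'a::topological_space measure \<Rightarrow> ('a \<times> 'b::metric_space) measure \<Rightarrow> ('a \<times> 'b) measure \<Rightarrow> ennreal" where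
  "vertical_dist \<mu> \<pi> \<pi>' = (\<integral>\<^sup>+x. wasserstein1 (disint \<mu> \<pi> x) (disint \<mu> \<pi>' x) \<partial>\<mu>)"

text \<open>Sequential \<open>\<Gamma>\<close>-convergence on \<open>V\<close> along the index filter \<open>F\<close>, with respect to the notion of
  convergence \<open>conv\<close>. On bounded sets of measures on a compact metric space the weak* topology is
  metrizable, so that there this agrees with the topological notion.\<close>

definition gamma_converges ::
  "'i filter \<Rightarrow> (('i \<Rightarrow> 'a) \<Rightarrow> 'a \<Rightarrow> bool) \<Rightarrow> 'a set \<Rightarrow> ('i \<Rightarrow> 'a \<Rightarrow> ereal) \<Rightarrow> ('a \<Rightarrow> ereal) \<Rightarrow> bool" where
  "gamma_converges F conv V \<Phi>s \<Phi> \<longleftrightarrow>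
     (\<forall>x\<in>V.
        (\<forall>xs. (\<forall>n. xs n \<in> V) \<and> conv xs x \<longrightarrow> \<Phi> x \<le> Liminf F (\<lambda>n. \<Phi>s n (xs n))) \<and>
        (\<exists>xs. (\<forall>n. xs n \<in> V) \<and> conv xs x \<and> Limsup F (\<lambda>n. \<Phi>s n (xs n)) \<le> \<Phi> x))"

text \<open>\<open>C\<^sup>1\<close> on a set that need not be open: restriction of a \<open>C\<^sup>1\<close> function on an open
  neighbourhood.\<close>

definition C1_on :: "'a::real_normed_vector set \<Rightarrow> ('a \<Rightarrow> real) \<Rightarrow> bool" where
  "C1_on S g \<longleftrightarrow>
     (\<exists>U h (D :: 'a \<Rightarrow> 'a \<Rightarrow>\<^sub>L real). open U \<and> S \<subseteq> U \<and>
        (\<forall>p\<in>U. (h has_derivative blinfun_apply (D p)) (at p)) \<and> continuous_on U D \<and>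
        (\<forall>p\<in>S. h p = g p))"

section \<open>Cells\<close>

definition pos_evens :: "nat set" where
  "pos_evens = {n. even n \<and> 0 < n}"

definition along :: "nat set \<Rightarrow> nat filter" where
  "along A = inf sequentially (principal A)"

definition X_dom :: "(real^'d) set" where
  "X_dom = {x. \<forall>l. 0 \<le> x $ l \<and> x $ l \<le> 1}"

definition Z_dom :: "(real^'d) set" where
  "Z_dom = {z. \<forall>l. - 1 \<le> z $ l \<and> z $ l \<le> 1}"

definition indices :: "nat \<Rightarrow> (nat^'d) set" where
  "indices n = {i. \<forall>l. i $ l < n}"

definition basic_cell :: "nat \<Rightarrow> nat^'d \<Rightarrow> (real^'d) set" where
  "basic_cell n i =
     {x. \<forall>l. real (i $ l) / real n \<le> x $ l \<and> x $ l \<le> real (i $ l) / real n + 1 / real n}"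

definition partition_A :: "nat \<Rightarrow> (nat^'d) set set" where
  "partition_A n =
     indices n // {(i, j). i \<in> indices n \<and> j \<in> indices n \<and> (\<forall>l. i $ l div 2 = j $ l div 2)}"

definition partition_B :: "nat \<Rightarrow> (nat^'d) set set" where
  "partition_B n =
     indices n //
       {(i, j). i \<in> indices n \<and> j \<in> indices n \<and> (\<forall>l. (i $ l + 1) div 2 = (j $ l + 1) div 2)}"

definition partition_at :: "nat \<Rightarrow> nat \<Rightarrow> (nat^'d) set set" where
  "partition_at n k = (if odd k then partition_A n else partition_B n)"

definition comp_cell :: "nat \<Rightarrow> (nat^'d) set \<Rightarrow> (real^'d) set" where
  "comp_cell n J = (\<Union>i\<in>J. basic_cell n i)"

definition cell_mass :: "(real^'d) measure \<Rightarrow> nat \<Rightarrow> (nat^'d) set \<Rightarrow> real" where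
  "cell_mass \<mu> n J = (\<Sum>i\<in>J. measure \<mu> (basic_cell n i))"

definition cell_center :: "nat \<Rightarrow> nat \<Rightarrow> (nat^'d) set \<Rightarrow> (real^'d)" where
  "cell_center n k J =
     (THE x. x \<in> comp_cell n J \<and>
        (\<forall>l. \<exists>j::nat. j \<le> n \<and> (if odd k then odd j else even j) \<and> x $ l = real j / real n))"

section \<open>Domain decomposition iterates and the discrete trajectory\<close>

definition cell_marginal ::
  "(real^'d) set \<Rightarrow> nat \<Rightarrow> (nat^'d) set \<Rightarrow> ((real^'d) \<times> (real^'d)) measure \<Rightarrow> (real^'d) measure" where
  "cell_marginal Y n J \<pi> = distr (restr (comp_cell n J \<times> Y) \<pi>) borel snd"

definition cell_objective ::
  "(real^'d) set \<Rightarrow> (real^'d) measure \<Rightarrow> (real^'d) measure \<Rightarrow> ((real^'d) \<times> (real^'d) \<Rightarrow> real) \<Rightarrow> real \<Rightarrow>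
   nat \<Rightarrow> (nat^'d) set \<Rightarrow> ((real^'d) \<times> (real^'d)) measure \<Rightarrow> ereal" where
  "cell_objective Y \<mu>n \<nu>n cn \<epsilon>n n J \<gamma> =
     ereal (LINT p:comp_cell n J \<times> Y|\<gamma>. cn p) +
     ereal \<epsilon>n * KL \<gamma> (restr (comp_cell n J) \<mu>n \<Otimes>\<^sub>M \<nu>n)"

text \<open>\<open>\<pi> k\<close> is the \<open>k\<close>-th iterate for one fixed \<open>n\<close>. The choice \<open>\<gamma>\<close> of cell-wise minimizers is
  arbitrary; the sum of the measures \<open>\<gamma> J\<close> is expressed set by set.\<close>

definition dd_iterates ::
  "(real^'d) set \<Rightarrow> (real^'d) measure \<Rightarrow> (real^'d) measure \<Rightarrow> ((real^'d) \<times> (real^'d) \<Rightarrow> real) \<Rightarrow> real \<Rightarrow>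
   nat \<Rightarrow> ((real^'d) \<times> (real^'d)) measure \<Rightarrow> (nat \<Rightarrow> ((real^'d) \<times> (real^'d)) measure) \<Rightarrow> bool" where
  "dd_iterates Y \<mu>n \<nu>n cn \<epsilon>n n \<pi>init \<pi> \<longleftrightarrow>
     \<pi> 0 = \<pi>init \<and>
     (\<forall>k\<ge>1. \<exists>\<gamma>.
        (\<forall>J\<in>partition_at n k.
           is_arg_min (cell_objective Y \<mu>n \<nu>n cn \<epsilon>n n J)
             (\<lambda>\<rho>. \<rho> \<in> couplings (restr (comp_cell n J) \<mu>n) (cell_marginal Y n J (\<pi> (k - 1))))
             (\<gamma> J)) \<and>
        sets (\<pi> k) = sets borel \<and>
        (\<forall>A\<in>sets borel. emeasure (\<pi> k) A = (\<Sum>J\<in>partition_at n k. emeasure (\<gamma> J) A)))"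

definition step_at :: "nat \<Rightarrow> real \<Rightarrow> nat" where
  "step_at n t = nat \<lfloor>real n * t\<rfloor>"

text \<open>For \<open>x\<close> on a common face of several composite cells an arbitrary one of them is selected.\<close>

definition cell_at :: "nat \<Rightarrow> real \<Rightarrow> (real^'d) \<Rightarrow> (nat^'d) set" where
  "cell_at n t x = (SOME J. J \<in> partition_at n (step_at n t) \<and> x \<in> comp_cell n J)"

definition center_at :: "nat \<Rightarrow> real \<Rightarrow> (real^'d) \<Rightarrow> (real^'d)" where
  "center_at n t x = cell_center n (step_at n t) (cell_at n t x)"

text \<open>\<open>\<pi>\<close> is the sequence of iterates for the given \<open>n\<close>. Normalization is by the mass of the
  cell under \<open>\<mu>\<close>, which equals its mass under \<open>\<mu>\<^sup>n\<close>.\<close>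

definition traj_fiber ::
  "(real^'d) set \<Rightarrow> (real^'d) measure \<Rightarrow> (nat \<Rightarrow> ((real^'d) \<times> (real^'d)) measure) \<Rightarrow>
   nat \<Rightarrow> real \<Rightarrow> (real^'d) \<Rightarrow> (real^'d) measure" where
  "traj_fiber Y \<mu> \<pi> n t x =
     scale_measure (ennreal (1 / cell_mass \<mu> n (cell_at n t x)))
       (cell_marginal Y n (cell_at n t x) (\<pi> (step_at n t)))"

definition traj_slice ::
  "(real^'d) set \<Rightarrow> (real^'d) measure \<Rightarrow> (nat \<Rightarrow> ((real^'d) \<times> (real^'d)) measure) \<Rightarrow>
   nat \<Rightarrow> real \<Rightarrow> ((real^'d) \<times> (real^'d)) measure" where
  "traj_slice Y \<mu> \<pi> n t = glue \<mu> (traj_fiber Y \<mu> \<pi> n t)"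

definition sigma_fiber ::
  "(real^'d) measure \<Rightarrow> (real^'d) measure \<Rightarrow> nat \<Rightarrow> real \<Rightarrow> (real^'d) \<Rightarrow> (real^'d) measure" where
  "sigma_fiber \<mu> \<mu>n n t x =
     scale_measure (ennreal (1 / cell_mass \<mu> n (cell_at n t x)))
       (distr (restr (comp_cell n (cell_at n t x)) \<mu>n) borel
         (\<lambda>x'. real n *\<^sub>R (x' - center_at n t x)))"

section \<open>Fiber and glued problems\<close>

definition perturbed_cost ::
  "('a \<Rightarrow> real) \<Rightarrow> (nat \<Rightarrow> 'a \<Rightarrow> real) \<Rightarrow> nat \<Rightarrow> 'a \<Rightarrow> real" where
  "perturbed_cost c f n p = c p + f n p / real n"

text \<open>The derivative is taken within \<open>X\<close>, so it is also meaningful on the boundary of \<open>X\<close> and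
  depends only on the values of \<open>c\<close> on \<open>X \<times> Y\<close>.\<close>

definition grad_X :: "((real^'d) \<times> (real^'d) \<Rightarrow> real) \<Rightarrow> (real^'d) \<Rightarrow> (real^'d) \<Rightarrow> (real^'d)" where
  "grad_X c x y = (THE g. ((\<lambda>x'. c (x', y)) has_derivative (\<lambda>h. g \<bullet> h)) (at x within X_dom))"

text \<open>At boundary cells \<open>x + z/n\<close> may leave \<open>X\<close>, where the cost is not defined. Such \<open>z\<close> are not
  charged by \<open>\<sigma>\<^sup>n\<close> and the value there is set to \<open>0\<close>.\<close>

definition Delta ::
  "((real^'d) \<times> (real^'d) \<Rightarrow> real) \<Rightarrow> (nat \<Rightarrow> (real^'d) \<times> (real^'d) \<Rightarrow> real) \<Rightarrow>
   nat \<Rightarrow> (real^'d) \<Rightarrow> (real^'d) \<Rightarrow> (real^'d) \<Rightarrow> real" where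
  "Delta c f n x z y =
     (if x + (1 / real n) *\<^sub>R z \<in> X_dom
      then real n * (perturbed_cost c f n (x + (1 / real n) *\<^sub>R z, y) - c (x, y)
                       - grad_X c x y \<bullet> ((1 / real n) *\<^sub>R z))
      else 0)"

definition L_n ::
  "(real^'d) set \<Rightarrow> ((real^'d) \<times> (real^'d) \<Rightarrow> real) \<Rightarrow> (nat \<Rightarrow> (real^'d) \<times> (real^'d) \<Rightarrow> real) \<Rightarrow>
   nat \<Rightarrow> real \<Rightarrow> (real^'d) \<Rightarrow> ((real^'d) \<times> (real^'d)) measure \<Rightarrow> real" where
  "L_n Y c f n t x \<gamma> =
     (LINT p:Z_dom \<times> Y|\<gamma>.
        grad_X c (center_at n t x) (snd p) \<bullet> fst p + Delta c f n (center_at n t x) (fst p) (snd p))"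

text \<open>If \<open>\<eta> = \<infinity>\<close> then \<open>\<epsilon> n = 0\<close> is possible for finitely many \<open>n\<close> only; the value for these is
  irrelevant.\<close>

definition F_n_fiber ::
  "(real^'d) set \<Rightarrow> (real^'d) measure \<Rightarrow> ((real^'d) \<times> (real^'d) \<Rightarrow> real) \<Rightarrow>
   (nat \<Rightarrow> (real^'d) \<times> (real^'d) \<Rightarrow> real) \<Rightarrow> (nat \<Rightarrow> real) \<Rightarrow> ereal \<Rightarrow> (nat \<Rightarrow> (real^'d) measure) \<Rightarrow>
   (nat \<Rightarrow> nat \<Rightarrow> ((real^'d) \<times> (real^'d)) measure) \<Rightarrow>
   nat \<Rightarrow> real \<Rightarrow> (real^'d) \<Rightarrow> ((real^'d) \<times> (real^'d)) measure \<Rightarrow> ereal" where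
  "F_n_fiber Y \<mu> c f \<epsilon> \<eta> \<mu>s \<pi>s n t x \<gamma> =
     (let \<sigma>n = sigma_fiber \<mu> (\<mu>s n) n t x; \<pi>n = traj_fiber Y \<mu> (\<pi>s n) n t x in
      if \<gamma> \<in> couplings \<sigma>n \<pi>n
      then (if \<eta> < \<infinity>
            then ereal (L_n Y c f n t x \<gamma>) + ereal (real n * \<epsilon> n) * KL \<gamma> (\<sigma>n \<Otimes>\<^sub>M \<pi>n)
            else KL \<gamma> (\<sigma>n \<Otimes>\<^sub>M \<pi>n) + ereal (1 / (real n * \<epsilon> n) * L_n Y c f n t x \<gamma>))
      else \<infinity>)"

text \<open>\<open>\<pi>tx\<close> stands for the fiber of the limit trajectory at \<open>(t, x)\<close>.\<close>

definition F_fiber ::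
  "(real^'d) set \<Rightarrow> ((real^'d) \<times> (real^'d) \<Rightarrow> real) \<Rightarrow> ereal \<Rightarrow> (real^'d) measure \<Rightarrow>
   (real^'d) measure \<Rightarrow> (real^'d) \<Rightarrow> ((real^'d) \<times> (real^'d)) measure \<Rightarrow> ereal" where
  "F_fiber Y c \<eta> \<sigma> \<pi>tx x \<gamma> =
     (if \<gamma> \<in> couplings \<sigma> \<pi>tx
      then (if \<eta> < \<infinity>
            then ereal (LINT p:Z_dom \<times> Y|\<gamma>. grad_X c x (snd p) \<bullet> fst p) + \<eta> * KL \<gamma> (\<sigma> \<Otimes>\<^sub>M \<pi>tx)
            else KL \<gamma> (\<sigma> \<Otimes>\<^sub>M \<pi>tx))
      else \<infinity>)"

definition glued_dom :: "(real^'d) set \<Rightarrow> real \<Rightarrow> ((real \<times> (real^'d)) \<times> ((real^'d) \<times> (real^'d))) set" where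
  "glued_dom Y T = ({0..T} \<times> X_dom) \<times> (Z_dom \<times> Y)"

definition V_T ::
  "(real^'d) set \<Rightarrow> (real^'d) measure \<Rightarrow> real \<Rightarrow>
   ((real \<times> (real^'d)) \<times> ((real^'d) \<times> (real^'d))) measure set" where
  "V_T Y \<mu> T =
     {M. sets M = sets borel \<and> emeasure M (- glued_dom Y T) = 0 \<and>
         distr M borel fst = restr {0..T} lborel \<Otimes>\<^sub>M \<mu>}"

text \<open>The glued functional for a family \<open>\<Phi> t x\<close> of fiber functionals.\<close>

definition glued ::
  "(real^'d) measure \<Rightarrow> (real \<Rightarrow> (real^'d) \<Rightarrow> ((real^'d) \<times> (real^'d)) measure \<Rightarrow> ereal) \<Rightarrow> real \<Rightarrow>
   ((real \<times> (real^'d)) \<times> ((real^'d) \<times> (real^'d))) measure \<Rightarrow> ereal" where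
  "glued \<mu> \<Phi> T M =
     ereal_integral (restr {0..T} lborel) (\<lambda>t.
       ereal_integral \<mu> (\<lambda>x. \<Phi> t x (disint (restr {0..T} lborel \<Otimes>\<^sub>M \<mu>) M (t, x))))"

definition F_n_T ::
  "(real^'d) set \<Rightarrow> (real^'d) measure \<Rightarrow> ((real^'d) \<times> (real^'d) \<Rightarrow> real) \<Rightarrow>
   (nat \<Rightarrow> (real^'d) \<times> (real^'d) \<Rightarrow> real) \<Rightarrow> (nat \<Rightarrow> real) \<Rightarrow> ereal \<Rightarrow> (nat \<Rightarrow> (real^'d) measure) \<Rightarrow>
   (nat \<Rightarrow> nat \<Rightarrow> ((real^'d) \<times> (real^'d)) measure) \<Rightarrow> real \<Rightarrow>
   nat \<Rightarrow> ((real \<times> (real^'d)) \<times> ((real^'d) \<times> (real^'d))) measure \<Rightarrow> ereal" where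
  "F_n_T Y \<mu> c f \<epsilon> \<eta> \<mu>s \<pi>s T n = glued \<mu> (F_n_fiber Y \<mu> c f \<epsilon> \<eta> \<mu>s \<pi>s n) T"

text \<open>The fibers \<open>(t, x) \<mapsto> \<pi>\<^sub>t\<^sub>,\<^sub>x\<close> of a measure on time \<open>\<times> X \<times> Y\<close>, with respect to Lebesgue measure
  on \<open>[0, \<infinity>)\<close> times \<open>\<mu>\<close>.\<close>

definition limit_fiber ::
  "(real^'d) measure \<Rightarrow> (real \<times> ((real^'d) \<times> (real^'d))) measure \<Rightarrow> real \<Rightarrow> (real^'d) \<Rightarrow> (real^'d) measure" where
  "limit_fiber \<mu> \<P> t x =
     disint (restr {0..} lborel \<Otimes>\<^sub>M \<mu>) (distr \<P> borel (\<lambda>(t, x, y). ((t, x), y))) (t, x)"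

definition F_T ::
  "(real^'d) set \<Rightarrow> (real^'d) measure \<Rightarrow> ((real^'d) \<times> (real^'d) \<Rightarrow> real) \<Rightarrow> ereal \<Rightarrow> (real^'d) measure \<Rightarrow>
   (real \<times> ((real^'d) \<times> (real^'d))) measure \<Rightarrow> real \<Rightarrow>
   ((real \<times> (real^'d)) \<times> ((real^'d) \<times> (real^'d))) measure \<Rightarrow> ereal" where
  "F_T Y \<mu> c \<eta> \<sigma> \<P> T = glued \<mu> (\<lambda>t x. F_fiber Y c \<eta> \<sigma> (limit_fiber \<mu> \<P> t x) x) T"

end

theory Submission
  imports Defs
begin

text \<open>The glued functionals integrate fiber problems over \<open>(t, x)\<close>, and the fiber problems are entropic
 transport problems whose marginals \<open>\<sigma>\<^sup>n\<^sub>t\<^sub>,\<^sub>x\<close>, \<open>\<pi>\<^sup>n\<^sub>t\<^sub>,\<^sub>x\<close> vary with \<open>n\<close>. Three things are needed: the marginals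
 converge, the costs converge uniformly, and the limit passes through the entropy and the hard marginal
 constraints, which are not continuous.

 Convergence of the marginals is only needed in mean over \<open>(t, x)\<close> and for one test function at a time.
 For \<open>\<sigma>\<^sup>n\<close> it is condition (B) with dominated convergence (\<open>sigma_kernels_converge\<close>). For \<open>\<pi>\<^sup>n\<close> a continuous
 test function on a compact set is Lipschitz up to a small error, so that its integral is controlled by
 \<open>W\<^sub>Y\<close>, and condition (A) applies (\<open>traj_kernels_converge\<close>). The cost of the fiber problem at \<open>(t, x)\<close> is a
 difference quotient of \<open>c\<close> at scale \<open>1/n\<close> near \<open>x\<close> plus \<open>f\<^sup>n\<close>, hence uniformly close to
 \<open>\<langle>\<nabla>\<^sub>Xc(x, y), z\<rangle>\<close> (\<open>linearisation_uniform\<close>).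

 For the lower bound everything is dualised. With \<open>KL(\<lambda>|\<beta>) \<ge> \<integral>g d\<lambda> - \<integral>(e\<^sup>g - 1) d\<beta>\<close> and with potentials
 \<open>h\<^sub>1(z) + h\<^sub>2(y)\<close> whose integrals against \<open>\<lambda>\<close> and \<open>\<sigma> \<otimes> \<pi>\<close> agree exactly when the marginals are right, the glued
 functional dominates \<open>dual_value\<close> for all continuous \<open>g\<close>, \<open>h\<^sub>1\<close>, \<open>h\<^sub>2\<close> on the glued space (\<open>glued_dual_bound\<close>).
 These dual values are integrals of continuous functions against \<open>\<lambda>\<^sup>n\<close> and against the glued products
 \<open>\<sigma>\<^sup>n \<otimes> \<pi>\<^sup>n\<close>, so they converge (\<open>weak_limit_products\<close>). Conversely, if all dual values of a measure are at most
 \<open>K\<close>, then almost all its fibers are couplings, it has a density with respect to the glued product, and the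
 limit functional is at most \<open>K\<close> (\<open>dual_bound_imp_couplings\<close>, \<open>F_T_le\<close>).

 For recovery sequences a coupling of \<open>\<sigma>\<close> and \<open>\<pi>\<close> has to be turned into couplings of \<open>\<sigma>\<^sup>n\<close> and \<open>\<pi>\<^sup>n\<close>,
 measurably in \<open>(t, x)\<close> and without increasing the entropy in the limit. Partitions of unity of mesh \<open>d\<close> on
 \<open>Z\<close> and \<open>Y\<close> reduce it to a finite matrix of block weights, which is corrected to the block weights of the
 new marginals by an explicit formula that is continuous at the limit (\<open>adjust\<close>) and then spread over each
 block proportionally to \<open>\<sigma>\<^sup>n \<otimes> \<pi>\<^sup>n\<close> (\<open>block_measure\<close>). By convexity, block averaging does not increase the
 entropy (\<open>block_KL_le\<close>). A diagonal argument lets \<open>d \<rightarrow> 0\<close> (\<open>recovery_sequence\<close>).\<close>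

abbreviation kernel :: "'a measure => ('a => 'b::topological_space measure) => bool" where
 "kernel \<a> \<k> \<equiv> \<k> \<in> \<a> \<rightarrow>\<^sub>M prob_algebra borel"

section \<open>Gluing and disintegration\<close>

lemma glue_kernel_measurable:
 fixes \<a> :: "'a::second_countable_topology measure" and \<k> :: "'a => 'b::second_countable_topology measure"
 assumes [measurable_cong]: "sets \<a> = sets borel" and [measurable]: "kernel \<a> \<k>"
 shows "kernel \<a> (\<lambda>a. distr (\<k> a) borel (Pair a))"
proof -
 have "(\<lambda>a. distr (\<k> a) (borel \<Otimes>\<^sub>M borel) (Pair a)) \<in> \<a> \<rightarrow>\<^sub>M prob_algebra (borel \<Otimes>\<^sub>M borel)"
  by (rule measurable_distr_prob_space2[where M=borel]) measurable
 then show ?thesis by (simp add: borel_prod)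
qed

lemma kernel_fiber:
 assumes "kernel \<a> \<k>" "a \<in> space \<a>"
 shows "prob_space (\<k> a)" "sets (\<k> a) = sets borel" "space (\<k> a) = UNIV"
proof -
 have "\<k> a \<in> space (prob_algebra borel)"
  using assms by (rule measurable_space)
 then show "prob_space (\<k> a)" "sets (\<k> a) = sets borel" "space (\<k> a) = UNIV"
  by (auto simp: space_prob_algebra dest: sets_eq_imp_space_eq)
qed

lemma measurable_Pair_borel[measurable]:
 "Pair (a::'a::second_countable_topology) \<in> borel \<rightarrow>\<^sub>M (borel :: ('a \<times> 'b::second_countable_topology) measure)"
 by (simp add: borel_prod[symmetric])

lemma nn_integral_glue:
 fixes \<a> :: "'a::second_countable_topology measure" and \<k> :: "'a => 'b::second_countable_topology measure"
 assumes \<a>: "sets \<a> = sets borel" and \<k>: "kernel \<a> \<k>"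
  and f: "f \<in> borel_measurable borel"
 shows "(\<integral>\<^sup>+p. f p \<partial>glue \<a> \<k>) = (\<integral>\<^sup>+a. \<integral>\<^sup>+b. f (a, b) \<partial>\<k> a \<partial>\<a>)"
proof -
 have "(\<integral>\<^sup>+p. f p \<partial>glue \<a> \<k>) = (\<integral>\<^sup>+a. \<integral>\<^sup>+p. f p \<partial>distr (\<k> a) borel (Pair a) \<partial>\<a>)"
  unfolding glue_def
  by (rule nn_integral_bind[OF f measurable_prob_algebraD[OF glue_kernel_measurable[OF \<a> \<k>]]])
 also have "\<dots> = (\<integral>\<^sup>+a. \<integral>\<^sup>+b. f (a, b) \<partial>\<k> a \<partial>\<a>)"
 proof (rule nn_integral_cong)
  fix a assume "a \<in> space \<a>"
  note kernel_fiber[OF \<k> this, measurable_cong]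
  then show "(\<integral>\<^sup>+p. f p \<partial>distr (\<k> a) borel (Pair a)) = (\<integral>\<^sup>+b. f (a, b) \<partial>\<k> a)"
   using f by (subst nn_integral_distr) (auto cong: measurable_cong_sets)
 qed
 finally show ?thesis .
qed

lemma sets_glue [simp]:
 fixes \<a> :: "'a::second_countable_topology measure" and \<k> :: "'a => 'b::second_countable_topology measure"
 assumes "sets \<a> = sets borel"
 shows "sets (glue \<a> \<k>) = sets borel"
 unfolding glue_def using assms
 by (subst sets_bind[of _ _ borel]) (auto dest: sets_eq_imp_space_eq)

lemma emeasure_glue:
 fixes \<a> :: "'a::second_countable_topology measure" and \<k> :: "'a => 'b::second_countable_topology measure"
 assumes \<a>: "sets \<a> = sets borel" and \<k>: "kernel \<a> \<k>"
  and S[measurable]: "S \<in> sets borel"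
 shows "emeasure (glue \<a> \<k>) S = (\<integral>\<^sup>+a. emeasure (\<k> a) (Pair a -` S) \<partial>\<a>)"
proof -
 have "emeasure (glue \<a> \<k>) S = (\<integral>\<^sup>+p. indicator S p \<partial>glue \<a> \<k>)"
  using \<a> by (subst nn_integral_indicator) auto
 also have "\<dots> = (\<integral>\<^sup>+a. \<integral>\<^sup>+b. indicator S (a, b) \<partial>\<k> a \<partial>\<a>)"
  by (rule nn_integral_glue[OF \<a> \<k>]) simp
 also have "\<dots> = (\<integral>\<^sup>+a. emeasure (\<k> a) (Pair a -` S) \<partial>\<a>)"
 proof (rule nn_integral_cong)
  fix a assume "a \<in> space \<a>"
  note fib = kernel_fiber[OF \<k> this]
  note fib(2)[measurable_cong]
  have "Pair a -` S \<in> sets (\<k> a)"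
   using measurable_sets[OF measurable_Pair_borel[of a] S] fib by simp
  then show "(\<integral>\<^sup>+b. indicator S (a, b) \<partial>\<k> a) = emeasure (\<k> a) (Pair a -` S)"
   by (simp add: indicator_vimage[symmetric] flip: nn_integral_indicator)
 qed
 finally show ?thesis .
qed

text \<open>Rectangles generate the Borel sets of a product, so that finite measures on it are determined by
 rectangles.\<close>

lemma sets_borel_rectangles:
 "sets (borel :: ('a::second_countable_topology \<times> 'b::second_countable_topology) measure) =
   sigma_sets UNIV {B \<times> C | B C. B \<in> sets borel \<and> C \<in> sets borel}"
 unfolding borel_prod[symmetric] sets_pair_measure by simp

lemma borel_UNIV: "UNIV \<in> sets borel"
 by simp

lemma emeasure_glue_Times:
 fixes \<a> :: "'a::second_countable_topology measure" and \<k> :: "'a => 'b::second_countable_topology measure"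
 assumes \<a>: "sets \<a> = sets borel" and \<k>: "kernel \<a> \<k>"
  and B[measurable]: "B \<in> sets borel" and C[measurable]: "C \<in> sets borel"
 shows "emeasure (glue \<a> \<k>) (B \<times> C) = (\<integral>\<^sup>+a. emeasure (\<k> a) C * indicator B a \<partial>\<a>)"
proof -
 have "B \<times> C \<in> sets borel" by (rule borel_Times[OF B C])
 then show ?thesis
  by (subst emeasure_glue[OF \<a> \<k>])
    (auto intro!: nn_integral_cong simp: vimage_def split: split_indicator)
qed

lemma distr_fst_glue:
 fixes \<a> :: "'a::second_countable_topology measure" and \<k> :: "'a => 'b::second_countable_topology measure"
 assumes \<a>: "sets \<a> = sets borel" and \<k>: "kernel \<a> \<k>"
 shows "distr (glue \<a> \<k>) borel fst = \<a>"
proof (rule measure_eqI)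
 fix B assume "B \<in> sets (distr (glue \<a> \<k>) borel fst)"
 then have B[measurable]: "B \<in> sets borel" by simp
 have [measurable]: "fst \<in> glue \<a> \<k> \<rightarrow>\<^sub>M borel"
  unfolding measurable_cong_sets[OF sets_glue[OF \<a>] refl] by (simp add: borel_prod[symmetric])
 have sp: "space (glue \<a> \<k>) = UNIV" using sets_eq_imp_space_eq[OF sets_glue[OF \<a>]] by simp
 have "emeasure (distr (glue \<a> \<k>) borel fst) B = emeasure (glue \<a> \<k>) (B \<times> UNIV)"
  by (subst emeasure_distr) (auto simp: sp intro!: arg_cong[where f="emeasure _"])
 also have "\<dots> = (\<integral>\<^sup>+a. indicator B a \<partial>\<a>)"
  unfolding emeasure_glue_Times[OF \<a> \<k> B borel_UNIV]
 proof (rule nn_integral_cong)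
  fix a assume "a \<in> space \<a>"
  from kernel_fiber[OF \<k> this] show "emeasure (\<k> a) UNIV * indicator B a = indicator B a"
   by (metis mult_1 prob_space.emeasure_space_1)
 qed
 finally show "emeasure (distr (glue \<a> \<k>) borel fst) B = emeasure \<a> B"
  using \<a> by simp
qed (simp add: \<a>)

lemma AE_le_of_set_integrals:
 assumes [measurable]: "f \<in> borel_measurable M" "g \<in> borel_measurable M"
  and fin: "(\<integral>\<^sup>+x. g x \<partial>M) \<noteq> \<infinity>"
  and le: "\<And>A. A \<in> sets M ==> (\<integral>\<^sup>+x. f x * indicator A x \<partial>M) \<le> (\<integral>\<^sup>+x. g x * indicator A x \<partial>M)"
 shows "AE x in M. f x \<le> (g x :: ennreal)"
proof (rule ccontr)
 let ?E = "{x \<in> space M. g x < f x}"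
 assume *: "\<not> ?thesis"
 have "(\<integral>\<^sup>+x. g x * indicator ?E x \<partial>M) < (\<integral>\<^sup>+x. f x * indicator ?E x \<partial>M)"
 proof (rule nn_integral_less)
  have "(\<integral>\<^sup>+x. g x * indicator ?E x \<partial>M) \<le> (\<integral>\<^sup>+x. g x \<partial>M)"
   by (intro nn_integral_mono) (auto split: split_indicator)
  then show "(\<integral>\<^sup>+x. g x * indicator ?E x \<partial>M) \<noteq> \<infinity>" using fin
   by (auto simp: top_unique)
  show "\<not> (AE x in M. f x * indicator ?E x \<le> g x * indicator ?E x)"
  proof
   assume "AE x in M. f x * indicator ?E x \<le> g x * indicator ?E x"
   then have "AE x in M. f x \<le> g x"
    using AE_space by eventually_elim (auto split: split_indicator_asm simp: not_less)
   with * show False by simp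
  qed
 qed (auto split: split_indicator)
 moreover have "?E \<in> sets M" by measurable
 ultimately show False using le[of ?E] by simp
qed

lemma finite_measure_eqI_rectangles:
 fixes M N :: "('a::second_countable_topology \<times> 'b::second_countable_topology) measure"
 assumes M: "sets M = sets borel" and N: "sets N = sets borel"
  and fin: "emeasure M UNIV \<noteq> \<infinity>"
  and eq: "\<And>B C. B \<in> sets borel ==> C \<in> sets borel ==> emeasure M (B \<times> C) = emeasure N (B \<times> C)"
 shows "M = N"
proof (rule measure_eqI_generator_eq)
 let ?E = "{B \<times> C | B C. B \<in> sets borel \<and> C \<in> sets (borel)} :: ('a \<times> 'b) set set"
 show "Int_stable ?E" by (rule Int_stable_pair_measure_generator)
 show "?E \<subseteq> Pow UNIV" by simp
 show "sets M = sigma_sets UNIV ?E" "sets N = sigma_sets UNIV ?E"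
  using M N sets_borel_rectangles by auto
 show "emeasure M (UNIV) \<noteq> \<infinity>" by fact
 show "range (\<lambda>_::nat. UNIV) \<subseteq> ?E" by (auto intro!: exI[of _ UNIV])
qed (use eq in auto)

lemma borel_countable_Int_stable_generator:
 obtains G :: "'b::second_countable_topology set set"
 where "countable G" "Int_stable G" "UNIV \<in> G" "sets borel = sigma_sets UNIV G"
proof -
 obtain B :: "'b set set" where B: "countable B" "topological_basis B"
  using ex_countable_basis by blast
 define G where "G = Inter ` {b. finite b \<and> b \<subseteq> B}"
 have "countable G" unfolding G_def
  by (intro countable_image countable_Collect_finite_subset B)
 moreover have "Int_stable G"
 proof (rule Int_stableI)
  fix a b assume "a \<in> G" "b \<in> G"
  then obtain a' b' where "a = \<Inter> a'" "b = \<Inter> b'" "finite a'" "a' \<subseteq> B" "finite b'" "b' \<subseteq> B"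
   by (auto simp: G_def)
  then show "a \<inter> b \<in> G"
   unfolding G_def by (intro image_eqI[of _ _ "a' \<union> b'"]) auto
 qed
 moreover have "UNIV \<in> G"
  unfolding G_def by (intro image_eqI[of _ _ "{}"]) auto
 moreover have "sets borel = sigma_sets UNIV G"
 proof
  have eq: "sets borel = sigma_sets UNIV B"
   unfolding borel_eq_countable_basis[OF B] by (rule sets_measure_of) simp
  have "B \<subseteq> G"
  proof
   fix b assume "b \<in> B" then show "b \<in> G"
    unfolding G_def by (intro image_eqI[of _ _ "{b}"]) auto
  qed
  then show "sets borel \<subseteq> sigma_sets UNIV G"
   unfolding eq by (rule sigma_sets_mono')
  have "G \<subseteq> sets borel"
  proof
   fix a assume "a \<in> G"
   then obtain b where b: "a = \<Inter> b" "finite b" "b \<subseteq> B" by (auto simp: G_def)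
   then have "\<And>x. x \<in> b ==> open x"
    using B(2) topological_basis_open by blast
   with b show "a \<in> sets borel" by (auto intro!: borel_open open_Inter)
  qed
  then show "sigma_sets UNIV G \<subseteq> sets borel"
   by (metis sets.sigma_sets_subset space_borel)
 qed
 ultimately show thesis by (rule that)
qed

text \<open>A countable generator suffices to compare two fibers, so that countably many null sets are
 discarded.\<close>

lemma glue_kernel_unique:
 fixes \<a> :: "'a::second_countable_topology measure" and \<k> \<k>' :: "'a => 'b::second_countable_topology measure"
 assumes sf: "sigma_finite_measure \<a>" and \<a>: "sets \<a> = sets borel"
  and \<k>: "kernel \<a> \<k>" and \<k>': "kernel \<a> \<k>'"
  and eq: "glue \<a> \<k> = glue \<a> \<k>'"
 shows "AE a in \<a>. \<k> a = \<k>' a"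
proof -
 obtain G :: "'b set set" where G: "countable G" "Int_stable G" "UNIV \<in> G" "sets borel = sigma_sets UNIV G"
  by (rule borel_countable_Int_stable_generator)
 note [measurable] = measurable_prob_algebraD[OF \<k>] measurable_prob_algebraD[OF \<k>']
 have "AE a in \<a>. emeasure (\<k> a) C = emeasure (\<k>' a) C" if "C \<in> G" for C
 proof (rule sigma_finite_measure.density_unique[OF sf])
  have C[measurable]: "C \<in> sets borel" using that G(4) by auto
  show m: "(\<lambda>a. emeasure (\<k> a) C) \<in> borel_measurable \<a>" "(\<lambda>a. emeasure (\<k>' a) C) \<in> borel_measurable \<a>"
   by measurable
  show "density \<a> (\<lambda>a. emeasure (\<k> a) C) = density \<a> (\<lambda>a. emeasure (\<k>' a) C)"
  proof (rule measure_eqI)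
   fix B assume "B \<in> sets (density \<a> (\<lambda>a. emeasure (\<k> a) C))"
   then have B: "B \<in> sets borel" using \<a> by simp
   show "emeasure (density \<a> (\<lambda>a. emeasure (\<k> a) C)) B = emeasure (density \<a> (\<lambda>a. emeasure (\<k>' a) C)) B"
    using emeasure_glue_Times[OF \<a> \<k> B C] emeasure_glue_Times[OF \<a> \<k>' B C] eq B \<a>
    by (simp add: emeasure_density[OF m(1)] emeasure_density[OF m(2)])
  qed simp
 qed
 then have "AE a in \<a>. \<forall>C\<in>G. emeasure (\<k> a) C = emeasure (\<k>' a) C"
  by (simp add: AE_ball_countable[OF G(1)])
 then show ?thesis
  using AE_space
 proof eventually_elim
  fix a assume *: "\<forall>C\<in>G. emeasure (\<k> a) C = emeasure (\<k>' a) C" "a \<in> space \<a>"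
  note f = kernel_fiber[OF \<k> *(2)] kernel_fiber[OF \<k>' *(2)]
  show "\<k> a = \<k>' a"
  proof (rule measure_eqI_generator_eq[OF G(2)])
   show "range (\<lambda>_::nat. UNIV) \<subseteq> G" using G(3) by auto
   show "emeasure (\<k> a) UNIV \<noteq> \<infinity>"
    using prob_space.emeasure_space_1[OF f(1)] f(3) by simp
  qed (use f G * in auto)
 qed
qed

text \<open>The countably many questions whether \<open>x \<bullet> b < q\<close>, with \<open>b\<close> a
 basis vector and \<open>q\<close> rational, determine \<open>x\<close>. Their answers are the digits of
 \<open>e x\<close> in base \<open>3\<close>; using only the digits \<open>0\<close> and \<open>1\<close>
 makes them recoverable from the number.\<close>

lemma borel_encoding_into_real:
 obtains e :: "'b::euclidean_space => real" and d :: "real => 'b"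
 where "e \<in> borel \<rightarrow>\<^sub>M borel" "d \<in> borel \<rightarrow>\<^sub>M borel" "\<And>x. d (e x) = x" "\<And>x. 0 \<le> e x \<and> e x < 1"
proof -
 have inf_Q: "infinite (\<rat> :: real set)"
 proof (rule infinite_super[OF Nats_subset_Rats])
  show "infinite (\<nat> :: real set)"
   unfolding Nats_def by (rule range_inj_infinite[OF inj_of_nat])
 qed
 define I where "I = (Basis :: 'b set) \<times> (\<rat> :: real set)"
 have "countable I" unfolding I_def
  by (intro countable_SIGMA countable_finite countable_rat) auto
 moreover have "infinite I" unfolding I_def
  using inf_Q Rats_0 by (auto simp: finite_cartesian_product_iff)
 ultimately obtain u :: "nat => 'b \<times> real" where u: "bij_betw u UNIV I"
  using countableE_infinite bij_betw_inv by metis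
 define bit where "bit k x = (if x \<bullet> fst (u k) < snd (u k) then 1 else 0 :: nat)" for k x
 \<comment> \<open>the tail after any digit is less than 1, so that no carries occur\<close>
 define e where "e x = (\<Sum>k. real (bit k x) * (1/3) ^ Suc k)" for x
 define dig where "dig k r = \<lfloor>3 ^ Suc k * r\<rfloor> mod 3" for k :: nat and r :: real
 define d where "d r = (\<Sum>b\<in>Basis. real_of_ereal (INF k. if fst (u k) = b \<and> dig k r = 1 then ereal (snd (u k)) else \<infinity>) *\<^sub>R b)" for r
 have summ: "summable (\<lambda>k. real (bit (k + m) x) * (1/3) ^ Suc k)" for x m
 proof (rule summable_comparison_test)
  show "\<exists>N. \<forall>n\<ge>N. norm (real (bit (n + m) x) * (1/3) ^ Suc n) \<le> (1/3) ^ n"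
   by (auto simp: bit_def)
  show "summable (\<lambda>n. (1/3::real) ^ n)" by (rule summable_geometric) simp
 qed
 have tail: "0 \<le> (\<Sum>k. real (bit (k + m) x) * (1/3) ^ Suc k) \<and> (\<Sum>k. real (bit (k + m) x) * (1/3) ^ Suc k) < 1" for x m
 proof -
  have "(\<Sum>k. real (bit (k + m) x) * (1/3) ^ Suc k) \<le> (\<Sum>k. (1/3) * (1/3::real) ^ k)"
   by (intro suminf_le summ summable_mult summable_geometric) (auto simp: bit_def)
  also have "\<dots> = 1/2" by (subst suminf_mult) (auto simp: suminf_geometric)
  finally show ?thesis using suminf_nonneg[OF summ[of m x]] by simp
 qed
 have [measurable]: "bit k \<in> borel \<rightarrow>\<^sub>M count_space UNIV" for k
  unfolding bit_def by measurable
 have e_m: "e \<in> borel \<rightarrow>\<^sub>M borel"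
  unfolding e_def by measurable
 have [measurable]: "dig k \<in> borel \<rightarrow>\<^sub>M count_space UNIV" for k
  unfolding dig_def by measurable
 have d_m: "d \<in> borel \<rightarrow>\<^sub>M borel"
  unfolding d_def by measurable
 have dig_e: "dig k (e x) = int (bit k x)" for k x
 proof -
  define t where "t = (\<Sum>j. real (bit (j + Suc k) x) * (1/3) ^ Suc j)"
  define h where "h = (\<Sum>j<k. int (bit j x) * 3 ^ (k - Suc j))"
  have t01: "0 \<le> t" "t < 1" using tail[of "Suc k" x] by (simp_all add: t_def)
  have "e x = (\<Sum>j. real (bit (j + Suc k) x) * (1/3) ^ Suc (j + Suc k)) + (\<Sum>j<Suc k. real (bit j x) * (1/3) ^ Suc j)"
   unfolding e_def using summ[of 0 x] by (intro suminf_split_initial_segment) simp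
  also have "(\<Sum>j. real (bit (j + Suc k) x) * (1/3) ^ Suc (j + Suc k)) = (\<Sum>j. (1/3) ^ Suc k * (real (bit (j + Suc k) x) * (1/3) ^ Suc j))"
   by (intro suminf_cong) (simp add: power_add)
  also have "\<dots> = (1/3) ^ Suc k * t"
   unfolding t_def by (intro suminf_mult summ)
  finally have "3 ^ Suc k * e x = t + (\<Sum>j<Suc k. 3 ^ Suc k * (real (bit j x) * (1/3) ^ Suc j))"
   by (simp add: distrib_left sum_distrib_left power_one_over del: sum.lessThan_Suc)
  also have "(\<Sum>j<Suc k. 3 ^ Suc k * (real (bit j x) * (1/3) ^ Suc j)) = (\<Sum>j<Suc k. real (bit j x) * 3 ^ (k - j))"
  proof (rule sum.cong)
   fix j assume "j \<in> {..<Suc k}"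
   then have "(3::real) ^ Suc k = 3 ^ (k - j) * 3 ^ Suc j"
    by (simp flip: power_add)
   then show "3 ^ Suc k * (real (bit j x) * (1/3) ^ Suc j) = real (bit j x) * 3 ^ (k - j)"
    by (simp add: power_one_over)
  qed simp
  also have "\<dots> = real (bit k x) + (\<Sum>j<k. real (bit j x) * (3 * 3 ^ (k - Suc j)))"
  proof -
   have "(3::real) ^ (k - j) = 3 * 3 ^ (k - Suc j)" if "j < k" for j
    using that by (metis Suc_diff_Suc power_Suc)
   then show ?thesis by simp
  qed
  also have "(\<Sum>j<k. real (bit j x) * (3 * 3 ^ (k - Suc j))) = of_int (3 * h)"
   unfolding h_def by (simp add: sum_distrib_left mult_ac)
  finally have "3 ^ Suc k * e x = t + of_int (int (bit k x) + 3 * h)"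
   by simp
  then have "\<lfloor>3 ^ Suc k * e x\<rfloor> = int (bit k x) + 3 * h"
   using t01 by (intro floor_unique) auto
  then show ?thesis
   unfolding dig_def by (simp add: bit_def)
 qed
 have "d (e x) = x" for x
 proof -
  have "(INF k. if fst (u k) = b \<and> dig k (e x) = 1 then ereal (snd (u k)) else \<infinity>) = ereal (x \<bullet> b)"
   if b: "b \<in> Basis" for b
  proof (rule antisym)
   show "ereal (x \<bullet> b) \<le> (INF k. if fst (u k) = b \<and> dig k (e x) = 1 then ereal (snd (u k)) else \<infinity>)"
    unfolding dig_e by (rule INF_greatest) (auto simp: bit_def split: if_splits)
   show "(INF k. if fst (u k) = b \<and> dig k (e x) = 1 then ereal (snd (u k)) else \<infinity>) \<le> ereal (x \<bullet> b)"
   proof (rule ereal_le_epsilon2)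
    fix \<epsilon> :: real assume "0 < \<epsilon>"
    then obtain q where q: "q \<in> \<rat>" "x \<bullet> b < q" "q < x \<bullet> b + \<epsilon>"
     using Rats_dense_in_real[of "x \<bullet> b" "x \<bullet> b + \<epsilon>"] by auto
    then have "(b, q) \<in> I" using b by (auto simp: I_def)
    then obtain k where k: "u k = (b, q)" using u by (metis bij_betw_iff_bijections)
    have "(INF k. if fst (u k) = b \<and> dig k (e x) = 1 then ereal (snd (u k)) else \<infinity>) \<le> ereal q"
     by (rule INF_lower2[of k]) (use k q in \<open>auto simp: dig_e bit_def\<close>)
    also have "\<dots> \<le> ereal (x \<bullet> b) + ereal \<epsilon>" using q by simp
    finally show "(INF k. if fst (u k) = b \<and> dig k (e x) = 1 then ereal (snd (u k)) else \<infinity>) \<le> ereal (x \<bullet> b) + ereal \<epsilon>" .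
   qed
  qed
  then show ?thesis
   unfolding d_def by (simp add: euclidean_representation)
 qed
 with e_m d_m tail[of 0] show thesis by (intro that[of e d]) (simp_all add: e_def)
qed

text \<open>The distribution function of the fiber over \<open>a\<close> at a rational \<open>q\<close> is
 the density of \<open>B \<mapsto> M (B \<times> {..q})\<close>. Outside a null set these densities are
 monotone in \<open>q\<close>, and their right limits are distribution functions on \<open>[0,
 1)\<close>.\<close>

lemma disintegration_exists_real:
 fixes \<a> :: "'a::second_countable_topology measure" and M :: "('a \<times> real) measure"
 assumes fin: "finite_measure \<a>" and \<a>: "sets \<a> = sets borel" and M: "sets M = sets borel"
  and marg: "distr M borel fst = \<a>" and unit: "emeasure M (UNIV \<times> - {0..<1}) = 0"
 obtains \<k> where "kernel \<a> \<k>" "M = glue \<a> \<k>"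
proof -
 interpret \<a>: finite_measure \<a> by fact
 note [measurable_cong] = \<a>
 have spM: "space M = UNIV" and sp\<a>: "space \<a> = UNIV"
  using M \<a> by (auto dest: sets_eq_imp_space_eq)
 have fst_m: "fst \<in> M \<rightarrow>\<^sub>M borel"
  unfolding measurable_cong_sets[OF M refl] by (simp add: borel_prod[symmetric])
 have strip: "emeasure M (B \<times> UNIV) = emeasure \<a> B" if "B \<in> sets borel" for B
  unfolding marg[symmetric] emeasure_distr[OF fst_m that] spM
  by (auto intro!: arg_cong[where f="emeasure M"])
 have rect: "B \<times> {..r} \<in> sets M" if "B \<in> sets borel" for B and r :: real
  using that M by (simp add: borel_Times)
 have finM: "emeasure M A \<noteq> \<infinity>" if "A \<in> sets M" for A
 proof -
  have "emeasure M A \<le> emeasure M (UNIV \<times> UNIV)"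
   using that M by (intro emeasure_mono) auto
  then show ?thesis
   using strip[OF borel_UNIV] \<a>.emeasure_finite[of UNIV] by (auto simp: top_unique)
 qed
 have "\<exists>p\<in>borel_measurable \<a>. \<forall>B\<in>sets borel. (\<integral>\<^sup>+a. p a * indicator B a \<partial>\<a>) = emeasure M (B \<times> {..r})" for r
 proof -
  define N where "N = distr (density M (indicator (UNIV \<times> {..r}))) borel fst"
  have N: "emeasure N B = emeasure M (B \<times> {..r})" if B: "B \<in> sets borel" for B
  proof -
   have "emeasure N B = emeasure (density M (indicator (UNIV \<times> {..r}))) (B \<times> UNIV)"
    unfolding N_def using fst_m B
    by (subst emeasure_distr) (auto simp: spM intro!: arg_cong[where f="emeasure _"])
   also have "\<dots> = emeasure M (B \<times> {..r})"
    using rect[OF borel_UNIV, of r] borel_Times[OF B borel_UNIV] M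
    by (subst emeasure_restricted) (simp_all add: Times_Int_Times)
   finally show ?thesis .
  qed
  have "absolutely_continuous \<a> N"
   unfolding absolutely_continuous_def null_sets_def
  proof safe
   fix B assume B: "B \<in> sets \<a>" "emeasure \<a> B = 0"
   then have "emeasure N B \<le> emeasure M (B \<times> UNIV)"
    using N \<a> M by (auto intro!: emeasure_mono simp: borel_Times)
   with B show "emeasure N B = 0" using strip[of B] \<a> by simp
   show "B \<in> sets N" using B \<a> by (simp add: N_def)
  qed
  moreover have "sets N = sets \<a>" using \<a> by (simp add: N_def)
  ultimately obtain p where p: "p \<in> borel_measurable \<a>" "density \<a> p = N"
   using \<a>.Radon_Nikodym by blast
  show ?thesis
  proof (intro bexI[OF _ p(1)] ballI)
   fix B :: "'a set" assume "B \<in> sets borel"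
   then show "(\<integral>\<^sup>+a. p a * indicator B a \<partial>\<a>) = emeasure M (B \<times> {..r})"
    using p \<a> N[of B] emeasure_density[OF p(1), of B] by simp
  qed
 qed
 then obtain p where p[measurable]: "\<And>r. p r \<in> borel_measurable \<a>"
  and p_int: "\<And>r B. B \<in> sets borel ==> (\<integral>\<^sup>+a. p r a * indicator B a \<partial>\<a>) = emeasure M (B \<times> {..r})"
  by metis
 have p_tot: "(\<integral>\<^sup>+a. p r a \<partial>\<a>) \<noteq> \<infinity>" for r
  using p_int[OF borel_UNIV, of r] finM[OF rect[OF borel_UNIV]] by simp
 have lim: "(\<lambda>k. emeasure M (B \<times> {..x k})) \<longlonglongrightarrow> emeasure M (B \<times> {..r})"
  if B: "B \<in> sets borel" and x: "decseq x" "x \<longlonglongrightarrow> r" for B x r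
 proof -
  have "(\<lambda>k. emeasure M (B \<times> {..x k})) \<longlonglongrightarrow> emeasure M (\<Inter>k. B \<times> {..x k})"
   using B x finM rect by (intro Lim_emeasure_decseq) (fastforce simp: decseq_def)+
  also have "(\<Inter>k. B \<times> {..x k}) = B \<times> {..r}"
  proof -
   have "r \<le> x k" for k using x by (rule decseq_ge)
   moreover have "y \<le> r" if "\<And>k. y \<le> x k" for y
    using x(2) that by (intro LIMSEQ_le_const) auto
   ultimately show ?thesis by (fastforce intro: order_trans)
  qed
  finally show ?thesis .
 qed
 have p_mono: "AE a in \<a>. p r a \<le> p s a" if "r \<le> s" for r s
 proof (rule AE_le_of_set_integrals[OF p p p_tot])
  fix B assume "B \<in> sets \<a>"
  then show "(\<integral>\<^sup>+a. p r a * indicator B a \<partial>\<a>) \<le> (\<integral>\<^sup>+a. p s a * indicator B a \<partial>\<a>)"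
   using that \<a> M by (auto simp: p_int borel_Times intro!: emeasure_mono)
 qed
 have p_le1: "AE a in \<a>. p r a \<le> 1" for r
 proof (rule AE_le_of_set_integrals)
  fix B assume B: "B \<in> sets \<a>"
  have "emeasure M (B \<times> {..r}) \<le> emeasure M (B \<times> UNIV)"
   using B \<a> M by (intro emeasure_mono) (auto simp: borel_Times)
  then show "(\<integral>\<^sup>+a. p r a * indicator B a \<partial>\<a>) \<le> (\<integral>\<^sup>+a. 1 * indicator B a \<partial>\<a>)"
   using B \<a> by (simp add: p_int strip)
 qed (use \<a>.emeasure_finite in auto)
 have unit_sets: "UNIV \<times> - {0..<1::real} \<in> sets M" using borel_Times[OF borel_UNIV, of "- {0..<1::real}"] M by simp
 have p_neg: "AE a in \<a>. p r a \<le> 0" if "r < 0" for r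
 proof (rule AE_le_of_set_integrals)
  fix B assume "B \<in> sets \<a>"
  moreover have "emeasure M (B \<times> {..r}) \<le> emeasure M (UNIV \<times> - {0..<1})"
   using that by (intro emeasure_mono unit_sets) auto
  ultimately show "(\<integral>\<^sup>+a. p r a * indicator B a \<partial>\<a>) \<le> (\<integral>\<^sup>+a. 0 * indicator B a \<partial>\<a>)"
   using \<a> by (simp add: p_int unit)
 qed auto
 have p_one: "AE a in \<a>. 1 \<le> p r a" if "1 \<le> r" for r
 proof (rule AE_le_of_set_integrals[OF _ p p_tot])
  fix B assume "B \<in> sets \<a>"
  then have B: "B \<in> sets borel" using \<a> by simp
  have "emeasure M (B \<times> UNIV) \<le> emeasure M (B \<times> {..r} \<union> UNIV \<times> - {0..<1})"
   using that by (intro emeasure_mono sets.Un unit_sets rect[OF B]) auto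
  also have "\<dots> \<le> emeasure M (B \<times> {..r}) + emeasure M (UNIV \<times> - {0..<1})"
   by (rule emeasure_subadditive[OF rect[OF B] unit_sets])
  finally show "(\<integral>\<^sup>+a. 1 * indicator B a \<partial>\<a>) \<le> (\<integral>\<^sup>+a. p r a * indicator B a \<partial>\<a>)"
   using B \<a> by (simp add: p_int unit strip)
 qed auto
 define good where "good a \<longleftrightarrow> (\<forall>q q'::rat. q \<le> q' \<longrightarrow> p (of_rat q) a \<le> p (of_rat q') a) \<and> (\<forall>q::rat. p (of_rat q) a \<le> 1)
  \<and> (\<forall>q::rat. q < 0 \<longrightarrow> p (of_rat q) a \<le> 0) \<and> (\<forall>q::rat. 1 \<le> q \<longrightarrow> 1 \<le> p (of_rat q) a)" for a
 have [measurable]: "Measurable.pred \<a> good"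
  unfolding good_def by measurable
 have good: "AE a in \<a>. good a"
  unfolding good_def using p_neg p_one p_le1 p_mono
  by (auto simp: AE_all_countable of_rat_less_eq intro!: AE_impI)
 define P where "P q a = (if good a then enn2real (p (of_rat q) a) else if 0 \<le> q then 1 else 0)" for q :: rat and a
 have P_m[measurable]: "P q \<in> borel_measurable \<a>" for q
  unfolding P_def by measurable
 have P_ennreal: "ennreal (P q a) = p (of_rat q) a" if "good a" for q a
 proof -
  have "p (of_rat q) a \<le> 1" using that by (auto simp: good_def)
  also have "(1::ennreal) < top" by simp
  finally show ?thesis using that by (simp add: P_def)
 qed
 have P01: "0 \<le> P q a" "P q a \<le> 1" for q a
 proof -
  show "0 \<le> P q a" by (simp add: P_def)
  show "P q a \<le> 1"
  proof (cases "good a")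
   case True
   then have "ennreal (P q a) \<le> 1" unfolding P_ennreal[OF True] by (auto simp: good_def)
   then show ?thesis by simp
  qed (auto simp: P_def)
 qed
 have P_mono: "P q a \<le> P q' a" if "q \<le> q'" for q q' a
 proof (cases "good a")
  case True
  then have "ennreal (P q a) \<le> ennreal (P q' a)"
   unfolding P_ennreal[OF True] using that by (auto simp: good_def)
  then show ?thesis using P01 by (simp add: ennreal_le_iff)
 qed (use that in \<open>auto simp: P_def\<close>)
 have P_neg: "P q a = 0" if "q < 0" for q a
  using that by (auto simp: P_def good_def enn2real_eq_0_iff)
 have P_one: "P q a = 1" if "1 \<le> q" for q a
 proof (cases "good a")
  case True
  then have "ennreal (P q a) = 1" unfolding P_ennreal[OF True] using that by (auto simp: good_def intro!: antisym)
  then show ?thesis by (simp add: ennreal_eq_1)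
 qed (use that in \<open>simp add: P_def\<close>)
 define F where "F a r = (INF q\<in>{q. r < of_rat q}. P q a)" for a and r :: real
 have ne: "{q. (r::real) < of_rat q} \<noteq> {}" for r
  using of_rat_dense[of r "r + 1"] by auto
 have bdd: "bdd_below ((\<lambda>q. P q a) ` S)" for S a
  using P01 by (auto intro!: bdd_belowI2[where m=0])
 have F_le: "F a r \<le> P q a" if "r < of_rat q" for a r q
  unfolding F_def using that bdd by (intro cINF_lower) auto
 have F_ge: "P q a \<le> F a r" if "of_rat q \<le> r" for a r q
  unfolding F_def
 proof (intro cINF_greatest ne)
  fix q' assume "q' \<in> {q. r < of_rat q}"
  with that have "real_of_rat q < of_rat q'"
   using le_less_trans[of "real_of_rat q" r "real_of_rat q'"] by simp
  then show "P q a \<le> P q' a" by (intro P_mono) (auto simp: of_rat_less)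
 qed
 have F_mono: "F a r \<le> F a s" if "r \<le> s" for a r s
  unfolding F_def using that ne bdd by (intro cINF_superset_mono) auto
 have F01: "0 \<le> F a r" "F a r \<le> 1" for a r
 proof -
  show "0 \<le> F a r" unfolding F_def using P01 ne by (intro cINF_greatest) auto
  obtain q where "r < of_rat q" using ne by blast
  then show "F a r \<le> 1" using F_le P01 order_trans by blast
 qed
 have F_rc: "continuous (at_right r) (F a)" for r a
 proof (subst continuous_at_right_real_increasing)
  show "\<forall>\<epsilon>>0. \<exists>d>0. F a (r + d) - F a r < \<epsilon>"
  proof safe
   fix \<epsilon> :: real assume "0 < \<epsilon>"
   then have "F a r < F a r + \<epsilon>" by simp
   then obtain q where q: "r < of_rat q" "P q a < F a r + \<epsilon>"
    unfolding F_def cINF_less_iff[OF ne bdd] by auto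
   have "F a (r + (of_rat q - r) / 2) \<le> P q a"
    by (rule F_le) (use q in \<open>simp add: field_simps\<close>)
   with q show "\<exists>d>0. F a (r + d) - F a r < \<epsilon>"
    by (intro exI[of _ "(of_rat q - r) / 2"]) auto
  qed
 qed (rule F_mono)
 have F_bot: "(F a \<longlongrightarrow> 0) at_bot" for a
 proof (rule tendsto_eventually)
  have "F a x = 0" if "x < - 1" for x
   using F_le[of x "- 1" a] F01(1)[of a x] P_neg[of "- 1" a] that by (simp add: of_rat_minus)
  then show "\<forall>\<^sub>F x in at_bot. F a x = 0" unfolding eventually_at_bot_dense by blast
 qed
 have F_top: "(F a \<longlongrightarrow> 1) at_top" for a
 proof (rule tendsto_eventually)
  have "F a x = 1" if "1 < x" for x
   using F_ge[of 1 x a] F01(2)[of a x] P_one[of 1 a] that by simp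
  then show "\<forall>\<^sub>F x in at_top. F a x = 1" unfolding eventually_at_top_dense by blast
 qed
 have dist: "real_distribution (interval_measure (F a))" for a
  by (intro real_distribution_interval_measure F_mono F_rc F_bot F_top)
 have cdf_F: "cdf (interval_measure (F a)) = F a" for a
  by (intro cdf_interval_measure F_mono F_rc F_bot F_top)
 have F_atMost: "emeasure (interval_measure (F a)) {..r} = ennreal (F a r)" for a r
 proof -
  interpret real_distribution "interval_measure (F a)" by (rule dist)
  show ?thesis using cdf_F[of a] by (simp add: emeasure_eq_measure cdf_def fun_eq_iff)
 qed
 have F_m[measurable]: "(\<lambda>a. F a r) \<in> borel_measurable \<a>" for r
  unfolding F_def using bdd by (intro borel_measurable_cINF) auto
 define \<k> where "\<k> a = interval_measure (F a)" for a
 have \<k>: "kernel \<a> \<k>"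
 proof (rule measurable_prob_algebra_generated[where \<Omega>=UNIV and G="range atMost"])
  show "sets borel = sigma_sets UNIV (range (atMost :: real => _))"
   by (subst borel_eq_atMost) simp
  show "Int_stable (range (atMost :: real => _))"
   by (auto simp: Int_stable_def)
  show "prob_space (\<k> a)" for a
   using dist[of a] by (simp add: \<k>_def real_distribution_def)
  show "(\<lambda>a. emeasure (\<k> a) A) \<in> borel_measurable \<a>" if "A \<in> range atMost" for A
   using that by (auto simp: \<k>_def F_atMost)
 qed (auto simp: \<k>_def)
 have "emeasure M (B \<times> {..r}) = emeasure (glue \<a> \<k>) (B \<times> {..r})" if B: "B \<in> sets borel" for B r
 proof -
  have [measurable]: "B \<in> sets \<a>" using B \<a> by simp
  have eq: "emeasure (glue \<a> \<k>) (B \<times> {..r}) = (\<integral>\<^sup>+a. ennreal (F a r) * indicator B a \<partial>\<a>)"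
   unfolding emeasure_glue_Times[OF \<a> \<k> B, of "{..r}", simplified] by (simp add: \<k>_def F_atMost)
  obtain x where x: "\<And>k. r < of_rat (x k)" "decseq (\<lambda>k. real_of_rat (x k))" "(\<lambda>k. real_of_rat (x k)) \<longlonglongrightarrow> r"
  proof -
   have "\<exists>q. r < of_rat q \<and> of_rat q < r + 1 / real (Suc k)" for k
    using of_rat_dense[of r "r + 1 / real (Suc k)"] by auto
   then obtain q where q: "\<And>k. r < of_rat (q k)" "\<And>k. of_rat (q k) < r + 1 / real (Suc k)" by metis
   define x where "x k = Min (q ` {..k})" for k
   have mem: "x k \<in> q ` {..k}" for k unfolding x_def by (rule Min_in) auto
   have le: "x k \<le> q k" for k unfolding x_def by (rule Min_le) auto
   have gr: "r < of_rat (x k)" for k using mem[of k] q by auto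
   have "x k \<le> x m" if "m \<le> k" for m k
    unfolding x_def using that by (intro Min_antimono) auto
   then have "decseq (\<lambda>k. real_of_rat (x k))"
    by (auto simp: decseq_def of_rat_less_eq)
   moreover have "(\<lambda>k. real_of_rat (x k)) \<longlonglongrightarrow> r"
   proof (rule tendsto_sandwich[where f="\<lambda>_. r" and h="\<lambda>k. r + 1 / real (Suc k)"])
    show "(\<lambda>k. r + 1 / real (Suc k)) \<longlonglongrightarrow> r"
     using tendsto_add[OF tendsto_const[of r] LIMSEQ_inverse_real_of_nat] by (simp add: inverse_eq_divide)
    show "\<forall>\<^sub>F k in sequentially. real_of_rat (x k) \<le> r + 1 / real (Suc k)"
    proof (rule always_eventually, rule allI)
     fix k have "real_of_rat (x k) \<le> of_rat (q k)" using le[of k] by (simp add: of_rat_less_eq)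
     then show "real_of_rat (x k) \<le> r + 1 / real (Suc k)" using q(2)[of k] by linarith
    qed

    show "\<forall>\<^sub>F k in sequentially. r \<le> real_of_rat (x k)"
     using gr by (simp add: less_imp_le)
   qed simp
   ultimately show thesis using gr that by blast
  qed
  have "(\<integral>\<^sup>+a. ennreal (F a r) * indicator B a \<partial>\<a>) \<le> emeasure M (B \<times> {..of_rat (x k)})" for k
   unfolding p_int[OF B, symmetric]
  proof (intro nn_integral_mono_AE, use good in eventually_elim)
   case (elim a)
   have "ennreal (F a r) \<le> p (of_rat (x k)) a"
    unfolding P_ennreal[OF elim, symmetric] using F_le[OF x(1)] by (intro ennreal_leI)
   then show ?case by (intro mult_right_mono) auto
  qed
  then have "(\<integral>\<^sup>+a. ennreal (F a r) * indicator B a \<partial>\<a>) \<le> emeasure M (B \<times> {..r})"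
   by (intro LIMSEQ_le_const[OF lim[OF B x(2,3)]]) auto
  moreover have "emeasure M (B \<times> {..r}) \<le> (\<integral>\<^sup>+a. ennreal (F a r) * indicator B a \<partial>\<a>)"
   unfolding p_int[OF B, symmetric]
  proof (rule nn_integral_mono_AE)
   have "AE a in \<a>. \<forall>q::rat. r < of_rat q \<longrightarrow> p r a \<le> p (of_rat q) a"
    using p_mono by (auto simp: AE_all_countable intro!: AE_impI)
   with good show "AE a in \<a>. p r a * indicator B a \<le> ennreal (F a r) * indicator B a"
   proof eventually_elim
    case (elim a)
    have "p r a \<le> ennreal (P q a)" if "r < of_rat q" for q
     using elim that by (auto simp: P_ennreal)
    note le = this
    obtain q0 where "r < of_rat q0" using ne by blast
    from le[OF this] obtain y where y: "p r a = ennreal y" "0 \<le> y"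
     by (cases "p r a") (auto simp: top_unique)
    have "y \<le> F a r"
     unfolding F_def using le y P01 by (intro cINF_greatest ne) (auto simp: ennreal_le_iff)
    then show ?case using y by (auto intro!: mult_right_mono ennreal_leI)
   qed
  qed
  ultimately show ?thesis unfolding eq by (rule antisym[rotated])
 qed
 note atMost_eq = this
 have "M = glue \<a> \<k>"
 proof (rule finite_measure_eqI_rectangles)
  fix B :: "'a set" and C :: "real set" assume B: "B \<in> sets borel" and C: "C \<in> sets borel"
  define R where "R L = distr (density L (indicator (B \<times> UNIV))) borel snd" for L :: "('a \<times> real) measure"
  have R: "emeasure (R L) C = emeasure L (B \<times> C)" if L: "sets L = sets borel" and C: "C \<in> sets borel" for L C
  proof -
   have sp: "space L = UNIV" using L by (auto dest: sets_eq_imp_space_eq)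
   have snd_m: "snd \<in> L \<rightarrow>\<^sub>M borel"
    unfolding measurable_cong_sets[OF L refl] by (simp add: borel_prod[symmetric])
   have "emeasure (R L) C = emeasure (density L (indicator (B \<times> UNIV))) (UNIV \<times> C)"
    unfolding R_def using snd_m C
    by (subst emeasure_distr) (auto simp: sp intro!: arg_cong[where f="emeasure _"])
   also have "\<dots> = emeasure L (B \<times> C)"
    using borel_Times[OF B borel_UNIV] borel_Times[OF borel_UNIV C] L
    by (subst emeasure_restricted) (simp_all add: Times_Int_Times)
   finally show ?thesis .
  qed
  have "R M = R (glue \<a> \<k>)"
  proof (rule measure_eqI_generator_eq[where \<Omega>=UNIV and E="range atMost" and A="\<lambda>k. {..real k}"])
   show "Int_stable (range (atMost :: real => _))"
    by (auto simp: Int_stable_def)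
   show "sets (R M) = sigma_sets UNIV (range atMost)" "sets (R (glue \<a> \<k>)) = sigma_sets UNIV (range atMost)"
    by (simp_all add: R_def) (simp_all add: borel_eq_atMost)
   show "emeasure (R M) A = emeasure (R (glue \<a> \<k>)) A" if "A \<in> range atMost" for A
    using that R[OF M] R[OF sets_glue[OF \<a>]] atMost_eq[OF B] by auto
   show "emeasure (R M) {..real k} \<noteq> \<infinity>" for k
    using R[OF M, of "{..real k}"] finM[OF rect[OF B]] by simp
   show "(\<Union>k. {..real k}) = UNIV"
    using real_arch_simple by auto
  qed auto
  then show "emeasure M (B \<times> C) = emeasure (glue \<a> \<k>) (B \<times> C)"
   using R[OF M C] R[OF sets_glue[OF \<a>] C] by simp
 qed (use M \<a> finM in auto)
 with \<k> show thesis by (rule that)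
qed

section \<open>Relative entropy and its dual formulation\<close>

lemma kl_phi_measurable [measurable]: "kl_phi \<in> borel_measurable borel"
 unfolding kl_phi_def by measurable

text \<open>Young inequality: the convex conjugate of \<open>\<phi>\<close> is \<open>e\<^sup>g -
 1\<close>.\<close>

lemma kl_phi_ge_dual:
 assumes "0 \<le> s" shows "s * g - (exp g - 1) \<le> kl_phi s"
proof (cases "s = 0")
 case False
 then have "0 < s" using assms by simp
 have "s * (1 + (g - ln s)) \<le> s * exp (g - ln s)"
  using exp_ge_add_one_self[of "g - ln s"] assms by (intro mult_left_mono) auto
 also have "\<dots> = exp g" using \<open>0 < s\<close> by (simp add: exp_diff)
 finally show ?thesis using False by (simp add: kl_phi_def algebra_simps)
qed (simp add: kl_phi_def)

lemma kl_phi_nonneg: "0 \<le> s ==> 0 \<le> kl_phi s"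
 using kl_phi_ge_dual[of s 0] by simp

lemma kl_phi_tangent:
 assumes "0 \<le> s" "0 < m" shows "s * ln m - (m - 1) \<le> kl_phi s"
 using kl_phi_ge_dual[of s "ln m"] assms by simp

lemma kl_phi_continuous: "continuous_on {0..} kl_phi"
proof -
 have eq: "kl_phi s = (if s = 0 then 0 else s * ln s) - s + 1" for s by (simp add: kl_phi_def)
 have "isCont (\<lambda>s. s * ln s - s + 1) s" if "0 < s" for s :: real
  using that by (intro continuous_intros) auto
 have "(kl_phi \<longlongrightarrow> kl_phi s) (at s within {0..})" if s: "0 \<le> s" for s
 proof (cases "s = 0")
  case True
  have "((\<lambda>s::real. s * ln s - s + 1) \<longlongrightarrow> 1) (at_right 0)"
   by real_asymp
  then have "(kl_phi \<longlongrightarrow> 1) (at_right 0)"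
   by (rule Lim_transform_eventually) (auto simp: kl_phi_def eventually_at_filter)
  then show ?thesis
   using True by (simp add: kl_phi_def at_within_Ici_at_right)
 next
  case False
  then have "isCont (\<lambda>s. s * ln s - s + 1) s"
   using s by (intro continuous_intros) auto
  then have "continuous (at s within {0..}) (\<lambda>s. s * ln s - s + 1)"
   by (rule continuous_at_imp_continuous_at_within)
  then have "((\<lambda>s. s * ln s - s + 1) \<longlongrightarrow> s * ln s - s + 1) (at s within {0..})"
   by (simp only: continuous_within)
  moreover have "\<forall>\<^sub>F x in at s within {0..}. x * ln x - x + 1 = kl_phi x"
   using eventually_neq_at_within[of 0 s "{0..}"] by eventually_elim (simp add: kl_phi_def)
  moreover have "kl_phi s = s * ln s - s + 1" using False by (simp add: kl_phi_def)
  ultimately show ?thesis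
   by (simp only: Lim_transform_eventually)
 qed
 then show ?thesis by (auto simp: continuous_on_def)
qed

lemma KL_density:
 assumes "finite_measure \<beta>" and f[measurable]: "f \<in> borel_measurable \<beta>" and nn: "\<And>x. 0 \<le> f x"
 shows "KL (density \<beta> (\<lambda>x. ennreal (f x))) \<beta> = enn2ereal (\<integral>\<^sup>+x. ennreal (kl_phi (f x)) \<partial>\<beta>)"
proof -
 interpret finite_measure \<beta> by fact
 have ac: "absolutely_continuous \<beta> (density \<beta> (\<lambda>x. ennreal (f x)))"
  by (rule absolutely_continuousI_density) measurable
 have "AE x in \<beta>. ennreal (f x) = RN_deriv \<beta> (density \<beta> (\<lambda>x. ennreal (f x))) x"
  by (rule RN_deriv_unique) auto
 then have "(\<integral>\<^sup>+x. ennreal (kl_phi (enn2real (RN_deriv \<beta> (density \<beta> (\<lambda>x. ennreal (f x))) x))) \<partial>\<beta>)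
   = (\<integral>\<^sup>+x. ennreal (kl_phi (f x)) \<partial>\<beta>)"
 proof (intro nn_integral_cong_AE, eventually_elim)
  case (elim x)
  then show ?case using nn[of x] by (metis enn2real_ennreal)
 qed
 with ac show ?thesis by (simp add: KL_def)
qed

lemma ac_real_density:
 assumes "finite_measure \<beta>" "finite_measure \<a>" "sets \<a> = sets \<beta>" "absolutely_continuous \<beta> \<a>"
 obtains f where "f \<in> borel_measurable \<beta>" "\<And>x. 0 \<le> f x" "\<a> = density \<beta> (\<lambda>x. ennreal (f x))"
proof -
 interpret \<beta>: finite_measure \<beta> by fact
 interpret \<a>: finite_measure \<a> by fact
 have "AE x in \<beta>. RN_deriv \<beta> \<a> x \<noteq> \<infinity>"
  using assms(3,4) by (intro \<beta>.RN_deriv_finite) (auto intro: \<a>.sigma_finite_measure_axioms)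
 then have "density \<beta> (\<lambda>x. ennreal (enn2real (RN_deriv \<beta> \<a> x))) = density \<beta> (RN_deriv \<beta> \<a>)"
  by (intro density_cong) (auto simp: less_top)
 also have "\<dots> = \<a>" using assms by (intro \<beta>.density_RN_deriv) auto
 finally show thesis
  by (intro that[of "\<lambda>x. enn2real (RN_deriv \<beta> \<a> x)"]) auto
qed

lemma bounded_integrable:
 fixes g :: "'a => real"
 assumes "finite_measure M" "g \<in> borel_measurable M" "\<And>x. x \<in> space M ==> \<bar>g x\<bar> \<le> C"
 shows "integrable M g"
proof -
 interpret finite_measure M by fact
 show ?thesis using assms by (intro integrable_const_bound[where B=C]) auto
qed

lemma KL_ge_dual:
 assumes fin: "finite_measure \<beta>" "finite_measure \<a>" and sets: "sets \<a> = sets \<beta>"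
  and g[measurable]: "g \<in> borel_measurable \<beta>" and bd: "\<And>x. \<bar>g x\<bar> \<le> C"
 shows "ereal ((\<integral>x. g x \<partial>\<a>) - (\<integral>x. exp (g x) - 1 \<partial>\<beta>)) \<le> KL \<a> \<beta>"
proof (cases "absolutely_continuous \<beta> \<a>")
 case True
 obtain f where f[measurable]: "f \<in> borel_measurable \<beta>" and nn: "\<And>x. 0 \<le> f x" and \<a>: "\<a> = density \<beta> (\<lambda>x. ennreal (f x))"
  using ac_real_density[OF fin sets True] by blast
 show ?thesis
 proof (cases "(\<integral>\<^sup>+x. ennreal (kl_phi (f x)) \<partial>\<beta>) = \<infinity>")
  case False
  have ik: "integrable \<beta> (\<lambda>x. kl_phi (f x))"
   using False nn kl_phi_nonneg by (intro integrableI_nonneg) (auto simp: less_top)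
  have "integrable \<a> g" using sets bd by (intro bounded_integrable[OF fin(2)]) (auto cong: measurable_cong_sets)
  then have ifg: "integrable \<beta> (\<lambda>x. f x * g x)"
   unfolding \<a> using nn by (subst (asm) integrable_density) auto
  have ie: "integrable \<beta> (\<lambda>x. exp (g x) - 1)"
  proof (rule bounded_integrable[OF fin(1)])
   show "\<bar>exp (g x) - 1\<bar> \<le> exp C + 1" for x
   proof -
    have "exp (g x) \<le> exp C" using bd[of x] by simp
    then show ?thesis by (simp add: abs_le_iff add_increasing add_increasing2 algebra_simps)
   qed
  qed measurable
  have "(\<integral>x. g x \<partial>\<a>) = (\<integral>x. f x * g x \<partial>\<beta>)"
   unfolding \<a> using nn by (subst integral_density) auto
  then have "(\<integral>x. g x \<partial>\<a>) - (\<integral>x. exp (g x) - 1 \<partial>\<beta>) = (\<integral>x. f x * g x - (exp (g x) - 1) \<partial>\<beta>)"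
   using ifg ie by simp
  also have "\<dots> \<le> (\<integral>x. kl_phi (f x) \<partial>\<beta>)"
   using ifg ie ik kl_phi_ge_dual nn by (intro integral_mono) auto
  also have "ereal \<dots> = enn2ereal (\<integral>\<^sup>+x. ennreal (kl_phi (f x)) \<partial>\<beta>)"
   using ik nn kl_phi_nonneg by (subst nn_integral_eq_integral) (auto simp: integral_nonneg_AE enn2ereal_ennreal)
  finally show ?thesis using KL_density[OF fin(1) f nn] by (simp add: \<a>)
 qed (use KL_density[OF fin(1) f nn] in \<open>simp add: \<a>\<close>)
qed (simp add: KL_def)

text \<open>Indicators are approximated by Urysohn functions between a compact subset and an open
 superset.\<close>

lemma continuous_L1_dense:
 fixes M :: "'e::euclidean_space measure" and f :: "'e => real"
 assumes fin: "finite_measure M" and sets: "sets M = sets borel" and f: "integrable M f"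
 shows "0 < e ==> \<exists>h. continuous_on UNIV h \<and> integrable M h \<and> (\<integral>x. \<bar>f x - h x\<bar> \<partial>M) < e"
 using f
proof (induction f arbitrary: e rule: integrable_induct)
 case (base A c)
 interpret finite_measure M by fact
 have sp: "space M = UNIV" using sets by (auto dest: sets_eq_imp_space_eq)
 define d where "d = e / (2 * (\<bar>c\<bar> + 1))"
 have d: "0 < d" using base by (simp add: d_def)
 have A: "A \<in> sets borel" using base sets by simp
 have finA: "emeasure M (space M) \<noteq> \<infinity>" by simp
 obtain K where K: "K \<subseteq> A" "compact K" "emeasure M A < emeasure M K + ennreal d"
 proof (cases "A = {}")
  case True
  then show thesis using that[of "{}"] d by simp
 next
  case False
  have "emeasure M A < (SUP K \<in> {K. K \<subseteq> A \<and> compact K}. emeasure M K) + ennreal d"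
   unfolding inner_regular[OF sets finA A, symmetric] using d
   by (simp add: emeasure_eq_measure ennreal_plus[symmetric] ennreal_less_iff del: ennreal_plus)
  also have "\<dots> = (SUP K \<in> {K. K \<subseteq> A \<and> compact K}. emeasure M K + ennreal d)"
   by (rule ennreal_SUP_add_left[symmetric]) auto
  finally show thesis using that by (auto simp: less_SUP_iff)
 qed
 obtain U where U: "A \<subseteq> U" "open U" "emeasure M U < emeasure M A + ennreal d"
 proof -
  have "(INF U \<in> {U. A \<subseteq> U \<and> open U}. emeasure M U) < emeasure M A + ennreal d"
   unfolding outer_regular[OF sets finA A, symmetric] using d
   by (simp add: emeasure_eq_measure ennreal_plus[symmetric] ennreal_less_iff del: ennreal_plus)
  then show thesis using that by (auto simp: INF_less_iff)
 qed
 have sK[measurable]: "K \<in> sets M" "U \<in> sets M" "A \<in> sets M" using K U A sets by (auto intro: borel_compact)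
 have "measure M A < measure M K + d" "measure M U < measure M A + d"
  using K(3) U(3) d
  by (auto simp: emeasure_eq_measure ennreal_plus[symmetric] ennreal_less_iff simp del: ennreal_plus)
 moreover have "measure M (U - K) = measure M U - measure M K"
  using K U by (intro finite_measure_Diff) auto
 ultimately have UK: "measure M (U - K) < 2 * d" by simp
 obtain h :: "'e => real" where h: "continuous_on UNIV h" "\<And>x. h x \<in> closed_segment 1 0" "\<And>x. x \<in> K ==> h x = 1" "\<And>x. x \<in> - U ==> h x = 0"
  using Urysohn[of K "- U" 1 "0::real"] K U by (auto simp: compact_imp_closed closed_Compl)
 have h01: "0 \<le> h x" "h x \<le> 1" for x using h(2)[of x] by (auto simp: closed_segment_eq_real_ivl)
 have hm[measurable]: "h \<in> borel_measurable M"
  using borel_measurable_continuous_onI[OF h(1)] by (simp cong: measurable_cong_sets add: sets)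
 have ih: "integrable M (\<lambda>x. c * h x)"
 proof (rule bounded_integrable[OF fin])
  show "\<bar>c * h x\<bar> \<le> \<bar>c\<bar>" for x
   using h01[of x] by (simp add: abs_mult mult_left_le)
 qed measurable
 have "(\<integral>x. \<bar>indicator A x *\<^sub>R c - c * h x\<bar> \<partial>M) \<le> (\<integral>x. \<bar>c\<bar> * indicator (U - K) x \<partial>M)"
 proof (rule integral_mono)
  show "integrable M (\<lambda>x. \<bar>indicator A x *\<^sub>R c - c * h x\<bar>)"
   using ih base by (intro integrable_abs Bochner_Integration.integrable_diff) (auto simp: less_top)
  show "integrable M (\<lambda>x. \<bar>c\<bar> * indicator (U - K) x)"
   by (auto simp: less_top[symmetric])
  fix x
  show "\<bar>indicator A x *\<^sub>R c - c * h x\<bar> \<le> \<bar>c\<bar> * indicator (U - K) x"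
  proof (cases "x \<in> U - K")
   case True
   have "\<bar>indicator A x *\<^sub>R c - c * h x\<bar> = \<bar>c\<bar> * \<bar>indicator A x - h x\<bar>"
    by (simp add: algebra_simps flip: abs_mult)
   also have "\<dots> \<le> \<bar>c\<bar> * 1" using h01[of x] by (intro mult_left_mono) (auto split: split_indicator)
   finally show ?thesis using True by simp
  next
   case False
   then have "x \<in> K \<or> x \<in> - U" by auto
   then show ?thesis using h(3,4)[of x] K(1) U(1) by (auto split: split_indicator)
  qed
 qed
 also have "\<dots> = \<bar>c\<bar> * measure M (U - K)" by simp
 also have "\<dots> \<le> \<bar>c\<bar> * (2 * d)" using UK by (intro mult_left_mono) auto
 also have "\<dots> < e" using base by (simp add: d_def field_simps)
 finally show ?case
  using h(1) ih by (intro exI[of _ "\<lambda>x. c * h x"]) (auto intro!: continuous_intros)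
next
 case (add f g)
 from add.IH(1)[of "e/2"] add.IH(2)[of "e/2"] add.prems obtain h k
  where h: "continuous_on UNIV h" "integrable M h" "(\<integral>x. \<bar>f x - h x\<bar> \<partial>M) < e/2"
   and k: "continuous_on UNIV k" "integrable M k" "(\<integral>x. \<bar>g x - k x\<bar> \<partial>M) < e/2" by auto
 have "(\<integral>x. \<bar>f x + g x - (h x + k x)\<bar> \<partial>M) \<le> (\<integral>x. \<bar>f x - h x\<bar> + \<bar>g x - k x\<bar> \<partial>M)"
  using h k add by (intro integral_mono) auto
 also have "\<dots> = (\<integral>x. \<bar>f x - h x\<bar> \<partial>M) + (\<integral>x. \<bar>g x - k x\<bar> \<partial>M)"
  using h k add by (intro Bochner_Integration.integral_add) auto
 finally show ?case using h k
  by (intro exI[of _ "\<lambda>x. h x + k x"]) (auto intro!: continuous_intros)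
next
 case (lim f s)
 have "(\<lambda>i. \<integral>x. norm (f x - s i x) \<partial>M) \<longlonglongrightarrow> (\<integral>x. 0 \<partial>M)"
 proof (rule integral_dominated_convergence[where w="\<lambda>x. 3 * norm (f x)"])
  show "AE x in M. (\<lambda>i. norm (f x - s i x)) \<longlonglongrightarrow> 0"
  proof (rule AE_I2)
   fix x assume "x \<in> space M"
   then have "(\<lambda>i. norm (f x - s i x)) \<longlonglongrightarrow> norm (f x - f x)"
    using lim by (intro tendsto_intros)
   then show "(\<lambda>i. norm (f x - s i x)) \<longlonglongrightarrow> 0" by simp
  qed
  show "AE x in M. norm (norm (f x - s i x)) \<le> 3 * norm (f x)" for i
  proof (rule AE_I2)
   fix x assume "x \<in> space M"
   then have "norm (s i x) \<le> 2 * norm (f x)" using lim by blast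
   with norm_triangle_ineq4[of "f x" "s i x"]
   show "norm (norm (f x - s i x)) \<le> 3 * norm (f x)" by simp
  qed
 qed (use lim in auto)
 then have "\<forall>\<^sub>F i in sequentially. (\<integral>x. norm (f x - s i x) \<partial>M) < e / 2"
  using lim.prems by (intro order_tendstoD) auto
 then obtain i where i: "(\<integral>x. \<bar>f x - s i x\<bar> \<partial>M) < e / 2"
  by (auto simp: eventually_sequentially)
 obtain h where h: "continuous_on UNIV h" "integrable M h" "(\<integral>x. \<bar>s i x - h x\<bar> \<partial>M) < e/2"
  using lim.IH[of "e/2"] lim.prems by auto
 have "(\<integral>x. \<bar>f x - h x\<bar> \<partial>M) \<le> (\<integral>x. \<bar>f x - s i x\<bar> + \<bar>s i x - h x\<bar> \<partial>M)"
  using h lim by (intro integral_mono) auto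
 also have "\<dots> = (\<integral>x. \<bar>f x - s i x\<bar> \<partial>M) + (\<integral>x. \<bar>s i x - h x\<bar> \<partial>M)"
  using h lim by (intro Bochner_Integration.integral_add) auto
 finally show ?case using h i by (intro exI[of _ h]) auto
qed

lemma bounded_continuous_AE_approx:
 fixes M :: "'e::euclidean_space measure" and g :: "'e => real"
 assumes fin: "finite_measure M" and sets: "sets M = sets borel"
  and g[measurable]: "g \<in> borel_measurable M" and bd: "\<And>x. \<bar>g x\<bar> \<le> C"
 obtains G :: "nat => 'e => real" where "\<And>k. continuous_on UNIV (G k)" "\<And>k x. \<bar>G k x\<bar> \<le> C"
  "AE x in M. (\<lambda>k. G k x) \<longlonglongrightarrow> g x"
proof -
 have ig: "integrable M g" by (rule bounded_integrable[OF fin g bd])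
 have "\<exists>h. continuous_on UNIV h \<and> integrable M h \<and> (\<integral>x. \<bar>g x - h x\<bar> \<partial>M) < 1 / real (Suc k)" for k
  by (rule continuous_L1_dense[OF fin sets ig]) simp
 then obtain h where h: "\<And>k. continuous_on UNIV (h k)" "\<And>k. integrable M (h k)"
   "\<And>k. (\<integral>x. \<bar>g x - h k x\<bar> \<partial>M) < 1 / real (Suc k)" by metis
 have "(\<lambda>k. \<integral>x. norm (g x - h k x) \<partial>M) \<longlonglongrightarrow> 0"
 proof (rule tendsto_sandwich[where f="\<lambda>_. 0" and h="\<lambda>k. 1 / real (Suc k)"])
  show "(\<lambda>k. 1 / real (Suc k)) \<longlonglongrightarrow> 0"
   using LIMSEQ_inverse_real_of_nat by (simp add: inverse_eq_divide)
  show "\<forall>\<^sub>F k in sequentially. (\<integral>x. norm (g x - h k x) \<partial>M) \<le> 1 / real (Suc k)"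
   using h(3) by (intro always_eventually allI less_imp_le) simp
 qed auto
 then obtain r :: "nat => nat" where r: "AE x in M. (\<lambda>k. g x - h (r k) x) \<longlonglongrightarrow> 0"
  using tendsto_L1_AE_subseq[of M "\<lambda>k x. g x - h k x"] h(2) ig by auto
 define G where "G k x = max (- C) (min C (h (r k) x))" for k x
 have C: "0 \<le> C" using bd[of undefined] by linarith
 show thesis
 proof (rule that[of G])
  show "continuous_on UNIV (G k)" for k
   unfolding G_def by (intro continuous_intros h)
  show "\<bar>G k x\<bar> \<le> C" for k x
   unfolding G_def using C by auto
  show "AE x in M. (\<lambda>k. G k x) \<longlonglongrightarrow> g x"
   using r
  proof eventually_elim
   case (elim x)
   then have "(\<lambda>k. g x - (g x - h (r k) x)) \<longlonglongrightarrow> g x - 0"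
    by (intro tendsto_intros)
   then have "(\<lambda>k. max (- C) (min C (h (r k) x))) \<longlonglongrightarrow> max (- C) (min C (g x))"
    by (intro tendsto_intros) simp
   also have "max (- C) (min C (g x)) = g x" using bd[of x] by auto
   finally show ?case by (simp add: G_def)
  qed
 qed
qed

lemma closed_indicator_approx:
 fixes F :: "'e::metric_space set"
 assumes "closed F"
 obtains h :: "nat => 'e => real" where "\<And>k. continuous_on UNIV (h k)" "\<And>k x. 0 \<le> h k x" "\<And>k x. h k x \<le> 1"
  "\<And>x. (\<lambda>k. h k x) \<longlonglongrightarrow> indicator F x"
proof (cases "F = {}")
 case True
 then show thesis by (intro that[of "\<lambda>_ _. 0"]) auto
next
 case False
 define h where "h k x = max 0 (1 - real k * infdist x F)" for k :: nat and x
 show thesis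
 proof (rule that[of h])
  show "continuous_on UNIV (h k)" for k unfolding h_def by (intro continuous_intros)
  show "0 \<le> h k x" "h k x \<le> 1" for k x by (auto simp: h_def infdist_nonneg)
  show "(\<lambda>k. h k x) \<longlonglongrightarrow> indicator F x" for x
  proof (cases "x \<in> F")
   case True
   then show ?thesis by (simp add: h_def)
  next
   case nin: False
   then have pos: "0 < infdist x F"
    using assms \<open>F \<noteq> {}\<close> by (simp add: infdist_pos_not_in_closed)
   obtain N :: nat where N: "1 < real N * infdist x F"
    using reals_Archimedean3[OF pos] by auto
   have "h k x = 0" if "N \<le> k" for k
   proof -
    have "real N * infdist x F \<le> real k * infdist x F" using that pos by simp
    with N show ?thesis by (simp add: h_def)
   qed
   then have "\<forall>\<^sub>F k in sequentially. h k x = 0" by (auto simp: eventually_sequentially)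
   then show ?thesis using nin by (simp add: tendsto_eventually)
  qed
 qed
qed

lemma measure_eqI_continuous:
 fixes M N :: "'e::metric_space measure"
 assumes fin: "finite_measure M" "finite_measure N" and sets: "sets M = sets borel" "sets N = sets borel"
  and eq: "\<And>h. continuous_on UNIV h ==> (\<And>x. 0 \<le> h x) ==> (\<And>x. h x \<le> 1) ==> (\<integral>x. h x \<partial>M) = (\<integral>x. h x \<partial>N :: real)"
 shows "M = N"
proof (rule measure_eqI_generator_eq[where E="Collect closed" and \<Omega>=UNIV and A="\<lambda>_. UNIV"])
 interpret M: finite_measure M by fact
 interpret N: finite_measure N by fact
 show "Int_stable (Collect (closed :: 'e set => bool))" by (auto simp: Int_stable_def)
 show "sets M = sigma_sets UNIV (Collect closed)" "sets N = sigma_sets UNIV (Collect closed)"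
  unfolding sets by (simp_all add: borel_eq_closed)
 show "emeasure M UNIV \<noteq> \<infinity>" by simp
 fix F :: "'e set" assume "F \<in> Collect closed"
 then have F: "closed F" by simp
 obtain h :: "nat => 'e => real" where h: "\<And>k. continuous_on UNIV (h k)" "\<And>k x. 0 \<le> h k x" "\<And>k x. h k x \<le> 1"
  "\<And>x. (\<lambda>k. h k x) \<longlonglongrightarrow> indicator F x" using closed_indicator_approx[OF F] by blast
 have lim: "(\<lambda>k. \<integral>x. h k x \<partial>L) \<longlonglongrightarrow> measure L F" if L: "finite_measure L" "sets L = sets borel" for L
 proof -
  interpret L: finite_measure L by fact
  have [measurable]: "h k \<in> borel_measurable L" for k
   using borel_measurable_continuous_onI[OF h(1)[of k]] by (simp cong: measurable_cong_sets add: L)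
  have Fs[measurable]: "F \<in> sets L" using F L by simp
  have "(\<lambda>k. \<integral>x. h k x \<partial>L) \<longlonglongrightarrow> (\<integral>x. indicator F x \<partial>L)"
   by (rule integral_dominated_convergence[where w="\<lambda>_. 1"]) (use h in auto)
  then show ?thesis using sets.sets_into_space[OF Fs] by (simp add: Int_absorb2)
 qed
 have "measure M F = measure N F"
  using LIMSEQ_unique[OF lim[OF fin(1) sets(1)]] lim[OF fin(2) sets(2)] eq[OF h(1-3)] by simp
 then show "emeasure M F = emeasure N F"
  by (simp add: M.emeasure_eq_measure N.emeasure_eq_measure)
qed auto

text \<open>Nonnegativity of the dual integrand for the truncations of the optimal \<open>g = ln s\<close>;
 it is what allows Fatou to be used when the truncation is removed.\<close>

lemma truncated_dual_nonneg:
 fixes s g K :: real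
 assumes "0 \<le> s" "g = (if s = 0 then - K else max (- K) (min K (ln s)))" "0 \<le> K"
 shows "0 \<le> s * g - (exp g - 1)"
proof (cases "s = 0")
 case True then show ?thesis using assms by simp
next
 case False
 then have s: "0 < s" using assms by simp
 have t: "0 \<le> exp a * a - exp a + 1" for a :: real
  using kl_phi_nonneg[of "exp a"] by (simp add: kl_phi_def)
 consider "ln s < - K" "g = - K" | "K \<le> ln s" "g = K" | "g = ln s"
  using assms False by (fastforce simp: max_def min_def not_less not_le split: if_splits)
 then show ?thesis
 proof cases
  case 1
  then have "s < exp (- K)" using s by (metis exp_less_mono exp_ln)
  then have "- (exp (- K) * K) \<le> - (s * K)" using assms(3) by (intro le_imp_neg_le mult_right_mono) auto
  then show ?thesis using 1 t[of "- K"] by simp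
 next
  case 2
  then have "exp K \<le> s" using s by (metis exp_le_cancel_iff exp_ln)
  then have "exp K * K \<le> s * K" using assms(3) by (intro mult_right_mono) auto
  then show ?thesis using 2 t[of K] by simp
 next
  case 3
  then show ?thesis using kl_phi_nonneg[of s] s by (simp add: kl_phi_def)
 qed
qed

text \<open>Test functions that are large on a compact \<open>\<beta>\<close>-null set show that it is also
 \<open>\<rho>\<close>-null, which gives a density \<open>f\<close>. Then \<open>g\<close> is taken close to
 truncations of \<open>ln f\<close>, and Fatou recovers the entropy of \<open>f\<close>.\<close>

lemma dual_bound_imp_density:
 fixes \<rho> \<beta> :: "'e::euclidean_space measure"
 assumes fin: "finite_measure \<rho>" "finite_measure \<beta>" and sets: "sets \<rho> = sets borel" "sets \<beta> = sets borel"
  and dual: "\<And>g C. continuous_on UNIV g ==> (\<And>x. \<bar>g x\<bar> \<le> C) ==> (\<integral>x. g x \<partial>\<rho>) - (\<integral>x. exp (g x) - 1 \<partial>\<beta>) \<le> K"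
 obtains f where "f \<in> borel_measurable borel" "\<And>x. 0 \<le> f x" "\<rho> = density \<beta> (\<lambda>x. ennreal (f x))"
  "(\<integral>\<^sup>+x. ennreal (kl_phi (f x)) \<partial>\<beta>) \<le> ennreal K"
proof -
 interpret \<rho>: finite_measure \<rho> by fact
 interpret \<beta>: finite_measure \<beta> by fact
 note [measurable_cong] = sets
 have sp: "space \<rho> = UNIV" "space \<beta> = UNIV" using sets by (auto dest: sets_eq_imp_space_eq)
 have lim: "(\<lambda>k. (\<integral>x. G k x \<partial>\<rho>) - (\<integral>x. exp (G k x) - 1 \<partial>\<beta>)) \<longlonglongrightarrow> (\<integral>x. g x \<partial>\<rho>) - (\<integral>x. exp (g x) - 1 \<partial>\<beta>)"
  if [measurable]: "\<And>k. G k \<in> borel_measurable borel" "g \<in> borel_measurable borel" and bd: "\<And>k x. \<bar>G k x\<bar> \<le> C"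
   and "AE x in \<rho>. (\<lambda>k. G k x) \<longlonglongrightarrow> g x" "AE x in \<beta>. (\<lambda>k. G k x) \<longlonglongrightarrow> g x" for G :: "nat => 'e => real" and g C
 proof (intro tendsto_diff)
  show "(\<lambda>k. \<integral>x. G k x \<partial>\<rho>) \<longlonglongrightarrow> (\<integral>x. g x \<partial>\<rho>)"
   by (rule integral_dominated_convergence[where w="\<lambda>_. C"]) (use that in auto)
  show "(\<lambda>k. \<integral>x. exp (G k x) - 1 \<partial>\<beta>) \<longlonglongrightarrow> (\<integral>x. exp (g x) - 1 \<partial>\<beta>)"
  proof (rule integral_dominated_convergence[where w="\<lambda>_. exp C + 1"])
   show "AE x in \<beta>. (\<lambda>k. exp (G k x) - 1) \<longlonglongrightarrow> exp (g x) - 1"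
    using that(5) by eventually_elim (intro tendsto_intros)
   show "AE x in \<beta>. norm (exp (G k x) - 1) \<le> exp C + 1" for k
   proof (rule AE_I2)
    fix x
    have "exp (G k x) \<le> exp C" using bd[of k x] by simp
    then show "norm (exp (G k x) - 1) \<le> exp C + 1" by (simp add: abs_le_iff add_increasing add_increasing2)
   qed
  qed auto
 qed
 have ac: "absolutely_continuous \<beta> \<rho>"
  unfolding absolutely_continuous_def
 proof
  fix N assume "N \<in> null_sets \<beta>"
  then have N: "N \<in> sets borel" "emeasure \<beta> N = 0" using sets by auto
  have "emeasure \<rho> L = 0" if L: "L \<subseteq> N" "compact L" for L
  proof (rule ccontr)
   assume "emeasure \<rho> L \<noteq> 0"
   then have pos: "0 < measure \<rho> L" by (simp add: \<rho>.emeasure_eq_measure zero_less_measure_iff)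
   have Ls[measurable]: "L \<in> sets borel" using L by (intro borel_compact)
   have "emeasure \<beta> L \<le> emeasure \<beta> N" using L N sets by (intro emeasure_mono) auto
   then have "emeasure \<beta> L = 0" using N by simp
   then have L0: "AE x in \<beta>. x \<notin> L" using Ls sets by (intro AE_not_in) (auto simp: null_sets_def)
   obtain h :: "nat => 'e => real" where h: "\<And>k. continuous_on UNIV (h k)" "\<And>k x. 0 \<le> h k x" "\<And>k x. h k x \<le> 1"
    "\<And>x. (\<lambda>k. h k x) \<longlonglongrightarrow> indicator L x"
    using closed_indicator_approx[OF compact_imp_closed[OF L(2)]] by blast
   \<comment> \<open>the dual value at \<open>c\<close> times the indicator of \<open>L\<close> is \<open>\<bar>K\<bar> + 1\<close>\<close>
   define c where "c = (\<bar>K\<bar> + 1) / measure \<rho> L"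
   have c: "0 \<le> c" using pos by (simp add: c_def)
   have hc: "continuous_on UNIV (\<lambda>x. c * h k x)" for k
    using h(1)[of k] by (intro continuous_intros)
   have hb: "\<bar>c * h k x\<bar> \<le> c" for k x
    using h(2,3)[of k x] c by (simp add: abs_mult mult_left_le)
   have "(\<lambda>k. (\<integral>x. c * h k x \<partial>\<rho>) - (\<integral>x. exp (c * h k x) - 1 \<partial>\<beta>)) \<longlonglongrightarrow> (\<integral>x. c * indicator L x \<partial>\<rho>) - (\<integral>x. exp (c * indicator L x) - 1 \<partial>\<beta>)"
   proof (rule lim[OF _ _ hb])
    show "(\<lambda>x. c * h k x) \<in> borel_measurable borel" for k
     by (rule borel_measurable_continuous_onI[OF hc])
    show "AE x in \<rho>. (\<lambda>k. c * h k x) \<longlonglongrightarrow> c * indicator L x" "AE x in \<beta>. (\<lambda>k. c * h k x) \<longlonglongrightarrow> c * indicator L x"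
     by (intro AE_I2 tendsto_intros h)+
   qed auto
   then have "(\<integral>x. c * indicator L x \<partial>\<rho>) - (\<integral>x. exp (c * indicator L x) - 1 \<partial>\<beta>) \<le> K"
    using dual[OF hc hb] by (intro LIMSEQ_le_const2) auto
   moreover have "(\<integral>x. exp (c * indicator L x) - 1 \<partial>\<beta>) = (\<integral>x. 0 \<partial>\<beta>)"
   proof (rule integral_cong_AE)
    show "AE x in \<beta>. exp (c * indicator L x) - 1 = 0"
     using L0 by eventually_elim simp
   qed measurable
   moreover have "(\<integral>x. c * indicator L x \<partial>\<rho>) = \<bar>K\<bar> + 1"
    using pos by (simp add: c_def sp)
   ultimately show False by simp
  qed
  then have "emeasure \<rho> N = 0"
   unfolding inner_regular[OF sets(1) _ N(1), simplified] by (auto simp: SUP_eq_const intro!: SUP_eqI antisym SUP_least)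
  then show "N \<in> null_sets \<rho>" using N sets by auto
 qed
 obtain f where f[measurable]: "f \<in> borel_measurable \<beta>" and nn: "\<And>x. 0 \<le> f x" and \<rho>: "\<rho> = density \<beta> (\<lambda>x. ennreal (f x))"
  using ac_real_density[OF fin(2,1) _ ac] sets by auto
 have f_b[measurable]: "f \<in> borel_measurable borel" using f by (simp cong: measurable_cong_sets add: sets)
 have int_f: "integrable \<beta> f"
 proof (rule integrableI_nonneg)
  have "(\<integral>\<^sup>+x. ennreal (f x) \<partial>\<beta>) = emeasure \<rho> UNIV"
   unfolding \<rho> by (simp add: emeasure_density sets)
  then show "(\<integral>\<^sup>+x. ennreal (f x) \<partial>\<beta>) < \<infinity>" by (simp add: \<rho>.emeasure_eq_measure)
 qed (use nn in auto)
 define g where "g k x = (if f x = 0 then - real k else max (- real k) (min (real k) (ln (f x))))" for k x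
 have g_m[measurable]: "g k \<in> borel_measurable borel" for k unfolding g_def by measurable
 have g_bd: "\<bar>g k x\<bar> \<le> real k" for k x by (auto simp: g_def)
 have e_int: "integrable \<beta> (\<lambda>x. exp (g k x) - 1)" for k
 proof (rule bounded_integrable[OF fin(2)])
  fix x
  have "exp (g k x) \<le> exp (real k)" using g_bd[of k x] by simp
  then show "\<bar>exp (g k x) - 1\<bar> \<le> exp (real k) + 1" by (simp add: abs_le_iff add_increasing add_increasing2)
 qed measurable
 have fg_int: "integrable \<beta> (\<lambda>x. f x * g k x)" for k
 proof (rule Bochner_Integration.integrable_bound)
  show "integrable \<beta> (\<lambda>x. real k * f x)" using int_f by simp
  show "AE x in \<beta>. norm (f x * g k x) \<le> norm (real k * f x)"
  proof (rule AE_I2)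
   fix x
   have "f x * \<bar>g k x\<bar> \<le> f x * real k" using g_bd nn by (intro mult_left_mono)
   then show "norm (f x * g k x) \<le> norm (real k * f x)"
    using nn[of x] by (simp add: abs_mult mult.commute)
  qed
 qed measurable
 have le: "(\<integral>\<^sup>+x. ennreal (f x * g k x - (exp (g k x) - 1)) \<partial>\<beta>) \<le> ennreal K" for k
 proof -
  have nn': "0 \<le> f x * g k x - (exp (g k x) - 1)" for x
   by (rule truncated_dual_nonneg[OF nn]) (auto simp: g_def)
  have gm: "g k \<in> borel_measurable \<beta>" by measurable
  obtain G :: "nat => 'e => real" where G: "\<And>j. continuous_on UNIV (G j)" "\<And>j x. \<bar>G j x\<bar> \<le> real k"
   "AE x in \<beta>. (\<lambda>j. G j x) \<longlonglongrightarrow> g k x"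
   using bounded_continuous_AE_approx[OF fin(2) sets(2) gm g_bd] by blast
  have "AE x in \<rho>. (\<lambda>j. G j x) \<longlonglongrightarrow> g k x"
   using G(3) by (rule absolutely_continuous_AE[OF _ ac, rotated]) (simp add: sets)
  then have "(\<lambda>j. (\<integral>x. G j x \<partial>\<rho>) - (\<integral>x. exp (G j x) - 1 \<partial>\<beta>)) \<longlonglongrightarrow> (\<integral>x. g k x \<partial>\<rho>) - (\<integral>x. exp (g k x) - 1 \<partial>\<beta>)"
   by (intro lim[OF borel_measurable_continuous_onI[OF G(1)] g_m G(2)] G(3))
  then have *: "(\<integral>x. g k x \<partial>\<rho>) - (\<integral>x. exp (g k x) - 1 \<partial>\<beta>) \<le> K"
   using dual[OF G(1,2)] by (intro LIMSEQ_le_const2) auto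
  have "(\<integral>x. g k x \<partial>\<rho>) = (\<integral>x. f x * g k x \<partial>\<beta>)"
   unfolding \<rho> using nn by (subst integral_density) auto
  with * have "(\<integral>x. f x * g k x - (exp (g k x) - 1) \<partial>\<beta>) \<le> K"
   using fg_int e_int by simp
  then show ?thesis
   using nn' fg_int e_int by (subst nn_integral_eq_integral) (auto intro!: ennreal_leI)
 qed
 have "(\<integral>\<^sup>+x. ennreal (kl_phi (f x)) \<partial>\<beta>) = (\<integral>\<^sup>+x. liminf (\<lambda>k. ennreal (f x * g k x - (exp (g k x) - 1))) \<partial>\<beta>)"
 proof (rule nn_integral_cong)
  fix x
  have "(\<lambda>k. f x * g k x - (exp (g k x) - 1)) \<longlonglongrightarrow> kl_phi (f x)"
  proof (cases "f x = 0")
   case True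
   have "(\<lambda>k. 1 - exp (- real k)) \<longlonglongrightarrow> 1" by real_asymp
   then show ?thesis using True by (simp add: g_def kl_phi_def)
  next
   case False
   then have "0 < f x" using nn[of x] by linarith
   have "f x * g k x - (exp (g k x) - 1) = kl_phi (f x)" if "nat \<lceil>\<bar>ln (f x)\<bar>\<rceil> \<le> k" for k
   proof -
    have "\<bar>ln (f x)\<bar> \<le> real k" using that by linarith
    then have "g k x = ln (f x)" using False by (auto simp: g_def)
    then show ?thesis using False \<open>0 < f x\<close> by (simp add: kl_phi_def)
   qed
   then have "\<forall>\<^sub>F k in sequentially. f x * g k x - (exp (g k x) - 1) = kl_phi (f x)"
    unfolding eventually_sequentially by blast
   then show ?thesis by (rule tendsto_eventually)
  qed
  then have "(\<lambda>k. ennreal (f x * g k x - (exp (g k x) - 1))) \<longlonglongrightarrow> ennreal (kl_phi (f x))"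
   by (intro tendsto_intros)
  then show "ennreal (kl_phi (f x)) = liminf (\<lambda>k. ennreal (f x * g k x - (exp (g k x) - 1)))"
   by (intro lim_imp_Liminf[symmetric]) auto
 qed
 also have "\<dots> \<le> liminf (\<lambda>k. \<integral>\<^sup>+x. ennreal (f x * g k x - (exp (g k x) - 1)) \<partial>\<beta>)"
  by (rule nn_integral_liminf) measurable
 also have "\<dots> \<le> liminf (\<lambda>k. ennreal K)"
  using le by (intro Liminf_mono) auto
 also have "\<dots> = ennreal K" by (simp add: Liminf_const)
 finally show thesis using that[OF f_b nn \<rho>] by simp
qed

text \<open>The fibers of the density are probability measures almost everywhere because both glued measures
 have the same first marginal; uniqueness of disintegrations does the rest.\<close>

lemma glue_density_fiber:
 fixes \<a> :: "'a::second_countable_topology measure" and \<k> \<theta> :: "'a => 'b::second_countable_topology measure"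
 assumes fin: "finite_measure \<a>" and \<a>: "sets \<a> = sets borel"
  and \<k>: "kernel \<a> \<k>" and \<theta>: "kernel \<a> \<theta>"
  and f[measurable]: "f \<in> borel_measurable borel" and nn: "\<And>p. 0 \<le> f p"
  and eq: "glue \<a> \<k> = density (glue \<a> \<theta>) (\<lambda>p. ennreal (f p))"
 shows "AE a in \<a>. \<k> a = density (\<theta> a) (\<lambda>b. ennreal (f (a, b)))"
proof -
 interpret \<a>: finite_measure \<a> by fact
 note [measurable_cong] = \<a>
 note \<theta>_m[measurable] = measurable_prob_algebraD[OF \<theta>]
 have f_pair[measurable]: "f \<in> borel_measurable (borel \<Otimes>\<^sub>M borel)"
  unfolding borel_prod by (rule f)
 have f_\<a>: "(\<lambda>(a, b). ennreal (f (a, b))) \<in> borel_measurable (\<a> \<Otimes>\<^sub>M borel)"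
  by measurable
 have f_fib[measurable]: "(\<lambda>b. f (a, b)) \<in> borel_measurable borel" for a
  using measurable_compose[OF measurable_Pair_borel f] .
 have mass_m: "(\<lambda>a. \<integral>\<^sup>+b. ennreal (f (a, b)) * indicator C b \<partial>\<theta> a) \<in> borel_measurable \<a>" if C[measurable]: "C \<in> sets borel" for C
 proof -
  have [measurable]: "(\<lambda>(a, b). ennreal (f (a, b)) * indicator C b) \<in> borel_measurable (\<a> \<Otimes>\<^sub>M borel)"
   by measurable
  show ?thesis by (rule nn_integral_measurable_subprob_algebra2[OF _ \<theta>_m]) measurable
 qed
 have em: "emeasure (density (\<theta> a) (\<lambda>b. ennreal (f (a, b)))) C = (\<integral>\<^sup>+b. ennreal (f (a, b)) * indicator C b \<partial>\<theta> a)"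
  if "a \<in> space \<a>" "C \<in> sets borel" for a C
  using kernel_fiber(2)[OF \<theta> that(1)] that f_fib[of a] by (intro emeasure_density) (auto cong: measurable_cong_sets)
 have rect: "emeasure (glue \<a> \<k>) (B \<times> C) = (\<integral>\<^sup>+a. (\<integral>\<^sup>+b. ennreal (f (a, b)) * indicator C b \<partial>\<theta> a) * indicator B a \<partial>\<a>)"
  if B[measurable]: "B \<in> sets borel" and C[measurable]: "C \<in> sets borel" for B C
 proof -
  have [measurable]: "B \<times> C \<in> sets borel" by (rule borel_Times[OF B C])
  have [measurable]: "f \<in> borel_measurable (glue \<a> \<theta>)"
   unfolding measurable_cong_sets[OF sets_glue[OF \<a>] refl] by (rule f)
  have "emeasure (glue \<a> \<k>) (B \<times> C) = (\<integral>\<^sup>+p. ennreal (f p) * indicator (B \<times> C) p \<partial>glue \<a> \<theta>)"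
   unfolding eq by (rule emeasure_density) (auto simp: \<a>)
  also have "\<dots> = (\<integral>\<^sup>+a. \<integral>\<^sup>+b. ennreal (f (a, b)) * indicator (B \<times> C) (a, b) \<partial>\<theta> a \<partial>\<a>)"
   by (rule nn_integral_glue[OF \<a> \<theta>]) measurable
  also have "\<dots> = (\<integral>\<^sup>+a. (\<integral>\<^sup>+b. ennreal (f (a, b)) * indicator C b \<partial>\<theta> a) * indicator B a \<partial>\<a>)"
  proof (rule nn_integral_cong)
   fix a
   show "(\<integral>\<^sup>+b. ennreal (f (a, b)) * indicator (B \<times> C) (a, b) \<partial>\<theta> a) = (\<integral>\<^sup>+b. ennreal (f (a, b)) * indicator C b \<partial>\<theta> a) * indicator B a"
    by (cases "a \<in> B") (auto simp: indicator_def)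
  qed
  finally show ?thesis .
 qed
 have "AE a in \<a>. (\<integral>\<^sup>+b. ennreal (f (a, b)) * indicator UNIV b \<partial>\<theta> a) = 1"
 proof (rule \<a>.density_unique)
  show "density \<a> (\<lambda>a. \<integral>\<^sup>+b. ennreal (f (a, b)) * indicator UNIV b \<partial>\<theta> a) = density \<a> (\<lambda>_. 1)"
  proof (rule measure_eqI)
   fix B assume "B \<in> sets (density \<a> (\<lambda>a. \<integral>\<^sup>+b. ennreal (f (a, b)) * indicator UNIV b \<partial>\<theta> a))"
   then have B: "B \<in> sets borel" by (simp add: \<a>)
   have "emeasure (glue \<a> \<k>) (B \<times> UNIV) = (\<integral>\<^sup>+a. indicator B a \<partial>\<a>)"
    unfolding emeasure_glue_Times[OF \<a> \<k> B borel_UNIV]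
   proof (rule nn_integral_cong)
    fix a assume "a \<in> space \<a>"
    from kernel_fiber[OF \<k> this] show "emeasure (\<k> a) UNIV * indicator B a = indicator B a"
     by (metis mult_1 prob_space.emeasure_space_1)
   qed
   then show "emeasure (density \<a> (\<lambda>a. \<integral>\<^sup>+b. ennreal (f (a, b)) * indicator UNIV b \<partial>\<theta> a)) B = emeasure (density \<a> (\<lambda>_. 1)) B"
    using rect[OF B borel_UNIV] emeasure_density[OF mass_m[OF borel_UNIV], of B] B \<a>
    by (simp add: emeasure_density)
  qed simp
 qed (use mass_m[OF borel_UNIV] in auto)
 note mass = this
 define \<k>' where "\<k>' a = (if (\<integral>\<^sup>+b. ennreal (f (a, b)) * indicator UNIV b \<partial>\<theta> a) = 1
  then density (\<theta> a) (\<lambda>b. ennreal (f (a, b))) else \<theta> a)" for a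
 have em': "emeasure (\<k>' a) C = (if (\<integral>\<^sup>+b. ennreal (f (a, b)) * indicator UNIV b \<partial>\<theta> a) = 1
  then (\<integral>\<^sup>+b. ennreal (f (a, b)) * indicator C b \<partial>\<theta> a) else emeasure (\<theta> a) C)" if "a \<in> space \<a>" "C \<in> sets borel" for a C
  using em[OF that] by (simp add: \<k>'_def)
 have \<k>': "kernel \<a> \<k>'"
 proof (rule measurable_prob_algebraI)
  fix a assume a: "a \<in> space \<a>"
  note fib = kernel_fiber[OF \<theta> a]
  show p: "prob_space (\<k>' a)"
  proof (rule prob_spaceI)
   have "space (\<k>' a) = UNIV" using fib by (simp add: \<k>'_def)
   then show "emeasure (\<k>' a) (space (\<k>' a)) = 1"
    using em'[OF a borel_UNIV] prob_space.emeasure_space_1[OF fib(1)] fib(3) by simp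
  qed
 next
  show "\<k>' \<in> \<a> \<rightarrow>\<^sub>M subprob_algebra borel"
  proof (rule measurable_subprob_algebra)
   fix a assume a: "a \<in> space \<a>"
   note fib = kernel_fiber[OF \<theta> a]
   show s: "sets (\<k>' a) = sets borel" using fib by (simp add: \<k>'_def)
   have "prob_space (\<k>' a)"
   proof (rule prob_spaceI)
    have "space (\<k>' a) = UNIV" using fib by (simp add: \<k>'_def)
    then show "emeasure (\<k>' a) (space (\<k>' a)) = 1"
     using em'[OF a borel_UNIV] prob_space.emeasure_space_1[OF fib(1)] fib(3) by simp
   qed
   then show "subprob_space (\<k>' a)" by (rule prob_space_imp_subprob_space)
  next
   fix C :: "'b set" assume C[measurable]: "C \<in> sets borel"
   note [measurable] = mass_m[OF C] mass_m[OF borel_UNIV]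
   have "(\<lambda>a. if (\<integral>\<^sup>+b. ennreal (f (a, b)) * indicator UNIV b \<partial>\<theta> a) = 1
    then (\<integral>\<^sup>+b. ennreal (f (a, b)) * indicator C b \<partial>\<theta> a) else emeasure (\<theta> a) C) \<in> borel_measurable \<a>"
    by (intro measurable_If) measurable
   then show "(\<lambda>a. emeasure (\<k>' a) C) \<in> borel_measurable \<a>"
    by (rule measurable_cong[THEN iffD1, rotated]) (simp add: em'[OF _ C])
  qed
 qed
 have "glue \<a> \<k> = glue \<a> \<k>'"
 proof (rule finite_measure_eqI_rectangles)
  show "emeasure (glue \<a> \<k>) (UNIV) \<noteq> \<infinity>"
  proof -
   have "emeasure (glue \<a> \<k>) (UNIV \<times> UNIV) \<le> (\<integral>\<^sup>+a. 1 \<partial>\<a>)"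
    unfolding emeasure_glue_Times[OF \<a> \<k> borel_UNIV borel_UNIV]
   proof (rule nn_integral_mono)
    fix a assume "a \<in> space \<a>"
    from kernel_fiber[OF \<k> this] show "emeasure (\<k> a) UNIV * indicator UNIV a \<le> 1"
     by (metis mult_1_right prob_space.emeasure_space_1 indicator_UNIV order_refl)
   qed
   also have "\<dots> < \<infinity>" by (simp add: \<a>.emeasure_eq_measure)
   finally show ?thesis by simp
  qed
  fix B :: "'a set" and C :: "'b set" assume B: "B \<in> sets borel" and C: "C \<in> sets borel"
  show "emeasure (glue \<a> \<k>) (B \<times> C) = emeasure (glue \<a> \<k>') (B \<times> C)"
   unfolding rect[OF B C] emeasure_glue_Times[OF \<a> \<k>' B C]
  proof (rule nn_integral_cong_AE)
   show "AE a in \<a>. (\<integral>\<^sup>+b. ennreal (f (a, b)) * indicator C b \<partial>\<theta> a) * indicator B a = emeasure (\<k>' a) C * indicator B a"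
    using mass AE_space by eventually_elim (simp add: em'[OF _ C])
  qed
 qed (simp_all add: \<a>)
 then have "AE a in \<a>. \<k> a = \<k>' a"
  by (rule glue_kernel_unique[OF \<a>.sigma_finite_measure_axioms \<a> \<k> \<k>'])
 with mass show ?thesis
  by eventually_elim (simp add: \<k>'_def)
qed

section \<open>Integrals of extended-real functions\<close>

lemma ereal_integral_mono_AE:
 assumes "AE x in M. f x \<le> g x"
 shows "ereal_integral M f \<le> ereal_integral M g"
 unfolding ereal_integral_def
proof (intro ereal_minus_mono)
 show "enn2ereal (\<integral>\<^sup>+x. e2ennreal (f x) \<partial>M) \<le> enn2ereal (\<integral>\<^sup>+x. e2ennreal (g x) \<partial>M)"
  unfolding less_eq_ennreal.rep_eq[symmetric]
  by (rule nn_integral_mono_AE) (use assms in eventually_elim, rule e2ennreal_mono)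
 show "enn2ereal (\<integral>\<^sup>+x. e2ennreal (- g x) \<partial>M) \<le> enn2ereal (\<integral>\<^sup>+x. e2ennreal (- f x) \<partial>M)"
  unfolding less_eq_ennreal.rep_eq[symmetric]
  by (rule nn_integral_mono_AE) (use assms in eventually_elim, rule e2ennreal_mono, simp)
qed

lemma ereal_integral_ereal:
 assumes f: "integrable M f"
 shows "ereal_integral M (\<lambda>x. ereal (f x)) = ereal (\<integral>x. f x \<partial>M)"
proof -
 have fin: "(\<integral>\<^sup>+x. ennreal (f x) \<partial>M) \<noteq> \<infinity>" "(\<integral>\<^sup>+x. ennreal (- f x) \<partial>M) \<noteq> \<infinity>"
  using f by (auto simp: real_integrable_def)
 have "enn2ereal u = ereal (enn2real u)" if "u \<noteq> \<infinity>" for u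
  using that by (cases u) (auto simp: enn2ereal_ennreal)
 then show ?thesis
  unfolding ereal_integral_def real_lebesgue_integral_def[OF f] using fin by simp
qed

lemma ereal_integral_ge:
 assumes "integrable M G" "AE x in M. ereal (G x) \<le> f x"
 shows "ereal (\<integral>x. G x \<partial>M) \<le> ereal_integral M f"
 using ereal_integral_mono_AE[OF assms(2)] by (simp add: ereal_integral_ereal[OF assms(1)])

lemma ereal_integral_le:
 assumes p[measurable]: "p \<in> borel_measurable M" and l: "integrable M l"
  and le: "AE x in M. f x \<le> enn2ereal (p x) + ereal (l x)"
 shows "ereal_integral M f \<le> enn2ereal (\<integral>\<^sup>+x. p x \<partial>M) + ereal (\<integral>x. l x \<partial>M)"
proof (cases "(\<integral>\<^sup>+x. p x \<partial>M) = \<infinity>")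
 case False
 have fin: "AE x in M. p x \<noteq> \<infinity>" using False by (intro nn_integral_noteq_infinite p) auto
 have "(\<integral>\<^sup>+x. ennreal (enn2real (p x)) \<partial>M) = (\<integral>\<^sup>+x. p x \<partial>M)"
  using fin by (intro nn_integral_cong_AE) (auto elim!: eventually_mono simp: less_top)
 note eq = this
 have ip: "integrable M (\<lambda>x. enn2real (p x))"
  using False eq by (intro integrableI_nonneg) (auto simp: less_top)
 have "AE x in M. f x \<le> ereal (enn2real (p x) + l x)"
  using le fin
 proof eventually_elim
  case (elim x)
  then show ?case by (cases "p x") (auto simp: enn2ereal_ennreal)
 qed
 then have "ereal_integral M f \<le> ereal (\<integral>x. enn2real (p x) + l x \<partial>M)"
  using ereal_integral_mono_AE[of f "\<lambda>x. ereal (enn2real (p x) + l x)" M] ereal_integral_ereal[of M "\<lambda>x. enn2real (p x) + l x"] ip l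
  by simp
 also have "\<dots> = ereal (\<integral>x. enn2real (p x) \<partial>M) + ereal (\<integral>x. l x \<partial>M)" using ip l by simp
 also have "ereal (\<integral>x. enn2real (p x) \<partial>M) = enn2ereal (\<integral>\<^sup>+x. p x \<partial>M)"
  unfolding eq[symmetric] using ip by (subst nn_integral_eq_integral) (auto simp: enn2ereal_ennreal)
 finally show ?thesis .
qed simp

text \<open>The integrand \<open>\<Phi>\<close> carries no measurability assumption, so that integrals of
 \<open>\<Phi>\<close> are only compared with those of measurable bounds.\<close>

lemma iterated_ereal_integral_ge:
 assumes \<tau>: "finite_measure \<tau>" and \<mu>: "finite_measure \<mu>" and G: "integrable (\<tau> \<Otimes>\<^sub>M \<mu>) G"
  and le: "AE a in \<tau> \<Otimes>\<^sub>M \<mu>. ereal (G a) \<le> \<Phi> (fst a) (snd a)"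
 shows "ereal (\<integral>a. G a \<partial>(\<tau> \<Otimes>\<^sub>M \<mu>)) \<le> ereal_integral \<tau> (\<lambda>t. ereal_integral \<mu> (\<Phi> t))"
proof -
 interpret \<tau>: finite_measure \<tau> by fact
 interpret \<mu>: finite_measure \<mu> by fact
 interpret pair_sigma_finite \<tau> \<mu> ..
 have "AE t in \<tau>. ereal (\<integral>x. G (t, x) \<partial>\<mu>) \<le> ereal_integral \<mu> (\<Phi> t)"
  using AE_pair[OF le] AE_integrable_fst'[OF G]
  by eventually_elim (auto intro: ereal_integral_ge)
 then show ?thesis
  unfolding integral_fst'[OF G, symmetric] by (rule ereal_integral_ge[OF integrable_fst'[OF G]])
qed

lemma iterated_ereal_integral_le:
 assumes \<tau>: "finite_measure \<tau>" and \<mu>: "finite_measure \<mu>" and p[measurable]: "p \<in> borel_measurable (\<tau> \<Otimes>\<^sub>M \<mu>)"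
  and l: "integrable (\<tau> \<Otimes>\<^sub>M \<mu>) l"
  and le: "AE a in \<tau> \<Otimes>\<^sub>M \<mu>. \<Phi> (fst a) (snd a) \<le> enn2ereal (p a) + ereal (l a)"
 shows "ereal_integral \<tau> (\<lambda>t. ereal_integral \<mu> (\<Phi> t)) \<le> enn2ereal (\<integral>\<^sup>+a. p a \<partial>(\<tau> \<Otimes>\<^sub>M \<mu>)) + ereal (\<integral>a. l a \<partial>(\<tau> \<Otimes>\<^sub>M \<mu>))"
proof -
 interpret \<tau>: finite_measure \<tau> by fact
 interpret \<mu>: finite_measure \<mu> by fact
 interpret pair_sigma_finite \<tau> \<mu> ..
 have "AE t in \<tau>. ereal_integral \<mu> (\<Phi> t) \<le> enn2ereal (\<integral>\<^sup>+x. p (t, x) \<partial>\<mu>) + ereal (\<integral>x. l (t, x) \<partial>\<mu>)"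
  using AE_pair[OF le] AE_integrable_fst'[OF l] AE_space
 proof eventually_elim
  case (elim t)
  have "(\<lambda>x. p (t, x)) \<in> borel_measurable \<mu>" using elim(3) by measurable
  with elim show ?case by (intro ereal_integral_le) auto
 qed
 then show ?thesis
  unfolding integral_fst'[OF l, symmetric] \<mu>.nn_integral_fst[OF p, symmetric]
  by (intro ereal_integral_le integrable_fst'[OF l]) auto
qed

section \<open>Bounded Borel functions and glued measures\<close>

definition bounded_borel :: "('a::topological_space => real) => bool" where
 "bounded_borel f \<longleftrightarrow> f \<in> borel_measurable borel \<and> (\<exists>C. \<forall>x. \<bar>f x\<bar> \<le> C)"

lemma bounded_borelI: "f \<in> borel_measurable borel ==> (\<And>x. \<bar>f x\<bar> \<le> C) ==> bounded_borel f"
 unfolding bounded_borel_def by blast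

lemma bounded_borel_measurable: "bounded_borel f ==> f \<in> borel_measurable borel"
 by (simp add: bounded_borel_def)

lemma bounded_borel_const [simp]: "bounded_borel (\<lambda>_. c)"
 by (rule bounded_borelI[of _ "\<bar>c\<bar>"]) auto

lemma bounded_borel_add [simp]: "bounded_borel f ==> bounded_borel g ==> bounded_borel (\<lambda>x. f x + g x)"
 unfolding bounded_borel_def
proof safe
 fix C D assume "\<forall>x. \<bar>f x\<bar> \<le> C" "\<forall>x. \<bar>g x\<bar> \<le> D"
 then have "\<bar>f x + g x\<bar> \<le> C + D" for x
  using order_trans[OF abs_triangle_ineq[of "f x" "g x"] add_mono[of "\<bar>f x\<bar>" C "\<bar>g x\<bar>" D]] by blast
 then show "\<exists>C. \<forall>x. \<bar>f x + g x\<bar> \<le> C" by blast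
qed measurable

lemma bounded_borel_mult [simp]: "bounded_borel f ==> bounded_borel g ==> bounded_borel (\<lambda>x. f x * g x)"
 unfolding bounded_borel_def
proof safe
 fix C D assume *: "\<forall>x. \<bar>f x\<bar> \<le> C" "\<forall>x. \<bar>g x\<bar> \<le> D"
 have "\<bar>f x * g x\<bar> \<le> C * D" for x
  unfolding abs_mult using * by (intro mult_mono) (auto intro: order_trans[OF abs_ge_zero])
 then show "\<exists>C. \<forall>x. \<bar>f x * g x\<bar> \<le> C" by blast
qed measurable

lemma bounded_borel_diff [simp]: "bounded_borel f ==> bounded_borel g ==> bounded_borel (\<lambda>x. f x - g x)"
 using bounded_borel_add[of f "\<lambda>x. (-1) * g x"] bounded_borel_mult[of "\<lambda>_. -1" g] by simp

lemma bounded_borel_exp [simp]: "bounded_borel f ==> bounded_borel (\<lambda>x. exp (f x))"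
 unfolding bounded_borel_def
proof safe
 fix C assume "\<forall>x. \<bar>f x\<bar> \<le> C"
 then have "\<bar>exp (f x)\<bar> \<le> exp C" for x by (auto intro: order_trans[OF abs_ge_self])
 then show "\<exists>C. \<forall>x. \<bar>exp (f x)\<bar> \<le> C" by blast
qed measurable

lemma bounded_borel_comp:
 assumes "bounded_borel f" "q \<in> borel_measurable borel" shows "bounded_borel (\<lambda>x. f (q x))"
 using assms measurable_compose[OF assms(2)] unfolding bounded_borel_def by auto

lemma bounded_borel_Pair [simp]:
 fixes f :: "'a::second_countable_topology \<times> 'b::second_countable_topology => real"
 shows "bounded_borel f ==> bounded_borel (\<lambda>b. f (a, b))"
 by (rule bounded_borel_comp[OF _ measurable_Pair_borel])

lemma bounded_borel_integrable:
 assumes "finite_measure M" "sets M = sets borel" "bounded_borel f"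
 shows "integrable M f"
proof -
 obtain C where "\<And>x. \<bar>f x\<bar> \<le> C" using assms(3) unfolding bounded_borel_def by blast
 then show ?thesis
  using assms by (intro bounded_integrable[OF assms(1)]) (auto simp: bounded_borel_def cong: measurable_cong_sets)
qed

lemma borel_measurable_fst_borel [measurable]:
 "fst \<in> (borel :: ('a::second_countable_topology \<times> 'b::second_countable_topology) measure) \<rightarrow>\<^sub>M borel"
 by (simp add: borel_prod[symmetric])

lemma borel_measurable_snd_borel [measurable]:
 "snd \<in> (borel :: ('a::second_countable_topology \<times> 'b::second_countable_topology) measure) \<rightarrow>\<^sub>M borel"
 by (simp add: borel_prod[symmetric])

lemma borel_measurable_Pair_borel:
 assumes "f \<in> M \<rightarrow>\<^sub>M borel" "g \<in> M \<rightarrow>\<^sub>M borel"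
 shows "(\<lambda>x. (f x, g x)) \<in> M \<rightarrow>\<^sub>M (borel :: ('a::second_countable_topology \<times> 'b::second_countable_topology) measure)"
 unfolding borel_prod[symmetric] using assms by measurable

lemma
 fixes \<a> :: "'a::second_countable_topology measure" and \<k> :: "'a => 'b::second_countable_topology measure"
 assumes fin: "finite_measure \<a>" and \<a>: "sets \<a> = sets borel" and \<k>: "kernel \<a> \<k>"
  and f: "bounded_borel f"
 shows integral_glue: "(\<integral>p. f p \<partial>glue \<a> \<k>) = (\<integral>a. \<integral>b. f (a, b) \<partial>\<k> a \<partial>\<a>)"
  and bounded_borel_kernel_integral: "bounded_borel (\<lambda>a. \<integral>b. f (a, b) \<partial>\<k> a)"
proof -
 have sp: "space \<a> = UNIV" using \<a> by (auto dest: sets_eq_imp_space_eq)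
 obtain C where C: "\<And>x. \<bar>f x\<bar> \<le> C" using f unfolding bounded_borel_def by blast
 have fm: "f \<in> borel_measurable borel" using f by (simp add: bounded_borel_def)
 note fib = kernel_fiber[OF \<k>, unfolded sp, OF UNIV_I]
 have in_distr: "integral\<^sup>L (distr (\<k> a) borel (Pair a)) f = (\<integral>b. f (a, b) \<partial>\<k> a)" for a
  using fm by (subst integral_distr) (auto simp: measurable_cong_sets[OF fib(2) refl])
 have "(\<integral>p. f p \<partial>glue \<a> \<k>) = (\<integral>a. integral\<^sup>L (distr (\<k> a) borel (Pair a)) f \<partial>\<a>)"
  unfolding glue_def
 proof (rule integral_bind[OF fm _ measurable_prob_algebraD[OF glue_kernel_measurable[OF \<a> \<k>]] fin, of C 1])
  show "AE x in \<a>. emeasure (distr (\<k> x) borel (Pair x)) (space (distr (\<k> x) borel (Pair x))) \<le> ennreal 1"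
  proof (rule AE_I2)
   fix a assume "a \<in> space \<a>"
   interpret prob_space "distr (\<k> a) borel (Pair a)"
    by (rule kernel_fiber(1)[OF glue_kernel_measurable[OF \<a> \<k>] \<open>a \<in> space \<a>\<close>])
   show "emeasure (distr (\<k> a) borel (Pair a)) (space (distr (\<k> a) borel (Pair a))) \<le> ennreal 1"
    using emeasure_space_1 by simp
  qed
 qed (rule C)
 then show "(\<integral>p. f p \<partial>glue \<a> \<k>) = (\<integral>a. \<integral>b. f (a, b) \<partial>\<k> a \<partial>\<a>)"
  by (simp add: in_distr)
 show "bounded_borel (\<lambda>a. \<integral>b. f (a, b) \<partial>\<k> a)"
 proof (rule bounded_borelI)
  have "(\<lambda>a. integral\<^sup>L (distr (\<k> a) borel (Pair a)) f) \<in> borel_measurable \<a>"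
   by (rule measurable_compose[OF measurable_prob_algebraD[OF glue_kernel_measurable[OF \<a> \<k>]] integral_measurable_subprob_algebra[OF fm]])
  then show "(\<lambda>a. \<integral>b. f (a, b) \<partial>\<k> a) \<in> borel_measurable borel"
   unfolding in_distr by (simp only: measurable_cong_sets[OF \<a> refl])
  show "\<bar>\<integral>b. f (a, b) \<partial>\<k> a\<bar> \<le> C" for a
  proof -
   interpret prob_space "\<k> a" by (rule fib(1))
   have i: "integrable (\<k> a) (\<lambda>b. f (a, b))"
    by (rule bounded_borel_integrable[OF _ fib(2) bounded_borel_Pair[OF f]]) unfold_locales
   have "(\<integral>b. f (a, b) \<partial>\<k> a) \<le> (\<integral>b. C \<partial>\<k> a)" "(\<integral>b. - C \<partial>\<k> a) \<le> (\<integral>b. f (a, b) \<partial>\<k> a)"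
    using C by (intro integral_mono i; simp add: abs_le_iff minus_le_iff)+
   then show ?thesis by (simp add: prob_space)
  qed
 qed
qed

lemma finite_measure_glue:
 fixes \<a> :: "'a::second_countable_topology measure" and \<k> :: "'a => 'b::second_countable_topology measure"
 assumes fin: "finite_measure \<a>" and \<a>: "sets \<a> = sets borel" and \<k>: "kernel \<a> \<k>"
 shows "finite_measure (glue \<a> \<k>)"
proof -
 interpret finite_measure \<a> by fact
 have sp: "space (glue \<a> \<k>) = UNIV" using sets_eq_imp_space_eq[OF sets_glue[OF \<a>, of \<k>]] by simp
 have "emeasure (glue \<a> \<k>) (space (glue \<a> \<k>)) = emeasure (distr (glue \<a> \<k>) borel fst) UNIV"
  by (subst emeasure_distr) (simp_all add: sp measurable_cong_sets[OF sets_glue[OF \<a>] refl])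
 then show ?thesis
  using emeasure_finite[of UNIV] distr_fst_glue[OF \<a> \<k>] by (intro finite_measureI) simp
qed

lemma distr_glue_snd:
 fixes \<a> :: "'a::second_countable_topology measure" and \<k> :: "'a => 'b::second_countable_topology measure"
  and q :: "'b => 'c::second_countable_topology"
 assumes \<a>: "sets \<a> = sets borel" and \<k>: "kernel \<a> \<k>" and q: "q \<in> borel \<rightarrow>\<^sub>M borel"
 shows "distr (glue \<a> \<k>) borel (\<lambda>p. (fst p, q (snd p))) = glue \<a> (\<lambda>a. distr (\<k> a) borel q)"
  and "kernel \<a> (\<lambda>a. distr (\<k> a) borel q)"
proof -
 show \<k>q: "kernel \<a> (\<lambda>a. distr (\<k> a) borel q)"
  by (rule measurable_compose[OF \<k> measurable_distr_prob_space[OF q]])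
 have Q: "(\<lambda>p. (fst p, q (snd p))) \<in> borel \<rightarrow>\<^sub>M (borel :: ('a \<times> 'c) measure)"
  by (intro borel_measurable_Pair_borel measurable_compose[OF _ q]) measurable
 show "distr (glue \<a> \<k>) borel (\<lambda>p. (fst p, q (snd p))) = glue \<a> (\<lambda>a. distr (\<k> a) borel q)"
 proof (rule measure_eqI)
  fix A assume "A \<in> sets (distr (glue \<a> \<k>) borel (\<lambda>p. (fst p, q (snd p))))"
  then have A: "A \<in> sets borel" by simp
  have pre: "(\<lambda>p. (fst p, q (snd p))) -` A \<in> sets borel"
   using measurable_sets[OF Q A] by simp
  have "emeasure (distr (glue \<a> \<k>) borel (\<lambda>p. (fst p, q (snd p)))) A = emeasure (glue \<a> \<k>) ((\<lambda>p. (fst p, q (snd p))) -` A)"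
   using sets_eq_imp_space_eq[OF sets_glue[OF \<a>, of \<k>]] Q A
   by (subst emeasure_distr) (simp_all add: measurable_cong_sets[OF sets_glue[OF \<a>] refl])
  also have "\<dots> = (\<integral>\<^sup>+a. emeasure (\<k> a) (Pair a -` ((\<lambda>p. (fst p, q (snd p))) -` A)) \<partial>\<a>)"
   by (rule emeasure_glue[OF \<a> \<k> pre])
  also have "\<dots> = (\<integral>\<^sup>+a. emeasure (distr (\<k> a) borel q) (Pair a -` A) \<partial>\<a>)"
  proof (rule nn_integral_cong)
   fix a assume "a \<in> space \<a>"
   note fib = kernel_fiber[OF \<k> this]
   have "Pair a -` A \<in> sets borel" using measurable_sets[OF measurable_Pair_borel A, of a] by simp
   then show "emeasure (\<k> a) (Pair a -` ((\<lambda>p. (fst p, q (snd p))) -` A)) = emeasure (distr (\<k> a) borel q) (Pair a -` A)"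
    using q by (subst emeasure_distr)
     (auto simp: fib(3) measurable_cong_sets[OF fib(2) refl] intro!: arg_cong[where f="emeasure _"])
  qed
  also have "\<dots> = emeasure (glue \<a> (\<lambda>a. distr (\<k> a) borel q)) A"
   by (rule emeasure_glue[OF \<a> \<k>q A, symmetric])
  finally show "emeasure (distr (glue \<a> \<k>) borel (\<lambda>p. (fst p, q (snd p)))) A = emeasure (glue \<a> (\<lambda>a. distr (\<k> a) borel q)) A" .
 qed (simp add: \<a>)
qed

lemma product_kernel:
 fixes \<sigma> :: "'a => 'b::second_countable_topology measure" and \<pi> :: "'a => 'c::second_countable_topology measure"
 assumes \<sigma>: "kernel \<a> \<sigma>" and \<pi>: "kernel \<a> \<pi>"
 shows "kernel \<a> (\<lambda>a. \<sigma> a \<Otimes>\<^sub>M \<pi> a)"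
proof -
 have "(\<lambda>a. \<sigma> a \<Otimes>\<^sub>M \<pi> a) \<in> \<a> \<rightarrow>\<^sub>M prob_algebra (borel \<Otimes>\<^sub>M borel)"
 proof (rule measurable_prob_algebraI)
  show "(\<lambda>a. \<sigma> a \<Otimes>\<^sub>M \<pi> a) \<in> \<a> \<rightarrow>\<^sub>M subprob_algebra (borel \<Otimes>\<^sub>M borel)"
   using \<sigma> \<pi> by (intro measurable_pair_measure measurable_prob_algebraD)
  fix a assume a: "a \<in> space \<a>"
  show "prob_space (\<sigma> a \<Otimes>\<^sub>M \<pi> a)"
   by (rule prob_space_pair) (use kernel_fiber(1)[OF \<sigma> a] kernel_fiber(1)[OF \<pi> a] in auto)
 qed
 then show ?thesis by (simp only: borel_prod)
qed

lemma product_marginals: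
 fixes s :: "'b::second_countable_topology measure" and p :: "'c::second_countable_topology measure"
 assumes s: "prob_space s" "sets s = sets borel" and p: "prob_space p" "sets p = sets borel"
 shows "distr (s \<Otimes>\<^sub>M p) borel fst = s" "distr (s \<Otimes>\<^sub>M p) borel snd = p"
  "prob_space (s \<Otimes>\<^sub>M p)" "sets (s \<Otimes>\<^sub>M p) = sets borel"
proof -
 interpret s: prob_space s by fact
 interpret p: prob_space p by fact
 have sps: "space s = UNIV" "space p = UNIV" using s p by (auto dest: sets_eq_imp_space_eq)
 have m: "fst \<in> s \<Otimes>\<^sub>M p \<rightarrow>\<^sub>M borel" "snd \<in> s \<Otimes>\<^sub>M p \<rightarrow>\<^sub>M borel"
  using measurable_fst[of s p] measurable_snd[of s p] s p by (simp_all cong: measurable_cong_sets)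
 have vim: "fst -` A = A \<times> UNIV" "snd -` B = UNIV \<times> B" for A :: "'b set" and B :: "'c set" by auto
 show "distr (s \<Otimes>\<^sub>M p) borel fst = s"
 proof (rule measure_eqI)
  fix A assume "A \<in> sets (distr (s \<Otimes>\<^sub>M p) borel fst)"
  then show "emeasure (distr (s \<Otimes>\<^sub>M p) borel fst) A = emeasure s A"
   using m p.emeasure_pair_measure_Times[of A s UNIV] p.emeasure_space_1 s p
   by (simp add: emeasure_distr vim space_pair_measure sps sets.top[of p, unfolded sps])
 qed (simp add: s)
 show "distr (s \<Otimes>\<^sub>M p) borel snd = p"
 proof (rule measure_eqI)
  fix A assume "A \<in> sets (distr (s \<Otimes>\<^sub>M p) borel snd)"
  then show "emeasure (distr (s \<Otimes>\<^sub>M p) borel snd) A = emeasure p A"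
   using m p.emeasure_pair_measure_Times[of UNIV s A] s.emeasure_space_1 s p
   by (simp add: emeasure_distr vim space_pair_measure sps)
 qed (simp add: p)
 show "prob_space (s \<Otimes>\<^sub>M p)" using s(1) p(1) by (rule prob_space_pair)
 show "sets (s \<Otimes>\<^sub>M p) = sets borel"
  unfolding sets_pair_measure_cong[OF s(2) p(2)] by (rule arg_cong[OF borel_prod])
qed

section \<open>Glued functionals and their dual lower bounds\<close>

text \<open>The dual objective for the functional \<open>A \<integral>lin d\<rho> + b
 KL(\<rho>|\<beta>)\<close> with marginal constraints: \<open>g\<close> is dual to the entropy and
 \<open>h\<close> to the constraints.\<close>

definition dual_value ::
 "real => real => ('e => real) => ('e => real) => ('e => real) => 'e measure => 'e measure => real" where
 "dual_value A b lin g h \<rho> \<beta> =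
   A * (\<integral>x. lin x \<partial>\<rho>) + b * ((\<integral>x. g x \<partial>\<rho>) - (\<integral>x. exp (g x) - 1 \<partial>\<beta>)) + ((\<integral>x. h x \<partial>\<rho>) - (\<integral>x. h x \<partial>\<beta>))"

abbreviation potential :: "('a \<times> 'b => real) => ('a \<times> 'c => real) => 'a \<times> 'b \<times> 'c => real" where
 "potential h1 h2 \<equiv> \<lambda>p. h1 (fst p, fst (snd p)) + h2 (fst p, snd (snd p))"

lemma fiber_dual_bound:
 fixes s :: "'b::second_countable_topology measure" and p :: "'c::second_countable_topology measure"
 assumes s: "prob_space s" "sets s = sets borel" and p: "prob_space p" "sets p = sets borel"
  and \<gamma>: "prob_space \<gamma>" "sets \<gamma> = sets borel"
  and g: "bounded_borel g" and h1: "bounded_borel h1" and h2: "bounded_borel h2" and b: "0 \<le> b"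
  and lower: "\<gamma> \<in> couplings s p ==> ereal (A * (\<integral>q. lin q \<partial>\<gamma>) - e) + ereal b * KL \<gamma> (s \<Otimes>\<^sub>M p) \<le> \<Phi>"
  and infeasible: "\<gamma> \<notin> couplings s p ==> \<Phi> = \<infinity>"
 shows "ereal (dual_value A b lin g (\<lambda>q. h1 (fst q) + h2 (snd q)) \<gamma> (s \<Otimes>\<^sub>M p) - e) \<le> \<Phi>"
proof (cases "\<gamma> \<in> couplings s p")
 case True
 note sp = product_marginals[OF s p]
 interpret \<gamma>: prob_space \<gamma> by fact
 interpret sp: prob_space "s \<Otimes>\<^sub>M p" by (rule sp)
 have m: "distr \<gamma> borel fst = s" "distr \<gamma> borel snd = p" using True by (auto simp: couplings_def)
 note meas = measurable_cong_sets[OF \<gamma>(2) refl] measurable_cong_sets[OF sp(4) refl]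
 have int: "integrable \<gamma> (\<lambda>q. h1 (fst q))" "integrable \<gamma> (\<lambda>q. h2 (snd q))"
  "integrable (s \<Otimes>\<^sub>M p) (\<lambda>q. h1 (fst q))" "integrable (s \<Otimes>\<^sub>M p) (\<lambda>q. h2 (snd q))"
  by (intro bounded_borel_integrable[OF _ _ bounded_borel_comp[OF h1]] bounded_borel_integrable[OF _ _ bounded_borel_comp[OF h2]] \<gamma> sp
    borel_measurable_fst_borel borel_measurable_snd_borel \<gamma>.finite_measure_axioms sp.finite_measure_axioms)+
 have "(\<integral>q. h1 (fst q) \<partial>\<gamma>) = (\<integral>q. h1 (fst q) \<partial>(s \<Otimes>\<^sub>M p))"
  using integral_distr[of fst \<gamma> borel h1] integral_distr[of fst "s \<Otimes>\<^sub>M p" borel h1] bounded_borel_measurable[OF h1] m sp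
  by (simp add: meas)
 moreover have "(\<integral>q. h2 (snd q) \<partial>\<gamma>) = (\<integral>q. h2 (snd q) \<partial>(s \<Otimes>\<^sub>M p))"
  using integral_distr[of snd \<gamma> borel h2] integral_distr[of snd "s \<Otimes>\<^sub>M p" borel h2] bounded_borel_measurable[OF h2] m sp
  by (simp add: meas)
 ultimately have h: "(\<integral>q. h1 (fst q) + h2 (snd q) \<partial>\<gamma>) = (\<integral>q. h1 (fst q) + h2 (snd q) \<partial>(s \<Otimes>\<^sub>M p))"
  using int by simp
 obtain C where C: "\<And>q. \<bar>g q\<bar> \<le> C" using g unfolding bounded_borel_def by blast
 have "ereal ((\<integral>q. g q \<partial>\<gamma>) - (\<integral>q. exp (g q) - 1 \<partial>(s \<Otimes>\<^sub>M p))) \<le> KL \<gamma> (s \<Otimes>\<^sub>M p)"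
  using bounded_borel_measurable[OF g] sp(4) \<gamma>(2)
  by (intro KL_ge_dual[OF _ _ _ _ C]) (auto simp: meas intro: \<gamma>.finite_measure_axioms sp.finite_measure_axioms)
 then have "ereal b * ereal ((\<integral>q. g q \<partial>\<gamma>) - (\<integral>q. exp (g q) - 1 \<partial>(s \<Otimes>\<^sub>M p))) \<le> ereal b * KL \<gamma> (s \<Otimes>\<^sub>M p)"
  using b by (intro ereal_mult_left_mono) auto
 then have "ereal (A * (\<integral>q. lin q \<partial>\<gamma>) - e) + ereal b * ereal ((\<integral>q. g q \<partial>\<gamma>) - (\<integral>q. exp (g q) - 1 \<partial>(s \<Otimes>\<^sub>M p)))
   \<le> ereal (A * (\<integral>q. lin q \<partial>\<gamma>) - e) + ereal b * KL \<gamma> (s \<Otimes>\<^sub>M p)"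
  by (rule add_left_mono)
 also have "\<dots> \<le> \<Phi>" by (rule lower[OF True])
 finally show ?thesis
  unfolding dual_value_def h by (simp add: algebra_simps)
qed (simp add: infeasible)

text \<open>Infeasible fibers cost \<open>\<infinity>\<close>, and on feasible fibers the potentials cancel;
 so the bound may be integrated over all fibers.\<close>

lemma glued_dual_bound:
 fixes \<tau> :: "real measure" and \<mu> :: "'x::second_countable_topology measure"
  and \<sigma> :: "real \<times> 'x => 'b::second_countable_topology measure" and \<pi> :: "real \<times> 'x => 'c::second_countable_topology measure"
 assumes \<tau>: "finite_measure \<tau>" "sets \<tau> = sets borel" and \<mu>: "finite_measure \<mu>" "sets \<mu> = sets borel"
  and \<sigma>: "kernel (\<tau> \<Otimes>\<^sub>M \<mu>) \<sigma>" and \<pi>: "kernel (\<tau> \<Otimes>\<^sub>M \<mu>) \<pi>"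
  and \<k>: "kernel (\<tau> \<Otimes>\<^sub>M \<mu>) \<k>"
  and lin: "bounded_borel lin" and g: "bounded_borel g" and h1: "bounded_borel h1" and h2: "bounded_borel h2" and b: "0 \<le> b"
  and lower: "AE a in \<tau> \<Otimes>\<^sub>M \<mu>. \<k> a \<in> couplings (\<sigma> a) (\<pi> a) \<longrightarrow>
    ereal (A * (\<integral>q. lin (a, q) \<partial>\<k> a) - e) + ereal b * KL (\<k> a) (\<sigma> a \<Otimes>\<^sub>M \<pi> a) \<le> \<Phi> (fst a) (snd a)"
  and infeasible: "AE a in \<tau> \<Otimes>\<^sub>M \<mu>. \<k> a \<notin> couplings (\<sigma> a) (\<pi> a) \<longrightarrow> \<Phi> (fst a) (snd a) = \<infinity>"
 shows "ereal (dual_value A b lin g (potential h1 h2)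
    (glue (\<tau> \<Otimes>\<^sub>M \<mu>) \<k>) (glue (\<tau> \<Otimes>\<^sub>M \<mu>) (\<lambda>a. \<sigma> a \<Otimes>\<^sub>M \<pi> a)) - e * measure (\<tau> \<Otimes>\<^sub>M \<mu>) UNIV)
   \<le> ereal_integral \<tau> (\<lambda>t. ereal_integral \<mu> (\<Phi> t))"
proof -
 let ?\<a> = "\<tau> \<Otimes>\<^sub>M \<mu>"
 let ?h = "\<lambda>p. h1 (fst p, fst (snd p)) + h2 (fst p, snd (snd p))"
 interpret \<tau>: finite_measure \<tau> by fact
 interpret \<mu>: finite_measure \<mu> by fact
 interpret pair_sigma_finite \<tau> \<mu> ..
 have \<a>: "sets ?\<a> = sets borel"
  unfolding sets_pair_measure_cong[OF \<tau>(2) \<mu>(2)] by (rule arg_cong[OF borel_prod])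
 have sp: "space ?\<a> = UNIV" using \<a> by (auto dest: sets_eq_imp_space_eq)
 have fin: "finite_measure ?\<a>" by (rule finite_measure_pair_measure) (rule \<tau> \<mu>)+
 interpret \<a>: finite_measure ?\<a> by (rule fin)
 note \<theta> = product_kernel[OF \<sigma> \<pi>]
 have meas: "(\<lambda>p :: (real \<times> 'x) \<times> 'b \<times> 'c. (fst p, fst (snd p))) \<in> borel \<rightarrow>\<^sub>M borel"
  "(\<lambda>p :: (real \<times> 'x) \<times> 'b \<times> 'c. (fst p, snd (snd p))) \<in> borel \<rightarrow>\<^sub>M borel"
  by (intro borel_measurable_Pair_borel measurable_compose[OF borel_measurable_snd_borel]
    borel_measurable_fst_borel borel_measurable_snd_borel)+
 have h: "bounded_borel ?h"
  by (intro bounded_borel_add bounded_borel_comp[OF h1] bounded_borel_comp[OF h2] meas)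
 have eg: "bounded_borel (\<lambda>p. exp (g p) - 1)" using g by simp
 define G where "G a = dual_value A b (\<lambda>q. lin (a, q)) (\<lambda>q. g (a, q)) (\<lambda>q. ?h (a, q)) (\<k> a) (\<sigma> a \<Otimes>\<^sub>M \<pi> a) - e" for a
 note ig = integral_glue[OF fin \<a> \<k>] integral_glue[OF fin \<a> \<theta>]
 note bk = bounded_borel_kernel_integral[OF fin \<a> \<k>] bounded_borel_kernel_integral[OF fin \<a> \<theta>]
 have int: "integrable ?\<a> (\<lambda>a. \<integral>q. f (a, q) \<partial>\<k> a)" "integrable ?\<a> (\<lambda>a. \<integral>q. f (a, q) \<partial>(\<sigma> a \<Otimes>\<^sub>M \<pi> a))"
  if "bounded_borel f" for f
  using bk[OF that] by (auto intro: bounded_borel_integrable[OF fin \<a>])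
 have iG: "integrable ?\<a> G"
  unfolding G_def dual_value_def using int(1)[OF lin] int(1)[OF g] int(1)[OF h] int(2)[OF eg] int(2)[OF h]
  by (intro Bochner_Integration.integrable_add Bochner_Integration.integrable_diff integrable_mult_right) auto
 have "(\<integral>a. G a \<partial>?\<a>) = dual_value A b lin g ?h (glue ?\<a> \<k>) (glue ?\<a> (\<lambda>a. \<sigma> a \<Otimes>\<^sub>M \<pi> a)) - e * measure ?\<a> UNIV"
  unfolding G_def dual_value_def ig(1)[OF lin] ig(1)[OF g] ig(1)[OF h] ig(2)[OF eg] ig(2)[OF h]
  using int(1)[OF lin] int(1)[OF g] int(1)[OF h] int(2)[OF eg] int(2)[OF h] by (simp add: sp)
 moreover have "ereal (\<integral>a. G a \<partial>?\<a>) \<le> ereal_integral \<tau> (\<lambda>t. ereal_integral \<mu> (\<Phi> t))"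
 proof (rule iterated_ereal_integral_ge[OF \<tau>(1) \<mu>(1) iG])
  show "AE a in ?\<a>. ereal (G a) \<le> \<Phi> (fst a) (snd a)"
   using lower infeasible
  proof eventually_elim
   case (elim a)
   have a: "a \<in> space ?\<a>" by (simp add: sp)
   note f1 = kernel_fiber[OF \<sigma> a] and f2 = kernel_fiber[OF \<pi> a] and f3 = kernel_fiber[OF \<k> a]
   show ?case
    unfolding G_def fst_conv snd_conv
    by (rule fiber_dual_bound[OF f1(1,2) f2(1,2) f3(1,2), where ?h1.0="\<lambda>z. h1 (a, z)" and ?h2.0="\<lambda>y. h2 (a, y)"])
      (use elim g h1 h2 b in \<open>auto\<close>)
  qed
 qed
 ultimately show ?thesis by simp
qed

text \<open>Scaling \<open>h\<close> by arbitrary factors shows that the potentials must integrate to the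
 same value, which identifies the marginals; scaling is not possible for \<open>g\<close>, which gives the
 entropy bound instead.\<close>

lemma dual_bound_imp_couplings:
 fixes \<a> :: "'a::euclidean_space measure"
  and \<sigma> :: "'a => 'b::euclidean_space measure" and \<pi> :: "'a => 'c::euclidean_space measure"
 assumes fin: "finite_measure \<a>" and \<a>: "sets \<a> = sets borel"
  and \<sigma>: "kernel \<a> \<sigma>" and \<pi>: "kernel \<a> \<pi>"
  and \<k>: "kernel \<a> \<k>"
  and b: "0 \<le> b"
  and bound: "\<And>g h1 h2. continuous_on UNIV g ==> continuous_on UNIV h1 ==> continuous_on UNIV h2 ==>
    bounded_borel g ==> bounded_borel h1 ==> bounded_borel h2 ==>
    dual_value A b lin g (potential h1 h2) (glue \<a> \<k>) (glue \<a> (\<lambda>a. \<sigma> a \<Otimes>\<^sub>M \<pi> a)) \<le> K"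
 shows "AE a in \<a>. \<k> a \<in> couplings (\<sigma> a) (\<pi> a)"
  and "0 < b ==> \<exists>f. f \<in> borel_measurable borel \<and> (\<forall>p. 0 \<le> f p) \<and>
    glue \<a> \<k> = density (glue \<a> (\<lambda>a. \<sigma> a \<Otimes>\<^sub>M \<pi> a)) (\<lambda>p. ennreal (f p)) \<and>
    (\<integral>\<^sup>+p. ennreal (kl_phi (f p)) \<partial>glue \<a> (\<lambda>a. \<sigma> a \<Otimes>\<^sub>M \<pi> a)) \<le> ennreal ((K - A * (\<integral>p. lin p \<partial>glue \<a> \<k>)) / b)"
proof -
 let ?\<beta> = "glue \<a> (\<lambda>a. \<sigma> a \<Otimes>\<^sub>M \<pi> a)"
 let ?\<rho> = "glue \<a> \<k>"
 note \<theta> = product_kernel[OF \<sigma> \<pi>]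
 have sp: "space \<a> = UNIV" using \<a> by (auto dest: sets_eq_imp_space_eq)
 note sets = sets_glue[OF \<a>, of \<k>] sets_glue[OF \<a>, of "\<lambda>a. \<sigma> a \<Otimes>\<^sub>M \<pi> a"]
 note fing = finite_measure_glue[OF fin \<a> \<k>] finite_measure_glue[OF fin \<a> \<theta>]
 have lin_null: "x = 0" if "\<And>c::real. L0 + c * x \<le> K" for x L0 :: real
 proof (rule ccontr)
  assume "x \<noteq> 0"
  then have "L0 + ((K - L0 + 1) / x) * x = K + 1" by simp
  with that[of "(K - L0 + 1) / x"] show False by simp
 qed
 have cont_b: "bounded_borel h" if "continuous_on UNIV h" "\<And>x. 0 \<le> h x" "\<And>x. h x \<le> 1" for h :: "'e::euclidean_space => real"
  using that by (intro bounded_borelI[of _ 1] borel_measurable_continuous_onI) auto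
 have marg: "distr ?\<rho> borel (\<lambda>p. (fst p, q (snd p))) = distr ?\<beta> borel (\<lambda>p. (fst p, q (snd p)))"
  if q: "q \<in> borel \<rightarrow>\<^sub>M borel" and
   ch: "\<And>h. continuous_on UNIV h ==> bounded_borel h ==>
    A * (\<integral>x. lin x \<partial>?\<rho>) + ((\<integral>p. h (fst p, q (snd p)) \<partial>?\<rho>) - (\<integral>p. h (fst p, q (snd p)) \<partial>?\<beta>)) \<le> K"
  for q :: "'b \<times> 'c => 'e::euclidean_space"
 proof (rule measure_eqI_continuous)
  have Q: "(\<lambda>p. (fst p, q (snd p))) \<in> borel \<rightarrow>\<^sub>M (borel :: ('a \<times> 'e) measure)"
   by (intro borel_measurable_Pair_borel measurable_compose[OF _ q]) measurable
  have Qm: "(\<lambda>p. (fst p, q (snd p))) \<in> ?\<rho> \<rightarrow>\<^sub>M (borel :: ('a \<times> 'e) measure)" "(\<lambda>p. (fst p, q (snd p))) \<in> ?\<beta> \<rightarrow>\<^sub>M (borel :: ('a \<times> 'e) measure)"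
   using Q by (simp_all only: measurable_cong_sets[OF sets(1) refl] measurable_cong_sets[OF sets(2) refl])
  show "finite_measure (distr ?\<rho> borel (\<lambda>p. (fst p, q (snd p))))" "finite_measure (distr ?\<beta> borel (\<lambda>p. (fst p, q (snd p))))"
   using fing Qm by (auto intro: finite_measure.finite_measure_distr)
  fix h :: "'a \<times> 'e => real" assume h: "continuous_on UNIV h" "\<And>x. 0 \<le> h x" "\<And>x. h x \<le> 1"
  have hb: "bounded_borel h" by (rule cont_b[OF h])
  have "(\<integral>p. h (fst p, q (snd p)) \<partial>?\<rho>) - (\<integral>p. h (fst p, q (snd p)) \<partial>?\<beta>) = 0"
  proof (rule lin_null[of "A * (\<integral>x. lin x \<partial>?\<rho>)"])
   fix c
   show "A * (\<integral>x. lin x \<partial>?\<rho>) + c * ((\<integral>p. h (fst p, q (snd p)) \<partial>?\<rho>) - (\<integral>p. h (fst p, q (snd p)) \<partial>?\<beta>)) \<le> K"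
    using ch[of "\<lambda>x. c * h x"] h hb by (simp add: right_diff_distrib continuous_on_mult)
  qed
  then show "integral\<^sup>L (distr ?\<rho> borel (\<lambda>p. (fst p, q (snd p)))) h = integral\<^sup>L (distr ?\<beta> borel (\<lambda>p. (fst p, q (snd p)))) h"
   using Qm bounded_borel_measurable[OF hb] by (simp add: integral_distr)
 qed simp_all
 have eq1: "AE a in \<a>. distr (\<k> a) borel fst = \<sigma> a"
 proof -
  have m: "distr ?\<rho> borel (\<lambda>p. (fst p, fst (snd p))) = distr ?\<beta> borel (\<lambda>p. (fst p, fst (snd p)))"
  proof (rule marg[OF borel_measurable_fst_borel])
   fix h :: "'a \<times> 'b => real" assume "continuous_on UNIV h" "bounded_borel h"
   then show "A * (\<integral>x. lin x \<partial>?\<rho>) + ((\<integral>p. h (fst p, fst (snd p)) \<partial>?\<rho>) - (\<integral>p. h (fst p, fst (snd p)) \<partial>?\<beta>)) \<le> K"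
    using bound[of "\<lambda>_. 0" h "\<lambda>_. 0"] by (simp add: dual_value_def)
  qed
  have "AE a in \<a>. distr (\<k> a) borel fst = distr (\<sigma> a \<Otimes>\<^sub>M \<pi> a) borel fst"
   using m unfolding distr_glue_snd(1)[OF \<a> \<k> borel_measurable_fst_borel] distr_glue_snd(1)[OF \<a> \<theta> borel_measurable_fst_borel]
   by (intro glue_kernel_unique[OF finite_measure.axioms(1)[OF fin] \<a>] distr_glue_snd(2)[OF \<a> \<k>] distr_glue_snd(2)[OF \<a> \<theta>]) auto
  then show ?thesis
   using AE_space
  proof eventually_elim
   case (elim a)
   then show ?case
    using product_marginals(1)[OF kernel_fiber(1,2)[OF \<sigma> elim(2)] kernel_fiber(1,2)[OF \<pi> elim(2)]] by simp
  qed
 qed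
 have eq2: "AE a in \<a>. distr (\<k> a) borel snd = \<pi> a"
 proof -
  have m: "distr ?\<rho> borel (\<lambda>p. (fst p, snd (snd p))) = distr ?\<beta> borel (\<lambda>p. (fst p, snd (snd p)))"
  proof (rule marg[OF borel_measurable_snd_borel])
   fix h :: "'a \<times> 'c => real" assume "continuous_on UNIV h" "bounded_borel h"
   then show "A * (\<integral>x. lin x \<partial>?\<rho>) + ((\<integral>p. h (fst p, snd (snd p)) \<partial>?\<rho>) - (\<integral>p. h (fst p, snd (snd p)) \<partial>?\<beta>)) \<le> K"
    using bound[of "\<lambda>_. 0" "\<lambda>_. 0" h] by (simp add: dual_value_def)
  qed
  have "AE a in \<a>. distr (\<k> a) borel snd = distr (\<sigma> a \<Otimes>\<^sub>M \<pi> a) borel snd"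
   using m unfolding distr_glue_snd(1)[OF \<a> \<k> borel_measurable_snd_borel] distr_glue_snd(1)[OF \<a> \<theta> borel_measurable_snd_borel]
   by (intro glue_kernel_unique[OF finite_measure.axioms(1)[OF fin] \<a>] distr_glue_snd(2)[OF \<a> \<k>] distr_glue_snd(2)[OF \<a> \<theta>]) auto
  then show ?thesis
   using AE_space
  proof eventually_elim
   case (elim a)
   then show ?case
    using product_marginals(2)[OF kernel_fiber(1,2)[OF \<sigma> elim(2)] kernel_fiber(1,2)[OF \<pi> elim(2)]] by simp
  qed
 qed
 show "AE a in \<a>. \<k> a \<in> couplings (\<sigma> a) (\<pi> a)"
  using eq1 eq2 AE_space by eventually_elim (auto simp: couplings_def kernel_fiber[OF \<k>])
 assume b: "0 < b"
 let ?K = "(K - A * (\<integral>p. lin p \<partial>glue \<a> \<k>)) / b"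
 have "(\<integral>x. g x \<partial>?\<rho>) - (\<integral>x. exp (g x) - 1 \<partial>?\<beta>) \<le> ?K" if "continuous_on UNIV g" "\<And>x. \<bar>g x\<bar> \<le> C" for g C
 proof -
  have "bounded_borel g" using that by (intro bounded_borelI[of _ C] borel_measurable_continuous_onI) auto
  then show ?thesis
   using bound[of g "\<lambda>_. 0" "\<lambda>_. 0"] that b by (simp add: dual_value_def pos_le_divide_eq mult.commute)
 qed
 then obtain f where "f \<in> borel_measurable borel" "\<And>x. 0 \<le> f x" "?\<rho> = density ?\<beta> (\<lambda>x. ennreal (f x))"
  "(\<integral>\<^sup>+x. ennreal (kl_phi (f x)) \<partial>?\<beta>) \<le> ennreal ?K"
  using dual_bound_imp_density[OF fing sets, of ?K] by blast
 then show "\<exists>f. f \<in> borel_measurable borel \<and> (\<forall>p. 0 \<le> f p) \<and>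
    ?\<rho> = density ?\<beta> (\<lambda>p. ennreal (f p)) \<and>
    (\<integral>\<^sup>+p. ennreal (kl_phi (f p)) \<partial>?\<beta>) \<le> ennreal ?K" by blast
qed

section \<open>Existence of disintegrations\<close>

lemma disintegration_exists_finite:
 fixes \<a> :: "'a::second_countable_topology measure" and M :: "('a \<times> 'b::euclidean_space) measure"
 assumes fin: "finite_measure \<a>" and \<a>: "sets \<a> = sets borel" and M: "sets M = sets borel"
  and marg: "distr M borel fst = \<a>"
 obtains \<k> where "is_disintegration \<a> M \<k>"
proof -
 obtain e :: "'b => real" and d where e: "e \<in> borel \<rightarrow>\<^sub>M borel" and d: "d \<in> borel \<rightarrow>\<^sub>M borel" and de: "\<And>x. d (e x) = x" and e01: "\<And>x. 0 \<le> e x \<and> e x < 1"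
  using borel_encoding_into_real[where 'b='b] by metis
 let ?E = "\<lambda>p :: 'a \<times> 'b. (fst p, e (snd p))" and ?D = "\<lambda>p :: 'a \<times> real. (fst p, d (snd p))"
 have E: "?E \<in> M \<rightarrow>\<^sub>M borel"
  unfolding measurable_cong_sets[OF M refl]
  by (intro borel_measurable_Pair_borel borel_measurable_fst_borel measurable_compose[OF borel_measurable_snd_borel e])
 have D: "?D \<in> borel \<rightarrow>\<^sub>M borel"
  by (intro borel_measurable_Pair_borel borel_measurable_fst_borel measurable_compose[OF borel_measurable_snd_borel d])
 have marg': "distr (distr M borel ?E) borel fst = \<a>"
  by (subst distr_distr[OF borel_measurable_fst_borel E]) (simp add: comp_def marg)
 have "?E -` (UNIV \<times> - {0..<1}) = {}" using e01 by auto
 then have "emeasure (distr M borel ?E) (UNIV \<times> - {0..<1}) = 0"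
  using borel_Times[OF borel_UNIV, of "- {0..<1::real}"] by (subst emeasure_distr[OF E]) auto
 then obtain \<k> where \<k>: "kernel \<a> \<k>" "distr M borel ?E = glue \<a> \<k>"
  by (rule disintegration_exists_real[OF fin \<a> sets_distr marg'])
 have "M = distr (distr M borel ?E) borel ?D"
  by (subst distr_distr[OF D E]) (simp add: comp_def de distr_id2[OF M[symmetric]])
 then have "M = glue \<a> (\<lambda>a. distr (\<k> a) borel d)"
  unfolding \<k>(2) distr_glue_snd(1)[OF \<a> \<k>(1) d] .
 then show thesis using distr_glue_snd(2)[OF \<a> \<k>(1) d] that by (auto simp: is_disintegration_def)
qed

text \<open>A positive integrable weight depending on the first coordinate reduces to a finite measure
 without changing the fibers.\<close>

lemma disintegration_exists:
 fixes \<a> :: "'a::second_countable_topology measure" and M :: "('a \<times> 'b::euclidean_space) measure"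
 assumes sf: "sigma_finite_measure \<a>" and \<a>: "sets \<a> = sets borel" and M: "sets M = sets borel"
  and marg: "distr M borel fst = \<a>"
 shows "is_disintegration \<a> M (disint \<a> M)"
proof -
 interpret \<a>: sigma_finite_measure \<a> by fact
 note [measurable_cong] = M \<a>
 have sp\<a>: "space \<a> = UNIV" and spM: "space M = UNIV" using M \<a> by (auto dest: sets_eq_imp_space_eq)
 obtain h where h[measurable]: "h \<in> borel_measurable \<a>" and h_fin: "integral\<^sup>N \<a> h \<noteq> \<infinity>"
  and h_pos: "\<And>a. 0 < h a \<and> h a < \<infinity>"
  using \<a>.Ex_finite_integrable_function sp\<a> by auto
 have h_b[measurable]: "h \<in> borel_measurable borel" using h by simp
 have fst_m[measurable]: "fst \<in> (borel :: ('a \<times> 'b) measure) \<rightarrow>\<^sub>M borel"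
  by (simp add: borel_prod[symmetric])
 define \<a>' where "\<a>' = density \<a> h"
 define M' where "M' = density M (\<lambda>p. h (fst p))"
 have \<a>': "sets \<a>' = sets borel" by (simp add: \<a>'_def \<a>)
 have m: "distr M' borel fst = \<a>'"
 proof (rule measure_eqI)
  fix B assume "B \<in> sets (distr M' borel fst)"
  then have B[measurable]: "B \<in> sets borel" by simp
  have [measurable]: "(fst -` B :: ('a \<times> 'b) set) \<in> sets borel" using measurable_sets[OF fst_m B] by simp
  have "emeasure (distr M' borel fst) B = (\<integral>\<^sup>+p. h (fst p) * indicator B (fst p) \<partial>M)"
   unfolding M'_def
   by (subst emeasure_distr) (auto simp: emeasure_density spM intro!: nn_integral_cong split: split_indicator)
  also have "\<dots> = (\<integral>\<^sup>+a. h a * indicator B a \<partial>distr M borel fst)"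
   by (subst nn_integral_distr) auto
  finally show "emeasure (distr M' borel fst) B = emeasure \<a>' B"
   unfolding marg \<a>'_def by (simp add: emeasure_density \<a>)
 qed (simp add: \<a>')
 have "finite_measure \<a>'"
  by (rule finite_measureI) (use h_fin in \<open>simp add: \<a>'_def emeasure_density sp\<a>\<close>)
 then obtain \<k> where "is_disintegration \<a>' M' \<k>"
  by (rule disintegration_exists_finite[OF _ \<a>' _ m]) (simp add: M'_def M)
 then have \<k>': "kernel \<a>' \<k>" "M' = glue \<a>' \<k>"
  unfolding is_disintegration_def by blast+
 then have \<k>: "kernel \<a> \<k>"
  by (simp add: \<a>'_def)
 have inv: "h a * (1 / h a) = 1" for a
  using h_pos[of a] by (auto simp: ennreal_times_divide intro!: ennreal_divide_self)
 have "M = glue \<a> \<k>"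
 proof (rule measure_eqI)
  fix A assume "A \<in> sets M"
  then have A[measurable]: "A \<in> sets borel" by (simp add: M)
  have "emeasure M A = (\<integral>\<^sup>+p. h (fst p) * (1 / h (fst p) * indicator A p) \<partial>M)"
   unfolding mult.assoc[symmetric] inv by simp
  also have "\<dots> = (\<integral>\<^sup>+p. 1 / h (fst p) * indicator A p \<partial>M')"
   unfolding M'_def by (subst nn_integral_density) auto
  also have "\<dots> = (\<integral>\<^sup>+a. \<integral>\<^sup>+b. 1 / h a * indicator A (a, b) \<partial>\<k> a \<partial>\<a>')"
   unfolding \<k>'(2) by (subst nn_integral_glue[OF \<a>' \<k>'(1)]) auto
  also have "\<dots> = (\<integral>\<^sup>+a. 1 / h a * emeasure (\<k> a) (Pair a -` A) \<partial>\<a>')"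
  proof (rule nn_integral_cong)
   fix a assume "a \<in> space \<a>'"
   note fib = kernel_fiber[OF \<k>'(1) this]
   note fib(2)[measurable_cong]
   have [measurable]: "Pair a -` A \<in> sets borel" using measurable_sets[OF measurable_Pair_borel A, of a] by simp
   have "(\<integral>\<^sup>+b. 1 / h a * indicator A (a, b) \<partial>\<k> a) = (\<integral>\<^sup>+b. 1 / h a * indicator (Pair a -` A) b \<partial>\<k> a)"
    by (intro nn_integral_cong) (auto split: split_indicator)
   also have "\<dots> = 1 / h a * emeasure (\<k> a) (Pair a -` A)"
    by (subst nn_integral_cmult_indicator) (auto simp: fib)
   finally show "(\<integral>\<^sup>+b. 1 / h a * indicator A (a, b) \<partial>\<k> a) = 1 / h a * emeasure (\<k> a) (Pair a -` A)" .
  qed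
  also have "\<dots> = (\<integral>\<^sup>+a. h a * (1 / h a * emeasure (\<k> a) (Pair a -` A)) \<partial>\<a>)"
  proof -
   have A': "A \<in> sets (borel \<Otimes>\<^sub>M borel)" unfolding borel_prod by (rule A)
   have sig: "Sigma (space \<a>) (\<lambda>a. Pair a -` A) = A" by (auto simp: sp\<a>)
   have [measurable]: "(\<lambda>a. emeasure (\<k> a) (Pair a -` A)) \<in> borel_measurable \<a>"
    by (rule emeasure_measurable_subprob_algebra2[OF _ measurable_prob_algebraD[OF \<k>]])
      (simp add: sig sets_pair_measure_cong[OF \<a> refl] A')
   show ?thesis unfolding \<a>'_def by (subst nn_integral_density) auto
  qed
  also have "\<dots> = emeasure (glue \<a> \<k>) A"
   unfolding mult.assoc[symmetric] inv by (simp add: emeasure_glue[OF \<a> \<k> A])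
  finally show "emeasure M A = emeasure (glue \<a> \<k>) A" .
 qed (simp add: \<a> M)
 with \<k> have "is_disintegration \<a> M \<k>" by (simp add: is_disintegration_def)
 then show ?thesis unfolding disint_def by (rule someI[of "is_disintegration \<a> M"])
qed

lemma disint_AE_eq:
 fixes \<a> :: "'a::second_countable_topology measure" and \<k> :: "'a => 'b::second_countable_topology measure"
 assumes sf: "sigma_finite_measure \<a>" and \<a>: "sets \<a> = sets borel"
  and \<k>: "is_disintegration \<a> M \<k>"
 shows "AE a in \<a>. disint \<a> M a = \<k> a"
proof -
 have "is_disintegration \<a> M (disint \<a> M)" unfolding disint_def using \<k> by (rule someI[of "is_disintegration \<a> M"])
 with \<k> show ?thesis
  unfolding is_disintegration_def by (intro glue_kernel_unique[OF sf \<a>]) auto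
qed

section \<open>Adjusting finite couplings\<close>

text \<open>A factor \<open>\<theta> \<le> 1\<close> with \<open>\<theta> * s i \<le> s\' i\<close> for all
 \<open>i\<close>. The product is used instead of the minimum because it is plainly measurable and continuous
 in \<open>s\'\<close>.\<close>

definition overlap :: "'i set => ('i => real) => ('i => real) => real" where
 "overlap I s s' = (\<Prod>i\<in>I. if s i = 0 then 1 else min 1 (s' i / s i))"

text \<open>Keep the fraction \<open>\<theta>\<close> of the coupling \<open>w\<close> and couple the
 remaining marginal mass independently. If \<open>\<theta> = 1\<close>, nothing remains and the quotient is
 \<open>0\<close>.\<close>

definition adjust ::
 "'i set => 'j set => ('i => real) => ('j => real) => ('i => real) => ('j => real) => ('i => 'j => real) => 'i => 'j => real" where
 "adjust I J s q s' q' w i j =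
   (let \<theta> = overlap I s s' * overlap J q q'
   in \<theta> * w i j + (s' i - \<theta> * s i) * (q' j - \<theta> * q j) / (1 - \<theta>))"

lemma prod_le_factor:
 fixes f :: "'i => real"
 assumes "finite I" "i \<in> I" "\<And>i. i \<in> I ==> 0 \<le> f i \<and> f i \<le> 1"
 shows "prod f I \<le> f i"
proof -
 have "prod f I = f i * prod f (I - {i})" using assms by (simp add: prod.remove)
 also have "\<dots> \<le> f i * 1" using assms by (intro mult_left_mono prod_le_1) auto
 finally show ?thesis by simp
qed

lemma overlap_bounds:
 assumes "finite I" "\<And>i. i \<in> I ==> 0 \<le> s i" "\<And>i. i \<in> I ==> 0 \<le> s' i"
 shows "0 \<le> overlap I s s'" "overlap I s s' \<le> 1" "i \<in> I ==> overlap I s s' * s i \<le> s' i"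
proof -
 have f: "0 \<le> (if s i = 0 then 1 else min 1 (s' i / s i)) \<and> (if s i = 0 then 1 else min 1 (s' i / s i)) \<le> 1" if "i \<in> I" for i
  using assms that by auto
 show "0 \<le> overlap I s s'" unfolding overlap_def by (rule prod_nonneg) (use f in auto)
 show "overlap I s s' \<le> 1" unfolding overlap_def by (rule prod_le_1) (use f in auto)
 assume i: "i \<in> I"
 show "overlap I s s' * s i \<le> s' i"
 proof (cases "s i = 0")
  case False
  then have "0 < s i" using assms(2)[OF i] by simp
  have "overlap I s s' \<le> (if s i = 0 then 1 else min 1 (s' i / s i))"
   unfolding overlap_def by (rule prod_le_factor[OF assms(1) i]) (use f in auto)
  also have "\<dots> \<le> s' i / s i" using False by simp
  finally show ?thesis using \<open>0 < s i\<close> by (simp add: pos_le_divide_eq)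
 qed (use assms(3)[OF i] in simp)
qed

locale finite_coupling =
 fixes I :: "'i set" and J :: "'j set" and s :: "'i => real" and q :: "'j => real" and w :: "'i => 'j => real"
 assumes finI: "finite I" and finJ: "finite J"
  and w0: "\<And>i j. i \<in> I ==> j \<in> J ==> 0 \<le> w i j"
  and ws: "\<And>i. i \<in> I ==> (\<Sum>j\<in>J. w i j) = s i" and wq: "\<And>j. j \<in> J ==> (\<Sum>i\<in>I. w i j) = q j"
  and s1: "(\<Sum>i\<in>I. s i) = 1"
begin

lemma q1: "(\<Sum>j\<in>J. q j) = 1"
proof -
 have "(\<Sum>j\<in>J. q j) = (\<Sum>i\<in>I. \<Sum>j\<in>J. w i j)" by (subst sum.swap) (simp add: wq)
 then show ?thesis by (simp add: ws s1)
qed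

lemma s0: "i \<in> I ==> 0 \<le> s i" and q0: "j \<in> J ==> 0 \<le> q j"
 using w0 by (auto simp flip: ws wq intro: sum_nonneg)

lemma w_le_s: "i \<in> I ==> j \<in> J ==> w i j \<le> s i"
 unfolding ws[symmetric] using w0 finJ by (intro member_le_sum) auto

lemma w_le_q: "i \<in> I ==> j \<in> J ==> w i j \<le> q j"
 unfolding wq[symmetric] using w0 finI by (intro member_le_sum[of i I "\<lambda>i. w i j"]) auto

lemma s_le_1: "i \<in> I ==> s i \<le> 1"
 unfolding s1[symmetric] using s0 finI by (intro member_le_sum) auto

lemma q_le_1: "j \<in> J ==> q j \<le> 1"
 unfolding q1[symmetric] using q0 finJ by (intro member_le_sum) auto

end

locale finite_coupling_adjust = finite_coupling +
 fixes s' :: "'a => real" and q' :: "'b => real"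
 assumes s'0: "\<And>i. i \<in> I ==> 0 \<le> s' i" and q'0: "\<And>j. j \<in> J ==> 0 \<le> q' j"
  and s'1: "(\<Sum>i\<in>I. s' i) = 1" and q'1: "(\<Sum>j\<in>J. q' j) = 1"
begin

definition theta where "theta = overlap I s s' * overlap J q q'"

lemma theta_bounds: "0 \<le> theta" "theta \<le> 1" "i \<in> I ==> theta * s i \<le> s' i" "j \<in> J ==> theta * q j \<le> q' j"
proof -
 have a: "0 \<le> overlap I s s'" "overlap I s s' \<le> 1" "\<And>i. i \<in> I ==> overlap I s s' * s i \<le> s' i"
  by (rule overlap_bounds; use finI s0 s'0 in blast)+
 have b: "0 \<le> overlap J q q'" "overlap J q q' \<le> 1" "\<And>j. j \<in> J ==> overlap J q q' * q j \<le> q' j"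
  by (rule overlap_bounds; use finJ q0 q'0 in blast)+
 show "0 \<le> theta" unfolding theta_def using a(1) b(1) by simp
 show "theta \<le> 1" unfolding theta_def using a(1,2) b(1,2) by (simp add: mult_le_one)
 have "theta \<le> overlap I s s'" unfolding theta_def using a(1) b(1,2) by (simp add: mult_left_le)
 then show "theta * s i \<le> s' i" if "i \<in> I"
  using order_trans[OF mult_right_mono[OF _ s0[OF that]] a(3)[OF that]] by blast
 have "theta \<le> overlap J q q'" unfolding theta_def using b(1) a(1,2) by (simp add: mult_left_le_one_le)
 then show "theta * q j \<le> q' j" if "j \<in> J"
  using order_trans[OF mult_right_mono[OF _ q0[OF that]] b(3)[OF that]] by blast
qed

lemma residual_sums: "(\<Sum>i\<in>I. s' i - theta * s i) = 1 - theta" "(\<Sum>j\<in>J. q' j - theta * q j) = 1 - theta"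
 by (simp_all add: sum_subtractf s'1 q'1 s1 q1 flip: sum_distrib_left)

lemma residual_le: "i \<in> I ==> s' i - theta * s i \<le> 1 - theta" "j \<in> J ==> q' j - theta * q j \<le> 1 - theta"
proof -
 show "s' i - theta * s i \<le> 1 - theta" if "i \<in> I"
  unfolding residual_sums(1)[symmetric] using theta_bounds(3) finI that
  by (intro member_le_sum[of i I "\<lambda>i. s' i - theta * s i"]) auto
 show "q' j - theta * q j \<le> 1 - theta" if "j \<in> J"
  unfolding residual_sums(2)[symmetric] using theta_bounds(4) finJ that
  by (intro member_le_sum[of j J "\<lambda>j. q' j - theta * q j"]) auto
qed

lemma adjust_eq: "adjust I J s q s' q' w i j = theta * w i j + (s' i - theta * s i) * (q' j - theta * q j) / (1 - theta)"
 by (simp add: adjust_def theta_def Let_def)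

lemma adjust_coupling: "finite_coupling I J s' q' (adjust I J s q s' q' w)"
proof
 show "0 \<le> adjust I J s q s' q' w i j" if "i \<in> I" "j \<in> J" for i j
  unfolding adjust_eq using theta_bounds(1,2) theta_bounds(3)[OF that(1)] theta_bounds(4)[OF that(2)] w0[OF that] by simp
 show "(\<Sum>j\<in>J. adjust I J s q s' q' w i j) = s' i" if i: "i \<in> I" for i
 proof -
  have "(\<Sum>j\<in>J. adjust I J s q s' q' w i j) = theta * s i + (s' i - theta * s i) * ((1 - theta) / (1 - theta))"
   unfolding adjust_eq sum.distrib residual_sums(2)[symmetric]
   by (simp add: ws[OF i] residual_sums(2) flip: sum_distrib_left sum_divide_distrib)
  also have "\<dots> = s' i"
  proof (cases "theta = 1")
   case True
   then show ?thesis using residual_le(1)[OF i] theta_bounds(3)[OF i] by simp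
  qed simp
  finally show ?thesis .
 qed
 show "(\<Sum>i\<in>I. adjust I J s q s' q' w i j) = q' j" if j: "j \<in> J" for j
 proof -
  have "(\<Sum>i\<in>I. adjust I J s q s' q' w i j) = theta * q j + ((1 - theta) / (1 - theta)) * (q' j - theta * q j)"
   unfolding adjust_eq sum.distrib residual_sums(1)[symmetric]
   by (simp add: wq[OF j] residual_sums(1) flip: sum_distrib_left sum_distrib_right sum_divide_distrib)
  also have "\<dots> = q' j"
  proof (cases "theta = 1")
   case True
   then show ?thesis using residual_le(2)[OF j] theta_bounds(4)[OF j] by simp
  qed simp
  finally show ?thesis .
 qed
qed (fact finI finJ s'1)+

lemma adjust_diff: "i \<in> I ==> j \<in> J ==> \<bar>adjust I J s q s' q' w i j - w i j\<bar> \<le> 2 * (1 - theta)"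
proof -
 assume i: "i \<in> I" and j: "j \<in> J"
 define t where "t = (s' i - theta * s i) * (q' j - theta * q j) / (1 - theta)"
 have t1: "t \<le> 1 - theta"
 proof (cases "theta = 1")
  case False
  then have "0 < 1 - theta" using theta_bounds(2) by simp
  have "(s' i - theta * s i) * (q' j - theta * q j) \<le> (1 - theta) * (1 - theta)"
   using residual_le(1)[OF i] residual_le(2)[OF j] theta_bounds(3)[OF i] theta_bounds(4)[OF j] by (intro mult_mono) auto
  then show ?thesis using \<open>0 < 1 - theta\<close> by (simp add: t_def pos_divide_le_eq)
 qed (simp add: t_def)
 have t0: "0 \<le> t"
  unfolding t_def using theta_bounds(2) theta_bounds(3)[OF i] theta_bounds(4)[OF j] by simp
 define d where "d = (1 - theta) * w i j"
 have "0 \<le> d" "d \<le> 1 - theta"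
  unfolding d_def using w0[OF i j] w_le_s[OF i j] s_le_1[OF i] theta_bounds(2) by (auto intro!: mult_left_le)
 moreover have "adjust I J s q s' q' w i j - w i j = t - d"
  by (simp add: adjust_eq t_def d_def left_diff_distrib)
 ultimately show ?thesis using t0 t1 unfolding abs_le_iff by auto
qed

end

lemma overlap_tendsto_1:
 assumes "\<And>i. i \<in> I ==> ((\<lambda>n. s' n i) \<longlongrightarrow> s i) F"
 shows "((\<lambda>n. overlap I s (s' n)) \<longlongrightarrow> 1) F"
proof -
 have "((\<lambda>n. \<Prod>i\<in>I. if s i = 0 then 1 else min 1 (s' n i / s i)) \<longlongrightarrow> (\<Prod>i\<in>I. 1)) F"
 proof (rule tendsto_prod)
  fix i assume i: "i \<in> I"
  show "((\<lambda>n. if s i = 0 then 1 else min 1 (s' n i / s i)) \<longlongrightarrow> 1) F"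
  proof (cases "s i = 0")
   case False
   then have "((\<lambda>n. min 1 (s' n i / s i)) \<longlongrightarrow> min 1 (s i / s i)) F"
    by (intro tendsto_intros assms i)
   then show ?thesis using False by simp
  qed simp
 qed
 then show ?thesis by (simp add: overlap_def)
qed

text \<open>The correction is at most \<open>2 (1 - \<theta>)\<close>, and \<open>\<theta> \<rightarrow>
 1\<close> as the marginals converge.\<close>

lemma adjust_tendsto:
 assumes w: "finite_coupling I J s q w"
  and ad: "\<And>n. finite_coupling_adjust I J s q w (s' n) (q' n)"
  and s': "\<And>i. i \<in> I ==> ((\<lambda>n. s' n i) \<longlongrightarrow> s i) F" and q': "\<And>j. j \<in> J ==> ((\<lambda>n. q' n j) \<longlongrightarrow> q j) F"
  and i: "i \<in> I" and j: "j \<in> J"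
 shows "((\<lambda>n. adjust I J s q (s' n) (q' n) w i j) \<longlongrightarrow> w i j) F"
proof -
 have "((\<lambda>n. 2 * (1 - overlap I s (s' n) * overlap J q (q' n))) \<longlongrightarrow> 2 * (1 - 1 * 1)) F"
  by (intro tendsto_intros overlap_tendsto_1 s' q')
 then have t: "((\<lambda>n. 2 * (1 - overlap I s (s' n) * overlap J q (q' n))) \<longlongrightarrow> 0) F" by simp
 have "\<bar>adjust I J s q (s' n) (q' n) w i j - w i j\<bar> \<le> 2 * (1 - overlap I s (s' n) * overlap J q (q' n))" for n
  using finite_coupling_adjust.adjust_diff[OF ad i j] by (simp add: finite_coupling_adjust.theta_def[OF ad])
 then have "((\<lambda>n. adjust I J s q (s' n) (q' n) w i j - w i j) \<longlongrightarrow> 0) F"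
  by (intro Lim_null_comparison[OF _ t] always_eventually) simp
 then show ?thesis by (simp add: Lim_null[symmetric])
qed

text \<open>Contribution of one block of mass \<open>W\<close> to the entropy relative to a product block of
 mass \<open>S * Q\<close>.\<close>

definition kl_term :: "real => real => real => real" where
 "kl_term W S Q = S * Q * kl_phi (W / (S * Q))"

lemma kl_term_bounds:
 assumes W: "0 \<le> W" "W \<le> S" "W \<le> Q" and S: "S \<le> 1" and Q: "Q \<le> 1"
 shows "0 \<le> kl_term W S Q" "kl_term W S Q \<le> 2 * sqrt (sqrt (S * Q)) + S * Q" "kl_term W S Q \<le> 3"
proof -
 have S0: "0 \<le> S" and Q0: "0 \<le> Q" using W by auto
 show "0 \<le> kl_term W S Q" unfolding kl_term_def using S0 Q0 W kl_phi_nonneg by simp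
 show *: "kl_term W S Q \<le> 2 * sqrt (sqrt (S * Q)) + S * Q"
 proof (cases "W = 0 \<or> S * Q = 0")
  case True
  then show ?thesis using S0 Q0 by (auto simp: kl_term_def kl_phi_def)
 next
  case False
  define r where "r = sqrt (S * Q)"
  have pos: "0 < W" "0 < S * Q" using False W S0 Q0 by (auto simp: less_le)
  then have r: "0 < r" "r * r = S * Q" by (auto simp: r_def)
  have "S * Q \<le> 1 * 1" using S Q S0 Q0 by (intro mult_mono) auto
  then have r1: "r \<le> 1" by (simp add: r_def)
  have "W * W \<le> S * Q" using W by (intro mult_mono) auto
  then have Wr: "W \<le> r" unfolding r_def by (simp add: real_le_rsqrt power2_eq_square)
  have "ln (W / (r * r)) \<le> ln (r / (r * r))" using pos r Wr by (subst ln_le_cancel_iff) (auto intro!: divide_right_mono)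
  also have "\<dots> = 2 * ln (1 / sqrt r)" using r(1) by (simp add: ln_div ln_sqrt ln_mult)
  finally have l: "ln (W / (r * r)) \<le> 2 * ln (1 / sqrt r)" .
  have l0: "0 \<le> ln (1 / sqrt r)" using r r1 by simp
  have "ln (1 / sqrt r) \<le> 1 / sqrt r - 1" using r by (intro ln_le_minus_one) auto
  then have l1: "ln (1 / sqrt r) \<le> 1 / sqrt r" by simp
  have "W * ln (W / (r * r)) \<le> W * (2 * ln (1 / sqrt r))" using l pos by (intro mult_left_mono) auto
  also have "\<dots> \<le> r * (2 * (1 / sqrt r))" using l0 l1 Wr r by (intro mult_mono) auto
  also have "\<dots> = 2 * (r / sqrt r)" by simp
  also have "r / sqrt r = sqrt r" using r(1) by (simp add: real_div_sqrt)
  finally have "W * ln (W / (r * r)) \<le> 2 * sqrt r" .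
  moreover have "kl_term W S Q = W * ln (W / (r * r)) - W + r * r"
   unfolding kl_term_def r(2)[symmetric] using pos(1) r(1) by (simp add: kl_phi_def field_simps)
  ultimately show ?thesis using pos r by (simp add: r_def)
 qed
 have SQ: "S * Q \<le> 1 * 1" using S Q S0 Q0 by (intro mult_mono) auto
 then have "sqrt (sqrt (S * Q)) \<le> sqrt (sqrt 1)" by (intro real_sqrt_le_mono) simp
 with SQ * show "kl_term W S Q \<le> 3" by (simp only: real_sqrt_one mult_1)
qed

text \<open>At a degenerate block with \<open>S * Q = 0\<close> continuity rests on \<open>W \<le> S\<close>
 and \<open>W \<le> Q\<close>, which holds for couplings and makes the logarithm harmless.\<close>

lemma kl_term_tendsto:
 assumes bounds: "\<And>n. 0 \<le> W n" "\<And>n. W n \<le> S n" "\<And>n. W n \<le> Q n" "\<And>n. S n \<le> 1" "\<And>n. Q n \<le> 1"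
  and W: "(W \<longlongrightarrow> w) F" and S: "(S \<longlongrightarrow> s) F" and Q: "(Q \<longlongrightarrow> q) F"
  and nn: "0 \<le> s" "0 \<le> q" "0 \<le> w"
 shows "((\<lambda>n. kl_term (W n) (S n) (Q n)) \<longlongrightarrow> kl_term w s q) F"
proof (cases "s * q = 0")
 case True
 have "((\<lambda>n. 2 * sqrt (sqrt (S n * Q n)) + S n * Q n) \<longlongrightarrow> 2 * sqrt (sqrt (s * q)) + s * q) F"
  by (intro tendsto_intros W S Q)
 then have t: "((\<lambda>n. 2 * sqrt (sqrt (S n * Q n)) + S n * Q n) \<longlongrightarrow> 0) F" using True by simp
 have "((\<lambda>n. kl_term (W n) (S n) (Q n)) \<longlongrightarrow> 0) F"
  using kl_term_bounds(1,2)[OF bounds] by (intro Lim_null_comparison[OF _ t] always_eventually) simp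
 then show ?thesis using True by (auto simp: kl_term_def)
next
 case False
 then have pos: "0 < s * q" using nn by (auto simp: less_le)
 have "((\<lambda>n. kl_phi (W n / (S n * Q n))) \<longlongrightarrow> kl_phi (w / (s * q))) F"
 proof (rule continuous_on_tendsto_compose[OF kl_phi_continuous])
  show "((\<lambda>n. W n / (S n * Q n)) \<longlongrightarrow> w / (s * q)) F"
   using False by (intro tendsto_intros W S Q)
  show n: "\<forall>\<^sub>F n in F. W n / (S n * Q n) \<in> {0..}"
  proof (rule always_eventually, rule allI)
   fix n
   have "0 \<le> S n" "0 \<le> Q n" using bounds(1-3)[of n] by linarith+
   then show "W n / (S n * Q n) \<in> {0..}" using bounds(1)[of n] by simp
  qed
  show "w / (s * q) \<in> {0..}" using nn pos by simp
 qed
 then show ?thesis unfolding kl_term_def by (intro tendsto_intros S Q)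
qed

section \<open>Partitions of unity\<close>

lemma partition_of_unity:
 fixes K :: "'b::euclidean_space set"
 assumes K: "compact K" "K \<noteq> {}" and d: "0 < d"
 obtains P :: "'b set" and \<zeta> :: "'b => 'b => real" where "finite P" "P \<subseteq> K"
  "\<And>p. bounded_borel (\<zeta> p)" "\<And>p. continuous_on K (\<zeta> p)" "\<And>p z. 0 \<le> \<zeta> p z"
  "\<And>z. (\<Sum>p\<in>P. \<zeta> p z) = 1" "\<And>p z. z \<in> K ==> \<zeta> p z \<noteq> 0 ==> dist z p < d"
proof -
 obtain P where P: "P \<subseteq> K" "finite P" "K \<subseteq> (\<Union>p\<in>P. ball p d)"
 proof (rule compactE_image[OF K(1), of K "\<lambda>x. ball x d"])
  show "K \<subseteq> (\<Union>c\<in>K. ball c d)" using d by auto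
 qed auto
 obtain p0 where p0: "p0 \<in> P" using P(3) K(2) by auto
 define \<psi> where "\<psi> p z = max 0 (d - dist z p)" for p z :: 'b
 define \<Psi> where "\<Psi> z = (\<Sum>p\<in>P. \<psi> p z)" for z
 define \<zeta> where "\<zeta> p z = (if p \<in> P then if \<Psi> z = 0 then if p = p0 then 1 else 0 else \<psi> p z / \<Psi> z else 0)" for p z
 have \<psi>0: "0 \<le> \<psi> p z" for p z by (simp add: \<psi>_def)
 then have \<Psi>0: "0 \<le> \<Psi> z" for z unfolding \<Psi>_def by (intro sum_nonneg)
 have pos: "0 < \<Psi> z" if z: "z \<in> K" for z
 proof -
  obtain p where p: "p \<in> P" "dist z p < d" using P(3) z by (auto simp: dist_commute)
  then have "0 < \<psi> p z" by (simp add: \<psi>_def)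
  also have "\<psi> p z \<le> \<Psi> z" unfolding \<Psi>_def using P(2) p(1) \<psi>0 by (intro member_le_sum) auto
  finally show ?thesis .
 qed
 have nn: "0 \<le> \<zeta> p z" for p z unfolding \<zeta>_def using \<psi>0 \<Psi>0 by simp
 have sum1: "(\<Sum>p\<in>P. \<zeta> p z) = 1" for z
 proof (cases "\<Psi> z = 0")
  case True
  then have "(\<Sum>p\<in>P. \<zeta> p z) = (\<Sum>p\<in>P. if p = p0 then 1 else 0)" by (intro sum.cong) (auto simp: \<zeta>_def)
  then show ?thesis using P(2) p0 by simp
 next
  case False
  then have "(\<Sum>p\<in>P. \<zeta> p z) = (\<Sum>p\<in>P. \<psi> p z / \<Psi> z)" by (intro sum.cong) (auto simp: \<zeta>_def)
  then show ?thesis using False by (simp add: \<Psi>_def flip: sum_divide_distrib)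
 qed
 have \<psi>c: "continuous_on UNIV (\<psi> p)" for p unfolding \<psi>_def by (intro continuous_intros)
 have \<Psi>c: "continuous_on UNIV \<Psi>" unfolding \<Psi>_def by (intro continuous_intros \<psi>c)
 note [measurable] = borel_measurable_continuous_onI[OF \<psi>c] borel_measurable_continuous_onI[OF \<Psi>c]
 show thesis
 proof (rule that[of P \<zeta>])
  show "bounded_borel (\<zeta> p)" for p
  proof (rule bounded_borelI[of _ 1])
   show "\<zeta> p \<in> borel_measurable borel" unfolding \<zeta>_def by measurable
   fix z
   show "\<bar>\<zeta> p z\<bar> \<le> 1"
   proof (cases "p \<in> P")
    case True
    then have "\<zeta> p z \<le> (\<Sum>p\<in>P. \<zeta> p z)" using P(2) nn by (intro member_le_sum) auto
    then show ?thesis using nn[of p z] by (simp add: sum1)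
   qed (simp add: \<zeta>_def)
  qed
  show "continuous_on K (\<zeta> p)" for p
  proof (cases "p \<in> P")
   case True
   have "continuous_on K (\<lambda>z. \<psi> p z / \<Psi> z)"
    using pos by (intro continuous_on_divide continuous_on_subset[OF \<psi>c] continuous_on_subset[OF \<Psi>c]) (auto simp: less_le)
   then show ?thesis
    using pos True by (elim continuous_on_eq) (auto simp: \<zeta>_def less_le)
  qed (simp add: \<zeta>_def)
  show "dist z p < d" if "z \<in> K" "\<zeta> p z \<noteq> 0" for p z
   using that pos[of z] by (auto simp: \<zeta>_def \<psi>_def max_def split: if_splits)
 qed (fact P nn sum1)+
qed

section \<open>Convergence along a set of indices\<close>

lemma eventually_along: "eventually P (along N) \<longleftrightarrow> (\<exists>m. \<forall>n\<ge>m. n \<in> N \<longrightarrow> P n)"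
 unfolding along_def eventually_inf_principal eventually_sequentially ..

lemma filterlim_along_subseq:
 assumes "strict_mono r" "\<And>k. r k \<in> N"
 shows "filterlim r (along N) sequentially"
 unfolding filterlim_iff eventually_along
proof safe
 fix P m assume P: "\<forall>n\<ge>m. n \<in> N \<longrightarrow> P n"
 have "P (r k)" if "m \<le> k" for k
  using P assms(2) seq_suble[OF assms(1), of k] that by (meson order_trans)
 then show "\<forall>\<^sub>F k in sequentially. P (r k)" by (auto simp: eventually_sequentially)
qed

lemma tendsto_along_subseqI:
 fixes v :: "nat => 'e::topological_space"
 assumes sub: "\<And>r. strict_mono r ==> (\<And>k. r k \<in> N) ==> \<exists>r'. strict_mono (r'::nat => nat) \<and> (\<lambda>k. v (r (r' k))) \<longlonglongrightarrow> l"
 shows "(v \<longlongrightarrow> l) (along N)"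
proof (rule ccontr)
 assume "\<not> ?thesis"
 then obtain S where S: "open S" "l \<in> S" "\<not> eventually (\<lambda>n. v n \<in> S) (along N)"
  unfolding tendsto_def by auto
 then have "\<forall>m. \<exists>n\<ge>m. n \<in> N \<and> v n \<notin> S" unfolding eventually_along by auto
 then have inf: "infinite {n \<in> N. v n \<notin> S}"
  unfolding infinite_nat_iff_unbounded_le by auto
 define r where "r = enumerate {n \<in> N. v n \<notin> S}"
 have r: "strict_mono r" unfolding r_def by (rule strict_mono_enumerate[OF inf])
 have rin: "r k \<in> N \<and> v (r k) \<notin> S" for k
  using enumerate_in_set[OF inf, of k] by (simp add: r_def)
 obtain r' where "(\<lambda>k. v (r (r' k))) \<longlonglongrightarrow> l" using sub[OF r] rin by blast
 then have "\<forall>\<^sub>F k in sequentially. v (r (r' k)) \<in> S" using S by (intro topological_tendstoD)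
 then show False using rin by (auto simp: eventually_sequentially)
qed

text \<open>Along a subsequence the data converge almost everywhere, and dominated convergence applies;
 subsequences of subsequences give the full limit.\<close>

lemma L1_convergence_transfer:
 fixes X :: "'i => nat => 'a => real" and V :: "nat => 'a => real"
 assumes fin: "finite_measure \<a>" and I: "finite I"
  and X: "\<And>i n. i \<in> I ==> integrable \<a> (X i n)" and X0: "\<And>i. i \<in> I ==> integrable \<a> (X0 i)"
  and lim: "\<And>i. i \<in> I ==> ((\<lambda>n. \<integral>a. \<bar>X i n a - X0 i a\<bar> \<partial>\<a>) \<longlongrightarrow> 0) (along N)"
  and V[measurable]: "\<And>n. V n \<in> borel_measurable \<a>" and bd: "\<And>n a. \<bar>V n a\<bar> \<le> C"
  and pt: "\<And>a (r :: nat => nat). (\<And>i. i \<in> I ==> (\<lambda>k. X i (r k) a) \<longlonglongrightarrow> X0 i a) ==> (\<lambda>k. V (r k) a) \<longlonglongrightarrow> 0"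
 shows "((\<lambda>n. \<integral>a. V n a \<partial>\<a>) \<longlongrightarrow> 0) (along N)"
proof (rule tendsto_along_subseqI)
 interpret finite_measure \<a> by fact
 fix r :: "nat => nat" assume r: "strict_mono r" "\<And>k. r k \<in> N"
 define Y where "Y n a = (\<Sum>i\<in>I. \<bar>X i n a - X0 i a\<bar>)" for n a
 have iY: "integrable \<a> (Y n)" for n
  unfolding Y_def using X X0 by (intro Bochner_Integration.integrable_sum integrable_abs Bochner_Integration.integrable_diff)
 have Y0: "0 \<le> Y n a" for n a unfolding Y_def by (intro sum_nonneg) auto
 have "((\<lambda>n. \<Sum>i\<in>I. \<integral>a. \<bar>X i n a - X0 i a\<bar> \<partial>\<a>) \<longlongrightarrow> (\<Sum>i\<in>I. 0)) (along N)"
  by (intro tendsto_sum lim)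
 also have "(\<lambda>n. \<Sum>i\<in>I. \<integral>a. \<bar>X i n a - X0 i a\<bar> \<partial>\<a>) = (\<lambda>n. \<integral>a. Y n a \<partial>\<a>)"
  unfolding Y_def using X X0
  by (intro ext Bochner_Integration.integral_sum[symmetric] integrable_abs Bochner_Integration.integrable_diff)
 finally have "((\<lambda>n. \<integral>a. Y n a \<partial>\<a>) \<longlongrightarrow> 0) (along N)" by simp
 then have "(\<lambda>k. \<integral>a. Y (r k) a \<partial>\<a>) \<longlonglongrightarrow> 0"
  by (rule filterlim_compose[OF _ filterlim_along_subseq[OF r]])
 then have "(\<lambda>k. \<integral>a. norm (Y (r k) a) \<partial>\<a>) \<longlonglongrightarrow> 0" using Y0 by simp
 from tendsto_L1_AE_subseq[OF iY this] obtain r' :: "nat => nat"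
  where r': "strict_mono r'" "AE a in \<a>. (\<lambda>k. Y (r (r' k)) a) \<longlonglongrightarrow> 0" by blast
 have "AE a in \<a>. (\<lambda>k. V (r (r' k)) a) \<longlonglongrightarrow> 0"
  using r'(2)
 proof eventually_elim
  case (elim a)
  show ?case
  proof (rule pt)
   fix i assume i: "i \<in> I"
   have "\<bar>X i n a - X0 i a\<bar> \<le> Y n a" for n
    unfolding Y_def using I i by (intro member_le_sum[of i I "\<lambda>i. \<bar>X i n a - X0 i a\<bar>"]) auto
   then have "(\<lambda>k. X i (r (r' k)) a - X0 i a) \<longlonglongrightarrow> 0"
    by (intro Lim_null_comparison[OF _ elim] always_eventually) simp
   then show "(\<lambda>k. X i (r (r' k)) a) \<longlonglongrightarrow> X0 i a" by (simp add: Lim_null[symmetric])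
  qed
 qed
 then have "(\<lambda>k. \<integral>a. V (r (r' k)) a \<partial>\<a>) \<longlonglongrightarrow> (\<integral>a. 0 \<partial>\<a>)"
  using bd by (intro integral_dominated_convergence[where w="\<lambda>_. C"]) auto
 with r'(1) show "\<exists>r'. strict_mono (r'::nat => nat) \<and> (\<lambda>k. \<integral>a. V (r (r' k)) a \<partial>\<a>) \<longlonglongrightarrow> 0" by auto
qed

text \<open>For each \<open>n\<close> the largest \<open>m \<le> n\<close> is chosen such that \<open>P
 m\<close> holds from \<open>n\<close> on.\<close>

lemma diagonal_along:
 fixes P :: "nat => nat => bool"
 assumes ev: "\<And>m. eventually (P m) (along N)"
 obtains m :: "nat => nat" where "filterlim m at_top (along N)" "eventually (\<lambda>n. P (m n) n) (along N)"
proof -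
 have "\<exists>k. \<forall>n\<ge>k. n \<in> N \<longrightarrow> P m n" for m using ev[of m] by (simp add: eventually_along)
 then obtain K where K: "\<And>m n. K m \<le> n ==> n \<in> N ==> P m n" by metis
 define S where "S n = {m. m \<le> n \<and> K m \<le> n}" for n
 define m where "m n = Max (insert 0 (S n))" for n
 have fin: "finite (S n)" for n unfolding S_def by simp
 show thesis
 proof (rule that[of m])
  show "filterlim m at_top (along N)"
   unfolding filterlim_at_top eventually_along
  proof
   fix Z
   have "Z \<le> m n" if "max Z (K Z) \<le> n" for n
   proof -
    have "Z \<in> S n" using that by (simp add: S_def)
    then show ?thesis unfolding m_def using fin by (intro Max_ge) auto
   qed
   then show "\<exists>k. \<forall>n\<ge>k. n \<in> N \<longrightarrow> Z \<le> m n" by blast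
  qed
  have "P (m n) n" if n: "K 0 \<le> n" "n \<in> N" for n
  proof -
   have "0 \<in> S n" using n by (simp add: S_def)
   then have "m n = Max (S n)" by (simp add: m_def insert_absorb)
   then have "m n \<in> S n" using Max_in[OF fin, of n] \<open>0 \<in> S n\<close> by auto
   then show ?thesis using K n by (auto simp: S_def)
  qed
  then show "eventually (\<lambda>n. P (m n) n) (along N)" unfolding eventually_along by blast
 qed
qed

section \<open>Block approximation of couplings\<close>

lemma bounded_borel_sum [simp]:
 "(\<And>i. i \<in> A ==> bounded_borel (f i)) ==> bounded_borel (\<lambda>x. \<Sum>i\<in>A. f i x)"
 by (induction A rule: infinite_finite_induct) auto

lemma bounded_borel_fst [simp]:
 fixes f :: "'b::second_countable_topology => real"
 shows "bounded_borel f ==> bounded_borel (\<lambda>q :: 'b \<times> 'c::second_countable_topology. f (fst q))"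
 by (rule bounded_borel_comp[OF _ borel_measurable_fst_borel])

lemma bounded_borel_snd [simp]:
 fixes f :: "'c::second_countable_topology => real"
 shows "bounded_borel f ==> bounded_borel (\<lambda>q :: 'b::second_countable_topology \<times> 'c. f (snd q))"
 by (rule bounded_borel_comp[OF _ borel_measurable_snd_borel])

lemma integral_product_functions:
 fixes s :: "'b::second_countable_topology measure" and p :: "'c::second_countable_topology measure"
 assumes s: "prob_space s" "sets s = sets borel" and p: "prob_space p" "sets p = sets borel"
  and f: "bounded_borel f" and g: "bounded_borel g"
 shows "(\<integral>q. f (fst q) * g (snd q) \<partial>(s \<Otimes>\<^sub>M p)) = (\<integral>z. f z \<partial>s) * (\<integral>y. g y \<partial>p)"
proof -
 interpret s: prob_space s by fact
 interpret p: prob_space p by fact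
 interpret pair_sigma_finite s p ..
 note sp = product_marginals[OF s p]
 interpret sp: prob_space "s \<Otimes>\<^sub>M p" by (rule sp)
 have "integrable (s \<Otimes>\<^sub>M p) (\<lambda>q. f (fst q) * g (snd q))"
  using f g by (intro bounded_borel_integrable[OF sp.finite_measure_axioms sp(4)]) simp
 from integral_fst'[OF this] show ?thesis by simp
qed

text \<open>Jensen inequality, from the tangent of \<open>\<phi>\<close> at the mean.\<close>

lemma kl_phi_convex_sum:
 assumes A: "finite A" and t: "\<And>i. i \<in> A ==> 0 \<le> t i" "(\<Sum>i\<in>A. t i) = 1" and m: "\<And>i. i \<in> A ==> 0 \<le> m i"
 shows "kl_phi (\<Sum>i\<in>A. t i * m i) \<le> (\<Sum>i\<in>A. t i * kl_phi (m i))"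
proof (cases "(\<Sum>i\<in>A. t i * m i) = 0")
 case True
 then have z: "\<And>i. i \<in> A ==> t i * m i = 0" using A t m by (subst (asm) sum_nonneg_eq_0_iff) auto
 have "t i * kl_phi (m i) = t i" if "i \<in> A" for i
  using z[OF that] by (auto simp: kl_phi_def)
 then have "(\<Sum>i\<in>A. t i * kl_phi (m i)) = (\<Sum>i\<in>A. t i)" by (intro sum.cong refl)
 then have "(\<Sum>i\<in>A. t i * kl_phi (m i)) = 1" using t(2) by simp
 then show ?thesis unfolding True by (simp add: kl_phi_def)
next
 case False
 define M where "M = (\<Sum>i\<in>A. t i * m i)"
 have "0 \<le> M" unfolding M_def using t m by (intro sum_nonneg) auto
 then have M: "0 < M" using False by (simp add: M_def)
 have "kl_phi M = (\<Sum>i\<in>A. t i * (m i * ln M - (M - 1)))"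
  using M t(2) by (simp add: kl_phi_def right_diff_distrib sum_subtractf M_def flip: sum_distrib_right mult.assoc)
 also have "\<dots> \<le> (\<Sum>i\<in>A. t i * kl_phi (m i))"
  using t m kl_phi_tangent[OF _ M] by (intro sum_mono mult_left_mono) auto
 finally show ?thesis by (simp add: M_def)
qed

text \<open>Partitions of unity \<open>\<zeta>\<close> on the first and \<open>\<xi>\<close> on the second
 factor, indexed by finite sets \<open>P\<close> and \<open>R\<close> of base points. The products
 \<open>\<zeta>\<^sub>p \<xi>\<^sub>r\<close> are the blocks.\<close>

locale two_unities =
 fixes P :: "'b::euclidean_space set" and R :: "'c::euclidean_space set"
  and \<zeta> :: "'b => 'b => real" and \<xi> :: "'c => 'c => real"
 assumes finP: "finite P" and finR: "finite R"
  and \<zeta>b [simp]: "\<And>p. bounded_borel (\<zeta> p)" and \<xi>b [simp]: "\<And>r. bounded_borel (\<xi> r)"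
  and \<zeta>0: "\<And>p z. 0 \<le> \<zeta> p z" and \<xi>0: "\<And>r y. 0 \<le> \<xi> r y"
  and \<zeta>1: "\<And>z. (\<Sum>p\<in>P. \<zeta> p z) = 1" and \<xi>1: "\<And>y. (\<Sum>r\<in>R. \<xi> r y) = 1"
begin

definition wz :: "'b measure => 'b => real" where "wz s p = (\<integral>z. \<zeta> p z \<partial>s)"
definition wy :: "'c measure => 'c => real" where "wy u r = (\<integral>y. \<xi> r y \<partial>u)"
definition wzy :: "('b \<times> 'c) measure => 'b => 'c => real" where "wzy \<gamma> p r = (\<integral>q. \<zeta> p (fst q) * \<xi> r (snd q) \<partial>\<gamma>)"

lemma unity_prod: "(\<Sum>p\<in>P. \<Sum>r\<in>R. \<zeta> p z * \<xi> r y) = 1"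
 by (simp add: \<zeta>1 \<xi>1 flip: sum_distrib_left)

lemma wz_sum:
 assumes "prob_space s" "sets s = sets borel"
 shows "(\<Sum>p\<in>P. wz s p) = 1" "0 \<le> wz s p"
proof -
 interpret prob_space s by fact
 have i: "integrable s (\<zeta> p)" for p by (rule bounded_borel_integrable[OF finite_measure_axioms assms(2)]) simp
 have "(\<Sum>p\<in>P. wz s p) = (\<integral>z. (\<Sum>p\<in>P. \<zeta> p z) \<partial>s)"
  unfolding wz_def using i by (simp add: Bochner_Integration.integral_sum)
 then show "(\<Sum>p\<in>P. wz s p) = 1" by (simp add: \<zeta>1 prob_space)
 show "0 \<le> wz s p" unfolding wz_def using \<zeta>0 by simp
qed

lemma wy_sum:
 assumes "prob_space u" "sets u = sets borel"
 shows "(\<Sum>r\<in>R. wy u r) = 1" "0 \<le> wy u r"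
proof -
 interpret prob_space u by fact
 have i: "integrable u (\<xi> r)" for r by (rule bounded_borel_integrable[OF finite_measure_axioms assms(2)]) simp
 have "(\<Sum>r\<in>R. wy u r) = (\<integral>y. (\<Sum>r\<in>R. \<xi> r y) \<partial>u)"
  unfolding wy_def using i by (simp add: Bochner_Integration.integral_sum)
 then show "(\<Sum>r\<in>R. wy u r) = 1" by (simp add: \<xi>1 prob_space)
 show "0 \<le> wy u r" unfolding wy_def using \<xi>0 by simp
qed

lemma coupling_weights:
 assumes s: "prob_space s" "sets s = sets borel" and u: "prob_space u" "sets u = sets borel"
  and \<gamma>: "prob_space \<gamma>" "\<gamma> \<in> couplings s u"
 shows "finite_coupling P R (wz s) (wy u) (wzy \<gamma>)"
proof
 interpret \<gamma>: prob_space \<gamma> by fact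
 have sets: "sets \<gamma> = sets borel" and m: "distr \<gamma> borel fst = s" "distr \<gamma> borel snd = u"
  using \<gamma> by (auto simp: couplings_def)
 note meas = measurable_cong_sets[OF sets refl]
 have int: "integrable \<gamma> f" if "bounded_borel f" for f
  by (rule bounded_borel_integrable[OF \<gamma>.finite_measure_axioms sets that])
 show "0 \<le> wzy \<gamma> p r" for p r unfolding wzy_def using \<zeta>0 \<xi>0 by simp
 show "(\<Sum>r\<in>R. wzy \<gamma> p r) = wz s p" for p
 proof -
  have "(\<Sum>r\<in>R. wzy \<gamma> p r) = (\<integral>q. (\<Sum>r\<in>R. \<zeta> p (fst q) * \<xi> r (snd q)) \<partial>\<gamma>)"
   unfolding wzy_def using int by (simp add: Bochner_Integration.integral_sum)
  also have "\<dots> = (\<integral>q. \<zeta> p (fst q) \<partial>\<gamma>)" by (simp add: \<xi>1 flip: sum_distrib_left)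
  also have "\<dots> = wz s p"
   unfolding wz_def m(1)[symmetric] using bounded_borel_measurable[OF \<zeta>b[of p]] by (subst integral_distr) (auto simp: meas)
  finally show ?thesis .
 qed
 show "(\<Sum>p\<in>P. wzy \<gamma> p r) = wy u r" for r
 proof -
  have "(\<Sum>p\<in>P. wzy \<gamma> p r) = (\<integral>q. (\<Sum>p\<in>P. \<zeta> p (fst q) * \<xi> r (snd q)) \<partial>\<gamma>)"
   unfolding wzy_def using int by (simp add: Bochner_Integration.integral_sum)
  also have "\<dots> = (\<integral>q. \<xi> r (snd q) \<partial>\<gamma>)" by (simp add: \<zeta>1 flip: sum_distrib_right)
  also have "\<dots> = wy u r"
   unfolding wy_def m(2)[symmetric] using bounded_borel_measurable[OF \<xi>b[of r]] by (subst integral_distr) (auto simp: meas)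
  finally show ?thesis .
 qed
 show "(\<Sum>p\<in>P. wz s p) = 1" by (rule wz_sum[OF s])
qed (fact finP finR)+

definition block_density :: "('b => 'c => real) => 'b \<times> 'c => real" where
 "block_density m q = (\<Sum>p\<in>P. \<Sum>r\<in>R. m p r * (\<zeta> p (fst q) * \<xi> r (snd q)))"

lemma block_density_bounded [simp]: "bounded_borel (block_density m)"
 unfolding block_density_def by simp

lemma block_density_nonneg: "(\<And>p r. p \<in> P ==> r \<in> R ==> 0 \<le> m p r) ==> 0 \<le> block_density m q"
 unfolding block_density_def using \<zeta>0 \<xi>0 by (intro sum_nonneg) auto

text \<open>On each block the measure is a multiple of the product measure, with total masses prescribed by
 \<open>W\<close>.\<close>

definition block_measure :: "'b measure => 'c measure => ('b => 'c => real) => ('b \<times> 'c) measure" where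
 "block_measure s u W = density (s \<Otimes>\<^sub>M u) (\<lambda>q. ennreal (block_density (\<lambda>p r. W p r / (wz s p * wy u r)) q))"

context
 fixes s :: "'b measure" and u :: "'c measure" and W :: "'b => 'c => real"
 assumes s: "prob_space s" "sets s = sets borel" and u: "prob_space u" "sets u = sets borel"
  and W: "finite_coupling P R (wz s) (wy u) W"
begin

interpretation W: finite_coupling P R "wz s" "wy u" W by (rule W)

abbreviation "mm p r \<equiv> W p r / (wz s p * wy u r)"

lemma mm_nonneg: "p \<in> P ==> r \<in> R ==> 0 \<le> mm p r"
 using W.w0[of p r] W.s0[of p] W.q0[of r] by simp

lemma mm_mult: "p \<in> P ==> r \<in> R ==> mm p r * (wz s p * wy u r) = W p r"
 using W.w0[of p r] W.w_le_s[of p r] W.w_le_q[of p r] by (cases "wz s p = 0"; cases "wy u r = 0") auto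

lemma su_facts: "finite_measure (s \<Otimes>\<^sub>M u)" "sets (s \<Otimes>\<^sub>M u) = sets borel" "prob_space (s \<Otimes>\<^sub>M u)"
 using product_marginals[OF s u] by (auto intro: prob_space.finite_measure)

lemma integral_block_measure:
 assumes k: "bounded_borel k"
 shows "(\<integral>q. k q \<partial>block_measure s u W) = (\<Sum>p\<in>P. \<Sum>r\<in>R. mm p r * (\<integral>q. k q * (\<zeta> p (fst q) * \<xi> r (snd q)) \<partial>(s \<Otimes>\<^sub>M u)))"
proof -
 note meas = measurable_cong_sets[OF su_facts(2) refl]
 have int: "integrable (s \<Otimes>\<^sub>M u) f" if "bounded_borel f" for f
  by (rule bounded_borel_integrable[OF su_facts(1,2) that])
 have "(\<integral>q. k q \<partial>block_measure s u W) = (\<integral>q. block_density mm q * k q \<partial>(s \<Otimes>\<^sub>M u))"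
  unfolding block_measure_def
  using bounded_borel_measurable[OF k] bounded_borel_measurable[OF block_density_bounded[of mm]] block_density_nonneg[OF mm_nonneg]
  by (subst integral_density) (auto simp: meas)
 also have "\<dots> = (\<integral>q. (\<Sum>p\<in>P. \<Sum>r\<in>R. mm p r * (k q * (\<zeta> p (fst q) * \<xi> r (snd q)))) \<partial>(s \<Otimes>\<^sub>M u))"
  unfolding block_density_def by (simp add: sum_distrib_left sum_distrib_right mult_ac)
 also have "\<dots> = (\<Sum>p\<in>P. \<Sum>r\<in>R. mm p r * (\<integral>q. k q * (\<zeta> p (fst q) * \<xi> r (snd q)) \<partial>(s \<Otimes>\<^sub>M u)))"
  using k int by (simp add: Bochner_Integration.integral_sum)
 finally show ?thesis .
qed

lemma block_measure_sets: "sets (block_measure s u W) = sets borel"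
 unfolding block_measure_def using su_facts(2) by simp

lemma block_measure_prob: "prob_space (block_measure s u W)"
proof (rule prob_spaceI)
 note meas = measurable_cong_sets[OF su_facts(2) refl]
 have sp: "space (s \<Otimes>\<^sub>M u) = UNIV" using su_facts(2) by (auto dest: sets_eq_imp_space_eq)
 have i: "integrable (s \<Otimes>\<^sub>M u) (block_density mm)"
  by (rule bounded_borel_integrable[OF su_facts(1,2)]) simp
 have "(\<integral>q. block_density mm q \<partial>(s \<Otimes>\<^sub>M u)) = (\<Sum>p\<in>P. \<Sum>r\<in>R. mm p r * (wz s p * wy u r))"
  unfolding block_density_def wz_def wy_def
  using integral_product_functions[OF s u \<zeta>b \<xi>b] bounded_borel_integrable[OF su_facts(1,2)]
  by (simp add: Bochner_Integration.integral_sum)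
 also have "\<dots> = (\<Sum>p\<in>P. \<Sum>r\<in>R. W p r)" using mm_mult by (intro sum.cong) auto
 also have "\<dots> = 1" using W.ws W.s1 by simp
 finally have "(\<integral>\<^sup>+q. ennreal (block_density mm q) \<partial>(s \<Otimes>\<^sub>M u)) = 1"
  using i block_density_nonneg[OF mm_nonneg] by (subst nn_integral_eq_integral) auto
 then show "emeasure (block_measure s u W) (space (block_measure s u W)) = 1"
  unfolding block_measure_def
  using bounded_borel_measurable[OF block_density_bounded[of mm]] by (simp add: emeasure_density meas sp su_facts)
qed

lemma block_measure_coupling: "block_measure s u W \<in> couplings s u"
proof -
 interpret B: prob_space "block_measure s u W" by (rule block_measure_prob)
 interpret S: prob_space s by (rule s)
 interpret U: prob_space u by (rule u)
 note measB = measurable_cong_sets[OF block_measure_sets refl]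
 have cancel_z: "(\<Sum>r\<in>R. mm p r * (x * wy u r)) = x" if p: "p \<in> P" and x: "0 \<le> x" "x \<le> wz s p" for p x
 proof (cases "wz s p = 0")
  case False
  have "(\<Sum>r\<in>R. mm p r * (x * wy u r)) = (\<Sum>r\<in>R. (mm p r * (wz s p * wy u r)) * (x / wz s p))"
   using False by (intro sum.cong) auto
  also have "\<dots> = (\<Sum>r\<in>R. W p r * (x / wz s p))" using mm_mult[OF p] by (intro sum.cong) auto
  also have "\<dots> = x" using W.ws[OF p] False by (simp flip: sum_distrib_right sum_divide_distrib)
  finally show ?thesis .
 qed (use x in simp)
 have cancel_y: "(\<Sum>p\<in>P. mm p r * (wz s p * x)) = x" if r: "r \<in> R" and x: "0 \<le> x" "x \<le> wy u r" for r x
 proof (cases "wy u r = 0")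
  case False
  have "(\<Sum>p\<in>P. mm p r * (wz s p * x)) = (\<Sum>p\<in>P. (mm p r * (wz s p * wy u r)) * (x / wy u r))"
   using False by (intro sum.cong) auto
  also have "\<dots> = (\<Sum>p\<in>P. W p r * (x / wy u r))" using mm_mult[OF _ r] by (intro sum.cong) auto
  also have "\<dots> = x" using W.wq[OF r] False by (simp flip: sum_distrib_right sum_divide_distrib)
  finally show ?thesis .
 qed (use x in simp)
 have "distr (block_measure s u W) borel fst = s"
 proof (rule measure_eqI_continuous[OF prob_space.finite_measure S.finite_measure_axioms sets_distr s(2)])
  show "prob_space (distr (block_measure s u W) borel fst)" by (rule B.prob_space_distr) (simp add: measB)
  fix h :: "'b => real" assume h: "continuous_on UNIV h" "\<And>x. 0 \<le> h x" "\<And>x. h x \<le> 1"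
  have hb[simp]: "bounded_borel h"
   using h by (intro bounded_borelI[of _ 1] borel_measurable_continuous_onI) (auto simp: abs_le_iff intro: order_trans[of _ 0])
  have int: "integrable s g" if "bounded_borel g" for g
   by (rule bounded_borel_integrable[OF S.finite_measure_axioms s(2) that])
  have x: "0 \<le> (\<integral>z. h z * \<zeta> p z \<partial>s)" "(\<integral>z. h z * \<zeta> p z \<partial>s) \<le> wz s p" for p
   unfolding wz_def using h \<zeta>0 int by (auto intro!: integral_nonneg_AE integral_mono mult_left_le_one_le)
  have "(\<integral>z. h z \<partial>distr (block_measure s u W) borel fst) = (\<integral>q. h (fst q) \<partial>block_measure s u W)"
   by (rule integral_distr) (simp_all add: measB bounded_borel_measurable)
  also have "\<dots> = (\<Sum>p\<in>P. \<Sum>r\<in>R. mm p r * ((\<integral>z. h z * \<zeta> p z \<partial>s) * wy u r))"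
   using integral_product_functions[OF s u bounded_borel_mult[OF hb \<zeta>b] \<xi>b] by (simp add: integral_block_measure wy_def mult.assoc)
  also have "\<dots> = (\<Sum>p\<in>P. \<integral>z. h z * \<zeta> p z \<partial>s)" by (intro sum.cong refl cancel_z x)
  also have "\<dots> = (\<integral>z. (\<Sum>p\<in>P. h z * \<zeta> p z) \<partial>s)" using int by (simp add: Bochner_Integration.integral_sum)
  finally show "(\<integral>z. h z \<partial>distr (block_measure s u W) borel fst) = (\<integral>z. h z \<partial>s)" by (simp add: \<zeta>1 flip: sum_distrib_left)
 qed
 moreover have "distr (block_measure s u W) borel snd = u"
 proof (rule measure_eqI_continuous[OF prob_space.finite_measure U.finite_measure_axioms sets_distr u(2)])
  show "prob_space (distr (block_measure s u W) borel snd)" by (rule B.prob_space_distr) (simp add: measB)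
  fix h :: "'c => real" assume h: "continuous_on UNIV h" "\<And>x. 0 \<le> h x" "\<And>x. h x \<le> 1"
  have hb[simp]: "bounded_borel h"
   using h by (intro bounded_borelI[of _ 1] borel_measurable_continuous_onI) (auto simp: abs_le_iff intro: order_trans[of _ 0])
  have int: "integrable u g" if "bounded_borel g" for g
   by (rule bounded_borel_integrable[OF U.finite_measure_axioms u(2) that])
  have x: "0 \<le> (\<integral>y. h y * \<xi> r y \<partial>u)" "(\<integral>y. h y * \<xi> r y \<partial>u) \<le> wy u r" for r
   unfolding wy_def using h \<xi>0 int by (auto intro!: integral_nonneg_AE integral_mono mult_left_le_one_le)
  have pr: "(\<integral>q. h (snd q) * (\<zeta> p (fst q) * \<xi> r (snd q)) \<partial>(s \<Otimes>\<^sub>M u)) = wz s p * (\<integral>y. h y * \<xi> r y \<partial>u)" for p r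
   using integral_product_functions[OF s u \<zeta>b[of p] bounded_borel_mult[OF hb \<xi>b[of r]]] by (simp add: wz_def mult_ac)
  have "(\<integral>y. h y \<partial>distr (block_measure s u W) borel snd) = (\<integral>q. h (snd q) \<partial>block_measure s u W)"
   by (rule integral_distr) (simp_all add: measB bounded_borel_measurable)
  also have "\<dots> = (\<Sum>p\<in>P. \<Sum>r\<in>R. mm p r * (wz s p * (\<integral>y. h y * \<xi> r y \<partial>u)))"
   using integral_block_measure[OF bounded_borel_snd[OF hb]] by (simp only: pr)
  also have "\<dots> = (\<Sum>r\<in>R. \<integral>y. h y * \<xi> r y \<partial>u)" by (subst sum.swap) (intro sum.cong refl cancel_y x)
  also have "\<dots> = (\<integral>y. (\<Sum>r\<in>R. h y * \<xi> r y) \<partial>u)" using int by (simp add: Bochner_Integration.integral_sum)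
  finally show "(\<integral>y. h y \<partial>distr (block_measure s u W) borel snd) = (\<integral>y. h y \<partial>u)" by (simp add: \<xi>1 flip: sum_distrib_left)
 qed
 ultimately show ?thesis using block_measure_sets by (simp add: couplings_def)
qed

text \<open>The density is a convex combination of the block ratios with weights \<open>\<zeta>\<^sub>p
 \<xi>\<^sub>r\<close>, and \<open>\<phi>\<close> is convex.\<close>

lemma block_measure_KL: "KL (block_measure s u W) (s \<Otimes>\<^sub>M u) \<le> ereal (\<Sum>p\<in>P. \<Sum>r\<in>R. kl_term (W p r) (wz s p) (wy u r))"
proof -
 note meas = measurable_cong_sets[OF su_facts(2) refl]
 have nn: "0 \<le> block_density mm q" for q by (rule block_density_nonneg[OF mm_nonneg])
 have mb: "block_density mm \<in> borel_measurable (s \<Otimes>\<^sub>M u)"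
  using bounded_borel_measurable[OF block_density_bounded[of mm]] by (simp add: meas)
 define g where "g q = (\<Sum>p\<in>P. \<Sum>r\<in>R. kl_phi (mm p r) * (\<zeta> p (fst q) * \<xi> r (snd q)))" for q
 have gb: "bounded_borel g" unfolding g_def by simp
 have le: "kl_phi (block_density mm q) \<le> g q" for q
 proof -
  have "kl_phi (\<Sum>x\<in>P \<times> R. (\<zeta> (fst x) (fst q) * \<xi> (snd x) (snd q)) * mm (fst x) (snd x))
   \<le> (\<Sum>x\<in>P \<times> R. (\<zeta> (fst x) (fst q) * \<xi> (snd x) (snd q)) * kl_phi (mm (fst x) (snd x)))"
  proof (rule kl_phi_convex_sum)
   show "(\<Sum>x\<in>P \<times> R. \<zeta> (fst x) (fst q) * \<xi> (snd x) (snd q)) = 1"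
    using unity_prod[of "fst q" "snd q"] by (simp add: sum.cartesian_product split_beta)
  qed (use finP finR \<zeta>0 \<xi>0 mm_nonneg in auto)
  then show ?thesis
   unfolding g_def block_density_def by (simp add: sum.cartesian_product split_beta mult.commute)
 qed
 have "KL (block_measure s u W) (s \<Otimes>\<^sub>M u) = enn2ereal (\<integral>\<^sup>+q. ennreal (kl_phi (block_density mm q)) \<partial>(s \<Otimes>\<^sub>M u))"
  unfolding block_measure_def by (rule KL_density[OF su_facts(1) mb nn])
 also have "\<dots> \<le> enn2ereal (\<integral>\<^sup>+q. ennreal (g q) \<partial>(s \<Otimes>\<^sub>M u))"
  unfolding less_eq_ennreal.rep_eq[symmetric] using le by (intro nn_integral_mono ennreal_leI)
 also have "(\<integral>\<^sup>+q. ennreal (g q) \<partial>(s \<Otimes>\<^sub>M u)) = ennreal (\<integral>q. g q \<partial>(s \<Otimes>\<^sub>M u))"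
  using order_trans[OF kl_phi_nonneg[OF nn] le] by (intro nn_integral_eq_integral bounded_borel_integrable[OF su_facts(1,2) gb]) auto
 also have "(\<integral>q. g q \<partial>(s \<Otimes>\<^sub>M u)) = (\<Sum>p\<in>P. \<Sum>r\<in>R. kl_phi (mm p r) * (wz s p * wy u r))"
  unfolding g_def wz_def wy_def
  using integral_product_functions[OF s u \<zeta>b \<xi>b] bounded_borel_integrable[OF su_facts(1,2)]
  by (simp add: Bochner_Integration.integral_sum)
 also have "\<dots> = (\<Sum>p\<in>P. \<Sum>r\<in>R. kl_term (W p r) (wz s p) (wy u r))"
  by (simp add: kl_term_def mult_ac)
 finally show ?thesis
  using order_trans[OF kl_phi_nonneg[OF nn] le]
  by (subst (asm) enn2ereal_ennreal) (auto intro!: sum_nonneg simp: kl_term_def kl_phi_nonneg mm_nonneg W.s0 W.q0)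
qed

text \<open>Integrands with small oscillation on blocks do not see how mass is spread inside the
 blocks.\<close>

lemma block_measure_approx:
 assumes k: "bounded_borel k" and e: "0 \<le> e"
  and osc: "\<And>p r. p \<in> P ==> r \<in> R ==> AE q in s \<Otimes>\<^sub>M u. \<zeta> p (fst q) \<noteq> 0 \<longrightarrow> \<xi> r (snd q) \<noteq> 0 \<longrightarrow> \<bar>k q - k (p, r)\<bar> \<le> e"
 shows "\<bar>(\<integral>q. k q \<partial>block_measure s u W) - (\<Sum>p\<in>P. \<Sum>r\<in>R. k (p, r) * W p r)\<bar> \<le> e"
proof -
 have int: "integrable (s \<Otimes>\<^sub>M u) f" if "bounded_borel f" for f
  by (rule bounded_borel_integrable[OF su_facts(1,2) that])
 have block: "\<bar>(\<integral>q. k q * (\<zeta> p (fst q) * \<xi> r (snd q)) \<partial>(s \<Otimes>\<^sub>M u)) - k (p, r) * (wz s p * wy u r)\<bar> \<le> e * (wz s p * wy u r)"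
  if pr: "p \<in> P" "r \<in> R" for p r
 proof -
  have wp: "(\<integral>q. \<zeta> p (fst q) * \<xi> r (snd q) \<partial>(s \<Otimes>\<^sub>M u)) = wz s p * wy u r"
   unfolding wz_def wy_def by (rule integral_product_functions[OF s u \<zeta>b \<xi>b])
  have "(\<integral>q. k q * (\<zeta> p (fst q) * \<xi> r (snd q)) \<partial>(s \<Otimes>\<^sub>M u)) - k (p, r) * (wz s p * wy u r)
    = (\<integral>q. (k q - k (p, r)) * (\<zeta> p (fst q) * \<xi> r (snd q)) \<partial>(s \<Otimes>\<^sub>M u))"
   unfolding wp[symmetric] using k int by (simp add: left_diff_distrib)
  also have "\<bar>\<dots>\<bar> \<le> (\<integral>q. e * (\<zeta> p (fst q) * \<xi> r (snd q)) \<partial>(s \<Otimes>\<^sub>M u))"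
  proof (rule order_trans[OF integral_abs_bound integral_mono_AE])
   show "AE q in s \<Otimes>\<^sub>M u. \<bar>(k q - k (p, r)) * (\<zeta> p (fst q) * \<xi> r (snd q))\<bar> \<le> e * (\<zeta> p (fst q) * \<xi> r (snd q))"
    using osc[OF pr]
   proof eventually_elim
    case (elim q)
    then show ?case using \<zeta>0[of p "fst q"] \<xi>0[of r "snd q"]
     by (cases "\<zeta> p (fst q) = 0"; cases "\<xi> r (snd q) = 0") (auto simp: abs_mult intro!: mult_right_mono)
   qed
   show "integrable (s \<Otimes>\<^sub>M u) (\<lambda>q. \<bar>(k q - k (p, r)) * (\<zeta> p (fst q) * \<xi> r (snd q))\<bar>)"
    by (intro integrable_abs int bounded_borel_mult bounded_borel_diff k bounded_borel_const bounded_borel_fst bounded_borel_snd \<zeta>b \<xi>b)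
   show "integrable (s \<Otimes>\<^sub>M u) (\<lambda>q. e * (\<zeta> p (fst q) * \<xi> r (snd q)))"
    by (intro int bounded_borel_mult bounded_borel_const bounded_borel_fst bounded_borel_snd \<zeta>b \<xi>b)
  qed
  also have "\<dots> = e * (wz s p * wy u r)" by (simp add: wp)
  finally show ?thesis .
 qed
 have mult_mm: "mm p r * (x * (wz s p * wy u r)) = x * W p r" if "p \<in> P" "r \<in> R" for p r x
  unfolding mult.left_commute[of "mm p r" x] by (simp only: mm_mult[OF that])
 have "(\<Sum>p\<in>P. \<Sum>r\<in>R. k (p, r) * W p r) = (\<Sum>p\<in>P. \<Sum>r\<in>R. mm p r * (k (p, r) * (wz s p * wy u r)))"
  by (intro sum.cong refl mult_mm[symmetric])
 then have diff: "(\<integral>q. k q \<partial>block_measure s u W) - (\<Sum>p\<in>P. \<Sum>r\<in>R. k (p, r) * W p r)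
   = (\<Sum>p\<in>P. \<Sum>r\<in>R. mm p r * ((\<integral>q. k q * (\<zeta> p (fst q) * \<xi> r (snd q)) \<partial>(s \<Otimes>\<^sub>M u)) - k (p, r) * (wz s p * wy u r)))"
  unfolding integral_block_measure[OF k] by (simp add: right_diff_distrib sum_subtractf)
 have "\<bar>(\<integral>q. k q \<partial>block_measure s u W) - (\<Sum>p\<in>P. \<Sum>r\<in>R. k (p, r) * W p r)\<bar>
   \<le> (\<Sum>p\<in>P. \<Sum>r\<in>R. mm p r * (e * (wz s p * wy u r)))"
  unfolding diff
 proof (intro order_trans[OF sum_abs] sum_mono)
  fix p r assume pr: "p \<in> P" "r \<in> R"
  show "\<bar>mm p r * ((\<integral>q. k q * (\<zeta> p (fst q) * \<xi> r (snd q)) \<partial>(s \<Otimes>\<^sub>M u)) - k (p, r) * (wz s p * wy u r))\<bar> \<le> mm p r * (e * (wz s p * wy u r))"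
   unfolding abs_mult abs_of_nonneg[OF mm_nonneg[OF pr]] by (rule mult_left_mono[OF block[OF pr] mm_nonneg[OF pr]])
 qed
 also have "(\<Sum>p\<in>P. \<Sum>r\<in>R. mm p r * (e * (wz s p * wy u r))) = e"
 proof -
  have "(\<Sum>p\<in>P. \<Sum>r\<in>R. mm p r * (e * (wz s p * wy u r))) = (\<Sum>p\<in>P. \<Sum>r\<in>R. e * W p r)"
   by (intro sum.cong refl mult_mm)
  also have "\<dots> = e * (\<Sum>p\<in>P. \<Sum>r\<in>R. W p r)"
   by (simp only: sum_distrib_left)
  also have "(\<Sum>p\<in>P. \<Sum>r\<in>R. W p r) = (\<Sum>p\<in>P. wz s p)"
   by (intro sum.cong refl W.ws)
  finally show ?thesis by (simp only: W.s1 mult_1_right)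
 qed
 finally show ?thesis .
qed

end

lemma coupling_approx:
 assumes \<gamma>: "prob_space \<gamma>" "sets \<gamma> = sets borel" and k: "bounded_borel k"
  and osc: "\<And>p r. p \<in> P ==> r \<in> R ==> AE q in \<gamma>. \<zeta> p (fst q) \<noteq> 0 \<longrightarrow> \<xi> r (snd q) \<noteq> 0 \<longrightarrow> \<bar>k q - k (p, r)\<bar> \<le> e"
 shows "\<bar>(\<integral>q. k q \<partial>\<gamma>) - (\<Sum>p\<in>P. \<Sum>r\<in>R. k (p, r) * wzy \<gamma> p r)\<bar> \<le> e"
proof -
 interpret prob_space \<gamma> by fact
 have int: "integrable \<gamma> f" if "bounded_borel f" for f
  by (rule bounded_borel_integrable[OF finite_measure_axioms \<gamma>(2) that])
 have "(\<integral>q. k q \<partial>\<gamma>) = (\<integral>q. k q * (\<Sum>p\<in>P. \<Sum>r\<in>R. \<zeta> p (fst q) * \<xi> r (snd q)) \<partial>\<gamma>)"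
  by (simp add: unity_prod)
 also have "\<dots> = (\<Sum>p\<in>P. \<Sum>r\<in>R. \<integral>q. k q * (\<zeta> p (fst q) * \<xi> r (snd q)) \<partial>\<gamma>)"
  using k int by (simp add: sum_distrib_left Bochner_Integration.integral_sum)
 finally have "(\<integral>q. k q \<partial>\<gamma>) - (\<Sum>p\<in>P. \<Sum>r\<in>R. k (p, r) * wzy \<gamma> p r)
  = (\<Sum>p\<in>P. \<Sum>r\<in>R. \<integral>q. (k q - k (p, r)) * (\<zeta> p (fst q) * \<xi> r (snd q)) \<partial>\<gamma>)"
  using k int by (simp add: wzy_def left_diff_distrib sum_subtractf)
 also have "\<bar>\<dots>\<bar> \<le> (\<Sum>p\<in>P. \<Sum>r\<in>R. \<integral>q. e * (\<zeta> p (fst q) * \<xi> r (snd q)) \<partial>\<gamma>)"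
 proof (intro order_trans[OF sum_abs] sum_mono order_trans[OF integral_abs_bound] integral_mono_AE)
  fix p r assume pr: "p \<in> P" "r \<in> R"
  show "AE q in \<gamma>. \<bar>(k q - k (p, r)) * (\<zeta> p (fst q) * \<xi> r (snd q))\<bar> \<le> e * (\<zeta> p (fst q) * \<xi> r (snd q))"
   using osc[OF pr]
  proof eventually_elim
   case (elim q)
   then show ?case using \<zeta>0[of p "fst q"] \<xi>0[of r "snd q"]
    by (cases "\<zeta> p (fst q) = 0"; cases "\<xi> r (snd q) = 0") (auto simp: abs_mult intro!: mult_right_mono)
  qed
  show "integrable \<gamma> (\<lambda>q. \<bar>(k q - k (p, r)) * (\<zeta> p (fst q) * \<xi> r (snd q))\<bar>)"
   by (intro integrable_abs int bounded_borel_mult bounded_borel_diff k bounded_borel_const bounded_borel_fst bounded_borel_snd \<zeta>b \<xi>b)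
  show "integrable \<gamma> (\<lambda>q. e * (\<zeta> p (fst q) * \<xi> r (snd q)))"
   by (intro int bounded_borel_mult bounded_borel_const bounded_borel_fst bounded_borel_snd \<zeta>b \<xi>b)
 qed
 also have "\<dots> = e * (\<integral>q. (\<Sum>p\<in>P. \<Sum>r\<in>R. \<zeta> p (fst q) * \<xi> r (snd q)) \<partial>\<gamma>)"
  using int by (simp add: Bochner_Integration.integral_sum sum_distrib_left)
 also have "\<dots> = e" by (simp add: unity_prod prob_space)
 finally show ?thesis .
qed

text \<open>Data processing: on each block the entropy density is bounded below by the tangent of
 \<open>\<phi>\<close> at the mean density of the block.\<close>

lemma block_KL_le:
 assumes s: "prob_space s" "sets s = sets borel" and u: "prob_space u" "sets u = sets borel"
  and f: "f \<in> borel_measurable borel" "\<And>q. 0 \<le> f q" and \<gamma>: "\<gamma> = density (s \<Otimes>\<^sub>M u) (\<lambda>q. ennreal (f q))"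
  and p\<gamma>: "prob_space \<gamma>"
 shows "ennreal (\<Sum>p\<in>P. \<Sum>r\<in>R. kl_term (wzy \<gamma> p r) (wz s p) (wy u r)) \<le> (\<integral>\<^sup>+q. ennreal (kl_phi (f q)) \<partial>(s \<Otimes>\<^sub>M u))"
proof (cases "(\<integral>\<^sup>+q. ennreal (kl_phi (f q)) \<partial>(s \<Otimes>\<^sub>M u)) = \<infinity>")
 case False
 note su = product_marginals[OF s u]
 interpret su: prob_space "s \<Otimes>\<^sub>M u" by (rule su)
 interpret \<gamma>: prob_space \<gamma> by fact
 note meas = measurable_cong_sets[OF su(4) refl]
 have fm: "f \<in> borel_measurable (s \<Otimes>\<^sub>M u)" using f by (simp add: meas)
 have k\<phi>: "(\<lambda>q. kl_phi (f q)) \<in> borel_measurable (s \<Otimes>\<^sub>M u)" using fm by measurable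
 have int: "integrable (s \<Otimes>\<^sub>M u) g" if "bounded_borel g" for g
  by (rule bounded_borel_integrable[OF su.finite_measure_axioms su(4) that])
 have ik: "integrable (s \<Otimes>\<^sub>M u) (\<lambda>q. kl_phi (f q))"
  using False f kl_phi_nonneg k\<phi> by (intro integrableI_nonneg) (auto simp: less_top)
 define b where "b p r q = \<zeta> p (fst q) * \<xi> r (snd q)" for p r q
 have bb [simp]: "bounded_borel (b p r)" for p r unfolding b_def by simp
 have b0: "0 \<le> b p r q" for p r q unfolding b_def using \<zeta>0 \<xi>0 by simp
 have b_le: "b p r q \<le> 1" if "p \<in> P" "r \<in> R" for p r q
 proof -
  have "b p r q \<le> (\<Sum>x\<in>P \<times> R. b (fst x) (snd x) q)"
   using that finP finR b0 member_le_sum[of "(p, r)" "P \<times> R" "\<lambda>x. b (fst x) (snd x) q"] by auto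
  also have "\<dots> = 1" using unity_prod[of "fst q" "snd q"] by (simp add: sum.cartesian_product split_beta b_def)
  finally show ?thesis .
 qed
 have ibk: "integrable (s \<Otimes>\<^sub>M u) (\<lambda>q. b p r q * kl_phi (f q))" if "p \<in> P" "r \<in> R" for p r
 proof (rule Bochner_Integration.integrable_bound[OF ik])
  show "(\<lambda>q. b p r q * kl_phi (f q)) \<in> borel_measurable (s \<Otimes>\<^sub>M u)"
   using k\<phi> bounded_borel_measurable[OF bb[of p r]] by (intro borel_measurable_times) (auto simp: meas)
  show "AE q in s \<Otimes>\<^sub>M u. norm (b p r q * kl_phi (f q)) \<le> norm (kl_phi (f q))"
   using b0 b_le[OF that] kl_phi_nonneg[OF f(2)] by (intro AE_I2) (simp add: abs_mult mult_left_le_one_le)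
 qed
 have w_int: "wzy \<gamma> p r = (\<integral>q. f q * b p r q \<partial>(s \<Otimes>\<^sub>M u))" "integrable (s \<Otimes>\<^sub>M u) (\<lambda>q. f q * b p r q)" for p r
 proof -
  have bm: "b p r \<in> borel_measurable (s \<Otimes>\<^sub>M u)" using bounded_borel_measurable[OF bb[of p r]] by (simp add: meas)
  show "wzy \<gamma> p r = (\<integral>q. f q * b p r q \<partial>(s \<Otimes>\<^sub>M u))"
   unfolding wzy_def b_def[symmetric] \<gamma> using bm fm f(2) by (subst integral_density) auto
  have "integrable \<gamma> (b p r)"
   using bounded_borel_integrable[OF \<gamma>.finite_measure_axioms _ bb] su(4) by (simp add: \<gamma>)
  then show "integrable (s \<Otimes>\<^sub>M u) (\<lambda>q. f q * b p r q)"
   unfolding \<gamma> using bm fm f(2) by (subst (asm) integrable_density) auto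
 qed
 have w0: "0 \<le> wzy \<gamma> p r" for p r unfolding wzy_def using \<zeta>0 \<xi>0 by simp
 have b_int: "(\<integral>q. b p r q \<partial>(s \<Otimes>\<^sub>M u)) = wz s p * wy u r" for p r
  unfolding b_def wz_def wy_def by (rule integral_product_functions[OF s u \<zeta>b \<xi>b])
 have tangent: "wzy \<gamma> p r * ln m - (m - 1) * (wz s p * wy u r) \<le> (\<integral>q. b p r q * kl_phi (f q) \<partial>(s \<Otimes>\<^sub>M u))"
  if pr: "p \<in> P" "r \<in> R" and m: "0 < m" for p r m
 proof -
  have "wzy \<gamma> p r * ln m - (m - 1) * (wz s p * wy u r) = (\<integral>q. ln m * (f q * b p r q) - (m - 1) * b p r q \<partial>(s \<Otimes>\<^sub>M u))"
   using w_int[of p r] int[OF bb[of p r]] by (simp add: b_int)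
  also have "\<dots> \<le> (\<integral>q. b p r q * kl_phi (f q) \<partial>(s \<Otimes>\<^sub>M u))"
  proof (rule integral_mono)
   fix q
   have "b p r q * (f q * ln m - (m - 1)) \<le> b p r q * kl_phi (f q)"
    using kl_phi_tangent[OF f(2) m] b0 by (intro mult_left_mono)
   then show "ln m * (f q * b p r q) - (m - 1) * b p r q \<le> b p r q * kl_phi (f q)"
    by (simp add: algebra_simps)
  qed (use w_int int ibk[OF pr] in auto)
  finally show ?thesis .
 qed
 have block: "kl_term (wzy \<gamma> p r) (wz s p) (wy u r) \<le> (\<integral>q. b p r q * kl_phi (f q) \<partial>(s \<Otimes>\<^sub>M u))" if pr: "p \<in> P" "r \<in> R" for p r
 proof -
  let ?S = "wz s p * wy u r"
  have S0: "0 \<le> ?S" using wz_sum(2)[OF s] wy_sum(2)[OF u] by simp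
  have k0: "0 \<le> (\<integral>q. b p r q * kl_phi (f q) \<partial>(s \<Otimes>\<^sub>M u))"
   using b0 kl_phi_nonneg[OF f(2)] by simp
  consider "?S = 0" | "?S \<noteq> 0" "wzy \<gamma> p r = 0" | "0 < ?S" "0 < wzy \<gamma> p r"
   using S0 w0[of p r] by linarith
  then show ?thesis
  proof cases
   case 1
   then have "kl_term (wzy \<gamma> p r) (wz s p) (wy u r) = 0" unfolding kl_term_def by (simp only: mult_zero_left)
   then show ?thesis using k0 by simp
  next
   case 2
   have "kl_term (wzy \<gamma> p r) (wz s p) (wy u r) = ?S" using 2 by (simp add: kl_term_def kl_phi_def)
   also have "?S \<le> (\<integral>q. b p r q * kl_phi (f q) \<partial>(s \<Otimes>\<^sub>M u))"
   proof (rule field_le_epsilon)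
    fix e :: real assume e: "0 < e"
    define m where "m = e / (?S + 1)"
    have m: "0 < m" using e S0 by (simp add: m_def)
    have "m * ?S \<le> m * (?S + 1)" using m by (intro mult_left_mono) auto
    also have "\<dots> = e" using S0 by (simp add: m_def)
    finally have "m * ?S \<le> e" .
    moreover have "(m - 1) * ?S = m * ?S - ?S" by (simp add: left_diff_distrib)
    ultimately show "?S \<le> (\<integral>q. b p r q * kl_phi (f q) \<partial>(s \<Otimes>\<^sub>M u)) + e"
     using tangent[OF pr m] unfolding 2(2) by linarith
   qed
   finally show ?thesis .
  next
   case 3
   let ?m = "wzy \<gamma> p r / ?S"
   have m: "0 < ?m" using 3 by simp
   have "kl_term (wzy \<gamma> p r) (wz s p) (wy u r) = wzy \<gamma> p r * ln ?m - (?m - 1) * ?S"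
    using 3 unfolding kl_term_def kl_phi_def by (simp add: field_simps)
   then show ?thesis using tangent[OF pr m] by simp
  qed
 qed
 have "(\<Sum>p\<in>P. \<Sum>r\<in>R. kl_term (wzy \<gamma> p r) (wz s p) (wy u r)) \<le> (\<Sum>p\<in>P. \<Sum>r\<in>R. \<integral>q. b p r q * kl_phi (f q) \<partial>(s \<Otimes>\<^sub>M u))"
  using block by (intro sum_mono)
 also have "\<dots> = (\<integral>q. (\<Sum>p\<in>P. \<Sum>r\<in>R. b p r q * kl_phi (f q)) \<partial>(s \<Otimes>\<^sub>M u))"
  using ibk by (simp add: Bochner_Integration.integral_sum)
 also have "\<dots> = (\<integral>q. kl_phi (f q) \<partial>(s \<Otimes>\<^sub>M u))"
  using unity_prod by (simp add: b_def flip: sum_distrib_right)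
 finally have "ennreal (\<Sum>p\<in>P. \<Sum>r\<in>R. kl_term (wzy \<gamma> p r) (wz s p) (wy u r)) \<le> ennreal (\<integral>q. kl_phi (f q) \<partial>(s \<Otimes>\<^sub>M u))"
  by (rule ennreal_leI)
 also have "\<dots> = (\<integral>\<^sup>+q. ennreal (kl_phi (f q)) \<partial>(s \<Otimes>\<^sub>M u))"
  using ik kl_phi_nonneg[OF f(2)] by (intro nn_integral_eq_integral[symmetric]) auto
 finally show ?thesis .
qed simp

end

section \<open>Limits of glued problems\<close>

lemma density_kernel:
 fixes \<a> :: "'a::second_countable_topology measure" and \<theta> :: "'a => 'b::second_countable_topology measure"
 assumes \<a>: "sets \<a> = sets borel" and \<theta>: "kernel \<a> \<theta>"
  and f[measurable]: "f \<in> borel_measurable borel"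
  and prob: "\<And>a. a \<in> space \<a> ==> prob_space (density (\<theta> a) (\<lambda>b. ennreal (f (a, b))))"
 shows "kernel \<a> (\<lambda>a. density (\<theta> a) (\<lambda>b. ennreal (f (a, b))))"
proof (rule measurable_prob_algebraI[OF prob])
 note [measurable_cong] = \<a>
 note \<theta>_m[measurable] = measurable_prob_algebraD[OF \<theta>]
 have f_pair[measurable]: "f \<in> borel_measurable (borel \<Otimes>\<^sub>M borel)"
  unfolding borel_prod by (rule f)
 have f_fib: "(\<lambda>b. f (a, b)) \<in> borel_measurable borel" for a
  using measurable_compose[OF measurable_Pair_borel f] .
 show "(\<lambda>a. density (\<theta> a) (\<lambda>b. ennreal (f (a, b)))) \<in> \<a> \<rightarrow>\<^sub>M subprob_algebra borel"
 proof (rule measurable_subprob_algebra)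
  fix a assume a: "a \<in> space \<a>"
  show "subprob_space (density (\<theta> a) (\<lambda>b. ennreal (f (a, b))))"
   by (rule prob_space_imp_subprob_space[OF prob[OF a]])
  show "sets (density (\<theta> a) (\<lambda>b. ennreal (f (a, b)))) = sets borel"
   using kernel_fiber(2)[OF \<theta> a] by simp
 next
  fix C :: "'b set" assume C[measurable]: "C \<in> sets borel"
  have [measurable]: "(\<lambda>(a, b). ennreal (f (a, b)) * indicator C b) \<in> borel_measurable (\<a> \<Otimes>\<^sub>M borel)"
   by measurable
  have "(\<lambda>a. \<integral>\<^sup>+b. ennreal (f (a, b)) * indicator C b \<partial>\<theta> a) \<in> borel_measurable \<a>"
   by (rule nn_integral_measurable_subprob_algebra2[OF _ \<theta>_m]) measurable
  then show "(\<lambda>a. emeasure (density (\<theta> a) (\<lambda>b. ennreal (f (a, b)))) C) \<in> borel_measurable \<a>"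
  proof (rule measurable_cong[THEN iffD1, rotated])
   fix a assume a: "a \<in> space \<a>"
   show "(\<integral>\<^sup>+b. ennreal (f (a, b)) * indicator C b \<partial>\<theta> a) = emeasure (density (\<theta> a) (\<lambda>b. ennreal (f (a, b)))) C"
    using kernel_fiber(2)[OF \<theta> a] C f_fib[of a] by (intro emeasure_density[symmetric]) (auto cong: measurable_cong_sets)
  qed
 qed
qed

lemma (in two_unities) wzy_product:
 assumes "prob_space s" "sets s = sets borel" "prob_space u" "sets u = sets borel"
 shows "wzy (s \<Otimes>\<^sub>M u) p r = wz s p * wy u r"
 unfolding wzy_def wz_def wy_def by (rule integral_product_functions[OF assms \<zeta>b \<xi>b])

text \<open>Uniform modulus of continuity in the fiber variables only; in \<open>a\<close> mere
 measurability is enough, because the first marginal is the same for all measures considered.\<close>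

definition fiberwise_osc ::
 "'a measure => 'b::metric_space set => 'c::metric_space set => ('a \<times> ('b \<times> 'c) => real) => real => real => bool" where
 "fiberwise_osc \<a> Z Y k d e \<longleftrightarrow>
   (AE a in \<a>. \<forall>z\<in>Z. \<forall>z'\<in>Z. \<forall>y\<in>Y. \<forall>y'\<in>Y. dist z z' < d \<longrightarrow> dist y y' < d \<longrightarrow> \<bar>k (a, (z, y)) - k (a, (z', y'))\<bar> \<le> e)"

lemma fiberwise_osc_mono: "fiberwise_osc \<a> Z Y k d e ==> d' \<le> d ==> fiberwise_osc \<a> Z Y k d' e"
 unfolding fiberwise_osc_def by (elim eventually_mono) (meson less_le_trans)

text \<open>The data of the limit passage: kernels of marginals supported in compact sets and converging in
 mean, tested with one continuous function at a time.\<close>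

locale glued_limit =
 fixes \<a> :: "'a::euclidean_space measure" and Z :: "'b::euclidean_space set" and Y :: "'c::euclidean_space set"
  and \<sigma> :: "'a => 'b measure" and \<pi> :: "'a => 'c measure"
  and \<sigma>s :: "nat => 'a => 'b measure" and \<pi>s :: "nat => 'a => 'c measure" and N :: "nat set"
 assumes fin: "finite_measure \<a>" and sets_\<a>: "sets \<a> = sets borel"
  and Z: "compact Z" "Z \<noteq> {}" and Y: "compact Y" "Y \<noteq> {}"
  and \<sigma>: "kernel \<a> \<sigma>" and \<pi>: "kernel \<a> \<pi>"
  and \<sigma>s: "\<And>n. kernel \<a> (\<sigma>s n)" and \<pi>s: "\<And>n. kernel \<a> (\<pi>s n)"
  and supp: "\<And>a. emeasure (\<sigma> a) (- Z) = 0" "\<And>a. emeasure (\<pi> a) (- Y) = 0"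
  and supps: "\<And>n a. emeasure (\<sigma>s n a) (- Z) = 0" "\<And>n a. emeasure (\<pi>s n a) (- Y) = 0"
  and \<sigma>_lim: "\<And>h. bounded_borel h ==> continuous_on Z h ==>
    ((\<lambda>n. \<integral>a. \<bar>(\<integral>z. h z \<partial>\<sigma>s n a) - (\<integral>z. h z \<partial>\<sigma> a)\<bar> \<partial>\<a>) \<longlongrightarrow> 0) (along N)"
  and \<pi>_lim: "\<And>h. bounded_borel h ==> continuous_on Y h ==>
    ((\<lambda>n. \<integral>a. \<bar>(\<integral>y. h y \<partial>\<pi>s n a) - (\<integral>y. h y \<partial>\<pi> a)\<bar> \<partial>\<a>) \<longlongrightarrow> 0) (along N)"
begin

abbreviation limit_prod where "limit_prod a \<equiv> \<sigma> a \<Otimes>\<^sub>M \<pi> a"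
abbreviation prods where "prods n a \<equiv> \<sigma>s n a \<Otimes>\<^sub>M \<pi>s n a"

lemma space_\<a>: "space \<a> = UNIV"
 using sets_\<a> by (auto dest: sets_eq_imp_space_eq)

lemmas fib = kernel_fiber[OF \<sigma>, unfolded space_\<a>, OF UNIV_I] kernel_fiber[OF \<pi>, unfolded space_\<a>, OF UNIV_I]
 kernel_fiber[OF \<sigma>s, unfolded space_\<a>, OF UNIV_I] kernel_fiber[OF \<pi>s, unfolded space_\<a>, OF UNIV_I]

lemma coupling_support:
 assumes \<gamma>: "\<gamma> \<in> couplings s u" and s: "emeasure s (- Z) = 0" and u: "emeasure u (- Y) = 0"
 shows "AE q in \<gamma>. fst q \<in> Z \<and> snd q \<in> Y"
proof -
 have sets: "sets \<gamma> = sets borel" and m: "distr \<gamma> borel fst = s" "distr \<gamma> borel snd = u"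
  using \<gamma> by (auto simp: couplings_def)
 note meas = measurable_cong_sets[OF sets refl]
 have cl: "- Z \<in> sets borel" "- Y \<in> sets borel" by (intro borel_open open_Compl compact_imp_closed Z Y)+
 have ms: "fst \<in> \<gamma> \<rightarrow>\<^sub>M borel" "snd \<in> \<gamma> \<rightarrow>\<^sub>M borel" by (simp_all add: meas)
 have "AE z in s. z \<notin> - Z" using s cl m(1) by (intro AE_not_in) (auto simp: null_sets_def)
 then have 1: "AE q in \<gamma>. fst q \<notin> - Z" unfolding m(1)[symmetric] using ms(1) by (rule AE_distrD[rotated])
 have "AE y in u. y \<notin> - Y" using u cl m(2) by (intro AE_not_in) (auto simp: null_sets_def)
 then have 2: "AE q in \<gamma>. snd q \<notin> - Y" unfolding m(2)[symmetric] using ms(2) by (rule AE_distrD[rotated])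
 from 1 2 show ?thesis by eventually_elim simp
qed

lemma product_support:
 assumes s: "prob_space s" "sets s = sets borel" "emeasure s (- Z) = 0" and u: "prob_space u" "sets u = sets borel" "emeasure u (- Y) = 0"
 shows "AE q in s \<Otimes>\<^sub>M u. fst q \<in> Z \<and> snd q \<in> Y"
 using product_marginals[OF s(1,2) u(1,2)] by (intro coupling_support[OF _ s(3) u(3)]) (simp add: couplings_def)

lemma unities:
 assumes "0 < d"
 obtains P R \<zeta> \<xi> where "two_unities P R \<zeta> \<xi>" "P \<subseteq> Z" "R \<subseteq> Y"
  "\<And>p. continuous_on Z (\<zeta> p)" "\<And>r. continuous_on Y (\<xi> r)"
  "\<And>p z. z \<in> Z ==> \<zeta> p z \<noteq> 0 ==> dist z p < d" "\<And>r y. y \<in> Y ==> \<xi> r y \<noteq> 0 ==> dist y r < d"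
proof -
 obtain P and \<zeta> :: "'b => 'b => real" where P: "finite P" "P \<subseteq> Z" "\<And>p. bounded_borel (\<zeta> p)" "\<And>p. continuous_on Z (\<zeta> p)" "\<And>p z. 0 \<le> \<zeta> p z"
  "\<And>z. (\<Sum>p\<in>P. \<zeta> p z) = 1" "\<And>p z. z \<in> Z ==> \<zeta> p z \<noteq> 0 ==> dist z p < d"
  using partition_of_unity[OF Z assms] by blast
 obtain R and \<xi> :: "'c => 'c => real" where R: "finite R" "R \<subseteq> Y" "\<And>p. bounded_borel (\<xi> p)" "\<And>p. continuous_on Y (\<xi> p)" "\<And>p z. 0 \<le> \<xi> p z"
  "\<And>z. (\<Sum>p\<in>R. \<xi> p z) = 1" "\<And>p z. z \<in> Y ==> \<xi> p z \<noteq> 0 ==> dist z p < d"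
  using partition_of_unity[OF Y assms] by blast
 have "two_unities P R \<zeta> \<xi>" by unfold_locales (use P R in auto)
 then show thesis using that P R by blast
qed

lemma block_osc:
 assumes osc: "\<forall>z\<in>Z. \<forall>z'\<in>Z. \<forall>y\<in>Y. \<forall>y'\<in>Y. dist z z' < d \<longrightarrow> dist y y' < d \<longrightarrow> \<bar>k (z, y) - k (z', y')\<bar> \<le> e"
  and P: "P \<subseteq> Z" "R \<subseteq> Y"
  and \<zeta>: "\<And>p z. z \<in> Z ==> \<zeta> p z \<noteq> 0 ==> dist z p < d" and \<xi>: "\<And>r y. y \<in> Y ==> \<xi> r y \<noteq> 0 ==> dist y r < d"
  and supp: "AE q in \<gamma>. fst q \<in> Z \<and> snd q \<in> Y" and p: "p \<in> P" and r: "r \<in> R"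
 shows "AE q in \<gamma>. \<zeta> p (fst q) \<noteq> 0 \<longrightarrow> \<xi> r (snd q) \<noteq> 0 \<longrightarrow> \<bar>k q - k (p, r)\<bar> \<le> e"
 using supp
proof eventually_elim
 case (elim q)
 show ?case
 proof (intro impI)
  assume nz: "\<zeta> p (fst q) \<noteq> 0" "\<xi> r (snd q) \<noteq> 0"
  have "dist (fst q) p < d" "dist (snd q) r < d" using \<zeta> \<xi> nz elim by auto
  then have "\<bar>k (fst q, snd q) - k (p, r)\<bar> \<le> e" using osc elim P p r by blast
  then show "\<bar>k q - k (p, r)\<bar> \<le> e" by simp
 qed
qed

lemma kernel_integral_bounded:
 fixes h :: "'d::second_countable_topology => real"
 assumes "kernel \<a> \<k>" "bounded_borel h"
 shows "bounded_borel (\<lambda>a. \<integral>b. h b \<partial>\<k> a)"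
 using bounded_borel_kernel_integral[OF fin sets_\<a> assms(1) bounded_borel_snd[OF assms(2)]] by simp

lemma \<a>_integrable: "bounded_borel f ==> integrable \<a> f"
 by (rule bounded_borel_integrable[OF fin sets_\<a>])

text \<open>Functions of finitely many averages against \<open>\<sigma>\<^sup>n\<close> and \<open>\<pi>\<^sup>n\<close> inherit convergence in mean; only
 continuity along sequences at the limit averages is used.\<close>

lemma unities_transfer:
 fixes U :: "nat => 'a => real"
 assumes fin_PR: "finite P" "finite R" and \<zeta>: "\<And>p. bounded_borel (\<zeta> p)" "\<And>p. continuous_on Z (\<zeta> p)"
  and \<xi>: "\<And>r. bounded_borel (\<xi> r)" "\<And>r. continuous_on Y (\<xi> r)"
  and U: "\<And>n. bounded_borel (U n)" "\<And>n a. \<bar>U n a\<bar> \<le> C"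
  and lim: "\<And>a r. (\<And>p. p \<in> P ==> (\<lambda>j. \<integral>z. \<zeta> p z \<partial>\<sigma>s (r j) a) \<longlonglongrightarrow> (\<integral>z. \<zeta> p z \<partial>\<sigma> a)) ==>
   (\<And>q. q \<in> R ==> (\<lambda>j. \<integral>y. \<xi> q y \<partial>\<pi>s (r j) a) \<longlonglongrightarrow> (\<integral>y. \<xi> q y \<partial>\<pi> a)) ==> (\<lambda>j. U (r j) a) \<longlonglongrightarrow> 0"
 shows "((\<lambda>n. \<integral>a. U n a \<partial>\<a>) \<longlongrightarrow> 0) (along N)"
proof -
 let ?Z = "\<lambda>i n a. case i of Inl p => \<integral>z. \<zeta> p z \<partial>\<sigma>s n a | Inr r => \<integral>y. \<xi> r y \<partial>\<pi>s n a"
 let ?Y = "\<lambda>i a. case i of Inl p => \<integral>z. \<zeta> p z \<partial>\<sigma> a | Inr r => \<integral>y. \<xi> r y \<partial>\<pi> a"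
 show ?thesis
 proof (rule L1_convergence_transfer[OF fin, where I="Inl ` P \<union> Inr ` R" and X="?Z" and ?X0.0="?Y" and C=C])
  show "finite (Inl ` P \<union> Inr ` R)" using fin_PR by simp
  show "U n \<in> borel_measurable \<a>" for n
   using bounded_borel_measurable[OF U(1)[of n]] by (simp add: measurable_cong_sets[OF sets_\<a> refl])
  show "\<bar>U n a\<bar> \<le> C" for n a by (rule U(2))
  show "(\<lambda>j. U (r j) a) \<longlonglongrightarrow> 0" if c: "\<And>i. i \<in> Inl ` P \<union> Inr ` R ==> (\<lambda>j. ?Z i (r j) a) \<longlonglongrightarrow> ?Y i a" for a r
  proof (rule lim)
   show "(\<lambda>j. \<integral>z. \<zeta> p z \<partial>\<sigma>s (r j) a) \<longlonglongrightarrow> (\<integral>z. \<zeta> p z \<partial>\<sigma> a)" if "p \<in> P" for p using c[of "Inl p"] that by simp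
   show "(\<lambda>j. \<integral>y. \<xi> q y \<partial>\<pi>s (r j) a) \<longlonglongrightarrow> (\<integral>y. \<xi> q y \<partial>\<pi> a)" if "q \<in> R" for q using c[of "Inr q"] that by simp
  qed
  fix i
  show "integrable \<a> (?Z i n)" for n
   by (cases i) (auto intro!: \<a>_integrable kernel_integral_bounded \<sigma>s \<pi>s \<zeta> \<xi>)
  show "integrable \<a> (?Y i)"
   by (cases i) (auto intro!: \<a>_integrable kernel_integral_bounded \<sigma> \<pi> \<zeta> \<xi>)
  show "((\<lambda>n. \<integral>a. \<bar>?Z i n a - ?Y i a\<bar> \<partial>\<a>) \<longlongrightarrow> 0) (along N)"
   using \<sigma>_lim[OF \<zeta>] \<pi>_lim[OF \<xi>] by (cases i) auto
 qed
qed

text \<open>Up to the oscillation of \<open>k\<close> on blocks, the integral over a fiber is a fixed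
 polynomial in the block weights of the two marginals.\<close>

lemma weak_limit_products:
 assumes k: "bounded_borel k" and osc: "\<And>e. 0 < e ==> \<exists>d>0. fiberwise_osc \<a> Z Y k d e"
 shows "((\<lambda>n. \<integral>x. k x \<partial>glue \<a> (prods n)) \<longlongrightarrow> (\<integral>x. k x \<partial>glue \<a> limit_prod)) (along N)"
proof (rule tendstoI)
 interpret \<a>: finite_measure \<a> by (rule fin)
 fix e0 :: real assume e0: "0 < e0"
 define A where "A = measure \<a> UNIV"
 have A: "0 \<le> A" by (simp add: A_def)
 define e where "e = e0 / (2 * (2 * A + 1))"
 have e: "0 < e" using e0 A by (simp add: e_def)
 obtain d where d: "0 < d" "fiberwise_osc \<a> Z Y k d e" using osc[OF e] by blast
 obtain P R \<zeta> \<xi> where tu: "two_unities P R \<zeta> \<xi>" and PR: "P \<subseteq> Z" "R \<subseteq> Y"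
  and cont: "\<And>p. continuous_on Z (\<zeta> p)" "\<And>r. continuous_on Y (\<xi> r)"
  and near: "\<And>p z. z \<in> Z ==> \<zeta> p z \<noteq> 0 ==> dist z p < d" "\<And>r y. y \<in> Y ==> \<xi> r y \<noteq> 0 ==> dist y r < d"
  using unities[OF d(1)] by blast
 interpret two_unities P R \<zeta> \<xi> by (rule tu)
 obtain B where B: "\<And>x. \<bar>k x\<bar> \<le> B" using k unfolding bounded_borel_def by blast
 define V where "V n a = (\<Sum>p\<in>P. \<Sum>r\<in>R. k (a, (p, r)) * (wz (\<sigma>s n a) p * wy (\<pi>s n a) r - wz (\<sigma> a) p * wy (\<pi> a) r))" for n a
 have wb: "bounded_borel (\<lambda>a. wz (\<sigma>s n a) p)" "bounded_borel (\<lambda>a. wz (\<sigma> a) p)"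
  "bounded_borel (\<lambda>a. wy (\<pi>s n a) r)" "bounded_borel (\<lambda>a. wy (\<pi> a) r)" for n p r
  unfolding wz_def wy_def by (simp_all add: kernel_integral_bounded \<sigma> \<pi> \<sigma>s \<pi>s)
 have kb: "bounded_borel (\<lambda>a. k (a, q))" for q
  by (rule bounded_borel_comp[OF k]) (intro borel_measurable_Pair_borel, auto)
 have Vb: "bounded_borel (V n)" for n
  unfolding V_def by (intro bounded_borel_sum bounded_borel_mult bounded_borel_diff kb wb)
 have w01: "0 \<le> wz (\<sigma> a) p" "0 \<le> wz (\<sigma>s n a) p" "0 \<le> wy (\<pi> a) r" "0 \<le> wy (\<pi>s n a) r" for a n p r
  using wz_sum(2)[OF fib(1,2)] wz_sum(2)[OF fib(7,8)] wy_sum(2)[OF fib(4,5)] wy_sum(2)[OF fib(10,11)] by auto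
 have w1: "wz (\<sigma> a) p \<le> 1" "wz (\<sigma>s n a) p \<le> 1" if "p \<in> P" for a n p
  using member_le_sum[OF that, of "wz (\<sigma> a)"] member_le_sum[OF that, of "wz (\<sigma>s n a)"] finP w01
   wz_sum(1)[OF fib(1,2), of a] wz_sum(1)[OF fib(7,8), of n a] by auto
 have w2: "wy (\<pi> a) r \<le> 1" "wy (\<pi>s n a) r \<le> 1" if "r \<in> R" for a n r
  using member_le_sum[OF that, of "wy (\<pi> a)"] member_le_sum[OF that, of "wy (\<pi>s n a)"] finR w01
   wy_sum(1)[OF fib(4,5), of a] wy_sum(1)[OF fib(10,11), of n a] by auto
 have V_lim: "((\<lambda>n. \<integral>a. V n a \<partial>\<a>) \<longlongrightarrow> 0) (along N)"
 proof (rule unities_transfer[OF finP finR \<zeta>b cont(1) \<xi>b cont(2) Vb, folded wz_def wy_def])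
  show "\<bar>V n a\<bar> \<le> (\<Sum>p\<in>P. \<Sum>r\<in>R. B * 1)" for n a
   unfolding V_def
  proof (intro order_trans[OF sum_abs] sum_mono)
   fix p r assume pr: "p \<in> P" "r \<in> R"
   have "0 \<le> wz (\<sigma>s n a) p * wy (\<pi>s n a) r" "wz (\<sigma>s n a) p * wy (\<pi>s n a) r \<le> 1"
    "0 \<le> wz (\<sigma> a) p * wy (\<pi> a) r" "wz (\<sigma> a) p * wy (\<pi> a) r \<le> 1"
    using w01 w1[OF pr(1)] w2[OF pr(2)] by (auto intro: mult_le_one)
   then have "\<bar>wz (\<sigma>s n a) p * wy (\<pi>s n a) r - wz (\<sigma> a) p * wy (\<pi> a) r\<bar> \<le> 1" by argo
   then show "\<bar>k (a, (p, r)) * (wz (\<sigma>s n a) p * wy (\<pi>s n a) r - wz (\<sigma> a) p * wy (\<pi> a) r)\<bar> \<le> B * 1"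
    unfolding abs_mult using B[of "(a, (p, r))"] by (intro mult_mono) auto
  qed
  fix a r assume c: "\<And>p. p \<in> P ==> (\<lambda>j. wz (\<sigma>s (r j) a) p) \<longlonglongrightarrow> wz (\<sigma> a) p" "\<And>q. q \<in> R ==> (\<lambda>j. wy (\<pi>s (r j) a) q) \<longlonglongrightarrow> wy (\<pi> a) q"
  have "(\<lambda>j. V (r j) a) \<longlonglongrightarrow> (\<Sum>p\<in>P. \<Sum>r\<in>R. k (a, (p, r)) * (wz (\<sigma> a) p * wy (\<pi> a) r - wz (\<sigma> a) p * wy (\<pi> a) r))"
   unfolding V_def by (intro tendsto_intros c)
  then show "(\<lambda>j. V (r j) a) \<longlonglongrightarrow> 0" by simp
 qed
 have fiber: "AE a in \<a>. \<bar>(\<integral>q. k (a, q) \<partial>(prods n a)) - (\<integral>q. k (a, q) \<partial>(limit_prod a)) - V n a\<bar> \<le> 2 * e" for n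
  using d(2) unfolding fiberwise_osc_def
 proof eventually_elim
  case (elim a)
  note pm = product_marginals[OF fib(7,8) fib(10,11), of n a n a] product_marginals[OF fib(1,2) fib(4,5), of a a]
  have 1: "\<bar>(\<integral>q. k (a, q) \<partial>(prods n a)) - (\<Sum>p\<in>P. \<Sum>r\<in>R. k (a, (p, r)) * wzy (prods n a) p r)\<bar> \<le> e"
   by (rule coupling_approx[OF pm(3,4) bounded_borel_Pair[OF k]])
     (rule block_osc[OF elim PR near product_support[OF fib(7,8) supps(1) fib(10,11) supps(2)]])
  have 2: "\<bar>(\<integral>q. k (a, q) \<partial>(limit_prod a)) - (\<Sum>p\<in>P. \<Sum>r\<in>R. k (a, (p, r)) * wzy (limit_prod a) p r)\<bar> \<le> e"
   by (rule coupling_approx[OF pm(7,8) bounded_borel_Pair[OF k]])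
     (rule block_osc[OF elim PR near product_support[OF fib(1,2) supp(1) fib(4,5) supp(2)]])
  have "V n a = (\<Sum>p\<in>P. \<Sum>r\<in>R. k (a, (p, r)) * wzy (prods n a) p r) - (\<Sum>p\<in>P. \<Sum>r\<in>R. k (a, (p, r)) * wzy (limit_prod a) p r)"
   unfolding V_def wzy_product[OF fib(7,8) fib(10,11)] wzy_product[OF fib(1,2) fib(4,5)]
   by (simp add: right_diff_distrib sum_subtractf)
  with 1 2 show ?case by argo
 qed
 note \<theta>s = product_kernel[OF \<sigma>s \<pi>s] and \<theta> = product_kernel[OF \<sigma> \<pi>]
 have key: "\<bar>(\<integral>x. k x \<partial>glue \<a> (prods n)) - (\<integral>x. k x \<partial>glue \<a> limit_prod) - (\<integral>a. V n a \<partial>\<a>)\<bar> \<le> 2 * e * A" for n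
 proof -
  note i = \<a>_integrable[OF bounded_borel_kernel_integral[OF fin sets_\<a> \<theta>s k]] \<a>_integrable[OF bounded_borel_kernel_integral[OF fin sets_\<a> \<theta> k]] \<a>_integrable[OF Vb]
  have "(\<integral>x. k x \<partial>glue \<a> (prods n)) - (\<integral>x. k x \<partial>glue \<a> limit_prod) - (\<integral>a. V n a \<partial>\<a>)
   = (\<integral>a. (\<integral>q. k (a, q) \<partial>(prods n a)) - (\<integral>q. k (a, q) \<partial>(limit_prod a)) - V n a \<partial>\<a>)"
   unfolding integral_glue[OF fin sets_\<a> \<theta>s k] integral_glue[OF fin sets_\<a> \<theta> k] using i by simp
  also have "\<bar>\<dots>\<bar> \<le> (\<integral>a. 2 * e \<partial>\<a>)"
   by (rule order_trans[OF integral_abs_bound integral_mono_AE]) (use i fiber in auto)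
  finally show ?thesis by (simp add: A_def space_\<a> mult_ac)
 qed
 have "\<forall>\<^sub>F n in along N. dist (\<integral>a. V n a \<partial>\<a>) 0 < e0 / 2"
  using V_lim e0 by (intro tendstoD) auto
 then show "\<forall>\<^sub>F n in along N. dist (\<integral>x. k x \<partial>glue \<a> (prods n)) (\<integral>x. k x \<partial>glue \<a> limit_prod) < e0"
 proof eventually_elim
  case (elim n)
  have "2 * e * A \<le> e * (2 * A + 1)" using e by (simp add: algebra_simps)
  also have "\<dots> = e0 / 2"
  proof -
   have "2 * A + 1 \<noteq> 0" using A by argo
   then show ?thesis by (simp add: e_def field_simps)
  qed
  finally show ?case using elim key[of n] unfolding dist_real_def by argo
 qed
qed

text \<open>Couplings \<open>\<k>s n\<close> of the marginals at \<open>n\<close> that reproduce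
 \<open>\<k>\<close> up to oscillations at scale \<open>d\<close>, with entropy bounds \<open>\<rho>s
 n\<close> whose mean tends to \<open>R\<close>, the entropy of the block weights of
 \<open>\<k>\<close>.\<close>

definition block_approximation ::
 "('a => ('b \<times> 'c) measure) => real => (nat => 'a => ('b \<times> 'c) measure) => (nat => real) => (nat => 'a => real) => real => bool" where
 "block_approximation \<k> d \<k>s E \<rho>s R \<longleftrightarrow>
   (\<forall>n. kernel \<a> (\<k>s n)) \<and> (\<forall>n a. \<k>s n a \<in> couplings (\<sigma>s n a) (\<pi>s n a)) \<and>
   ((E \<longlongrightarrow> 0) (along N)) \<and>
   (\<forall>n k B e. bounded_borel k \<longrightarrow> (\<forall>x. \<bar>k x\<bar> \<le> B) \<longrightarrow> 0 \<le> e \<longrightarrow> fiberwise_osc \<a> Z Y k d e \<longrightarrow>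
    \<bar>(\<integral>x. k x \<partial>glue \<a> (\<k>s n)) - (\<integral>x. k x \<partial>glue \<a> \<k>)\<bar> \<le> 2 * e * measure \<a> UNIV + B * E n) \<and>
   (\<forall>n. bounded_borel (\<rho>s n)) \<and> (\<forall>n a. 0 \<le> \<rho>s n a) \<and> (\<forall>n a. KL (\<k>s n a) (prods n a) \<le> ereal (\<rho>s n a)) \<and>
   ((\<lambda>n. \<integral>a. \<rho>s n a \<partial>\<a>) \<longlongrightarrow> R) (along N) \<and>
   (\<forall>f. f \<in> borel_measurable borel \<longrightarrow> (\<forall>x. 0 \<le> f x) \<longrightarrow>
    glue \<a> \<k> = density (glue \<a> limit_prod) (\<lambda>x. ennreal (f x)) \<longrightarrow>
    ennreal R \<le> (\<integral>\<^sup>+x. ennreal (kl_phi (f x)) \<partial>glue \<a> limit_prod))"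

lemma block_approximation_exists:
 assumes \<k>: "kernel \<a> \<k>" and coup: "\<And>a. \<k> a \<in> couplings (\<sigma> a) (\<pi> a)" and d: "0 < d"
 shows "\<exists>\<k>s E \<rho>s R. block_approximation \<k> d \<k>s E \<rho>s R"
proof -
 interpret \<a>: finite_measure \<a> by (rule fin)
 obtain P R \<zeta> \<xi> where tu: "two_unities P R \<zeta> \<xi>" and PR: "P \<subseteq> Z" "R \<subseteq> Y"
  and cont: "\<And>p. continuous_on Z (\<zeta> p)" "\<And>r. continuous_on Y (\<xi> r)"
  and near: "\<And>p z. z \<in> Z ==> \<zeta> p z \<noteq> 0 ==> dist z p < d" "\<And>r y. y \<in> Y ==> \<xi> r y \<noteq> 0 ==> dist y r < d"
  using unities[OF d] by blast
 interpret two_unities P R \<zeta> \<xi> by (rule tu)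
 note fib\<k> = kernel_fiber[OF \<k>, unfolded space_\<a>, OF UNIV_I]
 have fc: "finite_coupling P R (wz (\<sigma> a)) (wy (\<pi> a)) (wzy (\<k> a))" for a
  by (rule coupling_weights[OF fib(1,2) fib(4,5) fib\<k>(1) coup])
 have fca: "finite_coupling_adjust P R (wz (\<sigma> a)) (wy (\<pi> a)) (wzy (\<k> a)) (wz (\<sigma>s n a)) (wy (\<pi>s n a))" for n a
  using fc[of a] wz_sum[OF fib(7,8), of n a] wy_sum[OF fib(10,11), of n a]
  by (simp add: finite_coupling_adjust_def finite_coupling_adjust_axioms_def)
 define W where "W n a = adjust P R (wz (\<sigma> a)) (wy (\<pi> a)) (wz (\<sigma>s n a)) (wy (\<pi>s n a)) (wzy (\<k> a))" for n a
 have fcW: "finite_coupling P R (wz (\<sigma>s n a)) (wy (\<pi>s n a)) (W n a)" for n a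
  unfolding W_def by (rule finite_coupling_adjust.adjust_coupling[OF fca])
 define \<k>s where "\<k>s n a = block_measure (\<sigma>s n a) (\<pi>s n a) (W n a)" for n a
 have wb: "bounded_borel (\<lambda>a. wz (\<sigma>s n a) p)" "bounded_borel (\<lambda>a. wz (\<sigma> a) p)"
  "bounded_borel (\<lambda>a. wy (\<pi>s n a) r)" "bounded_borel (\<lambda>a. wy (\<pi> a) r)" "bounded_borel (\<lambda>a. wzy (\<k> a) p r)" for n p r
  unfolding wz_def wy_def wzy_def by (simp_all add: kernel_integral_bounded \<sigma> \<pi> \<sigma>s \<pi>s \<k>)
 note [measurable] = wb[THEN bounded_borel_measurable]
 have W_m[measurable]: "(\<lambda>a. W n a p r) \<in> borel_measurable borel" for n p r
  unfolding W_def adjust_def overlap_def Let_def by measurable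
 have W01: "0 \<le> W n a p r" "W n a p r \<le> 1" "W n a p r \<le> wz (\<sigma>s n a) p" "W n a p r \<le> wy (\<pi>s n a) r"
   "wz (\<sigma>s n a) p \<le> 1" "wy (\<pi>s n a) r \<le> 1" if "p \<in> P" "r \<in> R" for n a p r
  using finite_coupling.w0[OF fcW that] finite_coupling.w_le_s[OF fcW that] finite_coupling.s_le_1[OF fcW that(1)]
   finite_coupling.w_le_q[OF fcW that] finite_coupling.q_le_1[OF fcW that(2)]
   order_trans[OF finite_coupling.w_le_s[OF fcW that] finite_coupling.s_le_1[OF fcW that(1)]]
  by auto
 have w01: "0 \<le> wzy (\<k> a) p r" "wzy (\<k> a) p r \<le> 1" "wzy (\<k> a) p r \<le> wz (\<sigma> a) p" "wzy (\<k> a) p r \<le> wy (\<pi> a) r"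
   "wz (\<sigma> a) p \<le> 1" "wy (\<pi> a) r \<le> 1" "0 \<le> wz (\<sigma> a) p" "0 \<le> wy (\<pi> a) r" if "p \<in> P" "r \<in> R" for a p r
  using finite_coupling.w0[OF fc that] finite_coupling.w_le_s[OF fc that] finite_coupling.s_le_1[OF fc that(1)]
   finite_coupling.w_le_q[OF fc that] finite_coupling.q_le_1[OF fc that(2)]
   finite_coupling.s0[OF fc that(1)] finite_coupling.q0[OF fc that(2)]
   order_trans[OF finite_coupling.w_le_s[OF fc that] finite_coupling.s_le_1[OF fc that(1)]]
  by auto
 have \<k>s: "kernel \<a> (\<k>s n)" for n
 proof -
  define H where "H x = block_density (\<lambda>p r. W n (fst x) p r / (wz (\<sigma>s n (fst x)) p * wy (\<pi>s n (fst x)) r)) (snd x)" for x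
  have f1: "(\<lambda>x :: 'a \<times> 'b \<times> 'c. g (fst x)) \<in> borel_measurable borel" if "g \<in> borel_measurable borel" for g :: "'a => real"
   using measurable_compose[OF borel_measurable_fst_borel that] .
  have f2: "(\<lambda>x :: 'a \<times> 'b \<times> 'c. \<zeta> p (fst (snd x))) \<in> borel_measurable borel" for p
   using measurable_compose[OF borel_measurable_snd_borel measurable_compose[OF borel_measurable_fst_borel bounded_borel_measurable[OF \<zeta>b]]] .
  have f3: "(\<lambda>x :: 'a \<times> 'b \<times> 'c. \<xi> r (snd (snd x))) \<in> borel_measurable borel" for r
   using measurable_compose[OF borel_measurable_snd_borel measurable_compose[OF borel_measurable_snd_borel bounded_borel_measurable[OF \<xi>b]]] .
  have Hm: "H \<in> borel_measurable borel"
   unfolding H_def block_density_def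
   by (intro borel_measurable_sum borel_measurable_times borel_measurable_divide f1 f2 f3 W_m wb[THEN bounded_borel_measurable])
  have eq: "\<k>s n a = density (prods n a) (\<lambda>q. ennreal (H (a, q)))" for a
   by (simp add: \<k>s_def block_measure_def H_def)
  have "kernel \<a> (\<lambda>a. density (prods n a) (\<lambda>q. ennreal (H (a, q))))"
   by (rule density_kernel[OF sets_\<a> product_kernel[OF \<sigma>s \<pi>s] Hm])
     (simp add: eq[symmetric] \<k>s_def block_measure_prob[OF fib(7,8) fib(10,11) fcW])
  then show ?thesis by (simp add: eq[abs_def] cong: measurable_cong)
 qed
 have \<k>s_c: "\<k>s n a \<in> couplings (\<sigma>s n a) (\<pi>s n a)" for n a
  unfolding \<k>s_def by (rule block_measure_coupling[OF fib(7,8) fib(10,11) fcW])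
 define V where "V n a = (\<Sum>p\<in>P. \<Sum>r\<in>R. \<bar>W n a p r - wzy (\<k> a) p r\<bar>)" for n a
 define \<rho>s where "\<rho>s n a = (\<Sum>p\<in>P. \<Sum>r\<in>R. kl_term (W n a p r) (wz (\<sigma>s n a) p) (wy (\<pi>s n a) r))" for n a
 define \<rho> where "\<rho> a = (\<Sum>p\<in>P. \<Sum>r\<in>R. kl_term (wzy (\<k> a) p r) (wz (\<sigma> a) p) (wy (\<pi> a) r))" for a
 have kl_m: "(\<lambda>a. kl_term (f a) (g a) (h a)) \<in> borel_measurable borel"
  if [measurable]: "f \<in> borel_measurable borel" "g \<in> borel_measurable borel" "h \<in> borel_measurable borel" for f g h :: "'a => real"
  unfolding kl_term_def by measurable
 have klt: "0 \<le> kl_term (W n a p r) (wz (\<sigma>s n a) p) (wy (\<pi>s n a) r)" "kl_term (W n a p r) (wz (\<sigma>s n a) p) (wy (\<pi>s n a) r) \<le> 3"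
  "0 \<le> kl_term (wzy (\<k> a) p r) (wz (\<sigma> a) p) (wy (\<pi> a) r)" "kl_term (wzy (\<k> a) p r) (wz (\<sigma> a) p) (wy (\<pi> a) r) \<le> 3"
  if pr: "p \<in> P" "r \<in> R" for n a p r
  using kl_term_bounds(1,3)[OF W01(1,3,4,5,6)[OF pr]] kl_term_bounds(1,3)[OF w01(1,3,4,5,6)[OF pr]] by auto
 have \<rho>s0: "0 \<le> \<rho>s n a" and \<rho>0: "0 \<le> \<rho> a" for n a
  unfolding \<rho>s_def \<rho>_def using klt by (auto intro!: sum_nonneg)
 have \<rho>s_le: "\<rho>s n a \<le> (\<Sum>p\<in>P. \<Sum>r\<in>R. 3)" and \<rho>_le: "\<rho> a \<le> (\<Sum>p\<in>P. \<Sum>r\<in>R. 3)" for n a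
  unfolding \<rho>s_def \<rho>_def using klt by (auto intro!: sum_mono simp del: sum_constant)
 have \<rho>s_b: "bounded_borel (\<rho>s n)" for n
 proof (rule bounded_borelI)
  show "\<rho>s n \<in> borel_measurable borel" unfolding \<rho>s_def
   by (intro borel_measurable_sum kl_m W_m wb[THEN bounded_borel_measurable])
  show "\<bar>\<rho>s n a\<bar> \<le> (\<Sum>p\<in>P. \<Sum>r\<in>R. 3)" for a using \<rho>s0[of n a] \<rho>s_le[of n a] by simp
 qed
 have \<rho>_b: "bounded_borel \<rho>"
 proof (rule bounded_borelI)
  show "\<rho> \<in> borel_measurable borel" unfolding \<rho>_def
   by (intro borel_measurable_sum kl_m wb[THEN bounded_borel_measurable])
  show "\<bar>\<rho> a\<bar> \<le> (\<Sum>p\<in>P. \<Sum>r\<in>R. 3)" for a using \<rho>0[of a] \<rho>_le[of a] by simp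
 qed
 have V_le: "\<bar>V n a\<bar> \<le> (\<Sum>p\<in>P. \<Sum>r\<in>R. 1)" for n a
 proof -
  have "V n a \<le> (\<Sum>p\<in>P. \<Sum>r\<in>R. 1)" unfolding V_def
  proof (intro sum_mono)
   fix p r assume "p \<in> P" "r \<in> R"
   from W01(1,2)[OF this, of n a] w01(1,2)[OF this, of a] show "\<bar>W n a p r - wzy (\<k> a) p r\<bar> \<le> 1" by argo
  qed
  moreover have "0 \<le> V n a" unfolding V_def by (intro sum_nonneg) auto
  ultimately show ?thesis by simp
 qed
 have V_b: "bounded_borel (V n)" for n
  by (rule bounded_borelI[OF _ V_le]) (unfold V_def, measurable)
 note transfer = unities_transfer[OF finP finR \<zeta>b cont(1) \<xi>b cont(2), folded wz_def wy_def]
 have W_lim: "(\<lambda>j. W (r j) a p q) \<longlonglongrightarrow> wzy (\<k> a) p q"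
  if "\<And>p. p \<in> P ==> (\<lambda>j. wz (\<sigma>s (r j) a) p) \<longlonglongrightarrow> wz (\<sigma> a) p" "\<And>q. q \<in> R ==> (\<lambda>j. wy (\<pi>s (r j) a) q) \<longlonglongrightarrow> wy (\<pi> a) q"
   "p \<in> P" "q \<in> R" for a r p q
  unfolding W_def by (rule adjust_tendsto[OF fc fca that])
 have E: "((\<lambda>n. \<integral>a. V n a \<partial>\<a>) \<longlongrightarrow> 0) (along N)"
 proof (rule transfer[OF V_b V_le])
  fix a r assume c: "\<And>p. p \<in> P ==> (\<lambda>j. wz (\<sigma>s (r j) a) p) \<longlonglongrightarrow> wz (\<sigma> a) p" "\<And>q. q \<in> R ==> (\<lambda>j. wy (\<pi>s (r j) a) q) \<longlonglongrightarrow> wy (\<pi> a) q"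
  have "(\<lambda>j. V (r j) a) \<longlonglongrightarrow> (\<Sum>p\<in>P. \<Sum>q\<in>R. \<bar>wzy (\<k> a) p q - wzy (\<k> a) p q\<bar>)"
   unfolding V_def by (intro tendsto_intros W_lim c)
  then show "(\<lambda>j. V (r j) a) \<longlonglongrightarrow> 0" by simp
 qed
 have R_lim: "((\<lambda>n. \<integral>a. \<rho>s n a \<partial>\<a>) \<longlongrightarrow> (\<integral>a. \<rho> a \<partial>\<a>)) (along N)"
 proof -
  have "((\<lambda>n. \<integral>a. \<rho>s n a - \<rho> a \<partial>\<a>) \<longlongrightarrow> 0) (along N)"
  proof (rule transfer[where C="\<Sum>p\<in>P. \<Sum>r\<in>R. 3"])
   show "bounded_borel (\<lambda>a. \<rho>s n a - \<rho> a)" for n by (intro bounded_borel_diff \<rho>s_b \<rho>_b)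
   show "\<bar>\<rho>s n a - \<rho> a\<bar> \<le> (\<Sum>p\<in>P. \<Sum>r\<in>R. 3)" for n a
    using \<rho>s0[of n a] \<rho>s_le[of n a] \<rho>0[of a] \<rho>_le[of a] by argo
   fix a r assume c: "\<And>p. p \<in> P ==> (\<lambda>j. wz (\<sigma>s (r j) a) p) \<longlonglongrightarrow> wz (\<sigma> a) p" "\<And>q. q \<in> R ==> (\<lambda>j. wy (\<pi>s (r j) a) q) \<longlonglongrightarrow> wy (\<pi> a) q"
   have "(\<lambda>j. \<rho>s (r j) a) \<longlonglongrightarrow> \<rho> a"
    unfolding \<rho>s_def \<rho>_def
   proof (intro tendsto_sum)
    fix p q assume pq: "p \<in> P" "q \<in> R"
    show "(\<lambda>j. kl_term (W (r j) a p q) (wz (\<sigma>s (r j) a) p) (wy (\<pi>s (r j) a) q)) \<longlonglongrightarrow> kl_term (wzy (\<k> a) p q) (wz (\<sigma> a) p) (wy (\<pi> a) q)"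
     by (rule kl_term_tendsto[OF W01(1,3,4,5,6)[OF pq] W_lim[OF c pq] c(1)[OF pq(1)] c(2)[OF pq(2)] w01(7,8,1)[OF pq]])
   qed
   then have "(\<lambda>j. \<rho>s (r j) a - \<rho> a) \<longlonglongrightarrow> \<rho> a - \<rho> a" by (intro tendsto_intros)
   then show "(\<lambda>j. \<rho>s (r j) a - \<rho> a) \<longlonglongrightarrow> 0" by simp
  qed
  moreover have "(\<integral>a. \<rho>s n a - \<rho> a \<partial>\<a>) = (\<integral>a. \<rho>s n a \<partial>\<a>) - (\<integral>a. \<rho> a \<partial>\<a>)" for n
   using \<a>_integrable[OF \<rho>s_b] \<a>_integrable[OF \<rho>_b] by simp
  ultimately show ?thesis by (simp add: Lim_null[symmetric])
 qed
 have approx: "\<bar>(\<integral>x. k x \<partial>glue \<a> (\<k>s n)) - (\<integral>x. k x \<partial>glue \<a> \<k>)\<bar> \<le> 2 * e * measure \<a> UNIV + B * (\<integral>a. V n a \<partial>\<a>)"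
  if k: "bounded_borel k" and B: "\<forall>x. \<bar>k x\<bar> \<le> B" and e: "0 \<le> e" and osc: "fiberwise_osc \<a> Z Y k d e" for n k B e
 proof -
  have fiber: "AE a in \<a>. \<bar>(\<integral>q. k (a, q) \<partial>\<k>s n a) - (\<integral>q. k (a, q) \<partial>\<k> a)\<bar> \<le> 2 * e + B * V n a"
   using osc unfolding fiberwise_osc_def
  proof eventually_elim
   case (elim a)
   have 1: "\<bar>(\<integral>q. k (a, q) \<partial>\<k>s n a) - (\<Sum>p\<in>P. \<Sum>r\<in>R. k (a, (p, r)) * W n a p r)\<bar> \<le> e"
    unfolding \<k>s_def
    by (rule block_measure_approx[OF fib(7,8) fib(10,11) fcW bounded_borel_Pair[OF k] e])
      (rule block_osc[OF elim PR near product_support[OF fib(7,8) supps(1) fib(10,11) supps(2)]])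
   have 2: "\<bar>(\<integral>q. k (a, q) \<partial>\<k> a) - (\<Sum>p\<in>P. \<Sum>r\<in>R. k (a, (p, r)) * wzy (\<k> a) p r)\<bar> \<le> e"
    by (rule coupling_approx[OF fib\<k>(1,2) bounded_borel_Pair[OF k]])
      (rule block_osc[OF elim PR near coupling_support[OF coup supp]])
   have "(\<Sum>p\<in>P. \<Sum>r\<in>R. k (a, (p, r)) * W n a p r) - (\<Sum>p\<in>P. \<Sum>r\<in>R. k (a, (p, r)) * wzy (\<k> a) p r)
    = (\<Sum>p\<in>P. \<Sum>r\<in>R. k (a, (p, r)) * (W n a p r - wzy (\<k> a) p r))"
    by (simp add: right_diff_distrib sum_subtractf)
   also have "\<bar>\<dots>\<bar> \<le> (\<Sum>p\<in>P. \<Sum>r\<in>R. B * \<bar>W n a p r - wzy (\<k> a) p r\<bar>)"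
    using B by (intro order_trans[OF sum_abs] sum_mono) (auto simp: abs_mult intro!: mult_right_mono)
   also have "\<dots> = B * V n a" by (simp add: V_def sum_distrib_left)
   finally show ?case using 1 2 by argo
  qed
  note i = \<a>_integrable[OF bounded_borel_kernel_integral[OF fin sets_\<a> \<k>s k]] \<a>_integrable[OF bounded_borel_kernel_integral[OF fin sets_\<a> \<k> k]] \<a>_integrable[OF V_b]
  have eq: "(\<integral>x. k x \<partial>glue \<a> (\<k>s n)) - (\<integral>x. k x \<partial>glue \<a> \<k>) = (\<integral>a. (\<integral>q. k (a, q) \<partial>\<k>s n a) - (\<integral>q. k (a, q) \<partial>\<k> a) \<partial>\<a>)"
   unfolding integral_glue[OF fin sets_\<a> \<k>s k] integral_glue[OF fin sets_\<a> \<k> k] using i by simp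
  have "\<bar>(\<integral>x. k x \<partial>glue \<a> (\<k>s n)) - (\<integral>x. k x \<partial>glue \<a> \<k>)\<bar> \<le> (\<integral>a. 2 * e + B * V n a \<partial>\<a>)"
   unfolding eq by (rule order_trans[OF integral_abs_bound integral_mono_AE]) (use i fiber in auto)
  also have "\<dots> = 2 * e * measure \<a> UNIV + B * (\<integral>a. V n a \<partial>\<a>)"
   using i by (simp add: space_\<a> mult_ac)
  finally show ?thesis .
 qed
 have KL_le: "KL (\<k>s n a) (prods n a) \<le> ereal (\<rho>s n a)" for n a
  unfolding \<k>s_def \<rho>s_def by (rule block_measure_KL[OF fib(7,8) fib(10,11) fcW])
 have R_le: "ennreal (\<integral>a. \<rho> a \<partial>\<a>) \<le> (\<integral>\<^sup>+x. ennreal (kl_phi (f x)) \<partial>glue \<a> limit_prod)"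
  if f: "f \<in> borel_measurable borel" "\<forall>x. 0 \<le> f x" "glue \<a> \<k> = density (glue \<a> limit_prod) (\<lambda>x. ennreal (f x))" for f
 proof -
  have "AE a in \<a>. \<k> a = density (limit_prod a) (\<lambda>q. ennreal (f (a, q)))"
   by (rule glue_density_fiber[OF fin sets_\<a> \<k> product_kernel[OF \<sigma> \<pi>] f(1) f(2)[rule_format] f(3)])
  then have "AE a in \<a>. ennreal (\<rho> a) \<le> (\<integral>\<^sup>+q. ennreal (kl_phi (f (a, q))) \<partial>(limit_prod a))"
  proof eventually_elim
   case (elim a)
   have "(\<lambda>q. f (a, q)) \<in> borel_measurable borel" using measurable_compose[OF measurable_Pair_borel f(1)] .
   from block_KL_le[OF fib(1,2) fib(4,5) this f(2)[rule_format] elim fib\<k>(1)] show ?case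
    by (simp add: \<rho>_def)
  qed
  then have "(\<integral>\<^sup>+a. ennreal (\<rho> a) \<partial>\<a>) \<le> (\<integral>\<^sup>+a. \<integral>\<^sup>+q. ennreal (kl_phi (f (a, q))) \<partial>(limit_prod a) \<partial>\<a>)"
   by (rule nn_integral_mono_AE)
  also have "\<dots> = (\<integral>\<^sup>+x. ennreal (kl_phi (f x)) \<partial>glue \<a> limit_prod)"
  proof (rule nn_integral_glue[OF sets_\<a> product_kernel[OF \<sigma> \<pi>], symmetric])
   show "(\<lambda>x. ennreal (kl_phi (f x))) \<in> borel_measurable borel" using f(1) by measurable
  qed
  also have "(\<integral>\<^sup>+a. ennreal (\<rho> a) \<partial>\<a>) = ennreal (\<integral>a. \<rho> a \<partial>\<a>)"
   using \<rho>0 by (intro nn_integral_eq_integral \<a>_integrable[OF \<rho>_b]) auto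
  finally show ?thesis .
 qed
 have "block_approximation \<k> d \<k>s (\<lambda>n. \<integral>a. V n a \<partial>\<a>) \<rho>s (\<integral>a. \<rho> a \<partial>\<a>)"
  unfolding block_approximation_def
  by (intro conjI allI impI \<k>s \<k>s_c E approx \<rho>s_b \<rho>s0 KL_le R_lim R_le) blast+
 then show ?thesis by blast
qed

text \<open>Mesh \<open>1/(m+1)\<close> is used at index \<open>n\<close> with \<open>m = m(n) \<rightarrow>
 \<infinity>\<close> so slowly that the errors at mesh \<open>1/(m+1)\<close> are already small.\<close>

lemma recovery_sequence:
 assumes \<k>: "kernel \<a> \<k>" and coup: "\<And>a. \<k> a \<in> couplings (\<sigma> a) (\<pi> a)"
  and bs: "(bs \<longlongrightarrow> b) (along N)" and b: "0 \<le> b" and K: "0 \<le> K"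
  and dens: "0 < b ==> \<exists>f. f \<in> borel_measurable borel \<and> (\<forall>x. 0 \<le> f x) \<and>
    glue \<a> \<k> = density (glue \<a> limit_prod) (\<lambda>x. ennreal (f x)) \<and>
    (\<integral>\<^sup>+x. ennreal (kl_phi (f x)) \<partial>glue \<a> limit_prod) \<le> ennreal K"
 obtains \<k>s \<rho>s where "\<And>n. kernel \<a> (\<k>s n)" "\<And>n a. \<k>s n a \<in> couplings (\<sigma>s n a) (\<pi>s n a)"
  "\<And>k. bounded_borel k ==> (\<And>e. 0 < e ==> \<exists>d>0. fiberwise_osc \<a> Z Y k d e) ==>
    ((\<lambda>n. \<integral>x. k x \<partial>glue \<a> (\<k>s n)) \<longlongrightarrow> (\<integral>x. k x \<partial>glue \<a> \<k>)) (along N)"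
  "\<And>n. bounded_borel (\<rho>s n)" "\<And>n a. 0 \<le> \<rho>s n a" "\<And>n a. KL (\<k>s n a) (prods n a) \<le> ereal (\<rho>s n a)"
  "\<And>e. 0 < e ==> eventually (\<lambda>n. bs n * (\<integral>a. \<rho>s n a \<partial>\<a>) < b * K + e) (along N)"
proof -
 define dd where "dd m = 1 / real (Suc m)" for m
 have dd: "0 < dd m" for m by (simp add: dd_def)
 have dd_lim: "dd \<longlonglongrightarrow> 0" unfolding dd_def using LIMSEQ_inverse_real_of_nat by (simp add: inverse_eq_divide)
 have "\<forall>m. \<exists>\<k>s E \<rho>s R. block_approximation \<k> (dd m) \<k>s E \<rho>s R"
  using block_approximation_exists[OF \<k> coup dd] by blast
 then obtain \<k>m E \<rho>m R where ba: "\<And>m. block_approximation \<k> (dd m) (\<k>m m) (E m) (\<rho>m m) (R m)"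
  unfolding choice_iff by blast
 have \<k>m: "\<And>m n. kernel \<a> (\<k>m m n)" "\<And>m n a. \<k>m m n a \<in> couplings (\<sigma>s n a) (\<pi>s n a)" and
  E: "\<And>m. (E m \<longlongrightarrow> 0) (along N)" and
  approx: "\<And>m n k B e. bounded_borel k ==> (\<And>x. \<bar>k x\<bar> \<le> B) ==> 0 \<le> e ==> fiberwise_osc \<a> Z Y k (dd m) e ==>
    \<bar>(\<integral>x. k x \<partial>glue \<a> (\<k>m m n)) - (\<integral>x. k x \<partial>glue \<a> \<k>)\<bar> \<le> 2 * e * measure \<a> UNIV + B * E m n" and
  \<rho>m: "\<And>m n. bounded_borel (\<rho>m m n)" "\<And>m n a. 0 \<le> \<rho>m m n a" "\<And>m n a. KL (\<k>m m n a) (prods n a) \<le> ereal (\<rho>m m n a)" and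
  R: "\<And>m. ((\<lambda>n. \<integral>a. \<rho>m m n a \<partial>\<a>) \<longlongrightarrow> R m) (along N)" and
  R_le: "\<And>m f. f \<in> borel_measurable borel ==> (\<forall>x. 0 \<le> f x) ==>
    glue \<a> \<k> = density (glue \<a> limit_prod) (\<lambda>x. ennreal (f x)) ==>
    ennreal (R m) \<le> (\<integral>\<^sup>+x. ennreal (kl_phi (f x)) \<partial>glue \<a> limit_prod)"
  using ba unfolding block_approximation_def by blast+
 have bR: "b * R m \<le> b * K" for m
 proof (cases "b = 0")
  case False
  then have bpos: "0 < b" using b by simp
  obtain f where f: "f \<in> borel_measurable borel" "\<forall>x. 0 \<le> f x"
    "glue \<a> \<k> = density (glue \<a> limit_prod) (\<lambda>x. ennreal (f x))"
    "(\<integral>\<^sup>+x. ennreal (kl_phi (f x)) \<partial>glue \<a> limit_prod) \<le> ennreal K"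
   using dens[OF bpos] by blast
  have "ennreal (R m) \<le> ennreal K" using R_le[OF f(1-3), of m] f(4) by (rule order_trans)
  then have "R m \<le> K" using K by (simp add: ennreal_le_iff)
  then show ?thesis using b by (intro mult_left_mono)
 qed simp
 have "eventually (\<lambda>n. E m n < dd m \<and> bs n * (\<integral>a. \<rho>m m n a \<partial>\<a>) < b * K + dd m) (along N)" for m
 proof (rule eventually_conj)
  show "eventually (\<lambda>n. E m n < dd m) (along N)"
   by (rule order_tendstoD(2)[OF E dd])
  show "eventually (\<lambda>n. bs n * (\<integral>a. \<rho>m m n a \<partial>\<a>) < b * K + dd m) (along N)"
   by (rule order_tendstoD(2)[OF tendsto_mult[OF bs R]]) (use bR[of m] dd[of m] in argo)
 qed
 then obtain mm :: "nat => nat" where mm: "filterlim mm at_top (along N)"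
  "eventually (\<lambda>n. E (mm n) n < dd (mm n) \<and> bs n * (\<integral>a. \<rho>m (mm n) n a \<partial>\<a>) < b * K + dd (mm n)) (along N)"
  by (rule diagonal_along)
 have ddm: "((\<lambda>n. dd (mm n)) \<longlongrightarrow> 0) (along N)"
  by (rule filterlim_compose[OF dd_lim mm(1)])
 show thesis
 proof (rule that[of "\<lambda>n. \<k>m (mm n) n" "\<lambda>n. \<rho>m (mm n) n"])
  fix k :: "'a \<times> 'b \<times> 'c => real" assume k: "bounded_borel k" and osc: "\<And>e. 0 < e ==> \<exists>d>0. fiberwise_osc \<a> Z Y k d e"
  obtain B where B: "\<And>x. \<bar>k x\<bar> \<le> B" using k unfolding bounded_borel_def by blast
  have B0: "0 \<le> B" using B[of undefined] by argo
  define A where "A = measure \<a> UNIV"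
  have A: "0 \<le> A" by (simp add: A_def)
  show "((\<lambda>n. \<integral>x. k x \<partial>glue \<a> (\<k>m (mm n) n)) \<longlongrightarrow> (\<integral>x. k x \<partial>glue \<a> \<k>)) (along N)"
  proof (rule tendstoI)
   fix e0 :: real assume e0: "0 < e0"
   define e where "e = e0 / (2 * (2 * A + 1))"
   have e: "0 < e" using e0 A by (simp add: e_def)
   obtain d where d: "0 < d" "fiberwise_osc \<a> Z Y k d e" using osc[OF e] by blast
   have e2: "0 < e0 / (2 * (B + 1))" using e0 B0 by simp
   have "eventually (\<lambda>n. dd (mm n) < min d (e0 / (2 * (B + 1)))) (along N)"
    by (rule order_tendstoD(2)[OF ddm]) (use d e2 in simp)
   with mm(2) show "\<forall>\<^sub>F n in along N. dist (\<integral>x. k x \<partial>glue \<a> (\<k>m (mm n) n)) (\<integral>x. k x \<partial>glue \<a> \<k>) < e0"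
   proof eventually_elim
    case (elim n)
    have "\<bar>(\<integral>x. k x \<partial>glue \<a> (\<k>m (mm n) n)) - (\<integral>x. k x \<partial>glue \<a> \<k>)\<bar> \<le> 2 * e * A + B * E (mm n) n"
     unfolding A_def using elim(2) e
     by (intro approx k B fiberwise_osc_mono[OF d(2)]) auto
    moreover have "2 * e * A < e0 / 2"
    proof -
     have "2 * e * A < e * (2 * A + 1)" using e by (simp add: algebra_simps)
     also have "\<dots> = e0 / 2"
     proof -
      have "2 * A + 1 \<noteq> 0" using A by argo
      then show ?thesis by (simp add: e_def field_simps)
     qed
     finally show ?thesis .
    qed
    moreover have "B * E (mm n) n \<le> e0 / 2"
    proof -
     have "B * E (mm n) n \<le> B * (e0 / (2 * (B + 1)))" using elim B0 by (intro mult_left_mono) auto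
     also have "\<dots> \<le> (B + 1) * (e0 / (2 * (B + 1)))" using e2 by (intro mult_right_mono) auto
     also have "\<dots> = e0 / 2"
     proof -
      have "B + 1 \<noteq> 0" using B0 by argo
      then show ?thesis by (simp add: field_simps)
     qed
     finally show ?thesis .
    qed
    ultimately show ?case unfolding dist_real_def by argo
   qed
  qed
 next
  fix e :: real assume "0 < e"
  then have "eventually (\<lambda>n. dd (mm n) < e) (along N)" by (rule order_tendstoD(2)[OF ddm])
  with mm(2) show "eventually (\<lambda>n. bs n * (\<integral>a. \<rho>m (mm n) n a \<partial>\<a>) < b * K + e) (along N)"
   by eventually_elim argo
 qed (rule \<k>m \<rho>m)+
qed

end

section \<open>Cells\<close>

lemma X_dom_eq: "X_dom = cbox 0 (1 :: real^'d)"
 by (auto simp: X_dom_def mem_box_cart)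

lemma Z_dom_eq: "Z_dom = cbox (- 1) (1 :: real^'d)"
 by (auto simp: Z_dom_def mem_box_cart)

lemma compact_X_dom: "compact (X_dom :: (real^'d) set)" and compact_Z_dom: "compact (Z_dom :: (real^'d) set)"
 by (simp_all add: X_dom_eq Z_dom_eq)

lemma zero_in_Z_dom: "0 \<in> Z_dom"
 by (auto simp: Z_dom_def)

lemma basic_cell_eq: "basic_cell n i = cbox (\<chi> l. real (i $ l) / real n) (\<chi> l. real (i $ l) / real n + 1 / real n)"
 by (auto simp: basic_cell_def mem_box_cart)

lemma closed_basic_cell: "closed (basic_cell n i)"
 unfolding basic_cell_eq by (rule compact_imp_closed[OF compact_cbox])

lemma finite_indices: "finite (indices n :: (nat^'d) set)"
proof -
 have "indices n \<subseteq> (\<lambda>f. \<chi> l. f l) ` (Pi\<^sub>E (UNIV :: 'd set) (\<lambda>_. {..<n}))"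
 proof
  fix i :: "nat^'d" assume "i \<in> indices n"
  then show "i \<in> (\<lambda>f. \<chi> l. f l) ` (Pi\<^sub>E UNIV (\<lambda>_. {..<n}))"
   by (intro image_eqI[of _ _ "\<lambda>l. i $ l"]) (auto simp: indices_def)
 qed
 then show ?thesis by (rule finite_subset) (simp add: finite_PiE)
qed

lemma cell_overlap:
 assumes n: "0 < n" and ij: "i \<noteq> j" and x: "x \<in> basic_cell n i" "x \<in> basic_cell n j"
 shows "x \<in> frontier (basic_cell n i)"
proof -
 have "x \<notin> interior (basic_cell n i)"
 proof
  assume "x \<in> interior (basic_cell n i)"
  then have int: "real (i $ l) / real n < x $ l" "x $ l < real (i $ l) / real n + 1 / real n" for l
   by (auto simp: basic_cell_eq interior_cbox mem_box_cart)
  have "i $ l = j $ l" for l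
  proof -
   have "real (j $ l) / real n \<le> x $ l" "x $ l \<le> real (j $ l) / real n + 1 / real n"
    using x(2) by (auto simp: basic_cell_def)
   then have "real (j $ l) / real n < real (i $ l) / real n + 1 / real n" "real (i $ l) / real n < real (j $ l) / real n + 1 / real n"
    using int[of l] by linarith+
   then have "real (j $ l) < real (i $ l) + 1" "real (i $ l) < real (j $ l) + 1"
    using n by (simp_all add: field_simps)
   then show ?thesis by linarith
  qed
  then show False using ij by (simp add: vec_eq_iff)
 qed
 with x(1) show ?thesis by (simp add: frontier_def closure_closed[OF closed_basic_cell])
qed

text \<open>The composite cell that contains the basic cell with coordinate \<open>m\<close>, in one
 direction, at step \<open>k\<close>.\<close>

definition grp :: "nat => nat => nat" where
 "grp k m = (if odd k then m div 2 else (m + 1) div 2)"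

text \<open>\<open>ctr k m / n\<close> is the coordinate of the centre of that composite cell.\<close>

definition ctr :: "nat => nat => nat" where
 "ctr k m = (if odd k then 2 * grp k m + 1 else 2 * grp k m)"

lemma partition_at_eq:
 "partition_at n k = indices n // {(i, j). i \<in> indices n \<and> j \<in> indices n \<and> (\<forall>l. grp k (i $ l) = grp k (j $ l))}"
 by (simp add: partition_at_def partition_A_def partition_B_def grp_def)

lemma equiv_grp: "equiv (indices n) {(i, j). i \<in> indices n \<and> j \<in> indices n \<and> (\<forall>l. grp k (i $ l) = grp k (j $ l))}"
 by (rule equivI) (auto simp: refl_on_def sym_def trans_def)

lemma finite_partition_at: "finite (partition_at n k)"
 unfolding partition_at_eq by (rule finite_quotient[OF finite_indices]) auto

lemma partition_at_Union: "\<Union> (partition_at n k) = indices n"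
 unfolding partition_at_eq by (rule Union_quotient[OF equiv_grp])

lemma partition_at_subset: "J \<in> partition_at n k ==> J \<subseteq> indices n"
 using partition_at_Union by blast

lemma partition_at_disjoint: "J \<in> partition_at n k ==> J' \<in> partition_at n k ==> J \<noteq> J' ==> J \<inter> J' = {}"
 unfolding partition_at_eq using quotient_disj[OF equiv_grp] by blast

lemma partition_at_grp:
 assumes "J \<in> partition_at n k"
 obtains i0 where "i0 \<in> J" "J = {j \<in> indices n. \<forall>l. grp k (j $ l) = grp k (i0 $ l)}"
proof -
 obtain i0 where i0: "i0 \<in> indices n" "J = {(i, j). i \<in> indices n \<and> j \<in> indices n \<and> (\<forall>l. grp k (i $ l) = grp k (j $ l))} `` {i0}"
  using assms unfolding partition_at_eq by (rule quotientE)
 then show thesis by (intro that[of i0]) auto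
qed

lemma comp_cell_borel: "comp_cell n J \<in> sets borel"
proof -
 have "countable J" by (rule countable_subset[OF subset_UNIV]) (rule countableI_type)
 then show ?thesis
  unfolding comp_cell_def by (intro sets.countable_UN'' borel_closed closed_basic_cell) auto
qed

lemma basic_cell_subset_X: "i \<in> indices n ==> basic_cell n i \<subseteq> X_dom"
proof
 fix x assume i: "i \<in> indices n" and x: "x \<in> basic_cell n i"
 have "0 \<le> x $ l \<and> x $ l \<le> 1" for l
 proof -
  have il: "i $ l < n" using i by (simp add: indices_def)
  have xl: "real (i $ l) / real n \<le> x $ l" "x $ l \<le> real (i $ l) / real n + 1 / real n"
   using x by (auto simp: basic_cell_def)
  have "real (i $ l) / real n + 1 / real n = real (Suc (i $ l)) / real n" by (simp add: add_divide_distrib)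
  also have "\<dots> \<le> 1" using il by simp
  finally have "x $ l \<le> 1" using xl by simp
  moreover have "0 \<le> real (i $ l) / real n" by simp
  ultimately show ?thesis using xl by linarith
 qed
 then show "x \<in> X_dom" by (simp add: X_dom_def)
qed

lemma X_dom_cells:
 assumes n: "0 < n" and x: "x \<in> (X_dom :: (real^'d) set)"
 obtains i where "i \<in> indices n" "x \<in> basic_cell n i"
proof -
 define i :: "nat^'d" where "i = (\<chi> l. min (n - 1) (nat \<lfloor>real n * x $ l\<rfloor>))"
 have x01: "0 \<le> x $ l" "x $ l \<le> 1" for l using x by (auto simp: X_dom_def)
 have "real (i $ l) / real n \<le> x $ l \<and> x $ l \<le> real (i $ l) / real n + 1 / real n" for l
 proof -
  have nx: "0 \<le> real n * x $ l" using x01 n by simp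
  have fl: "real (nat \<lfloor>real n * x $ l\<rfloor>) \<le> real n * x $ l" "real n * x $ l < real (nat \<lfloor>real n * x $ l\<rfloor>) + 1"
   using nx by linarith+
  have "real (i $ l) \<le> real n * x $ l" using fl(1) by (simp add: i_def min_def)
  moreover have "real n * x $ l \<le> real (i $ l) + 1"
  proof (cases "nat \<lfloor>real n * x $ l\<rfloor> \<le> n - 1")
   case True
   then show ?thesis using fl(2) by (simp add: i_def)
  next
   case False
   then have "real (i $ l) + 1 = real n" using n by (simp add: i_def of_nat_diff)
   then show ?thesis using x01(2)[of l] n by (simp add: mult_left_le)
  qed
  ultimately show ?thesis using n by (simp add: field_simps)
 qed
 then show thesis using n by (intro that[of i]) (auto simp: i_def indices_def basic_cell_def)
qed

lemma cell_at_props: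
 assumes n: "0 < n" and x: "x \<in> X_dom"
 shows "cell_at n t x \<in> partition_at n (step_at n t)" "x \<in> comp_cell n (cell_at n t x)"
proof -
 obtain i where i: "i \<in> indices n" "x \<in> basic_cell n i" using X_dom_cells[OF n x] by blast
 then obtain J where "J \<in> partition_at n (step_at n t)" "i \<in> J" using partition_at_Union by blast
 then have "\<exists>J. J \<in> partition_at n (step_at n t) \<and> x \<in> comp_cell n J"
  using i by (auto simp: comp_cell_def)
 from someI_ex[OF this] show "cell_at n t x \<in> partition_at n (step_at n t)" "x \<in> comp_cell n (cell_at n t x)"
  by (auto simp: cell_at_def)
qed

lemma ctr_bounds: "m \<le> ctr k m" "ctr k m \<le> m + 1" "even n ==> m < n ==> ctr k m \<le> n" "even (ctr k m) \<longleftrightarrow> even k"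
proof -
 have "m \<le> ctr k m \<and> ctr k m \<le> m + 1 \<and> (even n \<longrightarrow> m < n \<longrightarrow> ctr k m \<le> n) \<and> (even (ctr k m) \<longleftrightarrow> even k)"
 proof (cases "odd k")
  case True
  then have "ctr k m = 2 * (m div 2) + 1" by (simp add: ctr_def grp_def)
  with True show ?thesis by presburger
 next
  case False
  then have "ctr k m = 2 * ((m + 1) div 2)" by (simp add: ctr_def grp_def)
  with False show ?thesis by presburger
 qed
 then show "m \<le> ctr k m" "ctr k m \<le> m + 1" "even n ==> m < n ==> ctr k m \<le> n" "even (ctr k m) \<longleftrightarrow> even k"
  by blast+
qed

lemma cell_center_eq:
 assumes n: "n \<in> pos_evens" and J: "J \<in> partition_at n k" and i0: "i0 \<in> J"
 shows "cell_center n k J = (\<chi> l. real (ctr k (i0 $ l)) / real n)"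
proof -
 have n0: "0 < n" "even n" using n by (auto simp: pos_evens_def)
 have ctr_J: "ctr k (i $ l) = ctr k (i0 $ l)" if "i \<in> J" for i l
 proof -
  obtain j where "j \<in> J" "J = {i \<in> indices n. \<forall>l. grp k (i $ l) = grp k (j $ l)}" by (rule partition_at_grp[OF J])
  then have "grp k (i $ l) = grp k (i0 $ l)" using i0 that by auto
  then show ?thesis by (simp add: ctr_def)
 qed
 have i0n: "i0 $ l < n" for l using partition_at_subset[OF J] i0 by (auto simp: indices_def)
 show ?thesis unfolding cell_center_def
 proof (rule the_equality, intro conjI allI)
  have "(\<chi> l. real (ctr k (i0 $ l)) / real n) \<in> basic_cell n i0"
  proof -
   have "real (i0 $ l) / real n \<le> real (ctr k (i0 $ l)) / real n \<and> real (ctr k (i0 $ l)) / real n \<le> real (i0 $ l) / real n + 1 / real n" for l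
   proof -
    have "real (ctr k (i0 $ l)) \<le> real (i0 $ l) + 1" using ctr_bounds(2)[of k "i0 $ l"] by linarith
    then have "real (ctr k (i0 $ l)) / real n \<le> (real (i0 $ l) + 1) / real n" by (intro divide_right_mono) auto
    moreover have "real (i0 $ l) / real n \<le> real (ctr k (i0 $ l)) / real n"
     using ctr_bounds(1)[of "i0 $ l" k] by (intro divide_right_mono) auto
    ultimately show ?thesis by (simp add: add_divide_distrib)
   qed
   then show ?thesis by (simp add: basic_cell_def)
  qed
  then show "(\<chi> l. real (ctr k (i0 $ l)) / real n) \<in> comp_cell n J" using i0 by (auto simp: comp_cell_def)
  show "\<exists>j\<le>n. (if odd k then odd j else even j) \<and> (\<chi> l. real (ctr k (i0 $ l)) / real n) $ l = real j / real n" for l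
   using ctr_bounds(3)[OF n0(2) i0n] ctr_bounds(4)[of k "i0 $ l"] by (intro exI[of _ "ctr k (i0 $ l)"]) auto
 next
  fix y assume y: "y \<in> comp_cell n J \<and> (\<forall>l. \<exists>j\<le>n. (if odd k then odd j else even j) \<and> y $ l = real j / real n)"
  then obtain i where i: "i \<in> J" "y \<in> basic_cell n i" by (auto simp: comp_cell_def)
  have "y $ l = real (ctr k (i0 $ l)) / real n" for l
  proof -
   obtain j where j: "j \<le> n" "if odd k then odd j else even j" "y $ l = real j / real n" using y by blast
   have "real (i $ l) / real n \<le> real j / real n" "real j / real n \<le> real (i $ l) / real n + 1 / real n"
    using i(2) unfolding j(3)[symmetric] by (simp_all add: basic_cell_def)
   then have "i $ l \<le> j" "j \<le> i $ l + 1"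
    using n0 by (simp_all add: divide_le_cancel flip: add_divide_distrib)
   moreover have "i $ l \<le> ctr k (i0 $ l)" "ctr k (i0 $ l) \<le> i $ l + 1"
    using ctr_bounds(1)[of "i $ l" k] ctr_bounds(2)[of k "i $ l"] ctr_J[OF i(1)] by auto
   moreover have "even j \<longleftrightarrow> even (ctr k (i0 $ l))" using j(2) ctr_bounds(4)[of k "i0 $ l"] by (auto split: if_splits)
   ultimately have "j = ctr k (i0 $ l)" by presburger
   then show ?thesis using j(3) by simp
  qed
  then show "y = (\<chi> l. real (ctr k (i0 $ l)) / real n)" by (simp add: vec_eq_iff)
 qed
qed

lemma comp_cell_center:
 assumes n: "n \<in> pos_evens" and J: "J \<in> partition_at n k"
 shows "cell_center n k J \<in> X_dom" "x \<in> comp_cell n J ==> \<bar>x $ l - cell_center n k J $ l\<bar> \<le> 1 / real n"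
proof -
 have n0: "0 < n" "even n" using n by (auto simp: pos_evens_def)
 obtain i0 where i0: "i0 \<in> J" using partition_at_grp[OF J] by blast
 have i0n: "i0 $ l < n" for l using partition_at_subset[OF J] i0 by (auto simp: indices_def)
 show "cell_center n k J \<in> X_dom"
  unfolding cell_center_eq[OF n J i0] X_dom_def using ctr_bounds(3)[OF n0(2) i0n] n0 by auto
 assume "x \<in> comp_cell n J"
 then obtain i where i: "i \<in> J" "x \<in> basic_cell n i" by (auto simp: comp_cell_def)
 have xl: "real (i $ l) / real n \<le> x $ l" "x $ l \<le> real (i $ l) / real n + 1 / real n"
  using i(2) by (auto simp: basic_cell_def)
 have "real (ctr k (i $ l)) / real n \<le> (real (i $ l) + 1) / real n"
  using ctr_bounds(2)[of k "i $ l"] by (intro divide_right_mono) auto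
 moreover have "real (i $ l) / real n \<le> real (ctr k (i $ l)) / real n"
  using ctr_bounds(1)[of "i $ l" k] by (intro divide_right_mono) auto
 ultimately show "\<bar>x $ l - cell_center n k J $ l\<bar> \<le> 1 / real n"
  unfolding cell_center_eq[OF n J i(1)] using xl by (auto simp: abs_le_iff add_divide_distrib)
qed

section \<open>Masses of cells and the iterates\<close>

lemma sets_restr: "sets (restr A L) = sets L"
 by (simp add: restr_def)

lemma emeasure_restr: "A \<in> sets L ==> B \<in> sets L ==> emeasure (restr A L) B = emeasure L (A \<inter> B)"
 unfolding restr_def by (rule emeasure_restricted)

text \<open>Measures that do not charge cell boundaries, so that closed cells may be treated as
 disjoint.\<close>

locale cell_measure =
 fixes n :: nat and M :: "(real^'d) measure"
 assumes n: "n \<in> pos_evens" and M: "M \<in> prob_on X_dom"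
  and null_frontier: "\<And>i. i \<in> indices n ==> measure M (frontier (basic_cell n i)) = 0"
begin

lemma n0: "0 < n" using n by (simp add: pos_evens_def)

lemma M_facts: "sets M = sets borel" "prob_space M" "emeasure M (- X_dom) = 0" "space M = UNIV"
 using M by (auto simp: prob_on_def dest: sets_eq_imp_space_eq)

sublocale M: prob_space M by (rule M_facts)

lemma AE_cells: "AE x in M. x \<in> X_dom \<and> (\<forall>i\<in>indices n. \<forall>j\<in>indices n. x \<in> basic_cell n i \<longrightarrow> x \<in> basic_cell n j \<longrightarrow> i = j)"
proof (rule AE_conjI)
 have "AE x in M. x \<notin> - X_dom"
  using M_facts by (intro AE_not_in) (auto simp: null_sets_def intro!: borel_open open_Compl compact_imp_closed compact_X_dom)
 then show "AE x in M. x \<in> X_dom" by eventually_elim simp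
 have "AE x in M. \<forall>i\<in>indices n. x \<notin> frontier (basic_cell n i)"
 proof (subst AE_ball_countable[OF countable_finite[OF finite_indices]], intro ballI AE_not_in)
  fix i :: "nat^'d" assume i: "i \<in> indices n"
  show "frontier (basic_cell n i) \<in> null_sets M"
   using null_frontier[OF i] M_facts by (auto simp: null_sets_def M.emeasure_eq_measure)
 qed
 then show "AE x in M. \<forall>i\<in>indices n. \<forall>j\<in>indices n. x \<in> basic_cell n i \<longrightarrow> x \<in> basic_cell n j \<longrightarrow> i = j"
  by eventually_elim (use cell_overlap[OF n0] in blast)
qed

lemma mass_comp_cell:
 assumes "J \<in> partition_at n k"
 shows "measure M (comp_cell n J) = (\<Sum>i\<in>J. measure M (basic_cell n i))"
 unfolding comp_cell_def
proof (rule measure_UNION_AE)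
 show "finite J" by (rule finite_subset[OF partition_at_subset[OF assms] finite_indices])
 show "basic_cell n i \<in> fmeasurable M" for i
  using M_facts closed_basic_cell[of n i] by (simp add: M.fmeasurable_eq_sets)
 show "pairwise (\<lambda>i j. AE x in M. x \<notin> basic_cell n i \<or> x \<notin> basic_cell n j) J"
  unfolding pairwise_def
 proof (intro ballI impI)
  fix i j assume "i \<in> J" "j \<in> J" "i \<noteq> j"
  with partition_at_subset[OF assms] have ij: "i \<in> indices n" "j \<in> indices n" "i \<noteq> j" by auto
  show "AE x in M. x \<notin> basic_cell n i \<or> x \<notin> basic_cell n j"
   using AE_cells by eventually_elim (use ij in blast)
 qed
qed

lemma sum_comp_cells:
 assumes A: "A \<in> sets borel"
 shows "(\<Sum>J\<in>partition_at n k. emeasure M (comp_cell n J \<inter> A)) = emeasure M A"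
proof -
 have "measure M (\<Union>J\<in>partition_at n k. comp_cell n J \<inter> A) = (\<Sum>J\<in>partition_at n k. measure M (comp_cell n J \<inter> A))"
 proof (rule measure_UNION_AE[OF finite_partition_at])
  show "comp_cell n J \<inter> A \<in> fmeasurable M" for J
   using M_facts A by (simp add: M.fmeasurable_eq_sets comp_cell_borel sets.Int)
  show "pairwise (\<lambda>J J'. AE x in M. x \<notin> comp_cell n J \<inter> A \<or> x \<notin> comp_cell n J' \<inter> A) (partition_at n k)"
   unfolding pairwise_def
  proof (intro ballI impI)
   fix J J' :: "(nat^'d) set" assume J: "J \<in> partition_at n k" "J' \<in> partition_at n k" "J \<noteq> J'"
   have s: "J \<subseteq> indices n" "J' \<subseteq> indices n" "J \<inter> J' = {}"
    using partition_at_subset partition_at_disjoint J by blast+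
   show "AE x in M. x \<notin> comp_cell n J \<inter> A \<or> x \<notin> comp_cell n J' \<inter> A"
    using AE_cells
   proof eventually_elim
    case (elim x)
    then show ?case using s unfolding comp_cell_def by blast
   qed
  qed
 qed
 moreover have "measure M (\<Union>J\<in>partition_at n k. comp_cell n J \<inter> A) = measure M A"
 proof (rule M.finite_measure_eq_AE)
  show "AE x in M. (x \<in> (\<Union>J\<in>partition_at n k. comp_cell n J \<inter> A)) = (x \<in> A)"
   using AE_cells
  proof eventually_elim
   case (elim x)
   obtain i where i: "i \<in> indices n" "x \<in> basic_cell n i" using X_dom_cells[OF n0] elim by blast
   then obtain J where "J \<in> partition_at n k" "i \<in> J" using partition_at_Union by blast
   with i show ?case by (auto simp: comp_cell_def)
  qed
  show "(\<Union>J\<in>partition_at n k. comp_cell n J \<inter> A) \<in> sets M"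
   unfolding M_facts(1) by (intro sets.finite_UN finite_partition_at sets.Int comp_cell_borel A)
  show "A \<in> sets M" using A M_facts by simp
 qed
 ultimately show ?thesis by (simp add: M.emeasure_eq_measure)
qed

end

locale iterates = cell_measure n M for n and M :: "(real^'d) measure" +
 fixes Y :: "(real^'d) set" and \<nu>n :: "(real^'d) measure" and cn and \<epsilon>n :: real
  and \<pi>0 :: "((real^'d) \<times> (real^'d)) measure" and \<pi> :: "nat => ((real^'d) \<times> (real^'d)) measure"
  and \<mu> :: "(real^'d) measure"
 assumes Y: "compact Y" and \<nu>n: "\<nu>n \<in> prob_on Y" and \<pi>0: "\<pi>0 \<in> couplings M \<nu>n"
  and iter: "dd_iterates Y M \<nu>n cn \<epsilon>n n \<pi>0 \<pi>"
  and mass_pos: "\<And>i. i \<in> indices n ==> 0 < measure \<mu> (basic_cell n i)"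
  and mass_eq: "\<And>i. i \<in> indices n ==> measure M (basic_cell n i) = measure \<mu> (basic_cell n i)"
begin

lemma Y_borel: "Y \<in> sets borel" "- Y \<in> sets borel"
 by (intro borel_closed borel_open open_Compl compact_imp_closed Y)+

lemma emeasure_cell_marginal:
 assumes L: "sets L = sets borel" and A: "A \<in> sets borel"
 shows "emeasure (cell_marginal Y n J L) A = emeasure L (comp_cell n J \<times> (Y \<inter> A))"
proof -
 have sp: "space L = UNIV" using L by (auto dest: sets_eq_imp_space_eq)
 have s: "snd \<in> restr (comp_cell n J \<times> Y) L \<rightarrow>\<^sub>M borel"
  using L by (simp add: measurable_cong_sets[OF trans[OF sets_restr L] refl])
 have "emeasure (cell_marginal Y n J L) A = emeasure (restr (comp_cell n J \<times> Y) L) (UNIV \<times> A)"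
  unfolding cell_marginal_def using s A
  by (subst emeasure_distr) (auto simp: restr_def sp intro!: arg_cong[where f="emeasure _"])
 also have "\<dots> = emeasure L (comp_cell n J \<times> (Y \<inter> A))"
  using L borel_Times[OF comp_cell_borel Y_borel(1)] borel_Times[OF borel_UNIV A]
  by (subst emeasure_restr) (auto simp: Times_Int_Times)
 finally show ?thesis .
qed

text \<open>Each step only re-couples inside composite cells: the first marginal is restored by summing over
 cells, and the second marginals remain in \<open>Y\<close>.\<close>

lemma iterate_marginals:
 "sets (\<pi> k) = sets borel \<and> (\<forall>A\<in>sets borel. emeasure (\<pi> k) (A \<times> UNIV) = emeasure M A) \<and> emeasure (\<pi> k) (UNIV \<times> - Y) = 0"
proof (induction k)
 case 0
 have p0: "\<pi> 0 = \<pi>0" using iter by (simp add: dd_iterates_def)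
 have sets: "sets \<pi>0 = sets borel" and m: "distr \<pi>0 borel fst = M" "distr \<pi>0 borel snd = \<nu>n"
  using \<pi>0 by (auto simp: couplings_def)
 note meas = measurable_cong_sets[OF sets refl]
 have sp: "space \<pi>0 = UNIV" using sets by (auto dest: sets_eq_imp_space_eq)
 have "emeasure \<pi>0 (A \<times> UNIV) = emeasure M A" if "A \<in> sets borel" for A
  unfolding m(1)[symmetric] using that
  by (subst emeasure_distr) (auto simp: meas sp intro!: arg_cong[where f="emeasure _"])
 moreover have "emeasure \<pi>0 (UNIV \<times> - Y) = emeasure \<nu>n (- Y)"
  unfolding m(2)[symmetric] using Y_borel
  by (subst emeasure_distr) (auto simp: meas sp intro!: arg_cong[where f="emeasure _"])
 ultimately show ?case using \<nu>n sets by (simp add: p0 prob_on_def)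
next
 case (Suc k)
 have "1 \<le> Suc k" by simp
 then obtain \<gamma> where g: "\<forall>J\<in>partition_at n (Suc k).
      is_arg_min (cell_objective Y M \<nu>n cn \<epsilon>n n J)
       (\<lambda>\<rho>. \<rho> \<in> couplings (restr (comp_cell n J) M) (cell_marginal Y n J (\<pi> (Suc k - 1)))) (\<gamma> J)"
  and sets: "sets (\<pi> (Suc k)) = sets borel"
  and sum: "\<And>A. A \<in> sets borel ==> emeasure (\<pi> (Suc k)) A = (\<Sum>J\<in>partition_at n (Suc k). emeasure (\<gamma> J) A)"
  using iter unfolding dd_iterates_def by metis
 have \<gamma>: "\<gamma> J \<in> couplings (restr (comp_cell n J) M) (cell_marginal Y n J (\<pi> k))" if "J \<in> partition_at n (Suc k)" for J
  using g that by (auto simp: is_arg_min_def)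
 have \<gamma>_fst: "emeasure (\<gamma> J) (A \<times> UNIV) = emeasure M (comp_cell n J \<inter> A)"
  and \<gamma>_snd: "emeasure (\<gamma> J) (UNIV \<times> - Y) = 0"
  if J: "J \<in> partition_at n (Suc k)" and A: "A \<in> sets borel" for J A
 proof -
  have s: "sets (\<gamma> J) = sets borel" and m: "distr (\<gamma> J) borel fst = restr (comp_cell n J) M" "distr (\<gamma> J) borel snd = cell_marginal Y n J (\<pi> k)"
   using \<gamma>[OF J] by (auto simp: couplings_def)
  note meas = measurable_cong_sets[OF s refl]
  have sp: "space (\<gamma> J) = UNIV" using s by (auto dest: sets_eq_imp_space_eq)
  have "emeasure (\<gamma> J) (A \<times> UNIV) = emeasure (restr (comp_cell n J) M) A"
   unfolding m(1)[symmetric] using A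
   by (subst emeasure_distr) (auto simp: meas sp intro!: arg_cong[where f="emeasure _"])
  then show "emeasure (\<gamma> J) (A \<times> UNIV) = emeasure M (comp_cell n J \<inter> A)"
   using A M_facts(1) by (simp add: emeasure_restr comp_cell_borel)
  have "emeasure (\<gamma> J) (UNIV \<times> - Y) = emeasure (cell_marginal Y n J (\<pi> k)) (- Y)"
   unfolding m(2)[symmetric] using Y_borel
   by (subst emeasure_distr) (auto simp: meas sp intro!: arg_cong[where f="emeasure _"])
  also have "\<dots> = 0" using Suc Y_borel by (subst emeasure_cell_marginal) auto
  finally show "emeasure (\<gamma> J) (UNIV \<times> - Y) = 0" .
 qed
 have "emeasure (\<pi> (Suc k)) (A \<times> UNIV) = emeasure M A" if A: "A \<in> sets borel" for A
  using sum[OF borel_Times[OF A borel_UNIV]] \<gamma>_fst[OF _ A] sum_comp_cells[OF A] by simp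
 moreover have "emeasure (\<pi> (Suc k)) (UNIV \<times> - Y) = 0"
  using sum[OF borel_Times[OF borel_UNIV Y_borel(2)]] \<gamma>_snd[OF _ borel_UNIV] by simp
 ultimately show ?case using sets by simp
qed

lemma cell_mass_eq: "J \<in> partition_at n k ==> cell_mass \<mu> n J = measure M (comp_cell n J)"
 using mass_comp_cell[of J k] mass_eq partition_at_subset[of J n k] by (auto simp: cell_mass_def intro!: sum.cong)

lemma cell_mass_pos:
 assumes "J \<in> partition_at n k" shows "0 < cell_mass \<mu> n J"
proof -
 obtain i0 where "i0 \<in> J" using partition_at_grp[OF assms] by blast
 then show ?thesis
  unfolding cell_mass_def using mass_pos partition_at_subset[OF assms] finite_subset[OF partition_at_subset[OF assms] finite_indices]
  by (intro sum_pos) auto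
qed

lemma normalize:
 assumes J: "J \<in> partition_at n k"
 shows "ennreal (1 / cell_mass \<mu> n J) * emeasure M (comp_cell n J) = 1"
 using cell_mass_pos[OF J] cell_mass_eq[OF J] by (simp add: M.emeasure_eq_measure ennreal_mult[symmetric])

lemma traj_fiber_prob_on:
 assumes x: "x \<in> X_dom"
 shows "traj_fiber Y \<mu> \<pi> n t x \<in> prob_on Y"
proof -
 let ?k = "step_at n t" and ?J = "cell_at n t x"
 note J = cell_at_props(1)[OF n0 x, of t]
 have sets: "sets (\<pi> ?k) = sets borel" and fst: "\<And>A. A \<in> sets borel ==> emeasure (\<pi> ?k) (A \<times> UNIV) = emeasure M A"
  and snd: "emeasure (\<pi> ?k) (UNIV \<times> - Y) = 0"
  using iterate_marginals[of ?k] by auto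
 have "emeasure (\<pi> ?k) (comp_cell n ?J \<times> Y) = emeasure (\<pi> ?k) (comp_cell n ?J \<times> UNIV)"
 proof (rule emeasure_eq_AE)
  have "AE q in \<pi> ?k. q \<notin> UNIV \<times> - Y"
   using snd sets borel_Times[OF borel_UNIV Y_borel(2)] by (intro AE_not_in) (auto simp: null_sets_def)
  then show "AE q in \<pi> ?k. (q \<in> comp_cell n ?J \<times> Y) = (q \<in> comp_cell n ?J \<times> UNIV)"
   by eventually_elim auto
 qed (simp_all add: sets borel_Times comp_cell_borel Y_borel(1))
 then have tot: "emeasure (\<pi> ?k) (comp_cell n ?J \<times> Y) = emeasure M (comp_cell n ?J)"
  using fst by (simp add: comp_cell_borel)
 show ?thesis
  unfolding prob_on_def traj_fiber_def
 proof (intro CollectI conjI)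
  have sc: "sets (cell_marginal Y n ?J (\<pi> ?k)) = sets borel" by (simp add: cell_marginal_def)
  show "sets (scale_measure (ennreal (1 / cell_mass \<mu> n ?J)) (cell_marginal Y n ?J (\<pi> ?k))) = sets borel"
   using sc by simp
  show "prob_space (scale_measure (ennreal (1 / cell_mass \<mu> n ?J)) (cell_marginal Y n ?J (\<pi> ?k)))"
  proof (rule prob_spaceI)
   have "space (cell_marginal Y n ?J (\<pi> ?k)) = UNIV" using sc by (auto dest: sets_eq_imp_space_eq)
   then show "emeasure (scale_measure (ennreal (1 / cell_mass \<mu> n ?J)) (cell_marginal Y n ?J (\<pi> ?k)))
     (space (scale_measure (ennreal (1 / cell_mass \<mu> n ?J)) (cell_marginal Y n ?J (\<pi> ?k)))) = 1"
    using emeasure_cell_marginal[OF sets borel_UNIV, of ?J] tot normalize[OF J] by (simp add: space_scale_measure)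
  qed
  show "emeasure (scale_measure (ennreal (1 / cell_mass \<mu> n ?J)) (cell_marginal Y n ?J (\<pi> ?k))) (- Y) = 0"
   using emeasure_cell_marginal[OF sets Y_borel(2), of ?J] by simp
 qed
qed

lemma sigma_fiber_prob_on:
 assumes x: "x \<in> X_dom"
 shows "sigma_fiber \<mu> M n t x \<in> prob_on Z_dom"
proof -
 let ?J = "cell_at n t x" and ?c = "center_at n t x"
 note J = cell_at_props(1)[OF n0 x, of t]
 let ?L = "distr (restr (comp_cell n ?J) M) borel (\<lambda>x'. real n *\<^sub>R (x' - ?c))"
 have m: "(\<lambda>x'. real n *\<^sub>R (x' - ?c)) \<in> restr (comp_cell n ?J) M \<rightarrow>\<^sub>M borel"
  unfolding measurable_cong_sets[OF trans[OF sets_restr M_facts(1)] refl] by measurable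
 have em: "emeasure ?L A = emeasure M (comp_cell n ?J \<inter> (\<lambda>x'. real n *\<^sub>R (x' - ?c)) -` A)" if A: "A \<in> sets borel" for A
 proof -
  have "(\<lambda>x'. real n *\<^sub>R (x' - ?c)) -` A \<in> sets M"
   using measurable_sets[OF m A] M_facts by (simp add: restr_def)
  then show ?thesis
   using m A M_facts by (subst emeasure_distr) (auto simp: emeasure_restr comp_cell_borel sets_restr restr_def[THEN arg_cong[where f=space]])
 qed
 have Zb: "- Z_dom \<in> sets (borel :: (real^'d) measure)"
  by (intro borel_open open_Compl compact_imp_closed compact_Z_dom)
 have "comp_cell n ?J \<inter> (\<lambda>x'. real n *\<^sub>R (x' - ?c)) -` (- Z_dom) = {}"
 proof safe
  fix x' assume x': "x' \<in> comp_cell n ?J" "real n *\<^sub>R (x' - ?c) \<notin> Z_dom"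
  have "- 1 \<le> real n * (x' $ l - ?c $ l) \<and> real n * (x' $ l - ?c $ l) \<le> 1" for l
  proof -
   have "\<bar>x' $ l - ?c $ l\<bar> \<le> 1 / real n"
    unfolding center_at_def by (rule comp_cell_center(2)[OF n J x'(1)])
   then have "real n * \<bar>x' $ l - ?c $ l\<bar> \<le> real n * (1 / real n)" by (intro mult_left_mono) auto
   then have "\<bar>real n * (x' $ l - ?c $ l)\<bar> \<le> 1" using n0 by (simp add: abs_mult)
   then show ?thesis by (simp add: abs_le_iff)
  qed
  then show "x' \<in> {}" using x'(2) by (simp add: Z_dom_def)
 qed
 then have supp: "emeasure ?L (- Z_dom) = 0" by (simp only: em[OF Zb] emeasure_empty)
 show ?thesis
  unfolding prob_on_def sigma_fiber_def
 proof (intro CollectI conjI)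
  show "prob_space (scale_measure (ennreal (1 / cell_mass \<mu> n ?J)) ?L)"
  proof (rule prob_spaceI)
   show "emeasure (scale_measure (ennreal (1 / cell_mass \<mu> n ?J)) ?L) (space (scale_measure (ennreal (1 / cell_mass \<mu> n ?J)) ?L)) = 1"
    using em[OF borel_UNIV] normalize[OF J] by (simp add: space_scale_measure)
  qed
 qed (use supp in simp_all)
qed

end

section \<open>Fibers as kernels\<close>

lemma prob_on_iff_kernel_value:
 "M \<in> prob_on S \<longleftrightarrow> M \<in> space (prob_algebra borel) \<and> emeasure M (- S) = 0"
 by (auto simp: prob_on_def space_prob_algebra)

lemma cell_at_outside:
 assumes x: "x \<notin> X_dom"
 shows "cell_at n t x = (SOME J. False)"
proof -
 have "\<not> (J \<in> partition_at n (step_at n t) \<and> x \<in> comp_cell n J)" for J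
  using x basic_cell_subset_X partition_at_subset unfolding comp_cell_def by blast
 then have "(\<lambda>J. J \<in> partition_at n (step_at n t) \<and> x \<in> comp_cell n J) = (\<lambda>J. False)" by blast
 then show ?thesis by (simp only: cell_at_def)
qed

lemma cell_selection_measurable:
 "(\<lambda>x. SOME J. J \<in> partition_at n k \<and> x \<in> comp_cell n J) \<in> (borel :: (real^'d) measure) \<rightarrow>\<^sub>M count_space UNIV"
proof -
 let ?C = "\<lambda>x :: real^'d. {J \<in> partition_at n k. x \<in> comp_cell n J}"
 have "?C \<in> (borel :: (real^'d) measure) \<rightarrow>\<^sub>M count_space (Pow (partition_at n k))"
 proof (subst measurable_count_space_eq2)
  show "finite (Pow (partition_at n k :: (nat^'d) set set))" using finite_partition_at by simp
  show "?C \<in> space borel \<rightarrow> Pow (partition_at n k) \<and> (\<forall>S\<in>Pow (partition_at n k). ?C -` {S} \<inter> space borel \<in> sets borel)"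
  proof (intro conjI ballI)
   fix S :: "(nat^'d) set set" assume S: "S \<in> Pow (partition_at n k)"
   have "?C -` {S} \<inter> space borel = {x \<in> space borel. \<forall>J\<in>partition_at n k. (x \<in> comp_cell n J) = (J \<in> S)}"
    using S by auto
   also have "\<dots> \<in> sets borel"
   proof (rule sets.sets_Collect_finite_All[OF _ finite_partition_at])
    fix J :: "(nat^'d) set"
    show "{x \<in> space borel. (x \<in> comp_cell n J) = (J \<in> S)} \<in> sets borel"
     using comp_cell_borel[of n J] borel_comp[OF comp_cell_borel[of n J]]
     by (cases "J \<in> S") (auto simp: Compl_eq)
   qed
   finally show "?C -` {S} \<inter> space borel \<in> sets borel" .
  qed auto
 qed
 then have "(\<lambda>x. (\<lambda>S. SOME J. J \<in> S) (?C x)) \<in> (borel :: (real^'d) measure) \<rightarrow>\<^sub>M count_space UNIV"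
  by (rule measurable_compose) simp
 then show ?thesis by simp
qed

text \<open>The fibers of the discrete problems depend on \<open>(t, x)\<close> only through the step and the selected
 composite cell; this makes them kernels although the selection of the cell is arbitrary.\<close>

lemma cellwise_kernel:
 fixes \<a> :: "(real \<times> (real^'d)) measure"
 assumes \<a>: "sets \<a> = sets borel" and N: "N \<in> space (prob_algebra borel)"
  and G: "\<And>t x. x \<in> X_dom ==> G (step_at n t) (cell_at n t x) \<in> space (prob_algebra borel)"
 shows "kernel \<a> (\<lambda>a. if snd a \<in> X_dom then G (step_at n (fst a)) (cell_at n (fst a) (snd a)) else N)"
proof -
 define G' where "G' k J = (if G k J \<in> space (prob_algebra borel) then G k J else N)" for k J
 have G': "kernel (count_space UNIV) (G' k)" for k
  using N by (auto simp: G'_def)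
 have fst: "fst \<in> \<a> \<rightarrow>\<^sub>M borel" and snd: "snd \<in> \<a> \<rightarrow>\<^sub>M borel"
  using borel_measurable_fst_borel borel_measurable_snd_borel by (simp_all add: measurable_cong_sets[OF \<a> refl])
 have sel: "(\<lambda>a. G' k (SOME J. J \<in> partition_at n k \<and> snd a \<in> comp_cell n J)) \<in> \<a> \<rightarrow>\<^sub>M prob_algebra borel" for k
  by (rule measurable_compose[OF measurable_compose[OF snd cell_selection_measurable] G'])
 have step: "(\<lambda>a. step_at n (fst a)) \<in> \<a> \<rightarrow>\<^sub>M count_space UNIV"
 proof -
  have "step_at n \<in> borel \<rightarrow>\<^sub>M count_space UNIV" unfolding step_at_def by measurable
  then show ?thesis by (rule measurable_compose[OF fst])
 qed
 have cell: "kernel \<a> (\<lambda>a. G' (step_at n (fst a)) (cell_at n (fst a) (snd a)))"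
  unfolding cell_at_def by (rule measurable_compose_countable[OF sel step])
 have "kernel \<a> (\<lambda>a. if snd a \<in> X_dom then G' (step_at n (fst a)) (cell_at n (fst a) (snd a)) else N)"
 proof (rule measurable_If[OF cell])
  show "kernel \<a> (\<lambda>a. N)" using N by simp
  have "snd -` X_dom \<inter> space \<a> \<in> sets \<a>"
   by (intro measurable_sets[OF snd] borel_closed compact_imp_closed compact_X_dom)
  moreover have "{x \<in> space \<a>. snd x \<in> X_dom} = snd -` X_dom \<inter> space \<a>" by auto
  ultimately show "{x \<in> space \<a>. snd x \<in> X_dom} \<in> sets \<a>" by simp
 qed
 then show ?thesis
  by (rule measurable_cong[THEN iffD1, rotated]) (use G in \<open>auto simp: G'_def\<close>)
qed

text \<open>Off a null set the fibers may be any fixed Borel measure, not necessarily a probability: \<open>glue\<close> is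
 defined through the image of \<open>\<a>\<close> under the fiber map, and preimages under a constant are trivial.\<close>

lemma glue_cong_constant_outside:
 fixes \<a> :: "'a::second_countable_topology measure" and \<k> \<k>' :: "'a => 'b::second_countable_topology measure"
 assumes \<a>: "sets \<a> = sets borel" and \<k>': "kernel \<a> \<k>'"
  and A: "A \<in> sets borel" "emeasure \<a> (- A) = 0"
  and eq: "\<And>a. a \<in> A ==> \<k> a = \<k>' a" and const: "\<And>a. a \<notin> A ==> \<k> a = \<k>0" and \<k>0: "sets \<k>0 = sets borel"
 shows "glue \<a> \<k> = glue \<a> \<k>'"
proof -
 have sp: "space \<a> = UNIV" using \<a> by (auto dest: sets_eq_imp_space_eq)
 let ?B = "borel :: ('a \<times> 'b) measure"
 let ?f = "\<lambda>a. distr (\<k> a) ?B (Pair a)" and ?g = "\<lambda>a. distr (\<k>' a) ?B (Pair a)"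
 have g: "?g \<in> \<a> \<rightarrow>\<^sub>M subprob_algebra ?B"
  using glue_kernel_measurable[OF \<a> \<k>'] by (rule measurable_prob_algebraD)
 have em: "emeasure \<a> (?f -` S \<inter> space \<a>) = emeasure \<a> (?g -` S \<inter> space \<a>)" if S: "S \<in> sets (subprob_algebra ?B)" for S
 proof -
  let ?O = "{a. a \<notin> A \<and> distr \<k>0 ?B (Pair a) \<in> S}"
  have O: "?O \<in> sets \<a>"
  proof (cases "\<k>0 \<in> space (subprob_algebra borel)")
   case True
   have "(\<lambda>a. distr \<k>0 ?B (Pair a)) \<in> \<a> \<rightarrow>\<^sub>M subprob_algebra ?B"
   proof (rule measurable_distr2)
    show "(\<lambda>a. \<k>0) \<in> \<a> \<rightarrow>\<^sub>M subprob_algebra borel" using True by simp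
    have "(\<lambda>x. (fst x, snd x)) \<in> \<a> \<Otimes>\<^sub>M borel \<rightarrow>\<^sub>M ?B"
     using \<a> by (intro borel_measurable_Pair_borel) (auto intro!: measurable_fst' measurable_snd' simp: measurable_cong_sets[OF refl \<a>[symmetric]])
    then show "(\<lambda>(x, y). (x, y)) \<in> \<a> \<Otimes>\<^sub>M borel \<rightarrow>\<^sub>M ?B" by (simp add: case_prod_beta')
   qed
   from measurable_sets[OF this S] have "{a. distr \<k>0 ?B (Pair a) \<in> S} \<in> sets \<a>" by (simp add: sp vimage_def)
   then have "(- A) \<inter> {a. distr \<k>0 ?B (Pair a) \<in> S} \<in> sets \<a>" using A \<a> by auto
   moreover have "(- A) \<inter> {a. distr \<k>0 ?B (Pair a) \<in> S} = ?O" by auto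
   ultimately show ?thesis by simp
  next
   case False
   have "distr \<k>0 ?B (Pair a) \<notin> S" for a
   proof
    assume "distr \<k>0 ?B (Pair a) \<in> S"
    then have "distr \<k>0 ?B (Pair a) \<in> space (subprob_algebra ?B)" using sets.sets_into_space[OF S] by auto
    then have "emeasure (distr \<k>0 ?B (Pair a)) UNIV \<le> 1"
     by (auto simp: space_subprob_algebra dest!: subprob_space.emeasure_space_le_1)
    moreover have "space \<k>0 = UNIV" using \<k>0 by (auto dest: sets_eq_imp_space_eq)
    moreover have "Pair a \<in> \<k>0 \<rightarrow>\<^sub>M ?B" by (simp add: measurable_cong_sets[OF \<k>0 refl] measurable_Pair_borel)
    ultimately have "emeasure \<k>0 (space \<k>0) \<le> 1" by (simp add: emeasure_distr)
    then show False
     using False \<k>0 \<open>space \<k>0 = UNIV\<close> by (auto simp: space_subprob_algebra intro!: subprob_spaceI)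
   qed
   then show ?thesis by simp
  qed
  have Ac: "- A \<in> sets \<a>" using A \<a> by auto
  have gS: "?g -` S \<inter> space \<a> \<in> sets \<a>" by (rule measurable_sets[OF g S])
  have f_eq: "?f -` S \<inter> space \<a> = (?g -` S \<inter> space \<a> \<inter> A) \<union> ?O"
  proof (rule set_eqI)
   show "a \<in> ?f -` S \<inter> space \<a> \<longleftrightarrow> a \<in> (?g -` S \<inter> space \<a> \<inter> A) \<union> ?O" for a
    by (cases "a \<in> A") (simp_all add: sp eq const)
  qed
  show ?thesis
  proof (rule emeasure_eq_AE)
   have "AE a in \<a>. a \<notin> - A" using A Ac by (intro AE_not_in) (auto simp: null_sets_def)
   then show "AE a in \<a>. (a \<in> ?f -` S \<inter> space \<a>) = (a \<in> ?g -` S \<inter> space \<a>)"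
    by eventually_elim (auto simp: eq)
   show "?f -` S \<inter> space \<a> \<in> sets \<a>" unfolding f_eq using gS O A \<a> by auto
  qed (rule gS)
 qed
 have dist: "distr \<a> (subprob_algebra ?B) ?f = distr \<a> (subprob_algebra ?B) ?g"
  unfolding distr_def[of \<a>] by (rule measure_of_eq) (auto simp: sets.space_closed em sets.sigma_sets_eq)
 have "subprob_algebra (?f a) = subprob_algebra ?B" "subprob_algebra (?g a) = subprob_algebra ?B" for a
  by (rule subprob_algebra_cong, simp)+
 then show ?thesis unfolding glue_def bind_def by (simp add: sp dist)
qed

section \<open>Convergence of the fibers\<close>

text \<open>On a compact set a continuous function is Lipschitz up to an arbitrarily small error.\<close>

lemma wasserstein1_test_function:
 fixes Y :: "'b::euclidean_space set"
 assumes Y: "compact Y" and h: "bounded_borel h" "continuous_on Y h" and e: "0 < e"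
 obtains C where "0 < C" "\<And>p q. p \<in> prob_on Y ==> q \<in> prob_on Y ==> ennreal ((\<bar>(\<integral>y. h y \<partial>p) - (\<integral>y. h y \<partial>q)\<bar> - e) / C) \<le> wasserstein1 p q"
proof -
 obtain B where B: "\<And>x. \<bar>h x\<bar> \<le> B" and hm[measurable]: "h \<in> borel_measurable borel" using h(1) by (auto simp: bounded_borel_def)
 have B0: "0 \<le> B" using B[of undefined] by simp
 obtain d where d: "0 < d" "\<And>x y. x \<in> Y ==> y \<in> Y ==> dist y x < d ==> dist (h y) (h x) < e"
  using compact_uniformly_continuous[OF h(2) Y] e unfolding uniformly_continuous_on_def by metis
 \<comment> \<open>points at distance at least \<open>d\<close> are handled by the bound \<open>2 * B\<close> on the increment\<close>
 define C where "C = 2 * B / d + 1"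
 have C: "0 < C" using B0 d by (simp add: C_def add_nonneg_pos)
 have lip: "\<bar>h x - h y\<bar> \<le> e + C * dist x y" if "x \<in> Y" "y \<in> Y" for x y
 proof (cases "dist x y < d")
  case True
  then have "\<bar>h x - h y\<bar> < e" using d(2)[of y x] that by (simp add: dist_real_def)
  moreover have "0 \<le> C * dist x y" using C by simp
  ultimately show ?thesis by linarith
 next
  case False
  then have "2 * B / d * d \<le> C * dist x y" using C B0 d(1) by (intro mult_mono) (auto simp: C_def)
  then have "2 * B \<le> C * dist x y" using d by simp
  then show ?thesis using B[of x] B[of y] e by linarith
 qed
 show thesis
 proof (rule that[OF C])
  fix p q assume p: "p \<in> prob_on Y" and q: "q \<in> prob_on Y"
  show "ennreal ((\<bar>(\<integral>y. h y \<partial>p) - (\<integral>y. h y \<partial>q)\<bar> - e) / C) \<le> wasserstein1 p q"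
   unfolding wasserstein1_def
  proof (rule INF_greatest)
   fix \<gamma> :: "('b \<times> 'b) measure" assume \<gamma>: "\<gamma> \<in> couplings p q"
   have s: "sets \<gamma> = sets borel" and m: "distr \<gamma> borel fst = p" "distr \<gamma> borel snd = q"
    using \<gamma> by (auto simp: couplings_def)
   note meas = measurable_cong_sets[OF s refl]
   have f1[measurable]: "fst \<in> \<gamma> \<rightarrow>\<^sub>M borel" "snd \<in> \<gamma> \<rightarrow>\<^sub>M borel" by (simp_all add: meas)
   have Yb: "- Y \<in> sets borel" by (intro borel_open open_Compl compact_imp_closed Y)
   interpret \<gamma>: prob_space \<gamma>
    using p m(1) f1(1) by (intro prob_space_distrD[of fst \<gamma> borel]) (auto simp: prob_on_def)
   have AE1: "AE y in p. y \<notin> - Y" "AE y in q. y \<notin> - Y"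
    by (rule AE_not_in, use p q Yb in \<open>simp add: null_sets_def prob_on_def\<close>)+
   have AE2: "AE x in \<gamma>. fst x \<in> Y" "AE x in \<gamma>. snd x \<in> Y"
    using AE_distrD[OF f1(1) AE1(1)[folded m(1)]] AE_distrD[OF f1(2) AE1(2)[folded m(2)]] by simp_all
   have i: "integrable \<gamma> (\<lambda>x. h (fst x))" "integrable \<gamma> (\<lambda>x. h (snd x))"
    by (intro \<gamma>.integrable_const_bound[of _ B]; simp add: B)+
   have I: "(\<integral>y. h y \<partial>p) - (\<integral>y. h y \<partial>q) = (\<integral>x. h (fst x) - h (snd x) \<partial>\<gamma>)"
    unfolding m[symmetric] using i by (simp add: integral_distr)
   show "ennreal ((\<bar>(\<integral>y. h y \<partial>p) - (\<integral>y. h y \<partial>q)\<bar> - e) / C) \<le> (\<integral>\<^sup>+x. ennreal (dist (fst x) (snd x)) \<partial>\<gamma>)"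
   proof (cases "(\<integral>\<^sup>+x. ennreal (dist (fst x) (snd x)) \<partial>\<gamma>) = \<infinity>")
    case False
    have dm: "(\<lambda>x. dist (fst x) (snd x)) \<in> borel_measurable \<gamma>" by measurable
    have di: "integrable \<gamma> (\<lambda>x. dist (fst x) (snd x))"
     using False by (intro integrableI_nonneg[OF dm]) (auto simp: top.not_eq_extremum)
    have "\<bar>\<integral>x. h (fst x) - h (snd x) \<partial>\<gamma>\<bar> \<le> (\<integral>x. \<bar>h (fst x) - h (snd x)\<bar> \<partial>\<gamma>)" by (rule integral_abs_bound)
    also have "\<dots> \<le> (\<integral>x. e + C * dist (fst x) (snd x) \<partial>\<gamma>)"
    proof (rule integral_mono_AE)
     show "AE x in \<gamma>. \<bar>h (fst x) - h (snd x)\<bar> \<le> e + C * dist (fst x) (snd x)"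
      using AE2 by eventually_elim (use lip in blast)
    qed (use i di in auto)
    also have "\<dots> = e + C * (\<integral>x. dist (fst x) (snd x) \<partial>\<gamma>)" using di by (simp add: \<gamma>.prob_space)
    finally have "(\<bar>(\<integral>y. h y \<partial>p) - (\<integral>y. h y \<partial>q)\<bar> - e) / C \<le> (\<integral>x. dist (fst x) (snd x) \<partial>\<gamma>)"
     unfolding I using C by (simp add: field_simps)
    then have "ennreal ((\<bar>(\<integral>y. h y \<partial>p) - (\<integral>y. h y \<partial>q)\<bar> - e) / C) \<le> ennreal (\<integral>x. dist (fst x) (snd x) \<partial>\<gamma>)" by (rule ennreal_leI)
    then show ?thesis using nn_integral_eq_integral[OF di] by simp
   qed simp
  qed
 qed
qed

lemma continuous_fiberwise_osc:
 fixes A :: "'a::metric_space set" and Z :: "'b::metric_space set" and Y :: "'c::metric_space set"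
 assumes "compact A" "compact Z" "compact Y" and k: "continuous_on (A \<times> (Z \<times> Y)) k"
  and A: "AE a in \<a>. a \<in> A" and e: "0 < e"
 shows "\<exists>d>0. fiberwise_osc \<a> Z Y k d e"
proof -
 have "compact (A \<times> (Z \<times> Y))" using assms by (intro compact_Times)
 from compact_uniformly_continuous[OF k this] e
 obtain d where d: "0 < d" "\<And>p q. p \<in> A \<times> (Z \<times> Y) ==> q \<in> A \<times> (Z \<times> Y) ==> dist q p < d ==> dist (k q) (k p) < e"
  unfolding uniformly_continuous_on_def by metis
 have "fiberwise_osc \<a> Z Y k (d / 2) e"
  unfolding fiberwise_osc_def using A
 proof eventually_elim
  case (elim a)
  show ?case
  proof (intro ballI impI)
   fix z z' y y' assume *: "z \<in> Z" "z' \<in> Z" "y \<in> Y" "y' \<in> Y" "dist z z' < d / 2" "dist y y' < d / 2"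
   have "dist (a, (z, y)) (a, (z', y')) \<le> dist z z' + dist y y'"
    by (simp add: dist_Pair_Pair sqrt_sum_squares_le_sum)
   then have "dist (a, (z, y)) (a, (z', y')) < d" using * by linarith
   then have "dist (k (a, (z, y))) (k (a, (z', y'))) < e" using d(2)[of "(a, (z', y'))" "(a, (z, y))"] * elim by simp
   then show "\<bar>k (a, (z, y)) - k (a, (z', y'))\<bar> \<le> e" by (simp add: dist_real_def)
  qed
 qed
 then show ?thesis using d(1) by (intro exI[of _ "d / 2"]) simp
qed

lemma continuous_on_compact_bounded_borel:
 fixes f :: "'e::euclidean_space => real"
 assumes K: "compact K" and f: "continuous_on K f"
 shows "bounded_borel (\<lambda>x. indicator K x * f x)"
proof -
 obtain B where B: "\<And>x. x \<in> K ==> norm (f x) \<le> B"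
  using compact_imp_bounded[OF compact_continuous_image[OF f K]] by (auto simp: bounded_iff)
 show ?thesis
 proof (rule bounded_borelI[of _ "max B 0"])
  show "(\<lambda>x. indicator K x * f x) \<in> borel_measurable borel"
   using borel_measurable_continuous_on_indicator[OF borel_closed[OF compact_imp_closed[OF K]] f] by simp
  show "\<bar>indicator K x * f x\<bar> \<le> max B 0" for x using B[of x] by (auto simp: indicator_def)
 qed
qed

section \<open>The linearised cost\<close>

lemma norm_le_card:
 fixes v :: "real^'d"
 assumes "\<And>l. \<bar>v $ l\<bar> \<le> b"
 shows "norm v \<le> real CARD('d) * b"
proof -
 have "norm v \<le> (\<Sum>l\<in>UNIV. \<bar>v $ l\<bar>)" by (rule norm_le_l1_cart)
 also have "\<dots> \<le> (\<Sum>l\<in>(UNIV :: 'd set). b)" by (intro sum_mono assms)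
 finally show ?thesis by simp
qed

lemma
 fixes c :: "(real^'d) \<times> (real^'d) => real"
 assumes c: "C1_on (X_dom \<times> Y) c"
 shows continuous_on_grad_X: "continuous_on (X_dom \<times> Y) (\<lambda>p. grad_X c (fst p) (snd p))"
  and grad_X_mean_value: "v \<in> X_dom ==> w \<in> X_dom ==> y \<in> Y ==>
   \<exists>s. 0 \<le> s \<and> s \<le> 1 \<and> c (w, y) - c (v, y) = grad_X c (v + s *\<^sub>R (w - v)) y \<bullet> (w - v)"
proof -
 obtain U h and D :: "(real^'d) \<times> (real^'d) => ((real^'d) \<times> (real^'d)) \<Rightarrow>\<^sub>L real"
  where U: "open U" "X_dom \<times> Y \<subseteq> U" and D: "\<And>p. p \<in> U ==> (h has_derivative blinfun_apply (D p)) (at p)"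
   and cont: "continuous_on U D" and hc: "\<And>p. p \<in> X_dom \<times> Y ==> h p = c p"
  using c unfolding C1_on_def by metis
 define G where "G p = (\<Sum>b\<in>Basis. blinfun_apply (D p) (b, 0) *\<^sub>R b)" for p
 have G: "G p \<bullet> v = blinfun_apply (D p) (v, 0)" for p v
 proof -
  interpret l: bounded_linear "\<lambda>v. blinfun_apply (D p) (v, 0)"
   by (intro bounded_linear_compose[OF blinfun.bounded_linear_right] bounded_linear_Pair bounded_linear_ident bounded_linear_zero)
  have "blinfun_apply (D p) (v, 0) = blinfun_apply (D p) ((\<Sum>b\<in>Basis. (v \<bullet> b) *\<^sub>R b), 0)" by (simp add: euclidean_representation)
  also have "\<dots> = (\<Sum>b\<in>Basis. (v \<bullet> b) * blinfun_apply (D p) (b, 0))" by (simp add: l.sum l.scaleR)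
  also have "\<dots> = G p \<bullet> v"
   unfolding G_def inner_sum_left inner_scaleR_left by (intro sum.cong refl) (simp add: inner_commute mult.commute)
  finally show ?thesis by simp
 qed
 have der: "((\<lambda>x'. h (x', y)) has_derivative (\<lambda>v. G (x, y) \<bullet> v)) (at x)" if "(x, y) \<in> U" for x y
 proof -
  have "((\<lambda>x'. (x', y)) has_derivative (\<lambda>v. (v, 0))) (at x)" by (auto intro!: derivative_eq_intros)
  from has_derivative_compose[OF this D[OF that]] show ?thesis by (simp add: G)
 qed
 have grad: "grad_X c x y = G (x, y)" if x: "x \<in> X_dom" and y: "y \<in> Y" for x y
 proof -
  have "((\<lambda>x'. h (x', y)) has_derivative (\<lambda>v. G (x, y) \<bullet> v)) (at x within X_dom)"
   using der[of x y] x y U(2) by (auto intro: has_derivative_at_withinI)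
  then have d: "((\<lambda>x'. c (x', y)) has_derivative (\<lambda>v. G (x, y) \<bullet> v)) (at x within X_dom)"
   by (rule has_derivative_transform[rotated 2]) (use x y hc in auto)
  show ?thesis unfolding grad_X_def
  proof (rule the_equality)
   show "((\<lambda>x'. c (x', y)) has_derivative (\<lambda>v. G (x, y) \<bullet> v)) (at x within X_dom)" by (rule d)
   fix g assume g: "((\<lambda>x'. c (x', y)) has_derivative (\<lambda>v. g \<bullet> v)) (at x within X_dom)"
   have "(\<lambda>v. g \<bullet> v) = (\<lambda>v. G (x, y) \<bullet> v)"
   proof (rule frechet_derivative_unique_within_closed_interval)
    show "(0 :: real^'d) \<bullet> i < 1 \<bullet> i" if "i \<in> Basis" for i
     using that by (auto simp: Basis_vec_def inner_axis)
   qed (use g d x in \<open>simp_all add: X_dom_eq[symmetric]\<close>)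
   then have "(g - G (x, y)) \<bullet> (g - G (x, y)) = 0" by (simp add: inner_diff_left fun_eq_iff)
   then show "g = G (x, y)" by simp
  qed
 qed
 have "continuous_on (X_dom \<times> Y) (\<lambda>p. G p)"
  unfolding G_def by (intro continuous_intros continuous_on_subset[OF cont U(2)])
 then show "continuous_on (X_dom \<times> Y) (\<lambda>p. grad_X c (fst p) (snd p))"
  by (rule continuous_on_cong[THEN iffD1, OF refl, rotated]) (auto simp: grad)
 assume v: "v \<in> X_dom" and w: "w \<in> X_dom" and y: "y \<in> Y"
 have seg: "v + s *\<^sub>R (w - v) \<in> X_dom" if "0 \<le> s" "s \<le> 1" for s
 proof -
  have "(1 - s) *\<^sub>R v + s *\<^sub>R w \<in> X_dom"
   using convex_box(1)[of 0 "1 :: real^'d"] v w that unfolding X_dom_eq by (intro convexD) auto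
  moreover have "(1 - s) *\<^sub>R v + s *\<^sub>R w = v + s *\<^sub>R (w - v)" by (simp add: algebra_simps)
  ultimately show ?thesis by simp
 qed
 have der_seg: "((\<lambda>s. h (v + s *\<^sub>R (w - v), y)) has_derivative (\<lambda>r. G (v + s *\<^sub>R (w - v), y) \<bullet> (r *\<^sub>R (w - v)))) (at s within {0..1})"
  if "0 \<le> s" "s \<le> 1" for s
 proof -
  have "((\<lambda>s. v + s *\<^sub>R (w - v)) has_derivative (\<lambda>r. r *\<^sub>R (w - v))) (at s within {0..1})"
   by (auto intro!: derivative_eq_intros)
  from has_derivative_compose[OF this der[of "v + s *\<^sub>R (w - v)" y]] seg[OF that] y U(2) show ?thesis by auto
 qed
 obtain s :: real where s: "s \<in> {0<..<1}"
  "h (v + 1 *\<^sub>R (w - v), y) - h (v + 0 *\<^sub>R (w - v), y) = G (v + s *\<^sub>R (w - v), y) \<bullet> ((1 - 0) *\<^sub>R (w - v))"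
  using mvt_simple[of 0 1 "\<lambda>s. h (v + s *\<^sub>R (w - v), y)" "\<lambda>s r. G (v + s *\<^sub>R (w - v), y) \<bullet> (r *\<^sub>R (w - v))"] der_seg by auto
 have "c (w, y) - c (v, y) = G (v + s *\<^sub>R (w - v), y) \<bullet> (w - v)"
  using s(2) hc[of "(w, y)"] hc[of "(v, y)"] v w y by simp
 then show "\<exists>s. 0 \<le> s \<and> s \<le> 1 \<and> c (w, y) - c (v, y) = grad_X c (v + s *\<^sub>R (w - v)) y \<bullet> (w - v)"
  using s(1) seg[of s] y by (intro exI[of _ s]) (auto simp: grad)
qed

text \<open>By the definition of \<open>\<Delta>\<^sup>n\<close> the gradient at the centre cancels, and what remains is a difference
 quotient of \<open>c\<close> over a distance of order \<open>1/n\<close> plus a value of \<open>f\<^sup>n\<close>.\<close>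

lemma linearisation_uniform:
 fixes c :: "(real^'d) \<times> (real^'d) => real"
 assumes Y: "compact Y" and c: "C1_on (X_dom \<times> Y) c"
  and f: "uniform_limit (X_dom \<times> Y) f (\<lambda>_. 0) (along pos_evens)" and e: "0 < e"
 shows "eventually (\<lambda>n. \<forall>x\<in>X_dom. \<forall>w\<in>X_dom. (\<forall>l. \<bar>x $ l - w $ l\<bar> \<le> 1 / real n) \<longrightarrow>
   (\<forall>z\<in>Z_dom. \<forall>y\<in>Y. \<bar>grad_X c w y \<bullet> z + Delta c f n w z y - grad_X c x y \<bullet> z\<bar> \<le> e)) (along pos_evens)"
proof -
 let ?N = "real CARD('d)"
 have N: "0 < ?N" by simp
 have "compact (X_dom \<times> Y)" by (intro compact_Times compact_X_dom Y)
 from compact_uniformly_continuous[OF continuous_on_grad_X[OF c] this]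
 obtain d where d: "0 < d"
  "\<And>p q. p \<in> X_dom \<times> Y ==> q \<in> X_dom \<times> Y ==> dist q p < d ==> dist (grad_X c (fst q) (snd q)) (grad_X c (fst p) (snd p)) < e / (2 * ?N)"
  unfolding uniformly_continuous_on_def using e N by (metis divide_pos_pos mult_pos_pos zero_less_numeral)
 have grad_close: "\<bar>grad_X c v y \<bullet> z - grad_X c x y \<bullet> z\<bar> \<le> e / 2"
  if "v \<in> X_dom" "x \<in> X_dom" "y \<in> Y" "z \<in> Z_dom" "dist v x < d" for v x y z
 proof -
  have nz: "norm z \<le> ?N"
   using norm_le_card[of z 1] that(4) by (auto simp: Z_dom_def abs_le_iff minus_le_iff)
  have "dist (grad_X c v y) (grad_X c x y) < e / (2 * ?N)"
   using d(2)[of "(x, y)" "(v, y)"] that by (simp add: dist_Pair_Pair)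
  then have "norm (grad_X c v y - grad_X c x y) * norm z \<le> e / (2 * ?N) * ?N"
   using nz e N by (intro mult_mono) (auto simp: dist_norm)
  moreover have "\<bar>(grad_X c v y - grad_X c x y) \<bullet> z\<bar> \<le> norm (grad_X c v y - grad_X c x y) * norm z"
   by (rule Cauchy_Schwarz_ineq2)
  ultimately show ?thesis using N by (simp add: inner_diff_left)
 qed
 have f_small: "eventually (\<lambda>n. \<forall>p\<in>X_dom \<times> Y. \<bar>f n p\<bar> < e / 2) (along pos_evens)"
  using uniform_limitD[OF f, of "e / 2"] e by (simp add: dist_real_def)
 obtain m :: nat where m: "2 * ?N / d < real m" using reals_Archimedean2 by blast
 have large: "eventually (\<lambda>n. n \<in> pos_evens \<and> m \<le> n) (along pos_evens)" unfolding eventually_along by blast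
 show ?thesis using f_small large
 proof eventually_elim
  case (elim n)
  have n: "0 < real n" using elim by (simp add: pos_evens_def)
  have nd: "2 * (?N * (1 / real n)) < d"
  proof -
   have "2 * ?N / d < real n" using m elim by linarith
   then show ?thesis using n d(1) by (simp add: field_simps)
  qed
  show ?case
  proof (intro ballI impI)
   fix x w z y :: "real^'d" assume x: "x \<in> X_dom" and w: "w \<in> X_dom" and xw: "\<forall>l. \<bar>x $ l - w $ l\<bar> \<le> 1 / real n"
    and z: "z \<in> Z_dom" and y: "y \<in> Y"
   have dwx: "norm (x - w) \<le> ?N * (1 / real n)" by (rule norm_le_card) (use xw in simp)
   show "\<bar>grad_X c w y \<bullet> z + Delta c f n w z y - grad_X c x y \<bullet> z\<bar> \<le> e"
   proof (cases "w + (1 / real n) *\<^sub>R z \<in> X_dom")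
    case True
    let ?u = "w + (1 / real n) *\<^sub>R z"
    obtain s where s: "0 \<le> s" "s \<le> 1" "c (?u, y) - c (w, y) = grad_X c (w + s *\<^sub>R (?u - w)) y \<bullet> (?u - w)"
     using grad_X_mean_value[OF c w True y] by blast
    let ?v = "w + s *\<^sub>R (?u - w)"
    have v: "?v \<in> X_dom"
    proof -
     have "(1 - s) *\<^sub>R w + s *\<^sub>R ?u \<in> X_dom"
      using convex_box(1)[of 0 "1 :: real^'d"] w True s unfolding X_dom_eq by (intro convexD) auto
     moreover have "(1 - s) *\<^sub>R w + s *\<^sub>R ?u = ?v" by (simp add: algebra_simps)
     ultimately show ?thesis by simp
    qed
    have "\<bar>(?v - w) $ l\<bar> \<le> 1 / real n" for l
    proof -
     have "\<bar>s * z $ l\<bar> \<le> 1 * 1"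
      unfolding abs_mult using s z by (intro mult_mono) (auto simp: Z_dom_def abs_le_iff minus_le_iff)
     then have "\<bar>s * z $ l\<bar> / real n \<le> 1 / real n" by (intro divide_right_mono) auto
     then show ?thesis using n by (simp add: abs_mult)
    qed
    then have "norm (?v - w) \<le> ?N * (1 / real n)" by (rule norm_le_card)
    moreover have "norm (?v - x) \<le> norm (?v - w) + norm (w - x)"
    proof -
     have "?v - x = (?v - w) + (w - x)" by simp
     then show ?thesis by (simp only: norm_triangle_ineq)
    qed
    ultimately have "dist ?v x < d" using dwx nd by (simp only: dist_norm norm_minus_commute[of w x])
    then have gc: "\<bar>grad_X c ?v y \<bullet> z - grad_X c x y \<bullet> z\<bar> \<le> e / 2" using v x y z by (intro grad_close)
    have fs: "\<bar>f n (?u, y)\<bar> < e / 2" using elim True y by blast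
    have "Delta c f n w z y = real n * (c (?u, y) - c (w, y)) + f n (?u, y) - grad_X c w y \<bullet> z"
     using True n by (simp add: Delta_def perturbed_cost_def algebra_simps)
    also have "real n * (c (?u, y) - c (w, y)) = grad_X c ?v y \<bullet> z"
     unfolding s(3) using n by simp
    finally have "grad_X c w y \<bullet> z + Delta c f n w z y - grad_X c x y \<bullet> z = (grad_X c ?v y \<bullet> z - grad_X c x y \<bullet> z) + f n (?u, y)"
     by simp
    then show ?thesis using gc fs by linarith
   next
    case False
    have "0 \<le> ?N * (1 / real n)" by simp
    then have "dist w x < d" using dwx nd by (simp only: dist_norm norm_minus_commute[of w x])
    then have "\<bar>grad_X c w y \<bullet> z - grad_X c x y \<bullet> z\<bar> \<le> e / 2" using w x y z by (intro grad_close)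
    then show ?thesis using False e by (simp add: Delta_def)
   qed
  qed
 qed
qed

text \<open>The limit cost \<open>\<langle>\<nabla>\<^sub>Xc(x, y), z\<rangle>\<close>, extended by zero
 outside the glued domain.\<close>

definition linear_cost ::
 "(real^'d) set => ((real^'d) \<times> (real^'d) => real) => real => (real \<times> (real^'d)) \<times> ((real^'d) \<times> (real^'d)) => real" where
 "linear_cost Y c T p = indicator (glued_dom Y T) p * (grad_X c (snd (fst p)) (snd (snd p)) \<bullet> fst (snd p))"

lemma compact_glued_dom: "compact Y ==> compact (glued_dom Y T)"
 unfolding glued_dom_def by (intro compact_Times compact_X_dom compact_Z_dom compact_Icc)

lemma
 assumes Y: "compact Y" and c: "C1_on (X_dom \<times> Y) c"
 shows continuous_on_linear_cost: "continuous_on (glued_dom Y T) (linear_cost Y c T)"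
  and bounded_borel_linear_cost: "bounded_borel (linear_cost Y c T)"
proof -
 have "continuous_on (glued_dom Y T) (\<lambda>p. grad_X c (fst (snd (fst p), snd (snd p))) (snd (snd (fst p), snd (snd p))))"
  by (rule continuous_on_compose2[OF continuous_on_grad_X[OF c]]) (auto simp: glued_dom_def intro!: continuous_intros)
 then have cont: "continuous_on (glued_dom Y T) (\<lambda>p. grad_X c (snd (fst p)) (snd (snd p)) \<bullet> fst (snd p))"
  by (intro continuous_intros) simp
 show "continuous_on (glued_dom Y T) (linear_cost Y c T)"
  by (rule continuous_on_cong[THEN iffD1, OF refl _ cont]) (simp add: linear_cost_def)
 show "bounded_borel (linear_cost Y c T)"
  using continuous_on_compact_bounded_borel[OF compact_glued_dom[OF Y] cont] by (simp add: linear_cost_def[abs_def])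
qed

lemma linear_cost_fiber:
 assumes "t \<in> {0..T}" "x \<in> X_dom"
 shows "(LINT p:Z_dom \<times> Y|\<gamma>. grad_X c x (snd p) \<bullet> fst p) = (\<integral>q. linear_cost Y c T ((t, x), q) \<partial>\<gamma>)"
 unfolding set_lebesgue_integral_def linear_cost_def using assms
 by (intro Bochner_Integration.integral_cong) (auto simp: glued_dom_def indicator_def)

text \<open>The integrand is continuous on each of two closed sets, according to whether \<open>x +
 z/n\<close> stays in \<open>X\<close>.\<close>

lemma borel_measurable_fiber_cost:
 fixes c :: "(real^'d) \<times> (real^'d) => real"
 assumes Y: "compact Y" and c: "C1_on (X_dom \<times> Y) c" and w: "w \<in> X_dom"
  and pc: "continuous_on (X_dom \<times> Y) (perturbed_cost c f n)"
 shows "(\<lambda>p. indicator (Z_dom \<times> Y) p * (grad_X c w (snd p) \<bullet> fst p + Delta c f n w (fst p) (snd p))) \<in> borel_measurable borel"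
proof -
 let ?K = "Z_dom \<times> Y" and ?A = "{p \<in> Z_dom \<times> Y. w + (1 / real n) *\<^sub>R fst p \<in> X_dom}"
 have K: "closed ?K" by (intro compact_imp_closed compact_Times compact_Z_dom Y)
 have "closed ((\<lambda>p :: (real^'d) \<times> (real^'d). w + (1 / real n) *\<^sub>R fst p) -` X_dom)"
  by (intro closed_vimage compact_imp_closed compact_X_dom continuous_intros)
 then have "closed (?K \<inter> (\<lambda>p. w + (1 / real n) *\<^sub>R fst p) -` X_dom)" by (rule closed_Int[OF K])
 moreover have "?K \<inter> (\<lambda>p. w + (1 / real n) *\<^sub>R fst p) -` X_dom = ?A" by blast
 ultimately have A: "closed ?A" by simp
 have grad: "continuous_on ?K (\<lambda>p. grad_X c w (snd p) \<bullet> fst p)"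
 proof -
  have "continuous_on ?K (\<lambda>p. grad_X c (fst (w, snd p)) (snd (w, snd p)))"
   by (rule continuous_on_compose2[OF continuous_on_grad_X[OF c]]) (auto simp: w intro!: continuous_intros)
  then show ?thesis by (intro continuous_intros) simp
 qed
 have cc: "continuous_on (X_dom \<times> Y) c"
  using c unfolding C1_on_def
 proof (elim exE conjE)
  fix U h and D :: "(real^'d) \<times> (real^'d) => ((real^'d) \<times> (real^'d)) \<Rightarrow>\<^sub>L real"
  assume *: "X_dom \<times> Y \<subseteq> U" "\<forall>p\<in>U. (h has_derivative blinfun_apply (D p)) (at p)" "\<forall>p\<in>X_dom \<times> Y. h p = c p"
  have "isCont h p" if "p \<in> X_dom \<times> Y" for p
   using * that by (intro has_derivative_continuous[of h "blinfun_apply (D p)"]) (metis subsetD)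
  then have "continuous_on (X_dom \<times> Y) h" by (simp add: continuous_at_imp_continuous_on)
  then show ?thesis by (rule continuous_on_cong[THEN iffD1, OF refl, rotated]) (use *(3) in blast)
 qed
 have val: "continuous_on ?A (\<lambda>p. real n * (perturbed_cost c f n (w + (1 / real n) *\<^sub>R fst p, snd p) - c (w, snd p)
    - grad_X c w (snd p) \<bullet> ((1 / real n) *\<^sub>R fst p)))"
 proof -
  have "continuous_on ?A (\<lambda>p. perturbed_cost c f n (w + (1 / real n) *\<^sub>R fst p, snd p))"
   by (rule continuous_on_compose2[OF pc]) (auto intro!: continuous_intros)
  moreover have "continuous_on ?A (\<lambda>p. c (w, snd p))"
   by (rule continuous_on_compose2[OF cc]) (auto simp: w intro!: continuous_intros)
  moreover have "continuous_on ?A (\<lambda>p. grad_X c w (snd p) \<bullet> fst p)"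
   by (rule continuous_on_subset[OF grad]) auto
  ultimately show ?thesis unfolding inner_scaleR_right by (intro continuous_on_mult continuous_on_diff continuous_on_const)
 qed
 have "(\<lambda>p. indicator ?K p *\<^sub>R (grad_X c w (snd p) \<bullet> fst p) + indicator ?A p *\<^sub>R (real n * (perturbed_cost c f n (w + (1 / real n) *\<^sub>R fst p, snd p) - c (w, snd p)
    - grad_X c w (snd p) \<bullet> ((1 / real n) *\<^sub>R fst p)))) \<in> borel_measurable borel"
  by (rule borel_measurable_add[OF borel_measurable_continuous_on_indicator[OF borel_closed[OF K] grad]
     borel_measurable_continuous_on_indicator[OF borel_closed[OF A] val]])
 then show ?thesis
  by (rule measurable_cong[THEN iffD1, rotated]) (auto simp: Delta_def indicator_def)
qed

lemma L_n_estimate: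
 fixes c :: "(real^'d) \<times> (real^'d) => real"
 assumes Y: "compact Y" and c: "C1_on (X_dom \<times> Y) c" and pc: "continuous_on (X_dom \<times> Y) (perturbed_cost c f n)"
  and tx: "t \<in> {0..T}" "x \<in> X_dom" and w: "center_at n t x \<in> X_dom" and \<gamma>: "prob_space \<gamma>" "sets \<gamma> = sets borel"
  and e: "0 \<le> e" "\<And>z y. z \<in> Z_dom ==> y \<in> Y ==>
   \<bar>grad_X c (center_at n t x) y \<bullet> z + Delta c f n (center_at n t x) z y - grad_X c x y \<bullet> z\<bar> \<le> e"
 shows "\<bar>L_n Y c f n t x \<gamma> - (\<integral>q. linear_cost Y c T ((t, x), q) \<partial>\<gamma>)\<bar> \<le> e"
proof -
 interpret \<gamma>: prob_space \<gamma> by (rule \<gamma>)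
 let ?u = "\<lambda>p. indicator (Z_dom \<times> Y) p * (grad_X c (center_at n t x) (snd p) \<bullet> fst p + Delta c f n (center_at n t x) (fst p) (snd p))"
 let ?l = "\<lambda>q. linear_cost Y c T ((t, x), q)"
 have close: "\<bar>?u q - ?l q\<bar> \<le> e" for q
  using e(2)[of "fst q" "snd q"] tx e(1) by (auto simp: linear_cost_def glued_dom_def indicator_def)
 have l: "bounded_borel ?l" by (rule bounded_borel_Pair[OF bounded_borel_linear_cost[OF Y c]])
 then obtain B where B: "\<And>q. \<bar>?l q\<bar> \<le> B" by (auto simp: bounded_borel_def)
 have "bounded_borel ?u"
 proof (rule bounded_borelI[OF borel_measurable_fiber_cost[OF Y c w pc]])
  show "\<bar>?u q\<bar> \<le> B + e" for q using close[of q] B[of q] by linarith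
 qed
 then have iu: "integrable \<gamma> ?u" by (rule bounded_borel_integrable[OF \<gamma>.finite_measure_axioms \<gamma>(2)])
 have il: "integrable \<gamma> ?l" by (rule bounded_borel_integrable[OF \<gamma>.finite_measure_axioms \<gamma>(2) l])
 have "L_n Y c f n t x \<gamma> = (\<integral>q. ?u q \<partial>\<gamma>)" by (simp add: L_n_def set_lebesgue_integral_def)
 then have "\<bar>L_n Y c f n t x \<gamma> - (\<integral>q. ?l q \<partial>\<gamma>)\<bar> = \<bar>\<integral>q. ?u q - ?l q \<partial>\<gamma>\<bar>" using iu il by simp
 also have "\<dots> \<le> (\<integral>q. \<bar>?u q - ?l q\<bar> \<partial>\<gamma>)" by (rule integral_abs_bound)
 also have "\<dots> \<le> (\<integral>q. e \<partial>\<gamma>)" by (intro integral_mono integrable_abs Bochner_Integration.integrable_diff iu il close) simp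
 finally show ?thesis by (simp add: \<gamma>.prob_space)
qed

section \<open>The limit trajectory and its fibers\<close>

lemma AE_restr_iff: "A \<in> sets M ==> (AE x in restr A M. P x) \<longleftrightarrow> (AE x in M. x \<in> A \<longrightarrow> P x)"
 unfolding restr_def by (subst AE_density) (auto simp: indicator_def)

lemma sigma_finite_restr_lborel: "A \<in> sets borel ==> sigma_finite_measure (restr A (lborel :: real measure))"
 unfolding restr_def by (subst sigma_finite_measure.sigma_finite_iff_density_finite[OF sigma_finite_lborel]) (auto simp: indicator_def)

lemma sets_pair_borel:
 fixes \<tau> :: "'a::second_countable_topology measure" and \<mu> :: "'b::second_countable_topology measure"
 assumes "sets \<tau> = sets borel" "sets \<mu> = sets borel"
 shows "sets (\<tau> \<Otimes>\<^sub>M \<mu>) = sets borel"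
proof -
 have "sets (\<tau> \<Otimes>\<^sub>M \<mu>) = sets (borel \<Otimes>\<^sub>M borel)" by (rule sets_pair_measure_cong[OF assms])
 also have "\<dots> = sets borel" by (rule arg_cong[OF borel_prod])
 finally show ?thesis .
qed

lemma
 fixes \<tau> :: "'a::second_countable_topology measure" and \<mu> :: "'b::second_countable_topology measure"
  and K :: "'a \<times> 'b => 'c::second_countable_topology measure"
 assumes \<tau>: "sets \<tau> = sets borel" and \<mu>: "sets \<mu> = sets borel" "prob_space \<mu>"
  and K: "kernel (\<tau> \<Otimes>\<^sub>M \<mu>) K"
 shows partial_glue_kernel: "kernel \<tau> (\<lambda>t. glue \<mu> (\<lambda>x. K (t, x)))"
  and glue_assoc: "distr (glue (\<tau> \<Otimes>\<^sub>M \<mu>) K) borel (\<lambda>p. (fst (fst p), (snd (fst p), snd p))) = glue \<tau> (\<lambda>t. glue \<mu> (\<lambda>x. K (t, x)))"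
proof -
 interpret \<mu>: prob_space \<mu> by (rule \<mu>)
 have s: "sets (\<tau> \<Otimes>\<^sub>M \<mu>) = sets borel" by (rule sets_pair_borel[OF \<tau> \<mu>(1)])
 have sp: "space \<tau> = UNIV" "space \<mu> = UNIV" using \<tau> \<mu> by (auto dest: sets_eq_imp_space_eq)
 have Kt: "kernel \<mu> (\<lambda>x. K (t, x))" for t
  by (rule measurable_compose[OF measurable_Pair1' K]) (simp add: sp)
 show ker: "kernel \<tau> (\<lambda>t. glue \<mu> (\<lambda>x. K (t, x)))"
  unfolding glue_def
 proof (rule measurable_bind_prob_space2)
  show "(\<lambda>t. \<mu>) \<in> \<tau> \<rightarrow>\<^sub>M prob_algebra \<mu>" using \<mu>(2) by (simp add: space_prob_algebra)
  have "(\<lambda>a. distr (K a) borel (\<lambda>y. (snd a, y))) \<in> \<tau> \<Otimes>\<^sub>M \<mu> \<rightarrow>\<^sub>M prob_algebra (borel :: ('b \<times> 'c) measure)"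
  proof (rule measurable_distr_prob_space2[OF K])
   have "(\<lambda>q. (snd (fst q), snd q)) \<in> (\<tau> \<Otimes>\<^sub>M \<mu>) \<Otimes>\<^sub>M borel \<rightarrow>\<^sub>M (borel :: ('b \<times> 'c) measure)"
    using \<mu>(1) by (intro borel_measurable_Pair_borel) (auto simp: measurable_cong_sets[OF refl \<mu>(1)[symmetric]])
   then show "(\<lambda>(a, y). (snd a, y)) \<in> (\<tau> \<Otimes>\<^sub>M \<mu>) \<Otimes>\<^sub>M borel \<rightarrow>\<^sub>M (borel :: ('b \<times> 'c) measure)" by (simp add: case_prod_beta')
  qed
  then show "kernel (\<tau> \<Otimes>\<^sub>M \<mu>) (\<lambda>(t, x). distr (K (t, x)) borel (Pair x))"
   by (simp add: case_prod_beta')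
 qed
 let ?q = "\<lambda>p :: ('a \<times> 'b) \<times> 'c. (fst (fst p), (snd (fst p), snd p))"
 have q: "?q \<in> borel \<rightarrow>\<^sub>M borel"
  by (intro borel_measurable_Pair_borel) (auto intro: measurable_compose[OF borel_measurable_fst_borel])
 show "distr (glue (\<tau> \<Otimes>\<^sub>M \<mu>) K) borel ?q = glue \<tau> (\<lambda>t. glue \<mu> (\<lambda>x. K (t, x)))"
 proof (rule measure_eqI)
  fix S assume "S \<in> sets (distr (glue (\<tau> \<Otimes>\<^sub>M \<mu>) K) borel ?q)"
  then have S: "S \<in> sets borel" by simp
  have q': "?q \<in> glue (\<tau> \<Otimes>\<^sub>M \<mu>) K \<rightarrow>\<^sub>M borel" using q by (simp add: measurable_cong_sets[OF sets_glue[OF s] refl])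
  have ind: "indicator S \<in> borel_measurable borel" "(\<lambda>p. indicator S (?q p) :: ennreal) \<in> borel_measurable borel"
   using S by (auto intro: measurable_compose[OF q])
  have m: "(\<lambda>a. \<integral>\<^sup>+y. indicator S (?q (a, y)) \<partial>K a) \<in> borel_measurable (\<tau> \<Otimes>\<^sub>M \<mu>)"
  proof (rule nn_integral_measurable_subprob_algebra2[OF _ measurable_prob_algebraD[OF K]])
   have "(\<lambda>p. indicator S (?q p) :: ennreal) \<in> borel_measurable ((\<tau> \<Otimes>\<^sub>M \<mu>) \<Otimes>\<^sub>M borel)"
    using ind(2) by (simp add: measurable_cong_sets[OF sets_pair_borel[OF s refl] refl])
   then show "(\<lambda>(a, y). indicator S (?q (a, y)) :: ennreal) \<in> borel_measurable ((\<tau> \<Otimes>\<^sub>M \<mu>) \<Otimes>\<^sub>M borel)" by (simp add: case_prod_beta')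
  qed
  have "emeasure (distr (glue (\<tau> \<Otimes>\<^sub>M \<mu>) K) borel ?q) S = (\<integral>\<^sup>+p. indicator S p \<partial>distr (glue (\<tau> \<Otimes>\<^sub>M \<mu>) K) borel ?q)"
   using S by simp
  also have "\<dots> = (\<integral>\<^sup>+p. indicator S (?q p) \<partial>glue (\<tau> \<Otimes>\<^sub>M \<mu>) K)" by (rule nn_integral_distr[OF q']) (use ind(1) in simp)
  also have "\<dots> = (\<integral>\<^sup>+a. \<integral>\<^sup>+y. indicator S (?q (a, y)) \<partial>K a \<partial>(\<tau> \<Otimes>\<^sub>M \<mu>))" by (rule nn_integral_glue[OF s K ind(2)])
  also have "\<dots> = (\<integral>\<^sup>+t. \<integral>\<^sup>+x. \<integral>\<^sup>+y. indicator S (?q ((t, x), y)) \<partial>K (t, x) \<partial>\<mu> \<partial>\<tau>)" by (rule \<mu>.nn_integral_fst[OF m, symmetric])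
  also have "\<dots> = (\<integral>\<^sup>+t. \<integral>\<^sup>+p. indicator S (t, p) \<partial>glue \<mu> (\<lambda>x. K (t, x)) \<partial>\<tau>)"
  proof (rule nn_integral_cong)
   fix t assume "t \<in> space \<tau>"
   have "(\<lambda>p. indicator S (t, p) :: ennreal) \<in> borel_measurable borel" using ind(1) by (rule measurable_compose[OF measurable_Pair_borel])
   from nn_integral_glue[OF \<mu>(1) Kt this]
   show "(\<integral>\<^sup>+x. \<integral>\<^sup>+y. indicator S (?q ((t, x), y)) \<partial>K (t, x) \<partial>\<mu>) = (\<integral>\<^sup>+p. indicator S (t, p) \<partial>glue \<mu> (\<lambda>x. K (t, x)))" by simp
  qed
  also have "\<dots> = (\<integral>\<^sup>+p. indicator S p \<partial>glue \<tau> (\<lambda>t. glue \<mu> (\<lambda>x. K (t, x))))" by (rule nn_integral_glue[OF \<tau> ker ind(1), symmetric])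
  also have "\<dots> = emeasure (glue \<tau> (\<lambda>t. glue \<mu> (\<lambda>x. K (t, x)))) S" using S \<tau> by simp
  finally show "emeasure (distr (glue (\<tau> \<Otimes>\<^sub>M \<mu>) K) borel ?q) S = emeasure (glue \<tau> (\<lambda>t. glue \<mu> (\<lambda>x. K (t, x)))) S" .
 qed (use \<tau> in simp)
qed

text \<open>Almost everywhere statements pass from \<open>[0, \<infinity>)\<close> to \<open>[0, T]\<close>
 without measurability of the predicate.\<close>

lemma AE_pair_transfer:
 fixes \<tau> \<tau>' :: "'a measure" and \<mu> :: "'b measure"
 assumes sf: "sigma_finite_measure \<tau>" "sigma_finite_measure \<tau>'" "sigma_finite_measure \<mu>" and sets: "sets \<tau> = sets \<tau>'"
  and ac: "\<And>P. AE t in \<tau>'. P t ==> AE t in \<tau>. P t" and AE: "AE a in \<tau>' \<Otimes>\<^sub>M \<mu>. P a"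
 shows "AE a in \<tau> \<Otimes>\<^sub>M \<mu>. P a"
proof -
 interpret p': pair_sigma_finite \<tau>' \<mu> using sf by (simp add: pair_sigma_finite_def)
 interpret p: pair_sigma_finite \<tau> \<mu> using sf by (simp add: pair_sigma_finite_def)
 obtain N where N: "{a \<in> space (\<tau>' \<Otimes>\<^sub>M \<mu>). \<not> P a} \<subseteq> N" "N \<in> null_sets (\<tau>' \<Otimes>\<^sub>M \<mu>)"
  using AE by (auto simp: eventually_ae_filter)
 have s: "sets (\<tau> \<Otimes>\<^sub>M \<mu>) = sets (\<tau>' \<Otimes>\<^sub>M \<mu>)" by (rule sets_pair_measure_cong[OF sets refl])
 have "AE a in \<tau>' \<Otimes>\<^sub>M \<mu>. a \<notin> N" by (rule AE_not_in[OF N(2)])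
 then have "AE t in \<tau>'. AE x in \<mu>. (t, x) \<notin> N" by (rule p'.AE_pair)
 then have *: "AE t in \<tau>. AE x in \<mu>. (t, x) \<notin> N" by (rule ac)
 have Ns: "N \<in> sets (\<tau> \<Otimes>\<^sub>M \<mu>)" using N(2) s by auto
 have "{a \<in> space (\<tau> \<Otimes>\<^sub>M \<mu>). a \<notin> N} = space (\<tau> \<Otimes>\<^sub>M \<mu>) - N" by auto
 then have "{a \<in> space (\<tau> \<Otimes>\<^sub>M \<mu>). a \<notin> N} \<in> sets (\<tau> \<Otimes>\<^sub>M \<mu>)" using Ns by auto
 then have "AE a in \<tau> \<Otimes>\<^sub>M \<mu>. a \<notin> N" using * by (rule p.AE_pair_measure)
 then show ?thesis
  using AE_space by eventually_elim (use N(1) sets_eq_imp_space_eq[OF s] in auto)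
qed

text \<open>The part of condition (A) that concerns the limit trajectory alone.\<close>

locale limit_trajectory =
 fixes Y :: "(real^'d) set" and \<mu> \<nu> :: "(real^'d) measure"
  and \<P> :: "(real \<times> ((real^'d) \<times> (real^'d))) measure" and \<P>t :: "real => ((real^'d) \<times> (real^'d)) measure"
 assumes compact_Y: "compact Y" and \<mu>: "\<mu> \<in> prob_on X_dom" and \<nu>: "\<nu> \<in> prob_on Y"
  and \<P>: "is_disintegration (restr {0..} lborel) \<P> \<P>t"
  and \<P>t: "AE t in restr {0..} lborel. \<P>t t \<in> couplings \<mu> \<nu>"
begin

lemma \<mu>_facts: "sets \<mu> = sets borel" "prob_space \<mu>" "emeasure \<mu> (- X_dom) = 0" "space \<mu> = UNIV"
 using \<mu> by (auto simp: prob_on_def dest: sets_eq_imp_space_eq)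

sublocale \<mu>: prob_space \<mu> by (rule \<mu>_facts)

lemma Y_borel: "Y \<in> sets borel" "- Y \<in> sets borel"
 by (intro borel_closed borel_open open_Compl compact_imp_closed compact_Y)+

abbreviation "halfline \<equiv> restr {0..} (lborel :: real measure)"

lemma halfline_facts: "sets halfline = sets borel" "sigma_finite_measure halfline" "space halfline = UNIV"
proof -
 show "sets halfline = sets borel" by (simp add: sets_restr)
 then show "space halfline = UNIV" by (auto dest: sets_eq_imp_space_eq)
qed (rule sigma_finite_restr_lborel, simp)

lemma sets_halfline_pair: "sets (halfline \<Otimes>\<^sub>M \<mu>) = sets borel"
 by (rule sets_pair_borel[OF halfline_facts(1) \<mu>_facts(1)])

lemma sigma_finite_halfline_pair: "sigma_finite_measure (halfline \<Otimes>\<^sub>M \<mu>)"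
 by (rule sigma_finite_pair_measure[OF halfline_facts(2) \<mu>.sigma_finite_measure_axioms])

lemma \<P>_facts: "kernel halfline \<P>t" "\<P> = glue halfline \<P>t" "sets \<P> = sets borel"
 using \<P> halfline_facts by (auto simp: is_disintegration_def)

abbreviation "regrouped \<equiv> distr \<P> borel (\<lambda>(t, x, y). ((t, x), y))"

lemma regroup_measurable:
 "(\<lambda>(t, x, y). ((t, x), y)) \<in> (borel :: (real \<times> (real^'d) \<times> (real^'d)) measure) \<rightarrow>\<^sub>M borel"
 unfolding case_prod_beta'
 by (intro borel_measurable_Pair_borel) (auto intro: measurable_compose[OF borel_measurable_snd_borel])

lemma regrouped_first_marginal: "distr regrouped borel fst = halfline \<Otimes>\<^sub>M \<mu>"
proof (rule measure_eqI)
 show "sets (distr regrouped borel fst) = sets (halfline \<Otimes>\<^sub>M \<mu>)" by (simp add: sets_halfline_pair)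
 fix S assume "S \<in> sets (distr regrouped borel fst)"
 then have S: "S \<in> sets borel" by simp
 have q: "(\<lambda>(t, x, y). ((t, x), y)) \<in> \<P> \<rightarrow>\<^sub>M borel"
  using regroup_measurable by (simp add: measurable_cong_sets[OF \<P>_facts(3) refl])
 have "distr regrouped borel fst = distr \<P> borel (\<lambda>p. (fst p, fst (snd p)))"
  by (subst distr_distr[OF borel_measurable_fst_borel q]) (simp add: comp_def case_prod_beta')
 also have "\<dots> = glue halfline (\<lambda>t. distr (\<P>t t) borel fst)"
  unfolding \<P>_facts(2) by (rule distr_glue_snd(1)[OF halfline_facts(1) \<P>_facts(1) borel_measurable_fst_borel])
 finally have "emeasure (distr regrouped borel fst) S = (\<integral>\<^sup>+t. emeasure (distr (\<P>t t) borel fst) (Pair t -` S) \<partial>halfline)"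
  by (simp add: emeasure_glue[OF halfline_facts(1) distr_glue_snd(2)[OF halfline_facts(1) \<P>_facts(1) borel_measurable_fst_borel] S])
 also have "\<dots> = (\<integral>\<^sup>+t. emeasure \<mu> (Pair t -` S) \<partial>halfline)"
 proof (rule nn_integral_cong_AE)
  show "AE t in halfline. emeasure (distr (\<P>t t) borel fst) (Pair t -` S) = emeasure \<mu> (Pair t -` S)"
   using \<P>t by eventually_elim (simp add: couplings_def)
 qed
 also have "\<dots> = emeasure (halfline \<Otimes>\<^sub>M \<mu>) S"
  by (rule \<mu>.emeasure_pair_measure_alt[symmetric]) (simp add: S sets_halfline_pair)
 finally show "emeasure (distr regrouped borel fst) S = emeasure (halfline \<Otimes>\<^sub>M \<mu>) S" .
qed

abbreviation "raw_fiber a \<equiv> limit_fiber \<mu> \<P> (fst a) (snd a)"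

lemma raw_fiber_disintegration:
 "kernel (halfline \<Otimes>\<^sub>M \<mu>) raw_fiber" "regrouped = glue (halfline \<Otimes>\<^sub>M \<mu>) raw_fiber"
 using disintegration_exists[OF sigma_finite_halfline_pair sets_halfline_pair _ regrouped_first_marginal]
 by (auto simp: limit_fiber_def is_disintegration_def)

text \<open>The fibers of the limit trajectory over \<open>(t, x)\<close> are obtained from one
 disintegration in both variables; for almost every \<open>t\<close> they are also the fibers of the slice at
 \<open>t\<close>.\<close>

lemma slice_eq: "AE t in halfline. \<P>t t = glue \<mu> (\<lambda>x. limit_fiber \<mu> \<P> t x)"
proof (rule glue_kernel_unique[OF halfline_facts(2,1) \<P>_facts(1)])
 show "kernel halfline (\<lambda>t. glue \<mu> (\<lambda>x. limit_fiber \<mu> \<P> t x))"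
  using partial_glue_kernel[OF halfline_facts(1) \<mu>_facts(1,2) raw_fiber_disintegration(1)] by simp
 have q: "(\<lambda>(t, x, y). ((t, x), y)) \<in> \<P> \<rightarrow>\<^sub>M borel"
  using regroup_measurable by (simp add: measurable_cong_sets[OF \<P>_facts(3) refl])
 have q': "(\<lambda>p. (fst (fst p), (snd (fst p), snd p))) \<in> borel \<rightarrow>\<^sub>M (borel :: (real \<times> (real^'d) \<times> (real^'d)) measure)"
  by (intro borel_measurable_Pair_borel) (auto intro: measurable_compose[OF borel_measurable_fst_borel])
 have "\<P> = distr \<P> \<P> (\<lambda>p. p)" by simp
 also have "\<dots> = distr \<P> borel (\<lambda>p. p)" by (rule distr_cong) (simp_all add: \<P>_facts(3))
 also have "\<dots> = distr regrouped borel (\<lambda>p. (fst (fst p), (snd (fst p), snd p)))"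
  by (subst distr_distr[OF q' q]) (simp add: comp_def case_prod_beta')
 also have "\<dots> = glue halfline (\<lambda>t. glue \<mu> (\<lambda>x. limit_fiber \<mu> \<P> t x))"
  unfolding raw_fiber_disintegration(2)
  using glue_assoc[OF halfline_facts(1) \<mu>_facts(1,2) raw_fiber_disintegration(1)] by simp
 finally show "glue halfline \<P>t = glue halfline (\<lambda>t. glue \<mu> (\<lambda>x. limit_fiber \<mu> \<P> t x))" using \<P>_facts(2) by simp
qed

lemma raw_fiber_prob_on: "AE a in halfline \<Otimes>\<^sub>M \<mu>. raw_fiber a \<in> prob_on Y"
proof -
 have sp: "space (halfline \<Otimes>\<^sub>M \<mu>) = UNIV" using sets_halfline_pair by (auto dest: sets_eq_imp_space_eq)
 have "AE t in halfline. emeasure (\<P>t t) (UNIV \<times> - Y) = 0"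
  using \<P>t
 proof eventually_elim
  case (elim t)
  then have s: "sets (\<P>t t) = sets borel" and m: "distr (\<P>t t) borel snd = \<nu>" by (auto simp: couplings_def)
  have sp: "space (\<P>t t) = UNIV" using s by (auto dest: sets_eq_imp_space_eq)
  have "emeasure (\<P>t t) (UNIV \<times> - Y) = emeasure (distr (\<P>t t) borel snd) (- Y)"
   using Y_borel by (subst emeasure_distr) (auto simp: measurable_cong_sets[OF s refl] sp intro!: arg_cong[where f="emeasure _"])
  then show ?case using \<nu> m by (simp add: prob_on_def)
 qed
 moreover have "emeasure \<P> (UNIV \<times> (UNIV \<times> - Y)) = (\<integral>\<^sup>+t. emeasure (\<P>t t) (UNIV \<times> - Y) * indicator UNIV t \<partial>halfline)"
  unfolding \<P>_facts(2) by (rule emeasure_glue_Times[OF halfline_facts(1) \<P>_facts(1) borel_UNIV borel_Times[OF borel_UNIV Y_borel(2)]])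
 ultimately have "emeasure \<P> (UNIV \<times> (UNIV \<times> - Y)) = (\<integral>\<^sup>+t. 0 \<partial>halfline)"
  by (simp add: nn_integral_cong_AE[of "\<lambda>t. emeasure (\<P>t t) (UNIV \<times> - Y)" "\<lambda>_. 0"])
 then have P0: "emeasure \<P> (UNIV \<times> (UNIV \<times> - Y)) = 0" by simp
 have spP: "space \<P> = UNIV" using \<P>_facts(3) by (auto dest: sets_eq_imp_space_eq)
 have "emeasure regrouped (UNIV \<times> - Y) = emeasure \<P> (UNIV \<times> (UNIV \<times> - Y))"
  using regroup_measurable borel_Times[OF borel_UNIV Y_borel(2)]
  by (subst emeasure_distr) (auto simp: measurable_cong_sets[OF \<P>_facts(3) refl] spP intro!: arg_cong[where f="emeasure _"])
 with P0 have "(\<integral>\<^sup>+a. emeasure (raw_fiber a) (- Y) * indicator UNIV a \<partial>(halfline \<Otimes>\<^sub>M \<mu>)) = 0"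
  unfolding raw_fiber_disintegration(2)
  by (subst (asm) emeasure_glue_Times[OF sets_halfline_pair raw_fiber_disintegration(1) borel_UNIV Y_borel(2)]) simp
 then have "(\<integral>\<^sup>+a. emeasure (raw_fiber a) (- Y) \<partial>(halfline \<Otimes>\<^sub>M \<mu>)) = 0" by simp
 moreover have "(\<lambda>a. emeasure (raw_fiber a) (- Y)) \<in> borel_measurable (halfline \<Otimes>\<^sub>M \<mu>)"
  by (rule measurable_compose[OF measurable_prob_algebraD[OF raw_fiber_disintegration(1)] measurable_emeasure_subprob_algebra[OF Y_borel(2)]])
 ultimately have "AE a in halfline \<Otimes>\<^sub>M \<mu>. emeasure (raw_fiber a) (- Y) = 0" by (simp add: nn_integral_0_iff_AE)
 then show ?thesis
  by eventually_elim (use kernel_fiber[OF raw_fiber_disintegration(1)] sp in \<open>simp add: prob_on_def\<close>)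
qed

text \<open>The fibers, with \<open>\<nu>\<close> as default value on the null set where the disintegration
 leaves \<open>Y\<close>; all supports are then contained in \<open>Y\<close>.\<close>

definition limit_kernel :: "real \<times> (real^'d) => (real^'d) measure" where
 "limit_kernel a = (if raw_fiber a \<in> prob_on Y then raw_fiber a else \<nu>)"

lemma limit_kernel_prob_on: "limit_kernel a \<in> prob_on Y"
 using \<nu> by (simp add: limit_kernel_def)

lemma limit_kernel_measurable:
 assumes \<a>: "sets \<a> = sets borel"
 shows "kernel \<a> limit_kernel"
proof -
 have K: "kernel \<a> raw_fiber"
  using raw_fiber_disintegration(1) by (simp add: measurable_cong_sets[OF trans[OF \<a> sets_halfline_pair[symmetric]] refl])
 have "limit_kernel = (\<lambda>a. if emeasure (raw_fiber a) (- Y) = 0 then raw_fiber a else \<nu>)"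
  using kernel_fiber[OF K] sets_eq_imp_space_eq[OF \<a>] by (auto simp: limit_kernel_def prob_on_def)
 moreover have "kernel \<a> (\<lambda>a. if emeasure (raw_fiber a) (- Y) = 0 then raw_fiber a else \<nu>)"
 proof (rule measurable_If[OF K])
  show "kernel \<a> (\<lambda>a. \<nu>)" using \<nu> by (simp add: prob_on_iff_kernel_value)
  have [measurable]: "(\<lambda>a. emeasure (raw_fiber a) (- Y)) \<in> borel_measurable \<a>"
   by (rule measurable_compose[OF measurable_prob_algebraD[OF K] measurable_emeasure_subprob_algebra[OF Y_borel(2)]])
  show "{a \<in> space \<a>. emeasure (raw_fiber a) (- Y) = 0} \<in> sets \<a>" by measurable
 qed
 ultimately show ?thesis by simp
qed

lemma limit_kernel_AE: "AE a in halfline \<Otimes>\<^sub>M \<mu>. limit_kernel a = raw_fiber a"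
 using raw_fiber_prob_on by eventually_elim (simp add: limit_kernel_def)

lemma slice_disintegration: "AE t in halfline. AE x in \<mu>. disint \<mu> (\<P>t t) x = limit_kernel (t, x)"
proof -
 interpret p: pair_sigma_finite halfline \<mu>
  using halfline_facts(2) \<mu>.sigma_finite_measure_axioms by (simp add: pair_sigma_finite_def)
 have Kt: "kernel \<mu> (\<lambda>x. limit_fiber \<mu> \<P> t x)" for t
  using measurable_compose[OF measurable_Pair1' raw_fiber_disintegration(1), of t] halfline_facts(3) by simp
 show ?thesis using slice_eq p.AE_pair[OF limit_kernel_AE]
 proof eventually_elim
  case (elim t)
  have "is_disintegration \<mu> (\<P>t t) (\<lambda>x. limit_fiber \<mu> \<P> t x)"
   using elim(1) Kt[of t] by (simp add: is_disintegration_def)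
  from disint_AE_eq[OF \<mu>.sigma_finite_measure_axioms \<mu>_facts(1) this] elim(2)
  show ?case by eventually_elim simp
 qed
qed

end

section \<open>Convergence of the fibers of the discrete problems\<close>

lemma bounded_borel_abs [simp]: "bounded_borel f ==> bounded_borel (\<lambda>x. \<bar>f x\<bar>)"
 unfolding bounded_borel_def by (auto intro: borel_measurable_abs)

lemma along_mono: "N \<subseteq> M ==> along N \<le> along M"
 unfolding along_def by (intro inf_mono) auto

lemma set_integral_full_support:
 fixes h :: "'a::topological_space => real"
 assumes M: "sets M = sets borel" "emeasure M (- S) = 0" and S: "S \<in> sets borel" and h: "h \<in> borel_measurable borel"
 shows "(LINT z:S|M. h z) = (\<integral>z. h z \<partial>M)"
proof -
 have "- S \<in> null_sets M" using M S by (auto simp: null_sets_def)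
 from AE_not_in[OF this] have AE: "AE z in M. z \<in> S" by simp
 show ?thesis unfolding set_lebesgue_integral_def
 proof (rule integral_cong_AE)
  show "(\<lambda>z. indicator S z *\<^sub>R h z) \<in> borel_measurable M" "h \<in> borel_measurable M"
   using S h by (simp_all add: measurable_cong_sets[OF M(1) refl])
  show "AE z in M. indicator S z *\<^sub>R h z = h z" using AE by eventually_elim simp
 qed
qed

lemma prob_on_set_integral:
 fixes h :: "'a::topological_space => real"
 shows "M \<in> prob_on S ==> S \<in> sets borel ==> h \<in> borel_measurable borel ==> (LINT z:S|M. h z) = (\<integral>z. h z \<partial>M)"
 by (rule set_integral_full_support) (auto simp: prob_on_def)

locale glued_setting = limit_trajectory Y \<mu> \<nu> \<P> \<P>t
 for Y :: "(real^'d) set" and \<mu> \<nu> \<P> \<P>t +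
 fixes c :: "(real^'d) \<times> (real^'d) => real" and f :: "nat => (real^'d) \<times> (real^'d) => real"
  and \<epsilon> :: "nat => real" and \<eta> :: ereal and \<mu>s \<nu>s :: "nat => (real^'d) measure"
  and \<pi>inits :: "nat => ((real^'d) \<times> (real^'d)) measure"
  and \<pi>s :: "nat => nat => ((real^'d) \<times> (real^'d)) measure"
  and N :: "nat set" and \<sigma> :: "(real^'d) measure" and T :: real
 assumes c: "C1_on (X_dom \<times> Y) c"
  and mass_pos: "\<And>n i. n \<in> pos_evens ==> i \<in> indices n ==> 0 < measure \<mu> (basic_cell n i)"
  and \<mu>s: "\<And>n. n \<in> pos_evens ==> \<mu>s n \<in> prob_on X_dom"
  and mass_eq: "\<And>n i. n \<in> pos_evens ==> i \<in> indices n ==> measure (\<mu>s n) (basic_cell n i) = measure \<mu> (basic_cell n i)"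
  and null_frontier: "\<And>n i. n \<in> pos_evens ==> i \<in> indices n ==> measure (\<mu>s n) (frontier (basic_cell n i)) = 0"
  and \<nu>s: "\<And>n. n \<in> pos_evens ==> \<nu>s n \<in> prob_on Y"
  and \<pi>inits: "\<And>n. n \<in> pos_evens ==> \<pi>inits n \<in> couplings (\<mu>s n) (\<nu>s n)"
  and continuous_cost: "\<And>n. n \<in> pos_evens ==> continuous_on (X_dom \<times> Y) (perturbed_cost c f n)"
  and f: "uniform_limit (X_dom \<times> Y) f (\<lambda>_. 0) (along pos_evens)"
  and \<epsilon>: "\<And>n. n \<in> pos_evens ==> 0 \<le> \<epsilon> n"
  and \<eta>: "((\<lambda>n. ereal (real n * \<epsilon> n)) \<longlongrightarrow> \<eta>) (along pos_evens)"
  and iter: "\<And>n. n \<in> pos_evens ==>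
      dd_iterates Y (\<mu>s n) (\<nu>s n) (perturbed_cost c f n) (\<epsilon> n) n (\<pi>inits n) (\<pi>s n)"
  and N: "infinite N" "N \<subseteq> pos_evens"
  and trajectory_limit: "AE t in restr {0..} lborel.
       ((\<lambda>n. vertical_dist \<mu> (traj_slice Y \<mu> (\<pi>s n) n t) (\<P>t t)) \<longlongrightarrow> 0) (along N)"
  and \<sigma>: "\<sigma> \<in> prob_on Z_dom"
  and cell_limit: "AE (t, x) in restr {0..} lborel \<Otimes>\<^sub>M \<mu>.
       weakstar_on Z_dom (along pos_evens) (\<lambda>n. sigma_fiber \<mu> (\<mu>s n) n t x) \<sigma>"
  and T: "0 < T"
begin

lemma iterates: "n \<in> pos_evens ==> iterates n (\<mu>s n) Y (\<nu>s n) (perturbed_cost c f n) (\<epsilon> n) (\<pi>inits n) (\<pi>s n) \<mu>"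
 using \<mu>s null_frontier compact_Y \<nu>s \<pi>inits iter mass_pos mass_eq by unfold_locales auto

abbreviation "interval \<equiv> restr {0..T} (lborel :: real measure)"
abbreviation "base \<equiv> interval \<Otimes>\<^sub>M \<mu>"

lemma interval_facts: "sets interval = sets borel" "finite_measure interval" "space interval = UNIV"
proof -
 show s: "sets interval = sets borel" by (simp add: sets_restr)
 then show sp: "space interval = UNIV" by (auto dest: sets_eq_imp_space_eq)
 show "finite_measure interval" by (rule finite_measureI) (simp add: sp emeasure_restr emeasure_lborel_Icc_eq)
qed

sublocale interval: finite_measure interval by (rule interval_facts)
sublocale base: pair_sigma_finite interval \<mu> by unfold_locales

lemma base_facts: "sets base = sets borel" "finite_measure base" "space base = UNIV"
proof -
 show s: "sets base = sets borel" by (rule sets_pair_borel[OF interval_facts(1) \<mu>_facts(1)])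
 then show "space base = UNIV" by (auto dest: sets_eq_imp_space_eq)
 show "finite_measure base" by (rule finite_measure_pair_measure) unfold_locales
qed

lemma AE_base_dom: "AE a in base. fst a \<in> {0..T} \<and> snd a \<in> X_dom"
proof (rule base.AE_pair_measure)
 have "{a \<in> space base. fst a \<in> {0..T} \<and> snd a \<in> X_dom} = {0..T} \<times> X_dom" using base_facts by auto
 then show "{a \<in> space base. fst a \<in> {0..T} \<and> snd a \<in> X_dom} \<in> sets base"
  by (simp add: base_facts borel_Times borel_closed[OF compact_imp_closed[OF compact_X_dom]])
 have "- X_dom \<in> null_sets \<mu>"
  using \<mu>_facts by (auto simp: null_sets_def intro!: borel_open open_Compl compact_imp_closed compact_X_dom)
 from AE_not_in[OF this] have x: "AE x in \<mu>. x \<in> X_dom" by simp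
 have "AE t in interval. t \<in> {0..T}" by (subst AE_restr_iff) auto
 then show "AE t in interval. AE x in \<mu>. fst (t, x) \<in> {0..T} \<and> snd (t, x) \<in> X_dom"
  by eventually_elim (use x in simp)
qed

lemma AE_interval: "AE t in halfline. P t ==> AE t in interval. P t"
 by (subst (asm) AE_restr_iff, simp, subst AE_restr_iff, simp, erule eventually_mono, auto)

lemma AE_base: "AE a in halfline \<Otimes>\<^sub>M \<mu>. P a ==> AE a in base. P a"
 by (rule AE_pair_transfer[of interval halfline \<mu>])
  (auto simp: halfline_facts interval_facts intro: AE_interval halfline_facts(2) interval.sigma_finite_measure_axioms \<mu>.sigma_finite_measure_axioms)

text \<open>Fibers of the discrete problems, completed by fixed probability measures to kernels on the whole
 space.\<close>

definition traj_kernel :: "nat => real \<times> (real^'d) => (real^'d) measure" where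
 "traj_kernel n a = (if n \<in> pos_evens \<and> snd a \<in> X_dom then traj_fiber Y \<mu> (\<pi>s n) n (fst a) (snd a) else \<nu>)"

definition sigma_kernel :: "nat => real \<times> (real^'d) => (real^'d) measure" where
 "sigma_kernel n a = (if n \<in> pos_evens \<and> snd a \<in> X_dom then sigma_fiber \<mu> (\<mu>s n) n (fst a) (snd a) else \<sigma>)"

lemma traj_kernel_prob_on: "traj_kernel n a \<in> prob_on Y"
 using \<nu> iterates.traj_fiber_prob_on[OF iterates] by (auto simp: traj_kernel_def)

lemma sigma_kernel_prob_on: "sigma_kernel n a \<in> prob_on Z_dom"
 using \<sigma> iterates.sigma_fiber_prob_on[OF iterates] by (auto simp: sigma_kernel_def)

lemma traj_kernel_measurable:
 assumes \<a>: "sets \<a> = sets borel"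
 shows "kernel \<a> (traj_kernel n)"
proof (cases "n \<in> pos_evens")
 case True
 let ?G = "\<lambda>k J. scale_measure (ennreal (1 / cell_mass \<mu> n J)) (cell_marginal Y n J (\<pi>s n k))"
 have "kernel \<a> (\<lambda>a. if snd a \<in> X_dom then ?G (step_at n (fst a)) (cell_at n (fst a) (snd a)) else \<nu>)"
  using \<nu> iterates.traj_fiber_prob_on[OF iterates[OF True]]
  by (intro cellwise_kernel \<a>) (auto simp: prob_on_iff_kernel_value traj_fiber_def)
 then show ?thesis unfolding traj_kernel_def[abs_def] traj_fiber_def using True by simp
next
 case False
 then have "traj_kernel n = (\<lambda>_. \<nu>)" by (simp add: traj_kernel_def fun_eq_iff)
 then show ?thesis using \<nu> by (simp add: prob_on_iff_kernel_value)
qed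

lemma sigma_kernel_measurable:
 assumes \<a>: "sets \<a> = sets borel"
 shows "kernel \<a> (sigma_kernel n)"
proof (cases "n \<in> pos_evens")
 case True
 let ?G = "\<lambda>k J. scale_measure (ennreal (1 / cell_mass \<mu> n J))
  (distr (restr (comp_cell n J) (\<mu>s n)) borel (\<lambda>x'. real n *\<^sub>R (x' - cell_center n k J)))"
 have "kernel \<a> (\<lambda>a. if snd a \<in> X_dom then ?G (step_at n (fst a)) (cell_at n (fst a) (snd a)) else \<sigma>)"
  using \<sigma> iterates.sigma_fiber_prob_on[OF iterates[OF True]]
  by (intro cellwise_kernel \<a>) (auto simp: prob_on_iff_kernel_value sigma_fiber_def center_at_def)
 then show ?thesis unfolding sigma_kernel_def[abs_def] sigma_fiber_def center_at_def using True by simp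
next
 case False
 then have "sigma_kernel n = (\<lambda>_. \<sigma>)" by (simp add: sigma_kernel_def fun_eq_iff)
 then show ?thesis using \<sigma> by (simp add: prob_on_iff_kernel_value)
qed

lemma traj_slice_fiber:
 assumes n: "n \<in> pos_evens"
 shows "AE x in \<mu>. disint \<mu> (traj_slice Y \<mu> (\<pi>s n) n t) x = traj_kernel n (t, x)"
proof (rule disint_AE_eq[OF \<mu>.sigma_finite_measure_axioms \<mu>_facts(1)])
 have ker: "kernel \<mu> (\<lambda>x. traj_kernel n (t, x))"
  by (rule measurable_compose[OF _ traj_kernel_measurable[OF refl]])
   (simp add: measurable_Pair_borel measurable_cong_sets[OF \<mu>_facts(1) refl])
 have "glue \<mu> (traj_fiber Y \<mu> (\<pi>s n) n t) = glue \<mu> (\<lambda>x. traj_kernel n (t, x))"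
 proof (rule glue_cong_constant_outside[OF \<mu>_facts(1) ker _ \<mu>_facts(3)])
  show "X_dom \<in> sets borel" by (rule borel_closed[OF compact_imp_closed[OF compact_X_dom]])
  show "traj_fiber Y \<mu> (\<pi>s n) n t x = scale_measure (ennreal (1 / cell_mass \<mu> n (SOME J. False)))
    (cell_marginal Y n (SOME J. False) (\<pi>s n (step_at n t)))" if "x \<notin> X_dom" for x
   by (simp add: traj_fiber_def cell_at_outside[OF that])
 qed (use n in \<open>simp_all add: traj_kernel_def cell_marginal_def\<close>)
 then show "is_disintegration \<mu> (traj_slice Y \<mu> (\<pi>s n) n t) (\<lambda>x. traj_kernel n (t, x))"
  using ker by (simp add: is_disintegration_def traj_slice_def)
qed

lemma kernel_gap_bounded:
 fixes h :: "real^'d => real"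
 assumes "kernel base \<k>" "kernel base \<k>'" "bounded_borel h"
 shows "bounded_borel (\<lambda>a. \<bar>(\<integral>b. h b \<partial>\<k> a) - (\<integral>b. h b \<partial>\<k>' a)\<bar>)"
proof -
 have "bounded_borel (\<lambda>p :: (real \<times> (real^'d)) \<times> (real^'d). h (snd p))" using assms(3) by simp
 from bounded_borel_kernel_integral[OF base_facts(2,1) assms(1) this] bounded_borel_kernel_integral[OF base_facts(2,1) assms(2) this]
 show ?thesis by simp
qed

lemma kernel_gap_le:
 fixes h :: "real^'d => real"
 assumes "kernel base \<k>" "kernel base \<k>'" "h \<in> borel_measurable borel" "\<And>b. \<bar>h b\<bar> \<le> B"
 shows "\<bar>(\<integral>b. h b \<partial>\<k> a) - (\<integral>b. h b \<partial>\<k>' a)\<bar> \<le> 2 * B"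
proof -
 have *: "\<bar>\<integral>b. h b \<partial>\<theta> a\<bar> \<le> B" if k: "kernel base \<theta>" for \<theta>
 proof -
  interpret prob_space "\<theta> a" using kernel_fiber(1)[OF k] base_facts by simp
  have m: "h \<in> borel_measurable (\<theta> a)"
   using assms(3) kernel_fiber(2)[OF k, of a] base_facts(3) by (simp add: measurable_cong_sets[of "\<theta> a" borel])
  have "\<bar>\<integral>b. h b \<partial>\<theta> a\<bar> \<le> (\<integral>b. \<bar>h b\<bar> \<partial>\<theta> a)" by (rule integral_abs_bound)
  also have "\<dots> \<le> (\<integral>b. B \<partial>\<theta> a)"
   by (intro integral_mono integrable_abs integrable_const_bound[of _ B] m assms(4)) (use assms(4) order_trans[OF abs_ge_zero assms(4)] in simp_all)
  finally show ?thesis by (simp add: prob_space)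
 qed
 show ?thesis using *[OF assms(1)] *[OF assms(2)] by linarith
qed

text \<open>The vertical metric controls the integrals of a fixed test function over almost every time slice,
 because a test function is Lipschitz up to an arbitrarily small error.\<close>

lemma traj_slices_converge:
 assumes h: "bounded_borel h" "continuous_on Y h"
 shows "AE t in halfline. ((\<lambda>n. \<integral>x. \<bar>(\<integral>y. h y \<partial>traj_kernel n (t, x)) - (\<integral>y. h y \<partial>limit_kernel (t, x))\<bar> \<partial>\<mu>) \<longlongrightarrow> 0) (along N)"
 using trajectory_limit slice_disintegration
proof eventually_elim
 case (elim t)
 let ?D = "\<lambda>n x. \<bar>(\<integral>y. h y \<partial>traj_kernel n (t, x)) - (\<integral>y. h y \<partial>limit_kernel (t, x))\<bar>"
 have D: "bounded_borel (?D n)" for n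
  by (rule bounded_borel_Pair[OF kernel_gap_bounded[OF traj_kernel_measurable[OF base_facts(1)] limit_kernel_measurable[OF base_facts(1)] h(1)]])
 note int = bounded_borel_integrable[OF \<mu>.finite_measure_axioms \<mu>_facts(1)]
 show ?case
 proof (rule tendstoI)
  fix e :: real assume e: "0 < e"
  obtain C where C: "0 < C" and W: "\<And>p q. p \<in> prob_on Y ==> q \<in> prob_on Y ==>
    ennreal ((\<bar>(\<integral>y. h y \<partial>p) - (\<integral>y. h y \<partial>q)\<bar> - e / 3) / C) \<le> wasserstein1 p q"
   using wasserstein1_test_function[OF compact_Y h, of "e / 3"] e by auto
  have "eventually (\<lambda>n. vertical_dist \<mu> (traj_slice Y \<mu> (\<pi>s n) n t) (\<P>t t) < ennreal (e / 3 / C)) (along N)"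
   using order_tendstoD(2)[OF elim(1), of "ennreal (e / 3 / C)"] e C by simp
  moreover have "eventually (\<lambda>n. n \<in> pos_evens) (along N)" unfolding eventually_along using N by blast
  ultimately show "eventually (\<lambda>n. dist (\<integral>x. ?D n x \<partial>\<mu>) 0 < e) (along N)"
  proof eventually_elim
   fix n assume n: "vertical_dist \<mu> (traj_slice Y \<mu> (\<pi>s n) n t) (\<P>t t) < ennreal (e / 3 / C)" "n \<in> pos_evens"
   let ?u = "\<lambda>x. (?D n x - e / 3) / C"
   have ub: "bounded_borel ?u" using bounded_borel_mult[OF bounded_borel_diff[OF D[of n] bounded_borel_const] bounded_borel_const, of "e / 3" "1 / C"] by simp
   have iu: "integrable \<mu> ?u" by (rule int[OF ub])
   have ip: "integrable \<mu> (\<lambda>x. max 0 (?u x))" using iu by (intro integrable_max) auto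
   have "ennreal (\<integral>x. max 0 (?u x) \<partial>\<mu>) = (\<integral>\<^sup>+x. ennreal (?u x) \<partial>\<mu>)"
    by (subst nn_integral_eq_integral[OF ip, symmetric]) (simp_all add: ennreal_max_0)
   also have "\<dots> \<le> vertical_dist \<mu> (traj_slice Y \<mu> (\<pi>s n) n t) (\<P>t t)"
    unfolding vertical_dist_def
   proof (rule nn_integral_mono_AE)
    show "AE x in \<mu>. ennreal (?u x) \<le> wasserstein1 (disint \<mu> (traj_slice Y \<mu> (\<pi>s n) n t) x) (disint \<mu> (\<P>t t) x)"
     using traj_slice_fiber[OF n(2), of t] elim(2)
     by eventually_elim (simp add: W traj_kernel_prob_on limit_kernel_prob_on)
   qed
   also note n(1)
   finally have "(\<integral>x. max 0 (?u x) \<partial>\<mu>) < e / 3 / C" using e C by (simp add: ennreal_less_iff)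
   then have less: "C * (\<integral>x. max 0 (?u x) \<partial>\<mu>) < e / 3" using C by (simp add: field_simps)
   have "(\<integral>x. ?D n x \<partial>\<mu>) \<le> (\<integral>x. e / 3 + C * max 0 (?u x) \<partial>\<mu>)"
   proof (rule integral_mono)
    show "?D n x \<le> e / 3 + C * max 0 (?u x)" for x
    proof -
     have "C * ?u x \<le> C * max 0 (?u x)" using C by (intro mult_left_mono) auto
     then show ?thesis using C by simp
    qed
   qed (use int[OF D[of n]] ip in auto)
   also have "\<dots> = e / 3 + C * (\<integral>x. max 0 (?u x) \<partial>\<mu>)" using ip by (simp add: \<mu>.prob_space)
   finally have "(\<integral>x. ?D n x \<partial>\<mu>) < e" using less e by linarith
   moreover have "0 \<le> (\<integral>x. ?D n x \<partial>\<mu>)" by simp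
   ultimately show "dist (\<integral>x. ?D n x \<partial>\<mu>) 0 < e" by (simp add: dist_real_def)
  qed
 qed
qed

text \<open>From slices to the whole time interval by dominated convergence.\<close>

lemma traj_kernels_converge:
 assumes h: "bounded_borel h" "continuous_on Y h"
 shows "((\<lambda>n. \<integral>a. \<bar>(\<integral>y. h y \<partial>traj_kernel n a) - (\<integral>y. h y \<partial>limit_kernel a)\<bar> \<partial>base) \<longlongrightarrow> 0) (along N)"
proof (rule tendsto_along_subseqI)
 fix r :: "nat => nat" assume r: "strict_mono r" "\<And>k. r k \<in> N"
 let ?D = "\<lambda>n a. \<bar>(\<integral>y. h y \<partial>traj_kernel n a) - (\<integral>y. h y \<partial>limit_kernel a)\<bar>"
 have D: "bounded_borel (?D n)" for n
  by (rule kernel_gap_bounded[OF traj_kernel_measurable[OF base_facts(1)] limit_kernel_measurable[OF base_facts(1)] h(1)])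
 obtain B where B: "\<And>x. \<bar>h x\<bar> \<le> B" and hm: "h \<in> borel_measurable borel" using h(1) by (auto simp: bounded_borel_def)
 have DB: "?D n a \<le> 2 * B" for n a
  by (rule kernel_gap_le[OF traj_kernel_measurable[OF base_facts(1)] limit_kernel_measurable[OF base_facts(1)] hm B])
 have iD: "integrable base (?D n)" for n by (rule bounded_borel_integrable[OF base_facts(2,1) D])
 have iDx: "integrable \<mu> (\<lambda>x. ?D n (t, x))" for n t
  by (rule bounded_borel_integrable[OF \<mu>.finite_measure_axioms \<mu>_facts(1) bounded_borel_Pair[OF D]])
 have m: "(\<lambda>t. \<integral>x. ?D n (t, x) \<partial>\<mu>) \<in> borel_measurable interval" for n
  by (rule \<mu>.borel_measurable_lebesgue_integral) (use iD[of n] in \<open>simp add: case_prod_beta'\<close>)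
 have "(\<lambda>k. \<integral>t. \<integral>x. ?D (r k) (t, x) \<partial>\<mu> \<partial>interval) \<longlonglongrightarrow> (\<integral>t. 0 \<partial>interval)"
 proof (rule integral_dominated_convergence[where w="\<lambda>_. 2 * B"])
  show "AE t in interval. (\<lambda>k. \<integral>x. ?D (r k) (t, x) \<partial>\<mu>) \<longlonglongrightarrow> 0"
   using AE_interval[OF traj_slices_converge[OF h]]
   by eventually_elim (rule filterlim_compose[OF _ filterlim_along_subseq[OF r]])
  show "AE t in interval. norm (\<integral>x. ?D (r k) (t, x) \<partial>\<mu>) \<le> 2 * B" for k
  proof (rule AE_I2)
   fix t
   have "(\<integral>x. ?D (r k) (t, x) \<partial>\<mu>) \<le> (\<integral>x. 2 * B \<partial>\<mu>)" by (intro integral_mono iDx DB) simp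
   then show "norm (\<integral>x. ?D (r k) (t, x) \<partial>\<mu>) \<le> 2 * B" by (simp add: \<mu>.prob_space)
  qed
 qed (use m in simp_all)
 then have "(\<lambda>k. \<integral>a. ?D (r k) a \<partial>base) \<longlonglongrightarrow> 0" by (simp add: base.integral_fst'[OF iD])
 then show "\<exists>r'. strict_mono (r' :: nat => nat) \<and> (\<lambda>k. \<integral>a. ?D (r (r' k)) a \<partial>base) \<longlonglongrightarrow> 0"
  by (intro exI[of _ "\<lambda>k. k"]) (simp add: strict_mono_def)
qed

lemma sigma_kernels_converge:
 assumes h: "bounded_borel h" "continuous_on Z_dom h"
 shows "((\<lambda>n. \<integral>a. \<bar>(\<integral>z. h z \<partial>sigma_kernel n a) - (\<integral>z. h z \<partial>\<sigma>)\<bar> \<partial>base) \<longlongrightarrow> 0) (along N)"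
proof (rule tendsto_along_subseqI)
 fix r :: "nat => nat" assume r: "strict_mono r" "\<And>k. r k \<in> N"
 let ?D = "\<lambda>n a. \<bar>(\<integral>z. h z \<partial>sigma_kernel n a) - (\<integral>z. h z \<partial>\<sigma>)\<bar>"
 have \<sigma>k: "kernel base (\<lambda>a. \<sigma>)" using \<sigma> by (simp add: prob_on_iff_kernel_value)
 have D: "bounded_borel (?D n)" for n
  by (rule kernel_gap_bounded[OF sigma_kernel_measurable[OF base_facts(1)] \<sigma>k h(1)])
 obtain B where B: "\<And>x. \<bar>h x\<bar> \<le> B" and hm: "h \<in> borel_measurable borel" using h(1) by (auto simp: bounded_borel_def)
 have DB: "?D n a \<le> 2 * B" for n a
  by (rule kernel_gap_le[OF sigma_kernel_measurable[OF base_facts(1)] \<sigma>k hm B])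
 have Zb: "Z_dom \<in> sets borel" by (rule borel_closed[OF compact_imp_closed[OF compact_Z_dom]])
 have lim: "AE a in base. ((\<lambda>n. ?D n a) \<longlongrightarrow> 0) (along N)"
  using AE_base[OF cell_limit] AE_base_dom
 proof eventually_elim
  case (elim a)
  have "((\<lambda>n. LINT z:Z_dom|sigma_fiber \<mu> (\<mu>s n) n (fst a) (snd a). h z) \<longlongrightarrow> (LINT z:Z_dom|\<sigma>. h z)) (along pos_evens)"
   using elim(1) h(2) by (auto simp: weakstar_on_def split: prod.splits)
  then have "((\<lambda>n. LINT z:Z_dom|sigma_fiber \<mu> (\<mu>s n) n (fst a) (snd a). h z) \<longlongrightarrow> (\<integral>z. h z \<partial>\<sigma>)) (along pos_evens)"
   by (simp add: prob_on_set_integral[OF \<sigma> Zb hm])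
  moreover have "eventually (\<lambda>n. (LINT z:Z_dom|sigma_fiber \<mu> (\<mu>s n) n (fst a) (snd a). h z) = (\<integral>z. h z \<partial>sigma_kernel n a)) (along pos_evens)"
   unfolding eventually_along
  proof (intro exI[of _ 0] allI impI)
   fix n assume n: "n \<in> pos_evens"
   then have "sigma_fiber \<mu> (\<mu>s n) n (fst a) (snd a) = sigma_kernel n a" using elim(2) by (simp add: sigma_kernel_def)
   then show "(LINT z:Z_dom|sigma_fiber \<mu> (\<mu>s n) n (fst a) (snd a). h z) = (\<integral>z. h z \<partial>sigma_kernel n a)"
    by (simp add: prob_on_set_integral[OF sigma_kernel_prob_on Zb hm])
  qed
  ultimately have "((\<lambda>n. \<integral>z. h z \<partial>sigma_kernel n a) \<longlongrightarrow> (\<integral>z. h z \<partial>\<sigma>)) (along pos_evens)"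
   by (rule Lim_transform_eventually)
  then have "((\<lambda>n. ?D n a) \<longlongrightarrow> 0) (along pos_evens)" by (intro tendsto_rabs_zero LIM_zero)
  then show ?case by (rule filterlim_mono[OF _ order_refl along_mono[OF N(2)]])
 qed
 have "(\<lambda>k. \<integral>a. ?D (r k) a \<partial>base) \<longlonglongrightarrow> (\<integral>a. 0 \<partial>base)"
 proof (rule integral_dominated_convergence[where w="\<lambda>_. 2 * B"])
  show "AE a in base. (\<lambda>k. ?D (r k) a) \<longlonglongrightarrow> 0"
   using lim by eventually_elim (rule filterlim_compose[OF _ filterlim_along_subseq[OF r]])
  show "AE a in base. norm (?D (r k) a) \<le> 2 * B" for k using DB[of "r k"] by simp
  show "?D (r k) \<in> borel_measurable base" for k
   using bounded_borel_integrable[OF base_facts(2,1) D[of "r k"]] by (rule borel_measurable_integrable)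
 qed (simp_all add: finite_measure.integrable_const[OF base_facts(2)])
 then have "(\<lambda>k. \<integral>a. ?D (r k) a \<partial>base) \<longlonglongrightarrow> 0" by simp
 then show "\<exists>r'. strict_mono (r' :: nat => nat) \<and> (\<lambda>k. \<integral>a. ?D (r (r' k)) a \<partial>base) \<longlonglongrightarrow> 0"
  by (intro exI[of _ "\<lambda>k. k"]) (simp add: strict_mono_def)
qed

lemma Y_nonempty: "Y \<noteq> {}"
proof
 assume "Y = {}"
 then have "emeasure \<nu> UNIV = 0" and "prob_space \<nu>" and "sets \<nu> = sets borel" using \<nu> by (auto simp: prob_on_def)
 then show False using prob_space.emeasure_space_1[of \<nu>] sets_eq_imp_space_eq[of \<nu> borel] by simp
qed

sublocale glued_limit base Z_dom Y "\<lambda>_. \<sigma>" limit_kernel sigma_kernel traj_kernel N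
proof (rule glued_limit.intro)
 show "finite_measure base" "sets base = sets borel" by (rule base_facts)+
 show "compact (Z_dom :: (real^'d) set)" "(Z_dom :: (real^'d) set) \<noteq> {}" "compact Y" "Y \<noteq> {}"
  using compact_Z_dom zero_in_Z_dom compact_Y Y_nonempty by auto
 show "kernel base (\<lambda>_. \<sigma>)" using \<sigma> by (simp add: prob_on_iff_kernel_value)
 show "kernel base limit_kernel" by (rule limit_kernel_measurable[OF base_facts(1)])
 show "kernel base (sigma_kernel n)" for n by (rule sigma_kernel_measurable[OF base_facts(1)])
 show "kernel base (traj_kernel n)" for n by (rule traj_kernel_measurable[OF base_facts(1)])
 show "emeasure \<sigma> (- Z_dom) = 0" using \<sigma> by (simp add: prob_on_def)
 show "emeasure (limit_kernel a) (- Y) = 0" for a using limit_kernel_prob_on[of a] by (simp add: prob_on_def)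
 show "emeasure (sigma_kernel n a) (- Z_dom) = 0" for n a using sigma_kernel_prob_on[of n a] by (simp add: prob_on_def)
 show "emeasure (traj_kernel n a) (- Y) = 0" for n a using traj_kernel_prob_on[of n a] by (simp add: prob_on_def)
qed (rule sigma_kernels_converge traj_kernels_converge; assumption)+

section \<open>The fiber functionals\<close>

text \<open>Both regimes have the form \<open>cost_weight * L\<^sup>n + entropy_weight * KL\<close>, so that
 the rest of the argument does not distinguish them; for \<open>\<eta> = \<infinity>\<close> the limit cost
 weight is \<open>0\<close>.\<close>

definition cost_weight :: "nat => real" where
 "cost_weight n = (if \<eta> < \<infinity> then 1 else 1 / (real n * \<epsilon> n))"
definition entropy_weight :: "nat => real" where
 "entropy_weight n = (if \<eta> < \<infinity> then real n * \<epsilon> n else 1)"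
definition cost_limit :: real where
 "cost_limit = (if \<eta> < \<infinity> then 1 else 0)"
definition entropy_limit :: real where
 "entropy_limit = (if \<eta> < \<infinity> then real_of_ereal \<eta> else 1)"

lemma along_pos_evens_not_bot: "along pos_evens \<noteq> bot" and along_N_not_bot: "along N \<noteq> bot"
proof -
 show "along N \<noteq> bot"
 proof
  assume "along N = bot"
  then have "eventually (\<lambda>_. False) (along N)" by simp
  then obtain m where "\<forall>n\<ge>m. n \<notin> N" unfolding eventually_along by blast
  then have "N \<subseteq> {..<m}" using not_le_imp_less by blast
  then show False using N(1) finite_subset by blast
 qed
 then show "along pos_evens \<noteq> bot" using along_mono[OF N(2)] by (auto simp: le_bot)
qed

lemma \<eta>_nonneg: "0 \<le> \<eta>"
proof (rule tendsto_lowerbound[OF \<eta> _ along_pos_evens_not_bot])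
 show "eventually (\<lambda>n. 0 \<le> ereal (real n * \<epsilon> n)) (along pos_evens)"
  unfolding eventually_along using \<epsilon> by auto
qed

lemma \<eta>_real: "\<eta> < \<infinity> ==> \<eta> = ereal entropy_limit"
 unfolding entropy_limit_def using \<eta>_nonneg by (cases \<eta>) auto

lemma weights_nonneg:
 "n \<in> pos_evens ==> 0 \<le> cost_weight n" "n \<in> pos_evens ==> 0 \<le> entropy_weight n"
 "0 \<le> cost_limit" "0 \<le> entropy_limit"
 using \<epsilon>[of n] \<eta>_nonneg
 by (auto simp: cost_weight_def entropy_weight_def cost_limit_def entropy_limit_def real_of_ereal_pos)

lemma weights_converge: "(cost_weight \<longlongrightarrow> cost_limit) (along N)" "(entropy_weight \<longlongrightarrow> entropy_limit) (along N)"
proof -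
 have \<eta>N: "((\<lambda>n. ereal (real n * \<epsilon> n)) \<longlongrightarrow> \<eta>) (along N)" by (rule filterlim_mono[OF \<eta> order_refl along_mono[OF N(2)]])
 have "(cost_weight \<longlongrightarrow> cost_limit) (along N) \<and> (entropy_weight \<longlongrightarrow> entropy_limit) (along N)"
 proof (cases "\<eta> < \<infinity>")
  case True
  then have "((\<lambda>n. real n * \<epsilon> n) \<longlongrightarrow> entropy_limit) (along N)"
   by (subst lim_ereal[symmetric]) (use \<eta>N \<eta>_real[OF True] in simp)
  then show ?thesis using True by (simp add: cost_weight_def[abs_def] entropy_weight_def[abs_def] cost_limit_def)
 next
  case False
  then have inf: "\<eta> = \<infinity>" by (simp add: less_top[symmetric] top_ereal_def)
  have "filterlim (\<lambda>n. real n * \<epsilon> n) at_top (along N)"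
   using \<eta>N unfolding inf tendsto_PInfty by (auto simp: filterlim_at_top_dense)
  then have "((\<lambda>n. inverse (real n * \<epsilon> n)) \<longlongrightarrow> 0) (along N)"
   by (rule tendsto_inverse_0_at_top)
  then show ?thesis unfolding cost_weight_def[abs_def] entropy_weight_def[abs_def] cost_limit_def entropy_limit_def
   using False by (simp add: inverse_eq_divide)
 qed
 then show "(cost_weight \<longlongrightarrow> cost_limit) (along N)" "(entropy_weight \<longlongrightarrow> entropy_limit) (along N)" by auto
qed

abbreviation "Fn n a \<equiv> F_n_fiber Y \<mu> c f \<epsilon> \<eta> \<mu>s \<pi>s n (fst a) (snd a)"
abbreviation "F a \<equiv> F_fiber Y c \<eta> \<sigma> (raw_fiber a) (snd a)"
abbreviation "lin \<equiv> linear_cost Y c T"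

lemma Fn_infeasible:
 assumes "n \<in> pos_evens" "snd a \<in> X_dom" "\<gamma> \<notin> couplings (sigma_kernel n a) (traj_kernel n a)"
 shows "Fn n a \<gamma> = \<infinity>"
 using assms by (simp add: F_n_fiber_def sigma_kernel_def traj_kernel_def)

lemma Fn_feasible:
 assumes "n \<in> pos_evens" "snd a \<in> X_dom" "\<gamma> \<in> couplings (sigma_kernel n a) (traj_kernel n a)"
 shows "Fn n a \<gamma> = ereal (cost_weight n * L_n Y c f n (fst a) (snd a) \<gamma>)
   + ereal (entropy_weight n) * KL \<gamma> (sigma_kernel n a \<Otimes>\<^sub>M traj_kernel n a)"
 using assms by (simp add: F_n_fiber_def sigma_kernel_def traj_kernel_def cost_weight_def entropy_weight_def
   add.commute flip: one_ereal_def)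

lemma F_infeasible:
 assumes "limit_kernel a = raw_fiber a" "\<gamma> \<notin> couplings \<sigma> (limit_kernel a)"
 shows "F a \<gamma> = \<infinity>"
 using assms by (simp add: F_fiber_def)

lemma F_feasible:
 assumes "fst a \<in> {0..T}" "snd a \<in> X_dom" "limit_kernel a = raw_fiber a" "\<gamma> \<in> couplings \<sigma> (limit_kernel a)"
 shows "F a \<gamma> = ereal (cost_limit * (\<integral>q. lin (a, q) \<partial>\<gamma>)) + ereal entropy_limit * KL \<gamma> (\<sigma> \<Otimes>\<^sub>M limit_kernel a)"
 using assms linear_cost_fiber[OF assms(1,2), where Y=Y and c=c and \<gamma>=\<gamma>] \<eta>_real
 by (auto simp: F_fiber_def cost_limit_def entropy_limit_def zero_ereal_def[symmetric] one_ereal_def[symmetric])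

lemma coupling_prob_space:
 fixes s :: "(real^'d) measure" and u :: "(real^'d) measure"
 assumes "\<gamma> \<in> couplings s u" "prob_space s"
 shows "prob_space \<gamma>" "sets \<gamma> = sets borel"
proof -
 show s: "sets \<gamma> = sets borel" using assms by (simp add: couplings_def)
 have "fst \<in> \<gamma> \<rightarrow>\<^sub>M borel" by (simp add: measurable_cong_sets[OF s refl])
 moreover have "distr \<gamma> borel fst = s" using assms by (simp add: couplings_def)
 ultimately show "prob_space \<gamma>" using assms(2) prob_space_distrD[of fst \<gamma> borel] by simp
qed

lemma fiber_cost_uniform:
 assumes e: "0 < e"
 shows "eventually (\<lambda>n. n \<in> pos_evens \<and> (\<forall>a \<gamma>. fst a \<in> {0..T} \<longrightarrow> snd a \<in> X_dom \<longrightarrow> \<gamma> \<in> couplings (sigma_kernel n a) (traj_kernel n a) \<longrightarrow>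
   \<bar>L_n Y c f n (fst a) (snd a) \<gamma> - (\<integral>q. lin (a, q) \<partial>\<gamma>)\<bar> \<le> e)) (along N)"
proof -
 have "eventually (\<lambda>n. n \<in> pos_evens) (along N)" unfolding eventually_along using N by blast
 moreover have "eventually (\<lambda>n. \<forall>x\<in>X_dom. \<forall>w\<in>X_dom. (\<forall>l. \<bar>x $ l - w $ l\<bar> \<le> 1 / real n) \<longrightarrow>
   (\<forall>z\<in>Z_dom. \<forall>y\<in>Y. \<bar>grad_X c w y \<bullet> z + Delta c f n w z y - grad_X c x y \<bullet> z\<bar> \<le> e)) (along N)"
  by (rule filter_leD[OF along_mono[OF N(2)] linearisation_uniform[OF compact_Y c f e]])
 ultimately show ?thesis
 proof eventually_elim
  case (elim n)
  show ?case
  proof (intro conjI allI impI elim(1))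
   fix a :: "real \<times> (real^'d)" and \<gamma>
   assume a: "fst a \<in> {0..T}" "snd a \<in> X_dom" and \<gamma>: "\<gamma> \<in> couplings (sigma_kernel n a) (traj_kernel n a)"
   have n0: "0 < n" using elim(1) by (simp add: pos_evens_def)
   note cell = cell_at_props[OF n0 a(2), of "fst a"]
   note center = comp_cell_center[OF elim(1) cell(1)]
   have p: "prob_space \<gamma>" "sets \<gamma> = sets borel"
    using coupling_prob_space[OF \<gamma>] sigma_kernel_prob_on[of n a] by (auto simp: prob_on_def)
   have "\<bar>L_n Y c f n (fst a) (snd a) \<gamma> - (\<integral>q. lin ((fst a, snd a), q) \<partial>\<gamma>)\<bar> \<le> e"
   proof (rule L_n_estimate[OF compact_Y c continuous_cost[OF elim(1)] a _ p])
    show "center_at n (fst a) (snd a) \<in> X_dom" unfolding center_at_def by (rule center(1))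
    show "\<bar>grad_X c (center_at n (fst a) (snd a)) y \<bullet> z + Delta c f n (center_at n (fst a) (snd a)) z y - grad_X c (snd a) y \<bullet> z\<bar> \<le> e"
     if "z \<in> Z_dom" "y \<in> Y" for z y
     using elim(2) a(2) center(1) center(2)[OF cell(2)] that unfolding center_at_def by blast
   qed (use e in simp)
   then show "\<bar>L_n Y c f n (fst a) (snd a) \<gamma> - (\<integral>q. lin (a, q) \<partial>\<gamma>)\<bar> \<le> e" by simp
  qed
 qed
qed

end

section \<open>Gamma-convergence of the glued functionals\<close>

lemma glue_cong_AE:
 fixes \<a> :: "'a::second_countable_topology measure" and \<k> \<k>' :: "'a => 'b::second_countable_topology measure"
 assumes \<a>: "sets \<a> = sets borel" and \<k>: "kernel \<a> \<k>" "kernel \<a> \<k>'"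
  and eq: "AE a in \<a>. \<k> a = \<k>' a"
 shows "glue \<a> \<k> = glue \<a> \<k>'"
proof (rule measure_eqI)
 fix S assume "S \<in> sets (glue \<a> \<k>)"
 then have S: "S \<in> sets borel" using \<a> by simp
 show "emeasure (glue \<a> \<k>) S = emeasure (glue \<a> \<k>') S"
  unfolding emeasure_glue[OF \<a> \<k>(1) S] emeasure_glue[OF \<a> \<k>(2) S]
 proof (rule nn_integral_cong_AE)
  show "AE a in \<a>. emeasure (\<k> a) (Pair a -` S) = emeasure (\<k>' a) (Pair a -` S)" using eq by eventually_elim simp
 qed
qed (use \<a> in simp)

lemma ereal_scale_ennreal: "0 \<le> b ==> ereal b * enn2ereal x = enn2ereal (ennreal b * x)"
 by (simp add: times_ennreal.rep_eq enn2ereal_ennreal)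

context glued_setting
begin

abbreviation "Gn n \<equiv> F_n_T Y \<mu> c f \<epsilon> \<eta> \<mu>s \<pi>s T n"
abbreviation "G \<equiv> F_T Y \<mu> c \<eta> \<sigma> \<P> T"
abbreviation "limit_product \<equiv> glue base (\<lambda>a. \<sigma> \<Otimes>\<^sub>M limit_kernel a)"

lemma kernels:
 "kernel base (\<lambda>_. \<sigma>)" "kernel base limit_kernel"
 "kernel base (sigma_kernel n)" "kernel base (traj_kernel n)"
 using \<sigma> by (simp_all add: prob_on_iff_kernel_value limit_kernel_measurable sigma_kernel_measurable traj_kernel_measurable base_facts)

lemmas prod_kernel = product_kernel[OF kernels(1,2)]

lemma AE_limit_kernel: "AE a in base. limit_kernel a = raw_fiber a"
 by (rule AE_base[OF limit_kernel_AE])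

lemma lin_bounded: "bounded_borel lin"
 by (rule bounded_borel_linear_cost[OF compact_Y c])

lemma V_T_facts:
 assumes M: "M \<in> V_T Y \<mu> T"
 shows "sets M = sets borel" "finite_measure M" "kernel base (disint base M)" "M = glue base (disint base M)"
proof -
 show s: "sets M = sets borel" using M by (simp add: V_T_def)
 have m: "distr M borel fst = base" using M by (simp add: V_T_def)
 have "is_disintegration base M (disint base M)"
  by (rule disintegration_exists[OF base.sigma_finite_measure_axioms base_facts(1) s m])
 then show k: "kernel base (disint base M)" and g: "M = glue base (disint base M)"
  by (auto simp: is_disintegration_def)
 show "finite_measure M" by (subst g) (rule finite_measure_glue[OF base_facts(2,1) k])
qed

lemma V_T_set_integral:
 fixes k :: "(real \<times> (real^'d)) \<times> ((real^'d) \<times> (real^'d)) => real"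
 assumes M: "M \<in> V_T Y \<mu> T" and k: "bounded_borel k"
 shows "(LINT x:glued_dom Y T|M. k x) = (\<integral>x. k x \<partial>M)"
 using M by (intro set_integral_full_support bounded_borel_measurable[OF k] borel_closed compact_imp_closed compact_glued_dom compact_Y)
  (auto simp: V_T_def)

lemma osc_continuous:
 assumes "continuous_on (glued_dom Y T) k" "0 < e"
 shows "\<exists>d>0. fiberwise_osc base Z_dom Y k d e"
proof (rule continuous_fiberwise_osc)
 show "compact ({0..T} \<times> (X_dom :: (real^'d) set))" by (intro compact_Times compact_X_dom compact_Icc)
 show "AE a in base. a \<in> {0..T} \<times> X_dom" using AE_base_dom by eventually_elim (auto simp: mem_Times_iff)
qed (use assms compact_Z_dom compact_Y in \<open>simp_all add: glued_dom_def\<close>)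

lemma potentials:
 fixes h1 h2 :: "(real \<times> (real^'d)) \<times> (real^'d) => real"
 assumes "continuous_on UNIV h1" "continuous_on UNIV h2" "bounded_borel h1" "bounded_borel h2"
 shows "continuous_on S (potential h1 h2)"
  "bounded_borel (\<lambda>p :: (real \<times> (real^'d)) \<times> ((real^'d) \<times> (real^'d)). h1 (fst p, fst (snd p)) + h2 (fst p, snd (snd p)))"
proof -
 show "continuous_on S (potential h1 h2)"
  by (intro continuous_on_add continuous_on_compose2[OF assms(1)] continuous_on_compose2[OF assms(2)] continuous_intros) auto
 show "bounded_borel (\<lambda>p :: (real \<times> (real^'d)) \<times> ((real^'d) \<times> (real^'d)). h1 (fst p, fst (snd p)) + h2 (fst p, snd (snd p)))"
  by (intro bounded_borel_add bounded_borel_comp[OF assms(3)] bounded_borel_comp[OF assms(4)] borel_measurable_Pair_borel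
     borel_measurable_fst_borel measurable_compose[OF borel_measurable_snd_borel])
   (simp_all add: borel_measurable_fst_borel borel_measurable_snd_borel)
qed

subsection \<open>Upper bounds for the limit functional\<close>

text \<open>A density of the glued measure is fiberwise a density, so that its entropy is the integral of
 the fiber entropies.\<close>

lemma F_T_le:
 assumes M: "M \<in> V_T Y \<mu> T" and coup: "AE a in base. disint base M a \<in> couplings \<sigma> (limit_kernel a)"
  and K: "0 \<le> K" and dens: "0 < entropy_limit ==> \<exists>g. g \<in> borel_measurable borel \<and> (\<forall>p. 0 \<le> g p) \<and>
    M = density limit_product (\<lambda>p. ennreal (g p)) \<and> (\<integral>\<^sup>+p. ennreal (kl_phi (g p)) \<partial>limit_product) \<le> ennreal K"
 shows "G M \<le> ereal (cost_limit * (\<integral>p. lin p \<partial>M) + entropy_limit * K)"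
proof -
 let ?A = cost_limit and ?b = entropy_limit
 note V = V_T_facts[OF M]
 let ?\<k> = "disint base M"
 define l where "l a = ?A * (\<integral>q. lin (a, q) \<partial>?\<k> a)" for a
 have lb: "bounded_borel (\<lambda>a. \<integral>q. lin (a, q) \<partial>?\<k> a)" by (rule bounded_borel_kernel_integral[OF base_facts(2,1) V(3) lin_bounded])
 have li: "integrable base l"
  unfolding l_def by (intro bounded_borel_integrable[OF base_facts(2,1)] bounded_borel_mult bounded_borel_const lb)
 have l_int: "(\<integral>a. l a \<partial>base) = ?A * (\<integral>p. lin p \<partial>M)"
  unfolding l_def by (subst (2) V(4)) (simp add: integral_glue[OF base_facts(2,1) V(3) lin_bounded])
 obtain p where p: "p \<in> borel_measurable base" "AE a in base. ereal ?b * KL (?\<k> a) (limit_prod a) \<le> enn2ereal (p a)"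
  "(\<integral>\<^sup>+a. p a \<partial>base) \<le> ennreal (?b * K)"
 proof (cases "0 < ?b")
  case False
  then have "?b = 0" using weights_nonneg(4) by simp
  then show thesis by (intro that[of "\<lambda>_. 0"]) (simp_all add: zero_ennreal.rep_eq flip: zero_ereal_def)
 next
  case True
  then obtain g where g: "g \<in> borel_measurable borel" "\<And>p. 0 \<le> g p" "M = density limit_product (\<lambda>p. ennreal (g p))"
   "(\<integral>\<^sup>+p. ennreal (kl_phi (g p)) \<partial>limit_product) \<le> ennreal K" using dens by blast
  have gm: "(\<lambda>p. ennreal (kl_phi (g p))) \<in> borel_measurable borel"
   by (intro measurable_compose[OF measurable_compose[OF g(1) kl_phi_measurable] measurable_ennreal])
  let ?p = "\<lambda>a. \<integral>\<^sup>+q. ennreal (kl_phi (g (a, q))) \<partial>(limit_prod a)"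
  have pm: "?p \<in> borel_measurable base"
  proof (rule nn_integral_measurable_subprob_algebra2[OF _ measurable_prob_algebraD[OF prod_kernel]])
   show "(\<lambda>(a, q). ennreal (kl_phi (g (a, q)))) \<in> borel_measurable (base \<Otimes>\<^sub>M borel)"
    using gm by (simp add: measurable_cong_sets[OF sets_pair_borel[OF base_facts(1) refl] refl])
  qed
  have "glue base ?\<k> = density limit_product (\<lambda>p. ennreal (g p))" using V(4) g(3) by simp
  from glue_density_fiber[OF base_facts(2,1) V(3) prod_kernel g(1,2) this]
  have KL: "AE a in base. KL (?\<k> a) (limit_prod a) = enn2ereal (?p a)"
  proof eventually_elim
   case (elim a)
   have fib: "prob_space (limit_prod a)" "sets (limit_prod a) = sets borel"
    using kernel_fiber[OF prod_kernel, of a] base_facts(3) by simp_all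
   have "(\<lambda>q. g (a, q)) \<in> borel_measurable (limit_prod a)"
    using measurable_compose[OF measurable_Pair_borel g(1)] by (simp add: measurable_cong_sets[OF fib(2) refl])
   from KL_density[OF prob_space.finite_measure[OF fib(1)] this g(2)] elim show ?case by simp
  qed
  have "(\<integral>\<^sup>+a. ennreal ?b * ?p a \<partial>base) = ennreal ?b * (\<integral>\<^sup>+p. ennreal (kl_phi (g p)) \<partial>limit_product)"
   by (simp add: nn_integral_cmult[OF pm] nn_integral_glue[OF base_facts(1) prod_kernel gm])
  also have "\<dots> \<le> ennreal ?b * ennreal K" by (intro mult_left_mono g(4)) simp
  finally have "(\<integral>\<^sup>+a. ennreal ?b * ?p a \<partial>base) \<le> ennreal (?b * K)" using True K by (simp add: ennreal_mult)
  moreover have "AE a in base. ereal ?b * KL (?\<k> a) (limit_prod a) \<le> enn2ereal (ennreal ?b * ?p a)"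
   using KL by eventually_elim (use True in \<open>simp add: ereal_scale_ennreal\<close>)
  moreover have "(\<lambda>a. ennreal ?b * ?p a) \<in> borel_measurable base" using pm by simp
  ultimately show thesis by (intro that)
 qed
 have "G M \<le> enn2ereal (\<integral>\<^sup>+a. p a \<partial>base) + ereal (\<integral>a. l a \<partial>base)"
  unfolding F_T_def glued_def
 proof (rule iterated_ereal_integral_le[OF interval_facts(2) \<mu>.finite_measure_axioms p(1) li])
  show "AE a in base. F_fiber Y c \<eta> \<sigma> (limit_fiber \<mu> \<P> (fst a) (snd a)) (snd a) (disint base M (fst a, snd a)) \<le> enn2ereal (p a) + ereal (l a)"
   using coup p(2) AE_base_dom AE_limit_kernel
  proof eventually_elim
   case (elim a)
   then have "F a (disint base M a) = ereal (l a) + ereal ?b * KL (?\<k> a) (limit_prod a)"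
    unfolding l_def by (intro F_feasible) auto
   also have "\<dots> \<le> ereal (l a) + enn2ereal (p a)" using elim(2) by (rule add_left_mono)
   finally show ?case by (simp add: add.commute)
  qed
 qed
 also have "\<dots> \<le> enn2ereal (ennreal (?b * K)) + ereal (\<integral>a. l a \<partial>base)"
  using p(3) by (intro add_right_mono) (simp add: less_eq_ennreal.rep_eq)
 also have "\<dots> = ereal (?A * (\<integral>p. lin p \<partial>M) + ?b * K)"
  using K weights_nonneg(4) l_int by (simp add: enn2ereal_ennreal add.commute)
 finally show ?thesis .
qed

text \<open>\<open>K\<close> is what the bound \<open>K0\<close> leaves for the entropy after subtracting
 the linear cost. If the entropy has weight zero, it may be infinite and \<open>K = 0\<close> is
 taken.\<close>

lemma dual_bound_consequences:
 assumes M: "M \<in> V_T Y \<mu> T"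
  and dual: "\<And>g h1 h2. continuous_on UNIV g ==> continuous_on UNIV h1 ==> continuous_on UNIV h2 ==>
    bounded_borel g ==> bounded_borel h1 ==> bounded_borel h2 ==>
    dual_value cost_limit entropy_limit lin g
     (potential h1 h2) M limit_product \<le> K0"
 obtains K where "0 \<le> K" "cost_limit * (\<integral>p. lin p \<partial>M) + entropy_limit * K \<le> K0"
  "AE a in base. disint base M a \<in> couplings \<sigma> (limit_kernel a)"
  "0 < entropy_limit ==> \<exists>g. g \<in> borel_measurable borel \<and> (\<forall>p. 0 \<le> g p) \<and>
    M = density limit_product (\<lambda>p. ennreal (g p)) \<and> (\<integral>\<^sup>+p. ennreal (kl_phi (g p)) \<partial>limit_product) \<le> ennreal K"
proof -
 let ?A = cost_limit and ?b = entropy_limit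
 note V = V_T_facts[OF M]
 have dual': "dual_value ?A ?b lin g (potential h1 h2) (glue base (disint base M)) limit_product \<le> K0"
  if "continuous_on UNIV g" "continuous_on UNIV h1" "continuous_on UNIV h2" "bounded_borel g" "bounded_borel h1" "bounded_borel h2" for g h1 h2
  using dual[OF that] V(4) by simp
 note D = dual_bound_imp_couplings[OF base_facts(2,1) kernels(1,2) V(3) weights_nonneg(4)]
 have low: "?A * (\<integral>p. lin p \<partial>M) \<le> K0"
  using dual[of "\<lambda>_. 0" "\<lambda>_. 0" "\<lambda>_. 0"] by (simp add: dual_value_def)
 define K where "K = (if 0 < ?b then (K0 - ?A * (\<integral>p. lin p \<partial>M)) / ?b else 0)"
 show thesis
 proof (rule that[of K])
  show "0 \<le> K" using low by (simp add: K_def)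
  show "?A * (\<integral>p. lin p \<partial>M) + ?b * K \<le> K0" using low weights_nonneg(4) by (simp add: K_def)
  show "AE a in base. disint base M a \<in> couplings \<sigma> (limit_kernel a)"
   by (rule D(1)) (rule dual'; assumption)
  assume b: "0 < ?b"
  show "\<exists>g. g \<in> borel_measurable borel \<and> (\<forall>p. 0 \<le> g p) \<and>
    M = density limit_product (\<lambda>p. ennreal (g p)) \<and> (\<integral>\<^sup>+p. ennreal (kl_phi (g p)) \<partial>limit_product) \<le> ennreal K"
  proof -
   have "\<exists>g. g \<in> borel_measurable borel \<and> (\<forall>p. 0 \<le> g p) \<and>
     glue base (disint base M) = density limit_product (\<lambda>p. ennreal (g p)) \<and>
     (\<integral>\<^sup>+p. ennreal (kl_phi (g p)) \<partial>limit_product) \<le> ennreal ((K0 - ?A * (\<integral>p. lin p \<partial>glue base (disint base M))) / ?b)"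
    by (rule D(2)[OF _ b]) (rule dual'; assumption)
   then show ?thesis using b V(4) by (simp add: K_def)
  qed
 qed
qed

subsection \<open>Lower bound\<close>

lemma discrete_dual_bound:
 fixes g :: "(real \<times> (real^'d)) \<times> ((real^'d) \<times> (real^'d)) => real" and h1 h2 :: "(real \<times> (real^'d)) \<times> (real^'d) => real"
 assumes M: "M \<in> V_T Y \<mu> T" and g: "bounded_borel g" and h: "bounded_borel h1" "bounded_borel h2"
  and n: "n \<in> pos_evens"
  and est: "\<And>a \<gamma>. fst a \<in> {0..T} ==> snd a \<in> X_dom ==> \<gamma> \<in> couplings (sigma_kernel n a) (traj_kernel n a) ==>
   \<bar>L_n Y c f n (fst a) (snd a) \<gamma> - (\<integral>q. lin (a, q) \<partial>\<gamma>)\<bar> \<le> e"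
 shows "ereal (dual_value (cost_weight n) (entropy_weight n) lin g (potential h1 h2)
    M (glue base (prods n)) - cost_weight n * e * measure base UNIV)
  \<le> Gn n M"
proof -
 note V = V_T_facts[OF M]
 have "ereal (dual_value (cost_weight n) (entropy_weight n) lin g (potential h1 h2)
    (glue base (disint base M)) (glue base (prods n)) - cost_weight n * e * measure base UNIV)
  \<le> ereal_integral interval (\<lambda>t. ereal_integral \<mu> (\<lambda>x. F_n_fiber Y \<mu> c f \<epsilon> \<eta> \<mu>s \<pi>s n t x (disint base M (t, x))))"
 proof (rule glued_dual_bound[OF interval_facts(2,1) \<mu>.finite_measure_axioms \<mu>_facts(1) kernels(3,4) V(3) lin_bounded g h weights_nonneg(2)[OF n]])
  show "AE a in base. disint base M a \<in> couplings (sigma_kernel n a) (traj_kernel n a) \<longrightarrow>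
    ereal (cost_weight n * (\<integral>q. lin (a, q) \<partial>disint base M a) - cost_weight n * e) +
    ereal (entropy_weight n) * KL (disint base M a) (prods n a)
    \<le> F_n_fiber Y \<mu> c f \<epsilon> \<eta> \<mu>s \<pi>s n (fst a) (snd a) (disint base M (fst a, snd a))"
   using AE_base_dom
  proof eventually_elim
   case (elim a)
   show ?case
   proof
    assume co: "disint base M a \<in> couplings (sigma_kernel n a) (traj_kernel n a)"
    have "(\<integral>q. lin (a, q) \<partial>disint base M a) - e \<le> L_n Y c f n (fst a) (snd a) (disint base M a)"
     using est[OF _ _ co] elim by (simp add: abs_le_iff)
    then have "cost_weight n * ((\<integral>q. lin (a, q) \<partial>disint base M a) - e) \<le> cost_weight n * L_n Y c f n (fst a) (snd a) (disint base M a)"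
     by (rule mult_left_mono[OF _ weights_nonneg(1)[OF n]])
    then have le: "ereal (cost_weight n * (\<integral>q. lin (a, q) \<partial>disint base M a) - cost_weight n * e) \<le> ereal (cost_weight n * L_n Y c f n (fst a) (snd a) (disint base M a))"
     by (simp add: right_diff_distrib)
    show "ereal (cost_weight n * (\<integral>q. lin (a, q) \<partial>disint base M a) - cost_weight n * e) +
     ereal (entropy_weight n) * KL (disint base M a) (prods n a)
     \<le> F_n_fiber Y \<mu> c f \<epsilon> \<eta> \<mu>s \<pi>s n (fst a) (snd a) (disint base M (fst a, snd a))"
     using Fn_feasible[OF n _ co] elim add_right_mono[OF le] by simp
   qed
  qed
  show "AE a in base. disint base M a \<notin> couplings (sigma_kernel n a) (traj_kernel n a) \<longrightarrow>
    F_n_fiber Y \<mu> c f \<epsilon> \<eta> \<mu>s \<pi>s n (fst a) (snd a) (disint base M (fst a, snd a)) = \<infinity>"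
   using AE_base_dom by eventually_elim (simp add: Fn_infeasible[OF n])
 qed
 then show ?thesis unfolding F_n_T_def glued_def V(4)[symmetric] .
qed

lemma weakstar_integral:
 assumes conv: "weakstar_on (glued_dom Y T) (along N) Ms M" and V: "M \<in> V_T Y \<mu> T" "\<And>n. Ms n \<in> V_T Y \<mu> T"
  and k: "continuous_on (glued_dom Y T) k" "bounded_borel k"
 shows "((\<lambda>n. \<integral>p. k p \<partial>Ms n) \<longlongrightarrow> (\<integral>p. k p \<partial>M)) (along N)"
proof -
 have "((\<lambda>n. LINT x:glued_dom Y T|Ms n. k x) \<longlongrightarrow> (LINT x:glued_dom Y T|M. k x)) (along N)"
  using conv k(1) unfolding weakstar_on_def by blast
 then show ?thesis by (simp only: V_T_set_integral[OF V(1) k(2)] V_T_set_integral[OF V(2) k(2)])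
qed

lemma dual_value_le_Liminf:
 fixes g :: "(real \<times> (real^'d)) \<times> ((real^'d) \<times> (real^'d)) => real" and h1 h2 :: "(real \<times> (real^'d)) \<times> (real^'d) => real"
 assumes M: "M \<in> V_T Y \<mu> T" "\<And>n. Ms n \<in> V_T Y \<mu> T" and conv: "weakstar_on (glued_dom Y T) (along N) Ms M"
  and g: "continuous_on UNIV g" "bounded_borel g" and h: "continuous_on UNIV h1" "continuous_on UNIV h2" "bounded_borel h1" "bounded_borel h2"
 shows "ereal (dual_value cost_limit entropy_limit lin g
     (potential h1 h2) M limit_product)
  \<le> Liminf (along N) (\<lambda>n. Gn n (Ms n))"
proof (rule ereal_le_epsilon2)
 fix e' :: real assume e': "0 < e'"
 let ?m = "measure base UNIV"
 let ?L = "Liminf (along N) (\<lambda>n. Gn n (Ms n))"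
 \<comment> \<open>the total cost error is at most \<open>e\<close> times the mass of the base space\<close>
 define e where "e = e' / (?m + 1)"
 have m0: "0 \<le> ?m" by simp
 have e: "0 < e" using e' by (simp add: e_def add_nonneg_pos)
 have em: "cost_limit * e * ?m \<le> e'"
 proof -
  have "e * ?m \<le> e * (?m + 1)" using e by (intro mult_left_mono) auto
  also have "\<dots> = e'"
  proof -
   have "?m + 1 \<noteq> 0" using m0 by linarith
   then show ?thesis by (simp add: e_def)
  qed
  finally show ?thesis using e' by (simp add: cost_limit_def)
 qed
 let ?h = "\<lambda>p. h1 (fst p, fst (snd p)) + h2 (fst p, snd (snd p))"
 let ?\<beta> = "\<lambda>n. glue base (prods n)"
 let ?dn = "\<lambda>n. dual_value (cost_weight n) (entropy_weight n) lin g ?h (Ms n) (?\<beta> n)"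
 let ?d = "dual_value cost_limit entropy_limit lin g ?h M limit_product"
 note hb = potentials[OF h]
 have gc: "continuous_on S g" for S using g(1) by (rule continuous_on_subset) simp
 have prod: "((\<lambda>n. \<integral>x. k x \<partial>?\<beta> n) \<longlongrightarrow> (\<integral>x. k x \<partial>limit_product)) (along N)"
  if "continuous_on (glued_dom Y T) k" "bounded_borel k" for k
  by (rule weak_limit_products[OF that(2) osc_continuous[OF that(1)]])
 have d_lim: "(?dn \<longlongrightarrow> ?d) (along N)"
  unfolding dual_value_def
  by (intro tendsto_intros weights_converge weakstar_integral[OF conv M] prod continuous_on_linear_cost[OF compact_Y c] lin_bounded gc g(2) hb
    continuous_on_diff continuous_on_exp continuous_on_const bounded_borel_diff bounded_borel_exp bounded_borel_const)
 have "((\<lambda>n. ereal (?dn n - cost_weight n * e * ?m)) \<longlongrightarrow> ereal (?d - cost_limit * e * ?m)) (along N)"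
  unfolding lim_ereal by (intro tendsto_intros d_lim weights_converge)
 from lim_imp_Liminf[OF along_N_not_bot this]
 have "ereal (?d - cost_limit * e * ?m) = Liminf (along N) (\<lambda>n. ereal (?dn n - cost_weight n * e * ?m))" by simp
 also have "\<dots> \<le> ?L"
 proof (rule Liminf_mono)
  show "eventually (\<lambda>n. ereal (?dn n - cost_weight n * e * ?m) \<le> Gn n (Ms n)) (along N)"
   using fiber_cost_uniform[OF e] by eventually_elim (intro discrete_dual_bound M(2) g(2) h(3,4), auto)
 qed
 finally have L: "ereal (?d - cost_limit * e * ?m) \<le> ?L" .
 have "ereal ?d \<le> ereal (?d - cost_limit * e * ?m) + ereal e'" using em by simp
 also have "\<dots> \<le> ?L + ereal e'" using L by (rule add_right_mono)
 finally show "ereal ?d \<le> ?L + ereal e'" .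
qed

lemma glued_liminf:
 assumes M: "M \<in> V_T Y \<mu> T" "\<And>n. Ms n \<in> V_T Y \<mu> T" and conv: "weakstar_on (glued_dom Y T) (along N) Ms M"
 shows "G M \<le> Liminf (along N) (\<lambda>n. Gn n (Ms n))" (is "_ \<le> ?L")
proof (cases ?L)
 case PInf
 then show ?thesis by simp
next
 case MInf
 then show ?thesis using dual_value_le_Liminf[OF M conv, of "\<lambda>_. 0" "\<lambda>_. 0" "\<lambda>_. 0"] by simp
next
 case (real K0)
 obtain K where K: "0 \<le> K" "cost_limit * (\<integral>p. lin p \<partial>M) + entropy_limit * K \<le> K0"
  "AE a in base. disint base M a \<in> couplings \<sigma> (limit_kernel a)"
  "0 < entropy_limit ==> \<exists>g. g \<in> borel_measurable borel \<and> (\<forall>p. 0 \<le> g p) \<and>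
    M = density limit_product (\<lambda>p. ennreal (g p)) \<and> (\<integral>\<^sup>+p. ennreal (kl_phi (g p)) \<partial>limit_product) \<le> ennreal K"
 proof (rule dual_bound_consequences[OF M(1), of K0])
  fix g :: "(real \<times> (real^'d)) \<times> ((real^'d) \<times> (real^'d)) => real" and h1 h2 :: "(real \<times> (real^'d)) \<times> (real^'d) => real"
  assume "continuous_on UNIV g" "continuous_on UNIV h1" "continuous_on UNIV h2" "bounded_borel g" "bounded_borel h1" "bounded_borel h2"
  then show "dual_value cost_limit entropy_limit lin g
     (potential h1 h2) M limit_product \<le> K0"
   using dual_value_le_Liminf[OF M conv, of g h1 h2] unfolding real by simp
 qed (use that in blast)
 have "G M \<le> ereal (cost_limit * (\<integral>p. lin p \<partial>M) + entropy_limit * K)"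
  by (rule F_T_le[OF M(1) K(3,1,4)])
 also have "\<dots> \<le> ereal K0" using K(2) by simp
 finally show ?thesis by (simp add: real)
qed

subsection \<open>Recovery sequences\<close>

text \<open>The same duality for the limit functional shows that finiteness of its value yields couplings
 with finite entropy. This replaces a direct measurability argument for the integrand.\<close>

lemma limit_dual_bound:
 fixes g :: "(real \<times> (real^'d)) \<times> ((real^'d) \<times> (real^'d)) => real" and h1 h2 :: "(real \<times> (real^'d)) \<times> (real^'d) => real"
 assumes M: "M \<in> V_T Y \<mu> T" and g: "bounded_borel g" and h: "bounded_borel h1" "bounded_borel h2"
 shows "ereal (dual_value cost_limit entropy_limit lin g
     (potential h1 h2) M limit_product) \<le> G M"
proof -
 note V = V_T_facts[OF M]
 have "ereal (dual_value cost_limit entropy_limit lin g (potential h1 h2)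
    (glue base (disint base M)) limit_product - 0 * measure base UNIV)
  \<le> ereal_integral interval (\<lambda>t. ereal_integral \<mu> (\<lambda>x. F_fiber Y c \<eta> \<sigma> (limit_fiber \<mu> \<P> t x) x (disint base M (t, x))))"
 proof (rule glued_dual_bound[OF interval_facts(2,1) \<mu>.finite_measure_axioms \<mu>_facts(1) kernels(1,2) V(3) lin_bounded g h weights_nonneg(4)])
  show "AE a in base. disint base M a \<in> couplings \<sigma> (limit_kernel a) \<longrightarrow>
    ereal (cost_limit * (\<integral>q. lin (a, q) \<partial>disint base M a) - 0) +
    ereal entropy_limit * KL (disint base M a) (limit_prod a)
    \<le> F_fiber Y c \<eta> \<sigma> (limit_fiber \<mu> \<P> (fst a) (snd a)) (snd a) (disint base M (fst a, snd a))"
   using AE_base_dom AE_limit_kernel by eventually_elim (simp add: F_feasible)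
  show "AE a in base. disint base M a \<notin> couplings \<sigma> (limit_kernel a) \<longrightarrow>
    F_fiber Y c \<eta> \<sigma> (limit_fiber \<mu> \<P> (fst a) (snd a)) (snd a) (disint base M (fst a, snd a)) = \<infinity>"
   using AE_limit_kernel by eventually_elim (simp add: F_infeasible)
 qed
 then show ?thesis unfolding F_T_def glued_def V(4)[symmetric] by simp
qed

text \<open>On the exceptional null set the product coupling is used, so that all fibers are
 couplings.\<close>

lemma coupling_kernel_version:
 assumes M: "M \<in> V_T Y \<mu> T" and coup: "AE a in base. disint base M a \<in> couplings \<sigma> (limit_kernel a)"
 obtains \<k> where "kernel base \<k>" "\<And>a. \<k> a \<in> couplings \<sigma> (limit_kernel a)" "glue base \<k> = M"
proof -
 note V = V_T_facts[OF M]
 obtain E where E: "{a \<in> space base. \<not> disint base M a \<in> couplings \<sigma> (limit_kernel a)} \<subseteq> E" "E \<in> null_sets base"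
  using coup by (auto simp: eventually_ae_filter)
 define \<k> where "\<k> a = (if a \<in> E then \<sigma> \<Otimes>\<^sub>M limit_kernel a else disint base M a)" for a
 have k: "kernel base \<k>"
  unfolding \<k>_def using E(2) base_facts(3) by (intro measurable_If prod_kernel V(3)) auto
 have "AE a in base. \<k> a = disint base M a"
  using AE_not_in[OF E(2)] by eventually_elim (simp add: \<k>_def)
 from glue_cong_AE[OF base_facts(1) k V(3) this] have "glue base \<k> = M" using V(4) by simp
 moreover have "\<k> a \<in> couplings \<sigma> (limit_kernel a)" for a
 proof (cases "a \<in> E")
  case True
  then show ?thesis
   using product_marginals[of \<sigma> "limit_kernel a"] \<sigma> limit_kernel_prob_on[of a] by (simp add: \<k>_def couplings_def prob_on_def)
 next
  case False
  then show ?thesis using E(1) base_facts(3) by (auto simp: \<k>_def)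
 qed
 ultimately show thesis using that k by blast
qed

text \<open>Couplings inherit their supports from the marginals.\<close>

lemma glue_in_V_T:
 assumes \<k>: "kernel base \<k>" and coup: "\<And>a. \<k> a \<in> couplings (s a) (u a)"
  and s: "\<And>a. s a \<in> prob_on Z_dom" and u: "\<And>a. u a \<in> prob_on Y"
 shows "glue base \<k> \<in> V_T Y \<mu> T"
proof -
 have "- glued_dom Y T \<in> sets borel"
  by (intro borel_open open_Compl compact_imp_closed compact_glued_dom compact_Y)
 from emeasure_glue[OF base_facts(1) \<k> this]
 have "emeasure (glue base \<k>) (- glued_dom Y T) = (\<integral>\<^sup>+a. emeasure (\<k> a) (Pair a -` (- glued_dom Y T)) \<partial>base)" .
 also have "\<dots> = (\<integral>\<^sup>+a. 0 \<partial>base)"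
 proof (rule nn_integral_cong_AE)
  show "AE a in base. emeasure (\<k> a) (Pair a -` (- glued_dom Y T)) = 0"
   using AE_base_dom
  proof eventually_elim
   case (elim a)
   have "AE q in \<k> a. fst q \<in> Z_dom \<and> snd q \<in> Y"
    using s[of a] u[of a] by (intro coupling_support[OF coup[of a]]) (auto simp: prob_on_def)
   then have "AE q in \<k> a. q \<notin> Pair a -` (- glued_dom Y T)"
    by eventually_elim (use elim in \<open>auto simp: glued_dom_def mem_Times_iff\<close>)
   then have "emeasure (\<k> a) {q \<in> space (\<k> a). q \<in> Pair a -` (- glued_dom Y T)} = 0" by (rule emeasure_eq_0_AE)
   then show ?case using kernel_fiber(3)[OF \<k>, of a] base_facts(3) by (simp add: vimage_def)
  qed
 qed
 finally show ?thesis
  using base_facts(1) distr_fst_glue[OF base_facts(1) \<k>] by (simp add: V_T_def)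
qed

lemma F_n_T_le:
 assumes \<k>: "kernel base \<k>" and coup: "\<And>a. \<k> a \<in> couplings (sigma_kernel n a) (traj_kernel n a)"
  and \<rho>: "bounded_borel \<rho>" "\<And>a. 0 \<le> \<rho> a" and KL: "\<And>a. KL (\<k> a) (prods n a) \<le> ereal (\<rho> a)"
  and n: "n \<in> pos_evens"
  and est: "\<And>a \<gamma>. fst a \<in> {0..T} ==> snd a \<in> X_dom ==> \<gamma> \<in> couplings (sigma_kernel n a) (traj_kernel n a) ==>
   \<bar>L_n Y c f n (fst a) (snd a) \<gamma> - (\<integral>q. lin (a, q) \<partial>\<gamma>)\<bar> \<le> e"
 shows "Gn n (glue base \<k>) \<le>
  ereal (entropy_weight n * (\<integral>a. \<rho> a \<partial>base) + cost_weight n * ((\<integral>p. lin p \<partial>glue base \<k>) + e * measure base UNIV))"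
proof -
 let ?A = "cost_weight n" and ?b = "entropy_weight n"
 have A: "0 \<le> ?A" and b: "0 \<le> ?b" using weights_nonneg(1,2)[OF n] by auto
 let ?l = "\<lambda>a. ?A * ((\<integral>q. lin (a, q) \<partial>\<k> a) + e)" and ?p = "\<lambda>a. ennreal (?b * \<rho> a)"
 have lb: "bounded_borel (\<lambda>a. \<integral>q. lin (a, q) \<partial>\<k> a)" by (rule bounded_borel_kernel_integral[OF base_facts(2,1) \<k> lin_bounded])
 note int = bounded_borel_integrable[OF base_facts(2,1)]
 have li: "integrable base ?l" by (intro int bounded_borel_mult bounded_borel_add bounded_borel_const lb)
 have pi: "integrable base (\<lambda>a. ?b * \<rho> a)" by (intro int bounded_borel_mult bounded_borel_const \<rho>(1))
 have "is_disintegration base (glue base \<k>) \<k>" using \<k> by (simp add: is_disintegration_def)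
 note dis = disint_AE_eq[OF base.sigma_finite_measure_axioms base_facts(1) this]
 have "Gn n (glue base \<k>) \<le> enn2ereal (\<integral>\<^sup>+a. ?p a \<partial>base) + ereal (\<integral>a. ?l a \<partial>base)"
  unfolding F_n_T_def glued_def
 proof (rule iterated_ereal_integral_le[OF interval_facts(2) \<mu>.finite_measure_axioms _ li])
  show "?p \<in> borel_measurable base" using borel_measurable_integrable[OF pi] by simp
  show "AE a in base. F_n_fiber Y \<mu> c f \<epsilon> \<eta> \<mu>s \<pi>s n (fst a) (snd a) (disint base (glue base \<k>) (fst a, snd a)) \<le> enn2ereal (?p a) + ereal (?l a)"
   using dis AE_base_dom
  proof eventually_elim
   case (elim a)
   have "\<bar>L_n Y c f n (fst a) (snd a) (\<k> a) - (\<integral>q. lin (a, q) \<partial>\<k> a)\<bar> \<le> e"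
    using est[OF _ _ coup[of a]] elim(2) by blast
   then have "L_n Y c f n (fst a) (snd a) (\<k> a) \<le> (\<integral>q. lin (a, q) \<partial>\<k> a) + e" by linarith
   then have "?A * L_n Y c f n (fst a) (snd a) (\<k> a) \<le> ?l a" by (rule mult_left_mono[OF _ A])
   moreover have "ereal ?b * KL (\<k> a) (prods n a) \<le> ereal ?b * ereal (\<rho> a)"
    by (rule ereal_mult_left_mono[OF KL]) (simp add: b)
   ultimately have "Fn n a (\<k> a) \<le> ereal (?l a) + ereal ?b * ereal (\<rho> a)"
    unfolding Fn_feasible[OF n conjunct2[OF elim(2)] coup] by (intro add_mono) simp_all
   then show ?case using elim(1) b \<rho>(2) by (simp add: enn2ereal_ennreal add.commute)
  qed
 qed
 also have "(\<integral>\<^sup>+a. ?p a \<partial>base) = ennreal (?b * (\<integral>a. \<rho> a \<partial>base))"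
  using nn_integral_eq_integral[OF pi] b \<rho>(2) by simp
 also have "enn2ereal (ennreal (?b * (\<integral>a. \<rho> a \<partial>base))) = ereal (?b * (\<integral>a. \<rho> a \<partial>base))"
  using b \<rho>(2) by (simp add: enn2ereal_ennreal)
 also have "(\<integral>a. ?l a \<partial>base) = ?A * ((\<integral>p. lin p \<partial>glue base \<k>) + e * measure base UNIV)"
 proof -
  have "(\<integral>a. (\<integral>q. lin (a, q) \<partial>\<k> a) + e \<partial>base) = (\<integral>a. \<integral>q. lin (a, q) \<partial>\<k> a \<partial>base) + (\<integral>a. e \<partial>base)"
   by (intro Bochner_Integration.integral_add int lb) simp
  then show ?thesis
   by (simp add: integral_glue[OF base_facts(2,1) \<k> lin_bounded] base_facts(3) mult.commute)
 qed
 finally show ?thesis by simp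
qed

lemma glued_recovery:
 assumes M: "M \<in> V_T Y \<mu> T"
 shows "\<exists>Ms. (\<forall>n. Ms n \<in> V_T Y \<mu> T) \<and> weakstar_on (glued_dom Y T) (along N) Ms M \<and>
  Limsup (along N) (\<lambda>n. Gn n (Ms n)) \<le> G M"
proof (cases "G M")
 case PInf
 then show ?thesis using M by (intro exI[of _ "\<lambda>_. M"]) (simp add: weakstar_on_def)
next
 case MInf
 then show ?thesis using limit_dual_bound[OF M, of "\<lambda>_. 0" "\<lambda>_. 0" "\<lambda>_. 0"] by simp
next
 case (real K0)
 let ?A = cost_limit and ?b = entropy_limit and ?m = "measure base UNIV"
 obtain K where K: "0 \<le> K" "?A * (\<integral>p. lin p \<partial>M) + ?b * K \<le> K0"
  "AE a in base. disint base M a \<in> couplings \<sigma> (limit_kernel a)"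
  "0 < ?b ==> \<exists>g. g \<in> borel_measurable borel \<and> (\<forall>p. 0 \<le> g p) \<and>
    M = density limit_product (\<lambda>p. ennreal (g p)) \<and> (\<integral>\<^sup>+p. ennreal (kl_phi (g p)) \<partial>limit_product) \<le> ennreal K"
 proof (rule dual_bound_consequences[OF M, of K0])
  fix g :: "(real \<times> (real^'d)) \<times> ((real^'d) \<times> (real^'d)) => real" and h1 h2 :: "(real \<times> (real^'d)) \<times> (real^'d) => real"
  assume "bounded_borel g" "bounded_borel h1" "bounded_borel h2"
  then show "dual_value ?A ?b lin g
     (potential h1 h2) M limit_product \<le> K0"
   using limit_dual_bound[OF M, of g h1 h2] unfolding real by simp
 qed (use that in blast)
 obtain \<k> where \<k>: "kernel base \<k>" "\<And>a. \<k> a \<in> couplings \<sigma> (limit_kernel a)" "glue base \<k> = M"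
  by (rule coupling_kernel_version[OF M K(3)]) (rule that; blast)
 have dens: "0 < ?b ==> \<exists>g. g \<in> borel_measurable borel \<and> (\<forall>p. 0 \<le> g p) \<and>
    glue base \<k> = density limit_product (\<lambda>p. ennreal (g p)) \<and> (\<integral>\<^sup>+p. ennreal (kl_phi (g p)) \<partial>limit_product) \<le> ennreal K"
  unfolding \<k>(3) by (rule K(4))
 obtain \<k>s \<rho>s where \<k>s: "\<And>n. kernel base (\<k>s n)" "\<And>n a. \<k>s n a \<in> couplings (sigma_kernel n a) (traj_kernel n a)"
  "\<And>k. bounded_borel k ==> (\<And>e. 0 < e ==> \<exists>d>0. fiberwise_osc base Z_dom Y k d e) ==>
    ((\<lambda>n. \<integral>x. k x \<partial>glue base (\<k>s n)) \<longlongrightarrow> (\<integral>x. k x \<partial>glue base \<k>)) (along N)"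
  and \<rho>s: "\<And>n. bounded_borel (\<rho>s n)" "\<And>n a. 0 \<le> \<rho>s n a" "\<And>n a. KL (\<k>s n a) (prods n a) \<le> ereal (\<rho>s n a)"
  "\<And>e. 0 < e ==> eventually (\<lambda>n. entropy_weight n * (\<integral>a. \<rho>s n a \<partial>base) < ?b * K + e) (along N)"
 proof (rule recovery_sequence[OF \<k>(1,2) weights_converge(2) weights_nonneg(4) K(1)], rule dens, assumption, goal_cases)
  case prems: (1 \<k>s \<rho>s)
  show thesis by (rule that[of \<k>s \<rho>s]) (fact prems)+
 qed
 let ?Ms = "\<lambda>n. glue base (\<k>s n)"
 have V: "?Ms n \<in> V_T Y \<mu> T" for n
  by (rule glue_in_V_T[OF \<k>s(1,2) sigma_kernel_prob_on traj_kernel_prob_on])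
 have conv: "((\<lambda>n. \<integral>x. indicator (glued_dom Y T) x * k x \<partial>?Ms n) \<longlongrightarrow> (\<integral>x. indicator (glued_dom Y T) x * k x \<partial>M)) (along N)"
  if k: "continuous_on (glued_dom Y T) k" for k :: "(real \<times> (real^'d)) \<times> ((real^'d) \<times> (real^'d)) => real"
  unfolding \<k>(3)[symmetric]
 proof (rule \<k>s(3))
  show "bounded_borel (\<lambda>x. indicator (glued_dom Y T) x * k x)"
   by (rule continuous_on_compact_bounded_borel[OF compact_glued_dom[OF compact_Y] k])
  show "\<exists>d>0. fiberwise_osc base Z_dom Y (\<lambda>x. indicator (glued_dom Y T) x * k x) d e" if "0 < e" for e
   by (rule osc_continuous[OF _ that]) (rule continuous_on_cong[THEN iffD1, OF refl _ k], simp)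
 qed
 have weak: "weakstar_on (glued_dom Y T) (along N) ?Ms M"
  using conv by (simp add: weakstar_on_def set_lebesgue_integral_def)
 have lin_lim: "((\<lambda>n. \<integral>p. lin p \<partial>?Ms n) \<longlongrightarrow> (\<integral>p. lin p \<partial>M)) (along N)"
  by (rule weakstar_integral[OF weak M V continuous_on_linear_cost[OF compact_Y c] lin_bounded])
 have "Limsup (along N) (\<lambda>n. Gn n (?Ms n)) \<le> ereal K0"
 proof (rule ereal_le_epsilon2)
  fix e' :: real assume e': "0 < e'"
  define e where "e = e' / (?m + 2)"
  have m0: "0 \<le> ?m" by simp
  have e: "0 < e" using e' by (simp add: e_def add_nonneg_pos)
  have e_eq: "e * ?m + 2 * e = e'"
  proof -
   have "?m + 2 \<noteq> 0" using m0 by linarith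
   then have "e * (?m + 2) = e'" by (simp add: e_def)
   then show ?thesis by (simp add: algebra_simps)
  qed
  have "((\<lambda>n. cost_weight n * ((\<integral>p. lin p \<partial>?Ms n) + e * ?m)) \<longlongrightarrow> ?A * ((\<integral>p. lin p \<partial>M) + e * ?m)) (along N)"
   by (intro tendsto_intros weights_converge lin_lim)
  from order_tendstoD(2)[OF this, of "?A * ((\<integral>p. lin p \<partial>M) + e * ?m) + e"] e
  have "eventually (\<lambda>n. cost_weight n * ((\<integral>p. lin p \<partial>?Ms n) + e * ?m) < ?A * ((\<integral>p. lin p \<partial>M) + e * ?m) + e) (along N)" by simp
  then have "eventually (\<lambda>n. Gn n (?Ms n) \<le> ereal K0 + ereal e') (along N)"
   using fiber_cost_uniform[OF e] \<rho>s(4)[OF e]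
  proof eventually_elim
   case (elim n)
   have "Gn n (?Ms n) \<le>
    ereal (entropy_weight n * (\<integral>a. \<rho>s n a \<partial>base) + cost_weight n * ((\<integral>p. lin p \<partial>?Ms n) + e * ?m))"
    using elim(2) by (intro F_n_T_le \<k>s(1,2) \<rho>s(1,2,3)) auto
   also have "entropy_weight n * (\<integral>a. \<rho>s n a \<partial>base) + cost_weight n * ((\<integral>p. lin p \<partial>?Ms n) + e * ?m) \<le> K0 + e'"
   proof -
    have "?A * ((\<integral>p. lin p \<partial>M) + e * ?m) \<le> ?A * (\<integral>p. lin p \<partial>M) + e * ?m"
     using e m0 by (simp add: cost_limit_def)
    then show ?thesis using elim(1,3) K(2) e_eq by linarith
   qed
   finally show ?case by simp
  qed
  then show "Limsup (along N) (\<lambda>n. Gn n (?Ms n)) \<le> ereal K0 + ereal e'" by (rule Limsup_bounded)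
 qed
 then show ?thesis unfolding real by (intro exI[of _ ?Ms] conjI allI V weak)
qed

theorem glued_gamma_convergence:
 "gamma_converges (along N) (weakstar_on (glued_dom Y T) (along N)) (V_T Y \<mu> T)
   (F_n_T Y \<mu> c f \<epsilon> \<eta> \<mu>s \<pi>s T) (F_T Y \<mu> c \<eta> \<sigma> \<P> T)"
 unfolding gamma_converges_def using glued_liminf glued_recovery by blast

end

theorem proposition5p14:
  fixes Y :: "(real^'d) set"
    and \<mu> \<nu> :: "(real^'d) measure"
    and c :: "(real^'d) \<times> (real^'d) \<Rightarrow> real"
    and \<pi>init :: "((real^'d) \<times> (real^'d)) measure"
    and \<mu>s \<nu>s :: "nat \<Rightarrow> (real^'d) measure"
    and \<pi>inits :: "nat \<Rightarrow> ((real^'d) \<times> (real^'d)) measure"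
    and f :: "nat \<Rightarrow> (real^'d) \<times> (real^'d) \<Rightarrow> real"
    and \<epsilon> :: "nat \<Rightarrow> real"
    and \<eta> :: ereal
    and \<pi>s :: "nat \<Rightarrow> nat \<Rightarrow> ((real^'d) \<times> (real^'d)) measure"
    and \<P> :: "(real \<times> ((real^'d) \<times> (real^'d))) measure"
    and \<P>t :: "real \<Rightarrow> ((real^'d) \<times> (real^'d)) measure"
    and \<Z> :: "nat set"
    and \<sigma> :: "(real^'d) measure"
    and T :: real
  assumes "compact Y"
    and "\<mu> \<in> prob_on X_dom" and "absolutely_continuous lborel \<mu>"
    and "\<nu> \<in> prob_on Y"
    and "C1_on (X_dom \<times> Y) c"
    and "\<pi>init \<in> couplings \<mu> \<nu>"
    and "\<And>n i. n \<in> pos_evens \<Longrightarrow> i \<in> indices n \<Longrightarrow> 0 < measure \<mu> (basic_cell n i)"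
    and "\<And>n. n \<in> pos_evens \<Longrightarrow> \<mu>s n \<in> prob_on X_dom"
    and "\<And>n i. n \<in> pos_evens \<Longrightarrow> i \<in> indices n \<Longrightarrow>
           measure (\<mu>s n) (basic_cell n i) = measure \<mu> (basic_cell n i)"
    and "\<And>n i. n \<in> pos_evens \<Longrightarrow> i \<in> indices n \<Longrightarrow>
           measure (\<mu>s n) (frontier (basic_cell n i)) = 0"
    and "\<And>n. n \<in> pos_evens \<Longrightarrow> \<nu>s n \<in> prob_on Y"
    and "weakstar_on Y (along pos_evens) \<nu>s \<nu>"
    and "\<And>n. n \<in> pos_evens \<Longrightarrow> \<pi>inits n \<in> couplings (\<mu>s n) (\<nu>s n)"
    and "weakstar_on (X_dom \<times> Y) (along pos_evens) \<pi>inits \<pi>init"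
    and "\<And>n. n \<in> pos_evens \<Longrightarrow> continuous_on (X_dom \<times> Y) (perturbed_cost c f n)"
    and "uniform_limit (X_dom \<times> Y) f (\<lambda>_. 0) (along pos_evens)"
    and "\<And>n. n \<in> pos_evens \<Longrightarrow> 0 \<le> \<epsilon> n"
    and "((\<lambda>n. ereal (real n * \<epsilon> n)) \<longlongrightarrow> \<eta>) (along pos_evens)"
    and "\<And>n. n \<in> pos_evens \<Longrightarrow>
           dd_iterates Y (\<mu>s n) (\<nu>s n) (perturbed_cost c f n) (\<epsilon> n) n (\<pi>inits n) (\<pi>s n)"
    and A: "is_disintegration (restr {0..} lborel) \<P> \<P>t"
           "AE t in restr {0..} lborel. \<P>t t \<in> couplings \<mu> \<nu>"
           "infinite \<Z>" "\<Z> \<subseteq> pos_evens"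
           "AE t in restr {0..} lborel.
              ((\<lambda>n. vertical_dist \<mu> (traj_slice Y \<mu> (\<pi>s n) n t) (\<P>t t)) \<longlongrightarrow> 0) (along \<Z>)"
    and B: "\<sigma> \<in> prob_on Z_dom"
           "AE (t, x) in restr {0..} lborel \<Otimes>\<^sub>M \<mu>.
              weakstar_on Z_dom (along pos_evens) (\<lambda>n. sigma_fiber \<mu> (\<mu>s n) n t x) \<sigma>"
           "\<And>l. measure \<sigma> {z \<in> Z_dom. z $ l = 0} = 0"
    and "0 < T"
  shows "gamma_converges (along \<Z>) (weakstar_on (glued_dom Y T) (along \<Z>)) (V_T Y \<mu> T)
           (F_n_T Y \<mu> c f \<epsilon> \<eta> \<mu>s \<pi>s T) (F_T Y \<mu> c \<eta> \<sigma> \<P> T)"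
proof -
  interpret glued_setting Y \<mu> \<nu> \<P> \<P>t c f \<epsilon> \<eta> \<mu>s \<nu>s \<pi>inits \<pi>s \<Z> \<sigma> T
    by (unfold_locales; fact assms)
  show ?thesis by (rule glued_gamma_convergence)
qed

end
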